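(* Let $a\ge4$ and $b>a$ both be even. Then: (1) $\rho^*(\alpha)=\delta_{0,1}=(1-\eta)(1-\beta)$. (2) If $b\ge 2a$ or $(a,b)=(4,6)$, then $(\delta_{k,1})_{k\ge0}$ is strictly decreasing with limit $$\delta_{\infty,1}:=\Big(1-\eta+\frac{2D^2}{1+D}\Big)\Big(1-\beta-\frac{2\beta}{1+D}\Big),$$ and $\mathcal L^*\cap(\delta_{\infty,1},\infty)=\{\delta_{k,1}:k\ge0\}\cup\{\delta_{0,5}\}\cup E_1\cup E_2$, where $E_1=\{\delta_{0,4}\}$ if $2a\le b\le 3a-6$ and $E_1=\emptyset$ otherwise, and $E_2=\{\delta_{-2}\}$ if $(a,b)=(4,6)$ and $E_2=\emptyset$ otherwise. (3) If $b=2a-2$ and $a\ge 8$, then $(\delta_{k,2})_{k\ge1}$ is increasing with limit $$\delta_{\infty,2}:=\Big(1-3\eta+\frac{2D(2-\eta)}{1-D}\Big)\Big(1+\beta-\frac{2\beta D(1-\eta+D)}{1-D}\Big),$$ and $\mathcal L^*\cap(\delta_{\infty,2},\infty)=\{\delta_{0,1},\delta_{0,4}\}$.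
   Context: Negative continued fractions: $[0;c_1,c_2,\dots]^-:=\cfrac{1}{c_1-\cfrac{1}{c_2-\cdots}}$. Fix integers $2\le a<b$ and set $\alpha=\eta:=[0;\overline{a,b}]^-=\tfrac12\big(b-\sqrt{b^2-4b/a}\big)$, $\beta:=[0;\overline{b,a}]^-=\tfrac12\big(a-\sqrt{a^2-4a/b}\big)$, $D:=\eta\beta$. For real $\gamma$, $M(\alpha,\gamma):=\liminf_{|n|\to\infty,\ n\in\mathbb Z}|n|\,\|n\alpha-\gamma\|$ ($\|x\|$ = distance from $x$ to the nearest integer) and $M^*(\alpha,\gamma):=4(1-D)M(\alpha,\gamma)$. Let $\mathcal L^*:=\{M^*(\alpha,\gamma):\gamma\in\mathbb R\setminus(\mathbb Z+\alpha\mathbb Z)\}$ and $\rho^*(\alpha):=\max\mathcal L^*$. Expansions: to a bounded integer sequence $(b_i)_{i\ge1}$ associate $\gamma((b_i)):=\sum_{i\ge1}(b_{2i-1}\eta+b_{2i}D)D^{i-1}$; a block is a pair $(b_{2i-1},b_{2i})$. For a finite word $P$ of blocks, $\gamma_P$ is $\gamma((b_i))$ for the purely periodic sequence repeating $P$; $X^k$ denotes $k$ repetitions of $X$ ($X^0$ empty). Blocks (with $a,b$ even, $t$ even): $A_t=\big(\tfrac{a-2}{2},\tfrac{b-2+t}{2}\big)$, $A'_t=\big(\tfrac{a-2}{2},\tfrac{b-2-t}{2}\big)$, $C_t=\big(\tfrac{a-4}{2},\tfrac{b-2+t}{2}\big)$, $C'_t=\big(\tfrac{a}{2},\tfrac{b-2-t}{2}\big)$.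 Define $\delta_{k,1}:=M^*(\alpha,\gamma_{A_0(A_2A_2')^k})$ ($k\ge0$), $\delta_{k,2}:=M^*(\alpha,\gamma_{A_2C_4^kC_2A_2'C_4'^{\,k}C_2'})$ ($k\ge1$), $\delta_{0,4}:=M^*(\alpha,\gamma_{C_4})$, $\delta_{0,5}:=M^*(\alpha,\gamma_{A_2A_2'})$, and (for $(a,b)=(4,6)$) $\delta_{-2}:=M^*(\alpha,\gamma_{A_2C_2})$. *)

theory Defs
  imports "HOL-Analysis.Analysis" "HOL-Library.Liminf_Limsup"
begin

text \<open>Parameters a, b are integers with 2 <= a < b.\<close>

definition eta :: "int \<Rightarrow> int \<Rightarrow> real" where
  "eta a b = (real_of_int b - sqrt ((real_of_int b)^2 - 4 * real_of_int b / real_of_int a)) / 2"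

definition beta :: "int \<Rightarrow> int \<Rightarrow> real" where
  "beta a b = (real_of_int a - sqrt ((real_of_int a)^2 - 4 * real_of_int a / real_of_int b)) / 2"

definition DD :: "int \<Rightarrow> int \<Rightarrow> real" where
  "DD a b = eta a b * beta a b"

definition dist_int :: "real \<Rightarrow> real" where
  "dist_int x = \<bar>x - of_int (round x)\<bar>"

definition M :: "real \<Rightarrow> real \<Rightarrow> ereal" where
  "M \<alpha> \<gamma> = Liminf (sup at_top at_bot)
      (\<lambda>n::int. ereal (\<bar>real_of_int n\<bar> * dist_int (real_of_int n * \<alpha> - \<gamma>)))"

definition Mstar :: "int \<Rightarrow> int \<Rightarrow> real \<Rightarrow> ereal" where
  "Mstar a b \<gamma> = ereal (4 * (1 - DD a b)) * M (eta a b) \<gamma>"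

definition Lstar :: "int \<Rightarrow> int \<Rightarrow> ereal set" where
  "Lstar a b = {Mstar a b \<gamma> | \<gamma>.
      \<gamma> \<notin> {real_of_int m + eta a b * real_of_int n | m n. True}}"

text \<open>gamma_P for a finite nonempty word P of blocks (pairs of integers),
  repeated periodically: sum over i>=1 of (b_{2i-1} eta + b_{2i} D) D^(i-1).\<close>
definition gammaP :: "int \<Rightarrow> int \<Rightarrow> (int \<times> int) list \<Rightarrow> real" where
  "gammaP a b P = (\<Sum>i. (real_of_int (fst (P ! (i mod length P))) * eta a b
                        + real_of_int (snd (P ! (i mod length P))) * DD a b) * DD a b ^ i)"

definition blkA :: "int \<Rightarrow> int \<Rightarrow> int \<Rightarrow> int \<times> int" where
  "blkA a b t = ((a - 2) div 2, (b - 2 + t) div 2)"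
definition blkA' :: "int \<Rightarrow> int \<Rightarrow> int \<Rightarrow> int \<times> int" where
  "blkA' a b t = ((a - 2) div 2, (b - 2 - t) div 2)"
definition blkC :: "int \<Rightarrow> int \<Rightarrow> int \<Rightarrow> int \<times> int" where
  "blkC a b t = ((a - 4) div 2, (b - 2 + t) div 2)"
definition blkC' :: "int \<Rightarrow> int \<Rightarrow> int \<Rightarrow> int \<times> int" where
  "blkC' a b t = (a div 2, (b - 2 - t) div 2)"

definition delta1 :: "int \<Rightarrow> int \<Rightarrow> nat \<Rightarrow> ereal" where
  "delta1 a b k = Mstar a b (gammaP a b
      ([blkA a b 0] @ concat (replicate k [blkA a b 2, blkA' a b 2])))"

definition delta2 :: "int \<Rightarrow> int \<Rightarrow> nat \<Rightarrow> ereal" where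
  "delta2 a b k = Mstar a b (gammaP a b
      ([blkA a b 2] @ replicate k (blkC a b 4) @ [blkC a b 2, blkA' a b 2]
        @ replicate k (blkC' a b 4) @ [blkC' a b 2]))"

definition delta04 :: "int \<Rightarrow> int \<Rightarrow> ereal" where
  "delta04 a b = Mstar a b (gammaP a b [blkC a b 4])"

definition delta05 :: "int \<Rightarrow> int \<Rightarrow> ereal" where
  "delta05 a b = Mstar a b (gammaP a b [blkA a b 2, blkA' a b 2])"

definition delta_m2 :: "int \<Rightarrow> int \<Rightarrow> ereal" where
  "delta_m2 a b = Mstar a b (gammaP a b [blkA a b 2, blkC a b 2])"

end

theory Submission
  imports Defs
begin

text \<open>
  Up to a factor, \<open>\<bar>n\<bar> \<parallel>n\<alpha> - \<gamma>\<parallel>\<close> is the value at a lattice point of the product of the two coordinates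
  on a translate of a planar lattice. Expanding \<open>\<gamma>\<close> in the two alternating bases, with digits centred so
  that \<open>\<gamma> = (1 - \<eta> + x) / 2\<close>, one sees at each position of the expansion four lattice points whose
  products are \<open>(1 \<plusminus> A \<plusminus> x) (1 \<plusminus> B \<plusminus> y)\<close>, where \<open>x\<close> and \<open>y\<close> are the values of the
  digits to the right and to the left and \<open>(A, B)\<close> is \<open>(\<eta>, \<beta>)\<close> or \<open>(\<beta>, \<eta>)\<close>. If
  \<open>M\<^sup>*\<close> exceeds \<open>c\<close>, then eventually all four products exceed \<open>c\<close>; conversely, for small digits,
  a lower bound for these products at all positions bounds \<open>M\<^sup>*\<close> from below, because a product at
  any other lattice point is no smaller than one of them.

  For \<open>c\<close> at least the claimed accumulation point, the four inequalities leave very few possible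
  digit patterns: local rules exclude all but small digits, a contraction argument forces the
  runs of alternating digits \<open>2, - 2\<close> between zeros to have one and the same even length, and
  what remains is eventually one of the listed periodic words. As \<open>M\<^sup>*\<close> depends only on the tail
  of the digit sequence, its value is that of the periodic word.
\<close>

section \<open>The lattice and its bases\<close>

text \<open>The planar lattice comes from Galois conjugation: \<open>1 / \<beta>\<close> is the
  conjugate of \<open>\<eta>\<close>, and the unit \<open>D\<close>, with conjugate
  \<open>1 / D\<close>, maps the lattice of \<open>\<eta>\<close> to itself. A large index
  \<open>n\<close> with a small distance is a lattice point with large first and small second
  coordinate, and shifting the digits by a block is multiplication by this unit. The obstacle is
  that each threshold is a limit of values of explicit words, so near it no numerical margin exists.
  For zero even digits, the deviations from the infinite alternating sequence are powers of
  \<open>- D\<close> up to bounded factors, and the two sides of every zero digit must be weighed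
  against each other. For \<open>b = 2 * a - 2\<close> the same role is played by a contraction
  towards the fixed point \<open>xi_inf\<close>. Everything else has slack. The digit rules use the
  cruder threshold \<open>c0 = (1 - \<eta>) * (1 - 3 * \<beta>)\<close>, which lies below the limit
  in question, and become polynomial inequalities in \<open>\<eta>\<close> and
  \<open>\<beta>\<close> that hold on whole regions, uniformly in \<open>a\<close> and
  \<open>b\<close>. The pair (4, 6) lies outside these regions and is treated numerically.\<close>

locale even_pair =
  fixes a b :: int
  assumes a4: "4 \<le> a" and ab: "a < b" and ea: "even a" and eb: "even b"
begin

abbreviation "\<eta> \<equiv> eta a b"
abbreviation "\<beta> \<equiv> beta a b"
abbreviation "D \<equiv> DD a b"

lemma b6: "6 \<le> b"
  using a4 ab ea eb by presburger

text \<open>\<open>D\<close> and its conjugate \<open>D'\<close> have product 1, and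
  \<open>(1 + D)^2 = a * b * D\<close> with \<open>a * b \<ge> 24\<close>. Feeding a bound for
  \<open>D\<close> back into this relation sharpens it, from 1/11 to 5/100 and then to 46/1000; the
  pair (4, 6) nearly attains the last value.\<close>

lemma basic:
  shows eta_a: "a * \<eta> = 1 + D" and beta_b: "b * \<beta> = 1 + D"
    and beta_pos: "0 < \<beta>" and D_small: "D < 46/1000"
proof -
  define A B where "A = real_of_int a" and "B = real_of_int b"
  have A: "4 \<le> A" and B: "6 \<le> B" using a4 b6 by (simp_all add: A_def B_def)
  define s where "s = sqrt (A^2 - 4 * A / B)"
  have "4 * A / B \<le> A * A" using A B mult_mono[of 4 A 1 B] by (simp add: field_simps)
  then have s2: "s^2 = A^2 - 4 * A / B" by (simp add: s_def power2_eq_square)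
  have s0: "0 \<le> s" by (simp add: s_def power2_eq_square \<open>4 * A / B \<le> A * A\<close>)
  have "sqrt (B^2 - 4 * B / A) = B / A * s"
  proof (rule real_sqrt_unique)
    show "(B / A * s)\<^sup>2 = B\<^sup>2 - 4 * B / A"
      using A B s2 by (simp add: power_mult_distrib power_divide) (simp add: field_simps power2_eq_square)
    show "0 \<le> B / A * s" using A B s0 by simp
  qed
  then have e: "\<eta> = (B - B / A * s) / 2" by (simp add: eta_def A_def B_def)
  have be: "\<beta> = (A - s) / 2" by (simp add: beta_def s_def A_def B_def)
  have eb: "A * \<eta> = B * \<beta>" using A by (simp add: e be field_simps)
  have q: "\<beta> * (A - \<beta>) = A / B" using s2 by (simp add: be field_simps power2_eq_square)
  have "s < A" using s2 s0 A B by (simp add: power2_less_imp_less)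
  then show pos: "0 < \<beta>" by (simp add: be)
  have DB: "D = B * \<beta> - 1"
  proof -
    have "A * D = B * \<beta>^2" using eb by (simp add: DD_def power2_eq_square)
    also have "\<dots> = B * (A * \<beta> - A / B)" using q by (simp add: power2_eq_square algebra_simps)
    also have "\<dots> = A * (B * \<beta> - 1)" using B by (simp add: field_simps)
    finally show ?thesis using A by simp
  qed
  then show "b * \<beta> = 1 + D" "a * \<eta> = 1 + D" using eb by (simp_all add: A_def B_def)
  define D' where "D' = B * (A - \<beta>) - 1"
  have AB: "24 \<le> A * B" using mult_mono[of 4 A 6 B] A B by linarith
  have DD': "D * D' = 1"
  proof -
    have "D * D' = B^2 * (\<beta> * (A - \<beta>)) - A * B + 1"
      by (simp add: DB D'_def algebra_simps power2_eq_square)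
    also have "\<dots> = 1" using B by (simp add: q power2_eq_square)
    finally show ?thesis .
  qed
  have "D' \<ge> 11"
  proof -
    have "B * (A - \<beta>) \<ge> B * (A / 2)" using B s0 by (intro mult_left_mono) (simp_all add: be)
    then show ?thesis using AB by (simp add: D'_def algebra_simps)
  qed
  moreover have Dpos: "0 < D" using DD' \<open>D' \<ge> 11\<close>
    by (metis less_le_not_le linorder_le_less_linear mult_nonpos_nonneg nle_le order_trans zero_le_numeral zero_less_one)
  ultimately have "D * 11 \<le> 1" using DD' by (metis less_eq_real_def mult_left_mono)
  have sq: "(1 + D)^2 = A * B * D"
    using DB eb by (simp add: DD_def power2_eq_square algebra_simps)
  have "24 * D \<le> A * B * D" using AB Dpos by simp
  then have "24 * D \<le> 1 + 2 * D + D * D" using sq by (simp add: power2_eq_square algebra_simps)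
  also have "D * D \<le> D * (1/11)" using Dpos \<open>D * 11 \<le> 1\<close> by (intro mult_left_mono) auto
  finally have D2: "D < 5/100" using Dpos by simp
  have "D * D \<le> D * (5/100)" using Dpos D2 by (intro mult_left_mono) auto
  then have "22 * D \<le> 1 + D * (5/100)" using \<open>24 * D \<le> 1 + 2 * D + D * D\<close> by simp
  then show "D < 46/1000" by simp
qed

lemma D_pos: "0 < D"
proof -
  have "0 < a * \<eta>" using beta_b eta_a beta_pos b6 by (metis mult_pos_pos of_int_0_less_iff
        order_less_le_trans zero_less_numeral)
  then have "0 < \<eta>" using a4 by (simp add: zero_less_mult_iff)
  then show ?thesis using beta_pos by (simp add: DD_def)
qed

lemma eta_pos: "0 < \<eta>"
  using D_pos beta_pos by (simp add: DD_def zero_less_mult_iff)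

lemma eta_small: "\<eta> < 2615/10000"
proof -
  have "4 * \<eta> \<le> a * \<eta>" using a4 eta_pos by simp
  then show ?thesis using eta_a D_small by simp
qed

lemma beta_small: "\<beta> < 1744/10000"
proof -
  have "6 * \<beta> \<le> b * \<beta>" using b6 beta_pos by simp
  then show ?thesis using beta_b D_small by simp
qed

lemma beta_less_eta: "\<beta> < \<eta>"
proof -
  have "b * \<beta> = a * \<eta>" using eta_a beta_b by simp
  moreover have "a * \<eta> < b * \<eta>" using ab eta_pos by simp
  ultimately have "b * \<beta> < b * \<eta>" by simp
  then show ?thesis using b6 by simp
qed

section \<open>The alternating base values and the scale after \<open>j\<close> positions\<close>

definition al :: "nat \<Rightarrow> real" where "al j = (if even j then \<eta> else \<beta>)"
definition nn :: "nat \<Rightarrow> int" where "nn j = (if even j then a else b)"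
definition Dj :: "nat \<Rightarrow> real" where "Dj j = (\<Prod>l<j. al l)"

lemma al_pos [simp]: "0 < al j" and al_nonneg [simp]: "0 \<le> al j" and al_neq0 [simp]: "al j \<noteq> 0"
  using eta_pos beta_pos by (auto simp: al_def)
lemma al_small: "al j < 2615/10000" 
  using eta_small beta_small by (auto simp: al_def)
lemma al_le_eta: "al j \<le> \<eta>" using beta_less_eta by (auto simp: al_def)
lemma al_prod: "al j * al (Suc j) = D" by (auto simp: al_def DD_def)
lemma al_SS [simp]: "al (Suc (Suc j)) = al j" by (simp add: al_def)
lemma al_nn: "nn j * al j = 1 + D" using eta_a beta_b by (auto simp: al_def nn_def)
text \<open>This is one step of the negative continued fraction, with partial quotients
  \<open>a\<close> and \<open>b\<close> in turn.\<close>

lemma nn_eq: "nn j = 1 / al j + al (Suc j)"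
  using al_nn[of j] al_prod[of j] by (simp add: field_simps)
lemma even_nn: "even (nn j)" using ea eb by (auto simp: nn_def)
lemma al_0: "al 0 = \<eta>" "al (Suc 0) = \<beta>" by (simp_all add: al_def)

lemma Dj_0 [simp]: "Dj 0 = 1" by (simp add: Dj_def)
lemma Dj_Suc [simp]: "Dj (Suc j) = Dj j * al j" by (simp add: Dj_def)
lemma Dj_pos [simp]: "0 < Dj j" by (induction j) auto
lemma Dj_neq0 [simp]: "Dj j \<noteq> 0" using Dj_pos[of j] by linarith
lemma Dj_le: "Dj j \<le> (1/3)^j"
proof (induction j)
  case (Suc j)
  have "Dj j * al j \<le> (1/3)^j * (1/3)"
    using Suc al_small[of j] by (intro mult_mono) (auto intro: less_imp_le)
  then show ?case by (simp add: mult.commute)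
qed auto
lemma Dj_lim: "Dj \<longlonglongrightarrow> 0"
proof (rule tendsto_sandwich[OF _ _ tendsto_const])
  show "(\<lambda>j. (1/3)^j) \<longlonglongrightarrow> (0::real)" by (rule LIMSEQ_realpow_zero) auto
  show "\<forall>\<^sub>F n in sequentially. Dj n \<le> (1 / 3) ^ n" using Dj_le by simp
qed (auto intro!: always_eventually less_imp_le)

section \<open>The lattice and its consecutive bases\<close>

definition lat :: "real \<Rightarrow> real \<Rightarrow> bool" where
  "lat X Y \<longleftrightarrow> (\<exists>n m. X = real_of_int n / \<beta> - real_of_int m \<and> Y = real_of_int n * \<eta> - real_of_int m)"

lemma lat_lin: "lat X Y \<Longrightarrow> lat X' Y' \<Longrightarrow> lat (of_int p * X + of_int q * X') (of_int p * Y + of_int q * Y')"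
  unfolding lat_def
proof clarify
  fix n m n' m' :: int
  show "\<exists>na ma. of_int p * (n / \<beta> - m) + of_int q * (n' / \<beta> - m') = real_of_int na / \<beta> - real_of_int ma \<and>
       of_int p * (n * \<eta> - m) + of_int q * (n' * \<eta> - m') = real_of_int na * \<eta> - real_of_int ma"
    by (rule exI[of _ "p * n + q * n'"], rule exI[of _ "p * m + q * m'"])
      (simp add: algebra_simps add_divide_distrib)
qed

lemma lat_add: "lat X Y \<Longrightarrow> lat X' Y' \<Longrightarrow> lat (X + X') (Y + Y')"
  using lat_lin[of X Y X' Y' 1 1] by simp
lemma lat_diff: "lat X Y \<Longrightarrow> lat X' Y' \<Longrightarrow> lat (X - X') (Y - Y')"
  using lat_lin[of X Y X' Y' 1 "-1"] by simp
lemma lat_minus: "lat X Y \<Longrightarrow> lat (- X) (- Y)"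
  using lat_lin[of X Y X Y "-1" 0] by simp
lemma lat_mult: "lat X Y \<Longrightarrow> lat (of_int p * X) (of_int p * Y)"
  using lat_lin[of X Y X Y p 0] by simp

text \<open>Together with \<open>Dj j\<close> this is the basis vector of index \<open>j\<close>:
  \<open>(1, 1)\<close> for \<open>j = 0\<close>, \<open>(1 / \<beta>, \<eta>)\<close> for
  \<open>j = 1\<close>, and then the recurrence \<open>v_rec\<close>. The factor
  \<open>al (Suc j)\<close> makes one formula serve both parities.\<close>

definition vX :: "nat \<Rightarrow> real" where "vX j = al (Suc j) / (\<beta> * Dj j)"

lemma vX_Suc: "vX (Suc j) = 1 / (\<beta> * Dj j)"
  by (simp add: vX_def field_simps)
lemma vX_pos [simp]: "0 < vX j" using beta_pos by (simp add: vX_def)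
lemma vX_eq: "vX j = al (Suc j) * vX (Suc j)"
  by (simp add: vX_Suc) (simp add: vX_def)

lemma v_rec: "Dj (Suc (Suc j)) = nn j * Dj (Suc j) - Dj j" "vX (Suc (Suc j)) = nn j * vX (Suc j) - vX j"
proof -
  have "Dj (Suc (Suc j)) = Dj j * D" by (simp add: al_prod)
  also have "\<dots> = Dj j * (nn j * al j - 1)" by (simp add: al_nn)
  finally show "Dj (Suc (Suc j)) = nn j * Dj (Suc j) - Dj j" by (simp add: algebra_simps)
  have "nn j * vX (Suc j) - vX j = (nn j - al (Suc j)) * vX (Suc j)"
    by (simp add: vX_eq[of j] algebra_simps)
  also have "\<dots> = vX (Suc (Suc j))" by (simp add: nn_eq vX_Suc)
  finally show "vX (Suc (Suc j)) = nn j * vX (Suc j) - vX j" by simp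
qed

lemma lat_v: "lat (vX j) (Dj j)"
proof (induction j rule: induct_nat_012)
  case 0
  then show ?case unfolding lat_def
    by (intro exI[of _ 0] exI[of _ "-1"]) (use beta_pos in \<open>simp add: vX_def al_0\<close>)
next
  case 1
  then show ?case unfolding lat_def
    by (intro exI[of _ 1] exI[of _ "0"]) (simp add: vX_Suc al_0)
next
  case (ge2 j)
  then show ?case using lat_lin[of "vX (Suc j)" "Dj (Suc j)" "vX j" "Dj j" "nn j" "-1"]
    by (simp add: v_rec del: Dj_Suc)
qed

text \<open>The passage from the basis vectors of index \<open>j\<close>, \<open>Suc j\<close> to
  those of index \<open>Suc j\<close>, \<open>Suc (Suc j)\<close> has determinant 1, so coordinates
  that are integers in the first basis remain integers in every later one.\<close>

lemma lat_coords: "lat X Y \<Longrightarrow> \<exists>i k. X = real_of_int i * vX j + real_of_int k * vX (Suc j) \<and> Y = real_of_int i * Dj j + real_of_int k * Dj (Suc j)"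
proof (induction j)
  case 0
  then obtain n m where "X = real_of_int n / \<beta> - real_of_int m" "Y = real_of_int n * \<eta> - real_of_int m"
    unfolding lat_def by auto
  then show ?case
    using beta_pos eta_pos
    by - (rule exI[of _ "-m"], rule exI[of _ n], simp add: vX_def al_0)
next
  case (Suc j)
  then obtain i k :: int where "X = i * vX j + k * vX (Suc j)" "Y = i * Dj j + k * Dj (Suc j)" by blast
  then show ?case
    by (intro exI[of _ "i * nn j + k"] exI[of _ "- i"])
      (simp add: v_rec algebra_simps del: Dj_Suc)
qed

text \<open>A normalisation: \<open>\<beta>\<close> times a product of coordinates measured in units
  of \<open>vX (Suc j)\<close> and \<open>Dj j\<close> is free of the scale. This is what makes the
  four products of a cell independent of the position.\<close>

lemma vX_Dj: "\<beta> * vX (Suc j) * Dj j = 1"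
  using beta_pos by (simp add: vX_Suc)

definition member :: "real \<Rightarrow> bool" where "member \<gamma> \<longleftrightarrow> (\<exists>X. lat X \<gamma>)"

lemma member_iff: "member \<gamma> \<longleftrightarrow> \<gamma> \<in> {real_of_int m + eta a b * real_of_int n | m n. True}"
proof
  assume "member \<gamma>"
  then obtain n m where "\<gamma> = real_of_int n * \<eta> - real_of_int m" by (auto simp: member_def lat_def)
  then show "\<gamma> \<in> {real_of_int m + eta a b * real_of_int n | m n. True}"
    by (intro CollectI exI[of _ "-m"] exI[of _ n]) (simp add: mult.commute)
next
  assume "\<gamma> \<in> {real_of_int m + eta a b * real_of_int n | m n. True}"
  then obtain n m where g: "\<gamma> = real_of_int m + eta a b * real_of_int n" by auto
  show "member \<gamma>" unfolding member_def lat_def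
    by (rule exI[of _ "real_of_int n / \<beta> - of_int (-m)"], rule exI[of _ n], rule exI[of _ "-m"])
      (simp add: g mult.commute)
qed

lemma Lstar_iff: "z \<in> Lstar a b \<longleftrightarrow> (\<exists>\<gamma>. \<not> member \<gamma> \<and> z = Mstar a b \<gamma>)"
  by (auto simp: Lstar_def member_iff)

end

section \<open>The functional and the gap values\<close>

lemma dist_int_le: "dist_int x \<le> \<bar>x - of_int m\<bar>"
  unfolding dist_int_def by (rule round_diff_minimal)

lemma eventually_int_ends:
  "eventually P (sup at_top at_bot) \<longleftrightarrow> (\<exists>N. \<forall>n::int. N \<le> \<bar>n\<bar> \<longrightarrow> P n)"
proof
  assume "eventually P (sup at_top at_bot)"
  then obtain N1 N2 where N: "\<And>n. n \<ge> N1 \<Longrightarrow> P n" "\<And>n. n \<le> N2 \<Longrightarrow> P n"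
    unfolding eventually_sup eventually_at_top_linorder eventually_at_bot_linorder by blast
  have "P n" if "max N1 (- N2) \<le> \<bar>n\<bar>" for n
    using N[of n] that by (cases "n \<ge> 0") auto
  then show "\<exists>N. \<forall>n::int. N \<le> \<bar>n\<bar> \<longrightarrow> P n" by blast
next
  assume "\<exists>N. \<forall>n::int. N \<le> \<bar>n\<bar> \<longrightarrow> P n"
  then obtain N where N: "\<And>n. N \<le> \<bar>n\<bar> \<Longrightarrow> P n" by blast
  show "eventually P (sup at_top at_bot)"
    unfolding eventually_sup eventually_at_top_linorder eventually_at_bot_linorder
    by (intro conjI exI[of _ N] exI[of _ "- N"]) (auto intro!: N)
qed

lemma ereal_less_mult_iff: "0 < k \<Longrightarrow> ereal c < ereal k * L \<longleftrightarrow> ereal (c / k) < L"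
  by (cases L) (auto simp: field_simps)

lemma ereal_mult_less_iff: "0 < k \<Longrightarrow> ereal k * L < ereal c \<longleftrightarrow> L < ereal (c / k)"
  by (cases L) (auto simp: field_simps)

context even_pair
begin

section \<open>The functional in lattice coordinates\<close>

abbreviation "Ms \<equiv> Mstar a b"

lemma D_less_1: "D < 1" using D_small by simp

text \<open>Passing to an intermediate \<open>c'\<close> makes the inequality uniform for all large
  indices and leaves room for error terms that tend to 0.\<close>

lemma Ms_greaterD:
  assumes "ereal c < Ms \<gamma>"
  obtains c' and N :: int where "c < c'" "\<And>n::int. N \<le> \<bar>n\<bar> \<Longrightarrow> c' < 4 * (1 - D) * (\<bar>real_of_int n\<bar> * dist_int (real_of_int n * \<eta> - \<gamma>))"
proof -
  obtain c' where c': "ereal c < ereal c'" "ereal c' < Ms \<gamma>" using assms ereal_dense2 by blast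
  have "0 < 4 * (1 - D)" using D_less_1 by simp
  then have "ereal (c' / (4 * (1 - D))) < M \<eta> \<gamma>"
    using c'(2) ereal_less_mult_iff unfolding Mstar_def by blast
  then have "\<forall>\<^sub>F n in sup at_top at_bot. ereal (c' / (4 * (1 - D))) <
      ereal (\<bar>real_of_int n\<bar> * dist_int (real_of_int n * \<eta> - \<gamma>))"
    unfolding M_def by (rule less_LiminfD)
  then obtain N :: int where "\<And>n::int. N \<le> \<bar>n\<bar> \<Longrightarrow> c' / (4 * (1 - D)) < \<bar>real_of_int n\<bar> * dist_int (real_of_int n * \<eta> - \<gamma>)"
    unfolding eventually_int_ends by auto
  then have "\<And>n::int. N \<le> \<bar>n\<bar> \<Longrightarrow> c' < 4 * (1 - D) * (\<bar>real_of_int n\<bar> * dist_int (real_of_int n * \<eta> - \<gamma>))"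
    using D_less_1 by (simp add: field_simps)
  then show ?thesis using c' that by (meson ereal_less(1) less_ereal.simps(1))
qed

lemma Ms_geI:
  assumes "\<And>c'. c' < c \<Longrightarrow> \<exists>N::int. \<forall>n::int. N \<le> \<bar>n\<bar> \<longrightarrow> c' \<le> 4 * (1 - D) * (\<bar>real_of_int n\<bar> * dist_int (real_of_int n * \<eta> - \<gamma>))"
  shows "ereal c \<le> Ms \<gamma>"
proof (rule ccontr)
  assume "\<not> ereal c \<le> Ms \<gamma>"
  then obtain c' where c': "Ms \<gamma> < ereal c'" "ereal c' < ereal c" unfolding not_le using ereal_dense2 by blast
  have k: "0 < 4 * (1 - D)" using D_less_1 by simp
  obtain N :: int where N: "\<And>n::int. N \<le> \<bar>n\<bar> \<Longrightarrow> c' \<le> 4 * (1 - D) * (\<bar>real_of_int n\<bar> * dist_int (real_of_int n * \<eta> - \<gamma>))"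
    using assms[of c'] c'(2) unfolding less_ereal.simps by blast
  have "\<forall>\<^sub>F n in sup at_top at_bot. ereal (c' / (4 * (1 - D))) \<le>
      ereal (\<bar>real_of_int n\<bar> * dist_int (real_of_int n * \<eta> - \<gamma>))"
    unfolding eventually_int_ends using N D_less_1 by (intro exI[of _ N]) (simp add: field_simps)
  then have "ereal (c' / (4 * (1 - D))) \<le> M \<eta> \<gamma>" unfolding M_def by (rule Liminf_bounded)
  moreover have "M \<eta> \<gamma> < ereal (c' / (4 * (1 - D)))"
    using c'(1) k ereal_mult_less_iff unfolding Mstar_def by blast
  ultimately show False by (simp only: leD)
qed

text \<open>The difference of the two coordinates isolates the index, because
  \<open>1 / \<beta> - \<eta> = (1 - D) / \<beta>\<close>. Hence the factor \<open>1 - D\<close> in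
  \<open>Mstar\<close>.\<close>

lemma lat_index:
  assumes "lat X Z"
  obtains n m :: int where "X = real_of_int n / \<beta> - real_of_int m" "Z = real_of_int n * \<eta> - real_of_int m" "(1 - D) * \<bar>real_of_int n\<bar> = \<beta> * \<bar>X - Z\<bar>"
proof -
  obtain n m :: int where nm: "X = real_of_int n / \<beta> - real_of_int m" "Z = real_of_int n * \<eta> - real_of_int m" using assms by (auto simp: lat_def)
  have "\<beta> * (X - Z) = (1 - D) * n" using beta_pos by (simp add: nm DD_def field_simps)
  then have "\<beta> * \<bar>X - Z\<bar> = (1 - D) * \<bar>real_of_int n\<bar>"
    using beta_pos D_less_1 by (metis abs_mult abs_of_pos diff_gt_0_iff_gt of_int_abs)
  with nm that show ?thesis by metis
qed

text \<open>The index is proportional to \<open>X - (Y + \<gamma>)\<close> rather than to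
  \<open>X\<close>. For small \<open>Y\<close> the discrepancy contributes only a multiple of
  \<open>Y\<close>, so the scale-free product of \<open>X\<close> and \<open>Y\<close> may replace
  the original one.\<close>

lemma product_error:
  assumes "\<bar>Y\<bar> \<le> 1" "\<bar>Y\<bar> * (8 * (1 + \<bar>\<gamma>\<bar>)) \<le> e"
  shows "\<bar>4 * (\<beta> * \<bar>X - (Y + \<gamma>)\<bar>) * \<bar>Y\<bar> - 4 * \<beta> * \<bar>X * Y\<bar>\<bar> \<le> e / 2"
proof -
  have "\<bar>\<bar>X - (Y + \<gamma>)\<bar> - \<bar>X\<bar>\<bar> \<le> \<bar>Y\<bar> + \<bar>\<gamma>\<bar>" by linarith
  also have "\<dots> \<le> 1 + \<bar>\<gamma>\<bar>" using assms by simp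
  finally have *: "\<bar>\<bar>X - (Y + \<gamma>)\<bar> - \<bar>X\<bar>\<bar> \<le> 1 + \<bar>\<gamma>\<bar>" .
  have "\<bar>4 * (\<beta> * \<bar>X - (Y + \<gamma>)\<bar>) * \<bar>Y\<bar> - 4 * \<beta> * \<bar>X * Y\<bar>\<bar> = \<bar>4 * \<beta> * \<bar>Y\<bar> * (\<bar>X - (Y + \<gamma>)\<bar> - \<bar>X\<bar>)\<bar>"
    by (simp add: abs_mult algebra_simps)
  also have "\<dots> = 4 * \<beta> * \<bar>Y\<bar> * \<bar>\<bar>X - (Y + \<gamma>)\<bar> - \<bar>X\<bar>\<bar>"
    using beta_pos by (simp add: abs_mult)
  also have "\<dots> \<le> 4 * 1 * \<bar>Y\<bar> * (1 + \<bar>\<gamma>\<bar>)"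
    using * beta_pos beta_small by (intro mult_mono) auto
  also have "\<dots> \<le> e / 2" using assms(2) by (simp add: algebra_simps)
  finally show ?thesis .
qed

lemma Ms_greater_lat:
  assumes "\<not> member \<gamma>" "ereal c < Ms \<gamma>"
  obtains c' \<delta> where "c < c'" "0 < \<delta>" "\<And>X Y. lat X (Y + \<gamma>) \<Longrightarrow> \<bar>Y\<bar> < \<delta> \<Longrightarrow> c' < 4 * \<beta> * \<bar>X * Y\<bar>"
proof -
  obtain c1 and N :: int where c1: "c < c1" and
    N: "\<And>n::int. N \<le> \<bar>n\<bar> \<Longrightarrow> c1 < 4 * (1 - D) * (\<bar>real_of_int n\<bar> * dist_int (real_of_int n * \<eta> - \<gamma>))"
    using Ms_greaterD[OF assms(2)] by metis
  \<comment> \<open>A distance below all those that occur for indices up to \<open>N\<close> forces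
    a larger index. These finitely many distances are positive because \<open>\<gamma>\<close> is
    not a member; the element 1 keeps the set nonempty.\<close>
  define S where "S = insert 1 ((\<lambda>n. dist_int (real_of_int n * \<eta> - \<gamma>)) ` {-N..N})"
  define d1 where "d1 = Min S"
  have dpos: "0 < dist_int (real_of_int n * \<eta> - \<gamma>)" for n
  proof (rule ccontr)
    define k where "k = round (n * \<eta> - \<gamma>)"
    assume "\<not> 0 < dist_int (real_of_int n * \<eta> - \<gamma>)"
    then have "n * \<eta> - \<gamma> = of_int k" by (simp add: dist_int_def k_def)
    then have "\<gamma> = n * \<eta> - of_int k" by simp
    then show False using assms(1) unfolding member_def lat_def by blast
  qed
  have fin: "finite S" by (simp add: S_def)
  have d1: "0 < d1" unfolding d1_def using fin dpos by (subst Min_gr_iff) (auto simp: S_def)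
  have d1_le: "d1 \<le> dist_int (real_of_int n * \<eta> - \<gamma>)" if "\<bar>n\<bar> \<le> N" for n
    unfolding d1_def using fin that by (intro Min_le) (auto simp: S_def abs_le_iff)
  define \<delta> where "\<delta> = min d1 (min 1 ((c1 - c) / (8 * (1 + \<bar>\<gamma>\<bar>))))"
  have g: "0 < 8 * (1 + \<bar>\<gamma>\<bar>)" by simp
  have "0 < \<delta>" using d1 c1 g by (simp add: \<delta>_def)
  moreover have "(c + c1) / 2 < 4 * \<beta> * \<bar>X * Y\<bar>" if XY: "lat X (Y + \<gamma>)" "\<bar>Y\<bar> < \<delta>" for X Y
  proof -
    obtain n m :: int where nm: "X = real_of_int n / \<beta> - real_of_int m" "Y + \<gamma> = real_of_int n * \<eta> - real_of_int m" "(1 - D) * \<bar>real_of_int n\<bar> = \<beta> * \<bar>X - (Y + \<gamma>)\<bar>"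
      using lat_index[OF XY(1)] by blast
    have Y: "Y = n * \<eta> - \<gamma> - m" using nm(2) by simp
    have dl: "dist_int (n * \<eta> - \<gamma>) \<le> \<bar>Y\<bar>" unfolding Y by (rule dist_int_le)
    have nN: "N \<le> \<bar>n\<bar>"
    proof (rule ccontr)
      assume "\<not> N \<le> \<bar>n\<bar>"
      then have "d1 \<le> \<bar>Y\<bar>" using d1_le[of n] dl by simp
      then show False using XY(2) by (simp add: \<delta>_def)
    qed
    have "c1 < 4 * (1 - D) * (\<bar>real_of_int n\<bar> * dist_int (real_of_int n * \<eta> - \<gamma>))" by (rule N[OF nN])
    also have "\<dots> \<le> 4 * (1 - D) * (\<bar>real_of_int n\<bar> * \<bar>Y\<bar>)"
      using dl D_less_1 by (intro mult_left_mono) auto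
    also have "\<dots> = 4 * (\<beta> * \<bar>X - (Y + \<gamma>)\<bar>) * \<bar>Y\<bar>" unfolding nm(3)[symmetric] by simp
    finally have 1: "c1 < 4 * (\<beta> * \<bar>X - (Y + \<gamma>)\<bar>) * \<bar>Y\<bar>" .
    have "\<bar>Y\<bar> < (c1 - c) / (8 * (1 + \<bar>\<gamma>\<bar>))" using XY(2) by (simp add: \<delta>_def)
    then have "\<bar>Y\<bar> * (8 * (1 + \<bar>\<gamma>\<bar>)) \<le> c1 - c" using g by (simp only: pos_less_divide_eq less_imp_le)
    moreover have "\<bar>Y\<bar> \<le> 1" using XY(2) by (simp add: \<delta>_def)
    ultimately have "\<bar>4 * (\<beta> * \<bar>X - (Y + \<gamma>)\<bar>) * \<bar>Y\<bar> - 4 * \<beta> * \<bar>X * Y\<bar>\<bar> \<le> (c1 - c) / 2"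
      by (intro product_error)
    then show ?thesis using 1 unfolding abs_le_iff by argo
  qed
  moreover have "c < (c + c1) / 2" using c1 by simp
  ultimately show ?thesis using that by blast
qed

lemma Ms_ge_lat:
  assumes "\<And>c'. c' < c \<Longrightarrow> \<exists>\<delta>>0. \<forall>X Y. lat X (Y + \<gamma>) \<longrightarrow> \<bar>Y\<bar> < \<delta> \<longrightarrow> c' \<le> 4 * \<beta> * \<bar>X * Y\<bar>"
  shows "ereal c \<le> Ms \<gamma>"
proof (rule Ms_geI)
  fix c' assume "c' < c"
  define c1 where "c1 = (c + c') / 2"
  have c1: "c' < c1" "c1 < c" using \<open>c' < c\<close> by (simp_all add: c1_def)
  obtain d where d: "0 < d" "\<And>X Y. lat X (Y + \<gamma>) \<Longrightarrow> \<bar>Y\<bar> < d \<Longrightarrow> c1 \<le> 4 * \<beta> * \<bar>X * Y\<bar>"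
    using assms[OF c1(2)] by blast
  define \<delta> where "\<delta> = min d (min 1 ((c1 - c') / (8 * (1 + \<bar>\<gamma>\<bar>))))"
  have g: "0 < 8 * (1 + \<bar>\<gamma>\<bar>)" by simp
  have \<delta>: "0 < \<delta>" using d c1 g by (simp add: \<delta>_def)
  \<comment> \<open>From this index on, a distance of at least \<open>\<delta>\<close> makes the
    product large enough by itself.\<close>
  define N where "N = \<lceil>\<bar>c'\<bar> / (4 * (1 - D) * \<delta>)\<rceil>"
  have k: "0 < 4 * (1 - D) * \<delta>" using \<delta> D_less_1 by simp
  show "\<exists>N::int. \<forall>n::int. N \<le> \<bar>n\<bar> \<longrightarrow> c' \<le> 4 * (1 - D) * (\<bar>real_of_int n\<bar> * dist_int (real_of_int n * \<eta> - \<gamma>))"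
  proof (intro exI allI impI)
    fix n :: int assume n: "N \<le> \<bar>n\<bar>"
    define m where "m = round (n * \<eta> - \<gamma>)"
    define Y where "Y = n * \<eta> - \<gamma> - m"
    define X where "X = n / \<beta> - m"
    have dY: "dist_int (n * \<eta> - \<gamma>) = \<bar>Y\<bar>" by (simp add: dist_int_def Y_def m_def)
    show "c' \<le> 4 * (1 - D) * (\<bar>real_of_int n\<bar> * dist_int (real_of_int n * \<eta> - \<gamma>))"
    proof (cases "\<bar>Y\<bar> < \<delta>")
      case True
      have Z: "Y + \<gamma> = n * \<eta> - m" by (simp add: Y_def)
      have l: "lat X (Y + \<gamma>)" unfolding lat_def X_def Z by blast
      have "\<beta> * (X - (Y + \<gamma>)) = (1 - D) * n"
        using beta_pos unfolding Z by (simp add: X_def DD_def field_simps)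
      then have e: "\<beta> * \<bar>X - (Y + \<gamma>)\<bar> = (1 - D) * \<bar>real_of_int n\<bar>"
        using beta_pos D_less_1 by (metis abs_mult abs_of_pos diff_gt_0_iff_gt of_int_abs)
      have "c1 \<le> 4 * \<beta> * \<bar>X * Y\<bar>" using d(2)[OF l] True by (simp add: \<delta>_def)
      moreover
      have "\<bar>Y\<bar> < (c1 - c') / (8 * (1 + \<bar>\<gamma>\<bar>))" using True by (simp add: \<delta>_def)
      then have "\<bar>Y\<bar> * (8 * (1 + \<bar>\<gamma>\<bar>)) \<le> c1 - c'" using g by (simp only: pos_less_divide_eq less_imp_le)
      moreover have "\<bar>Y\<bar> \<le> 1" using True by (simp add: \<delta>_def)
      ultimately have "\<bar>4 * (\<beta> * \<bar>X - (Y + \<gamma>)\<bar>) * \<bar>Y\<bar> - 4 * \<beta> * \<bar>X * Y\<bar>\<bar> \<le> (c1 - c') / 2"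
        by (intro product_error)
      then have "c' \<le> 4 * (\<beta> * \<bar>X - (Y + \<gamma>)\<bar>) * \<bar>Y\<bar>"
        using \<open>c1 \<le> _\<close> c1 unfolding abs_le_iff by argo
      then show ?thesis unfolding e dY by (simp add: mult_ac)
    next
      case False
      have "c' \<le> \<bar>c'\<bar>" by simp
      also have "\<dots> = \<bar>c'\<bar> / (4 * (1 - D) * \<delta>) * (4 * (1 - D) * \<delta>)" using \<delta> D_less_1 by simp
      also have "\<dots> \<le> N * (4 * (1 - D) * \<delta>)"
        using k unfolding N_def by (intro mult_right_mono) auto
      also have "\<dots> \<le> \<bar>real_of_int n\<bar> * (4 * (1 - D) * \<bar>Y\<bar>)"
        using False n D_less_1 k
        by (intro mult_mono mult_left_mono) (simp_all flip: of_int_abs)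
      finally show ?thesis unfolding dY by (simp add: mult_ac)
    qed
  qed
qed

text \<open>All invariances of \<open>Ms\<close> come from this comparison: a map between the points
  of two translated lattices may change the product by a multiple of \<open>Y\<close>, since only
  \<open>Y\<close> tending to 0 matters.\<close>

lemma Ms_le_transfer:
  assumes "\<not> member \<gamma>"
    and f: "\<And>X Y. lat X (Y + \<gamma>') \<Longrightarrow>
      \<exists>X1 Y1. lat X1 (Y1 + \<gamma>) \<and> \<bar>Y1\<bar> \<le> K * \<bar>Y\<bar> \<and> \<bar>X1 * Y1\<bar> \<le> \<bar>X * Y\<bar> + K * \<bar>Y\<bar>"
  shows "Ms \<gamma> \<le> Ms \<gamma>'"
proof (rule ccontr)
  assume "\<not> Ms \<gamma> \<le> Ms \<gamma>'"
  then obtain c where c: "Ms \<gamma>' < ereal c" "ereal c < Ms \<gamma>" unfolding not_le using ereal_dense2 by blast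
  obtain c1 d where d: "c < c1" "0 < d" "\<And>X Y. lat X (Y + \<gamma>) \<Longrightarrow> \<bar>Y\<bar> < d \<Longrightarrow> c1 < 4 * \<beta> * \<bar>X * Y\<bar>"
    using Ms_greater_lat[OF assms(1) c(2)] by metis
  have "ereal c \<le> Ms \<gamma>'"
  proof (rule Ms_ge_lat)
    fix c' assume c': "c' < c"
    define L where "L = 1 + \<bar>K\<bar>"
    define \<delta> where "\<delta> = min (d / L) ((c - c') / (4 * L))"
    have L: "0 < L" "K \<le> L" by (simp_all add: L_def)
    have "0 < \<delta>" using d c' L by (simp add: \<delta>_def)
    moreover have "c' \<le> 4 * \<beta> * \<bar>X * Y\<bar>" if XY: "lat X (Y + \<gamma>')" "\<bar>Y\<bar> < \<delta>" for X Y
    proof -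
      obtain X1 Y1 where 1: "lat X1 (Y1 + \<gamma>)" "\<bar>Y1\<bar> \<le> K * \<bar>Y\<bar>" "\<bar>X1 * Y1\<bar> \<le> \<bar>X * Y\<bar> + K * \<bar>Y\<bar>"
        using f[OF XY(1)] by blast
      have KL: "K * \<bar>Y\<bar> \<le> L * \<bar>Y\<bar>" using L by (intro mult_right_mono) auto
      have "\<bar>Y\<bar> < d / L" "\<bar>Y\<bar> < (c - c') / (4 * L)" using XY(2) by (simp_all add: \<delta>_def)
      then have Y: "L * \<bar>Y\<bar> < d" "4 * (L * \<bar>Y\<bar>) < c - c'" using L by (simp_all add: field_simps)
      have "c1 < 4 * \<beta> * \<bar>X1 * Y1\<bar>" using d(3)[OF 1(1)] 1(2) KL Y by linarith
      also have "\<dots> \<le> 4 * \<beta> * (\<bar>X * Y\<bar> + L * \<bar>Y\<bar>)"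
        using 1(3) KL beta_pos by (intro mult_left_mono) auto
      also have "\<dots> \<le> 4 * \<beta> * \<bar>X * Y\<bar> + 1 * (4 * (L * \<bar>Y\<bar>))"
        using beta_small L mult_right_mono[of \<beta> 1 "4 * (L * \<bar>Y\<bar>)"] by (simp add: algebra_simps)
      finally show ?thesis using Y(2) d(1) by linarith
    qed
    ultimately show "\<exists>\<delta>>0. \<forall>X Y. lat X (Y + \<gamma>') \<longrightarrow> \<bar>Y\<bar> < \<delta> \<longrightarrow> c' \<le> 4 * \<beta> * \<bar>X * Y\<bar>" by blast
  qed
  then show False using c(1) by simp
qed

section \<open>Invariance under lattice shifts, negation and the unit \<open>D\<close>\<close>

lemma Ms_lat_shift_le:
  assumes "\<not> member \<gamma>" "lat P \<mu>"
  shows "Ms \<gamma> \<le> Ms (\<gamma> + \<mu>)"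
proof (rule Ms_le_transfer[OF assms(1), where K = "1 + \<bar>P\<bar>"])
  fix X Y assume "lat X (Y + (\<gamma> + \<mu>))"
  then have "lat (X - P) (Y + \<gamma>)" using lat_diff[OF _ assms(2)] by (fastforce simp: algebra_simps)
  moreover have "\<bar>(X - P) * Y\<bar> \<le> \<bar>X * Y\<bar> + (1 + \<bar>P\<bar>) * \<bar>Y\<bar>"
    by (simp add: algebra_simps abs_mult[symmetric])
  moreover have "\<bar>Y\<bar> \<le> (1 + \<bar>P\<bar>) * \<bar>Y\<bar>" by (simp add: algebra_simps)
  ultimately show "\<exists>X1 Y1. lat X1 (Y1 + \<gamma>) \<and> \<bar>Y1\<bar> \<le> (1 + \<bar>P\<bar>) * \<bar>Y\<bar> \<and> \<bar>X1 * Y1\<bar> \<le> \<bar>X * Y\<bar> + (1 + \<bar>P\<bar>) * \<bar>Y\<bar>"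
    by blast
qed

lemma member_shift: 
  assumes P: "lat P \<mu>" shows "member (\<gamma> + \<mu>) \<longleftrightarrow> member \<gamma>"
proof
  assume "member (\<gamma> + \<mu>)"
  then obtain X where "lat X (\<gamma> + \<mu>)" by (auto simp: member_def)
  from lat_diff[OF this P] show "member \<gamma>" by (auto simp: member_def)
next
  assume "member \<gamma>"
  then obtain X where "lat X \<gamma>" by (auto simp: member_def)
  from lat_add[OF this P] show "member (\<gamma> + \<mu>)" by (auto simp: member_def)
qed

lemma Ms_lat_shift:
  assumes "\<not> member \<gamma>" "lat P \<mu>"
  shows "Ms (\<gamma> + \<mu>) = Ms \<gamma>"
proof (rule antisym)
  have "Ms (\<gamma> + \<mu>) \<le> Ms (\<gamma> + \<mu> + (- \<mu>))"
    by (rule Ms_lat_shift_le[where P = "- P"]) (simp_all add: assms member_shift[OF assms(2)] lat_minus)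
  then show "Ms (\<gamma> + \<mu>) \<le> Ms \<gamma>" by simp
qed (rule Ms_lat_shift_le[OF assms])

lemma member_minus: "member (- \<gamma>) \<longleftrightarrow> member \<gamma>"
proof -
  have "member \<gamma> \<Longrightarrow> member (- \<gamma>)" for \<gamma> unfolding member_def using lat_minus by blast
  from this[of \<gamma>] this[of "- \<gamma>"] show ?thesis by auto
qed

lemma Ms_minus_le:
  assumes "\<not> member \<gamma>"
  shows "Ms \<gamma> \<le> Ms (- \<gamma>)"
proof (rule Ms_le_transfer[OF assms(1), where K = 1])
  fix X Y assume "lat X (Y + - \<gamma>)"
  then have "lat (- X) (- Y + \<gamma>)" using lat_minus by fastforce
  then show "\<exists>X1 Y1. lat X1 (Y1 + \<gamma>) \<and> \<bar>Y1\<bar> \<le> 1 * \<bar>Y\<bar> \<and> \<bar>X1 * Y1\<bar> \<le> \<bar>X * Y\<bar> + 1 * \<bar>Y\<bar>"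
    by (intro exI[of _ "- X"] exI[of _ "- Y"]) simp
qed

lemma Ms_minus: "\<not> member \<gamma> \<Longrightarrow> Ms (- \<gamma>) = Ms \<gamma>"
  using Ms_minus_le[of \<gamma>] Ms_minus_le[of "- \<gamma>"] by (simp add: member_minus antisym)

text \<open>Since \<open>D + 1 / D = a * b - 2\<close> is an integer, \<open>D\<close> is a unit
  with conjugate \<open>1 / D\<close>, so it acts on the two coordinates by inverse factors. The
  basis vectors of index 2 and 3 are the images of those of index 0 and 1, which settles one
  direction; the integer trace settles the other.\<close>

lemma lat_unit:
  assumes "lat X Y"
  shows "lat (X / D) (D * Y)" and "lat (D * X) (Y / D)"
proof -
  obtain n m :: int where nm: "X = n / \<beta> - m" "Y = n * \<eta> - m" using assms by (auto simp: lat_def)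
  have 2: "lat (1 / D) D"
    using lat_v[of 2] by (simp add: numeral_2_eq_2 vX_Suc al_0 DD_def mult.commute)
  have 3: "lat (1 / (\<beta> * D)) (\<eta> * D)"
    using lat_v[of 3] by (simp add: numeral_3_eq_3 vX_Suc al_0 DD_def mult_ac)
  show "lat (X / D) (D * Y)"
    using lat_lin[OF 3 2, of n "- m"] by (simp add: nm field_simps diff_divide_distrib)
  have T: "D + 1 / D = of_int (a * b - 2)"
  proof -
    have "(1 + D)^2 = (a * \<eta>) * (b * \<beta>)" by (simp only: eta_a beta_b power2_eq_square)
    then have "(1 + D)^2 = a * b * D" by (simp add: DD_def)
    then show ?thesis using D_pos by (simp add: field_simps power2_eq_square)
  qed
  then have T': "of_int (a * b - 2) - 1 / D = D" "of_int (a * b - 2) - D = 1 / D" by linarith+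
  have 4: "lat (1 / \<beta>) \<eta>" unfolding lat_def by (intro exI[of _ 1] exI[of _ 0]) auto
  have 5: "lat 1 1" unfolding lat_def by (rule exI[of _ 0], rule exI[of _ "-1"]) auto
  have 6: "lat D (1 / D)"
    using lat_diff[OF lat_mult[OF 5, of "a * b - 2"] 2] by (simp only: T' mult_1_right)
  have 7: "lat (D / \<beta>) (\<eta> / D)"
  proof -
    have "lat (of_int (a * b - 2) * (1 / \<beta>) - 1 / (\<beta> * D)) (of_int (a * b - 2) * \<eta> - \<eta> * D)"
      using lat_diff[OF lat_mult[OF 4] 3] .
    moreover have "of_int (a * b - 2) * (1 / \<beta>) - 1 / (\<beta> * D) = (of_int (a * b - 2) - 1 / D) * (1 / \<beta>)"
      by (simp only: left_diff_distrib) simp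
    moreover have "of_int (a * b - 2) * \<eta> - \<eta> * D = (of_int (a * b - 2) - D) * \<eta>"
      by (simp only: left_diff_distrib) simp
    ultimately show ?thesis by (simp only: T') simp
  qed
  show "lat (D * X) (Y / D)"
    using lat_lin[OF 7 6, of n "- m"] by (simp add: nm algebra_simps diff_divide_distrib)
qed

lemma member_unit: "member (D * \<gamma>) \<longleftrightarrow> member \<gamma>"
proof
  assume "member (D * \<gamma>)"
  then show "member \<gamma>" unfolding member_def using lat_unit(2)[of _ "D * \<gamma>"] D_pos by auto
qed (use lat_unit(1) in \<open>auto simp: member_def\<close>)

lemma Ms_unit:
  assumes "\<not> member \<gamma>"
  shows "Ms (D * \<gamma>) = Ms \<gamma>"
proof (rule antisym)
  show "Ms (D * \<gamma>) \<le> Ms \<gamma>"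
  proof (rule Ms_le_transfer[where K = 1])
    show "\<not> member (D * \<gamma>)" using assms member_unit by simp
    fix X Y assume "lat X (Y + \<gamma>)"
    then have "lat (X / D) (D * Y + D * \<gamma>)" using lat_unit(1) by (fastforce simp: distrib_left)
    then show "\<exists>X1 Y1. lat X1 (Y1 + D * \<gamma>) \<and> \<bar>Y1\<bar> \<le> 1 * \<bar>Y\<bar> \<and> \<bar>X1 * Y1\<bar> \<le> \<bar>X * Y\<bar> + 1 * \<bar>Y\<bar>"
      using D_pos D_less_1
      by (intro exI[of _ "X / D"] exI[of _ "D * Y"]) (simp add: abs_mult mult_left_le_one_le)
  qed
  show "Ms \<gamma> \<le> Ms (D * \<gamma>)"
  proof (rule Ms_le_transfer[OF assms, where K = "1 / D"])
    fix X Y assume "lat X (Y + D * \<gamma>)"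
    then have "lat (D * X) (Y / D + \<gamma>)" using lat_unit(2) D_pos by (fastforce simp: add_divide_distrib)
    then show "\<exists>X1 Y1. lat X1 (Y1 + \<gamma>) \<and> \<bar>Y1\<bar> \<le> 1 / D * \<bar>Y\<bar> \<and> \<bar>X1 * Y1\<bar> \<le> \<bar>X * Y\<bar> + 1 / D * \<bar>Y\<bar>"
      using D_pos by (intro exI[of _ "D * X"] exI[of _ "Y / D"]) (simp add: abs_mult)
  qed
qed

end

text \<open>Absolute values are needed until \<open>x\<close> and \<open>y\<close> are known to lie
  in the square where all eight factors are positive; \<open>good\<close> is the form after
  that.\<close>

definition Sgt :: "real \<Rightarrow> real \<Rightarrow> real \<Rightarrow> real \<Rightarrow> real \<Rightarrow> bool" where
  "Sgt A B c x y \<longleftrightarrow>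
    c < \<bar>(1 - A + x) * (1 - B + y)\<bar> \<and> c < \<bar>(1 - A - x) * (1 - B - y)\<bar> \<and>
    c < \<bar>(1 + A - x) * (1 + B + y)\<bar> \<and> c < \<bar>(1 + A + x) * (1 + B - y)\<bar>"

context even_pair
begin

section \<open>Digit chains and the corners of their cells\<close>

definition chain :: "(nat \<Rightarrow> int) \<Rightarrow> (nat \<Rightarrow> real) \<Rightarrow> (nat \<Rightarrow> real) \<Rightarrow> bool" where
  "chain t x y \<longleftrightarrow> (\<forall>j. even (t j) \<and> x j = al j * (of_int (t j) + x (Suc j)) \<and>
     y (Suc j) = al j * (of_int (t j) + y j))"

definition gam :: "real \<Rightarrow> real" where "gam x = (1 - \<eta> + x) / 2"

text \<open>Uncentred right and left values: in terms of \<open>uu\<close>, \<open>ww\<close> and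
  \<open>dg\<close> a chain is the ordinary expansion with digits \<open>dg t j\<close>, the one
  that \<open>gammaP\<close> sums up.\<close>

definition uu :: "(nat \<Rightarrow> real) \<Rightarrow> nat \<Rightarrow> real" where "uu x j = (1 - al j + x j) / 2"
definition ww :: "(nat \<Rightarrow> real) \<Rightarrow> nat \<Rightarrow> real" where "ww y j = (1 - al (Suc j) + y j) / 2"
definition dg :: "(nat \<Rightarrow> int) \<Rightarrow> nat \<Rightarrow> int" where "dg t j = (t j + nn j - 2) div 2"

lemma dg_real: "even (t j) \<Longrightarrow> real_of_int (dg t j) = (t j + nn j - 2) / 2"
proof -
  assume "even (t j)"
  then have "2 * dg t j = t j + nn j - 2" using even_nn[of j] by (simp add: dg_def)
  then have "real_of_int (2 * dg t j) = real_of_int (t j + nn j - 2)" by simp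
  then show ?thesis by simp
qed

lemma chainD:
  assumes "chain t x y"
  shows "even (t j)" "x j = al j * (of_int (t j) + x (Suc j))" "y (Suc j) = al j * (of_int (t j) + y j)"
  using assms unfolding chain_def by blast+

lemma uu_Suc:
  assumes "chain t x y"
  shows "uu x j = al j * (dg t j + uu x (Suc j))"
proof -
  have "uu x j = (1 - al j + al j * (of_int (t j) + x (Suc j))) / 2"
    using chainD(2)[OF assms, of j] by (simp add: uu_def)
  moreover have "2 * (al j * (dg t j + uu x (Suc j))) =
      al j * t j + nn j * al j - al j + al j * x (Suc j) - al j * al (Suc j)"
    by (simp add: dg_real[OF chainD(1)[OF assms]] uu_def field_simps)
  ultimately show ?thesis using al_nn[of j] al_prod[of j] by (simp add: field_simps)
qed

lemma ww_Suc:
  assumes "chain t x y"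
  shows "ww y (Suc j) = al j * (ww y j + dg t j)"
proof -
  have "ww y (Suc j) = (1 - al j + al j * (of_int (t j) + y j)) / 2"
    using chainD(3)[OF assms, of j] by (simp add: ww_def)
  moreover have "2 * (al j * (ww y j + dg t j)) =
      al j * t j + nn j * al j - al j + al j * y j - al j * al (Suc j)"
    by (simp add: dg_real[OF chainD(1)[OF assms]] ww_def field_simps)
  ultimately show ?thesis using al_nn[of j] al_prod[of j] by (simp add: field_simps)
qed

lemma gam_uu: "gam (x 0) = uu x 0" by (simp add: gam_def uu_def al_0)

text \<open>Each step adds \<open>dg t j\<close> times the next basis vector, which is exactly what
  the left value gains and the right value gives up. The offset \<open>ww y 0 / \<beta>\<close>
  records the initial left value.\<close>

lemma vertex:
  assumes "chain t x y"
  shows "lat (ww y j * vX (Suc j) - ww y 0 / \<beta>) (- (Dj j * uu x j) + gam (x 0))"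
proof (induction j)
  case 0
  show ?case unfolding lat_def by (rule exI[of _ 0], rule exI[of _ 0]) (simp add: gam_uu vX_Suc)
next
  case (Suc j)
  have 1: "ww y (Suc j) * vX (Suc (Suc j)) = ww y j * vX (Suc j) + dg t j * vX (Suc j)"
    unfolding ww_Suc[OF assms] vX_eq[of "Suc j"] by (simp add: algebra_simps)
  have 2: "Dj (Suc j) * uu x (Suc j) = Dj j * uu x j - dg t j * Dj (Suc j)"
    unfolding uu_Suc[OF assms, of j] by (simp add: algebra_simps)
  show ?case using lat_add[OF Suc lat_mult[OF lat_v[of "Suc j"], of "dg t j"]] unfolding 1 2
    by (simp add: algebra_simps)
qed

lemma vertex_point:
  assumes "chain t x y"
  shows "lat (ww y j * vX (Suc j) - ww y 0 / \<beta> + (of_int p * vX j - of_int q * vX (Suc j)))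
      (Dj j * (- uu x j + of_int p - of_int q * al j) + gam (x 0))"
  using lat_add[OF vertex[OF assms, of j] lat_lin[OF lat_v[of j] lat_v[of "Suc j"], of p "- q"]]
  by (simp add: algebra_simps)

text \<open>The point \<open>p\<close>, \<open>q\<close> steps away from the vertex has second
  coordinate of order \<open>Dj j\<close>, hence is eventually subject to the lattice bound. Its
  first coordinate differs from the scale-free form by a fixed offset, whose contribution to the
  product vanishes with \<open>Dj j\<close>.\<close>

lemma vertex_eventually:
  assumes ch: "chain t x y" and nm: "\<not> member (gam (x 0))" and c: "ereal c < Ms (gam (x 0))"
    and B: "\<And>j. \<bar>x j\<bar> \<le> B"
  shows "\<exists>c'>c. \<forall>p q. \<forall>\<^sub>F j in sequentially.
    c' < \<bar>(1 + y j - al (Suc j) + 2 * of_int p * al (Suc j) - 2 * of_int q) *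
       (- 1 + al j - x j + 2 * of_int p - 2 * of_int q * al j)\<bar>"
proof -
  obtain c1 \<delta> where c1: "c < c1" "0 < \<delta>" and
    \<delta>: "\<And>X Y. lat X (Y + gam (x 0)) \<Longrightarrow> \<bar>Y\<bar> < \<delta> \<Longrightarrow> c1 < 4 * \<beta> * \<bar>X * Y\<bar>"
    using Ms_greater_lat[OF nm c] by metis
  have "\<forall>\<^sub>F j in sequentially. (c + c1) / 2 < \<bar>(1 + y j - al (Suc j) + 2 * of_int p * al (Suc j) - 2 * of_int q) *
       (- 1 + al j - x j + 2 * of_int p - 2 * of_int q * al j)\<bar>" for p q :: int
  proof -
    define Y where "Y j = Dj j * (- uu x j + of_int p - of_int q * al j)" for j
    define X where "X j = ww y j * vX (Suc j) - ww y 0 / \<beta> + (of_int p * vX j - of_int q * vX (Suc j))" for j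
    define C where "C = 2 + B + \<bar>of_int p\<bar> + \<bar>of_int q :: real\<bar>"
    have Yle: "\<bar>Y j\<bar> \<le> Dj j * C" for j
    proof -
      have "\<bar>of_int q * al j\<bar> \<le> \<bar>of_int q\<bar> * 1"
        using al_small[of j] al_nonneg[of j] unfolding abs_mult by (intro mult_left_mono) auto
      then have "\<bar>- uu x j + of_int p - of_int q * al j\<bar> \<le> C"
        using B[of j] al_small[of j] al_pos[of j] unfolding uu_def C_def by argo
      then show ?thesis by (simp add: Y_def abs_mult abs_of_pos)
    qed
    have "(\<lambda>j. Dj j * C) \<longlonglongrightarrow> 0 * C" by (intro tendsto_intros Dj_lim)
    then have lim: "(\<lambda>j. Dj j * C) \<longlonglongrightarrow> 0" by simp
    have e1: "\<forall>\<^sub>F j in sequentially. Dj j * C < \<delta>" by (rule order_tendstoD(2)[OF lim]) (use c1 in simp)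
    have pos: "0 < (c1 - c) / (8 * (1 + \<bar>ww y 0\<bar>))" using c1 by simp
    have e2: "\<forall>\<^sub>F j in sequentially. Dj j * C < (c1 - c) / (8 * (1 + \<bar>ww y 0\<bar>))"
      by (rule order_tendstoD(2)[OF lim pos])
    show ?thesis using e1 e2
    proof eventually_elim
      case (elim j)
      have l: "lat (X j) (Y j + gam (x 0))" unfolding X_def Y_def by (rule vertex_point[OF ch])
      have "\<bar>Y j\<bar> < \<delta>" using Yle[of j] elim by simp
      then have 1: "c1 < 4 * \<beta> * \<bar>X j * Y j\<bar>" by (rule \<delta>[OF l])
      have "\<beta> * X j * Dj j = (ww y j + of_int p * al (Suc j) - of_int q) * (\<beta> * vX (Suc j) * Dj j) - ww y 0 * Dj j"
        using beta_pos unfolding X_def vX_eq[of j] by (simp add: algebra_simps)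
      then have "\<beta> * X j * Dj j = (ww y j + of_int p * al (Suc j) - of_int q) - ww y 0 * Dj j"
        by (simp add: vX_Dj)
      then have "\<beta> * X j * Y j = ((ww y j + of_int p * al (Suc j) - of_int q) - ww y 0 * Dj j)
          * (- uu x j + of_int p - of_int q * al j)"
        unfolding Y_def by (metis mult.assoc)
      then have 2: "4 * (\<beta> * X j * Y j) = (1 + y j - al (Suc j) + 2 * of_int p * al (Suc j) - 2 * of_int q) *
       (- 1 + al j - x j + 2 * of_int p - 2 * of_int q * al j) - 4 * ww y 0 * Y j" (is "_ = ?F - _")
        by (simp add: ww_def uu_def Y_def field_simps)
      have "4 * \<beta> * \<bar>X j * Y j\<bar> = \<bar>4 * (\<beta> * X j * Y j)\<bar>" using beta_pos by (simp add: abs_mult)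
      also have "\<dots> \<le> \<bar>?F\<bar> + \<bar>4 * ww y 0 * Y j\<bar>" unfolding 2 by (rule abs_triangle_ineq4)
      also have "\<bar>4 * ww y 0 * Y j\<bar> \<le> 4 * (1 + \<bar>ww y 0\<bar>) * (Dj j * C)"
        using Yle[of j] unfolding abs_mult by (intro mult_mono) auto
      also have "\<dots> \<le> (c1 - c) / 2"
      proof -
        have "0 < 8 * (1 + \<bar>ww y 0\<bar>)" by simp
        from pos_less_divide_eq[OF this] elim(2)
        have "Dj j * C * (8 * (1 + \<bar>ww y 0\<bar>)) < c1 - c" by blast
        then show ?thesis by (simp add: algebra_simps)
      qed
      finally show ?case using 1 by (simp add: field_simps)
    qed
  qed
  then show ?thesis using c1 by (intro exI[of _ "(c + c1) / 2"]) simp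
qed

lemma Sgt_eventually:
  assumes "chain t x y" "\<not> member (gam (x 0))" "ereal c < Ms (gam (x 0))" "\<And>j. \<bar>x j\<bar> \<le> B"
  obtains c' K where "c < c'" "\<And>j. K \<le> j \<Longrightarrow> Sgt (al j) (al (Suc j)) c' (x j) (y j)"
proof -
  obtain c' where c': "c < c'" and ev: "\<And>p q. \<forall>\<^sub>F j in sequentially.
    c' < \<bar>(1 + y j - al (Suc j) + 2 * of_int p * al (Suc j) - 2 * of_int q) *
       (- 1 + al j - x j + 2 * of_int p - 2 * of_int q * al j)\<bar>"
    using vertex_eventually[OF assms] by blast
  have "\<forall>\<^sub>F j in sequentially. Sgt (al j) (al (Suc j)) c' (x j) (y j)"
    using ev[of 0 0] ev[of 1 0] ev[of 0 1] ev[of 1 1]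
  proof eventually_elim
    case (elim j)
    let ?f = "\<lambda>p q. (1 + y j - al (Suc j) + 2 * real_of_int p * al (Suc j) - 2 * real_of_int q) *
       (- 1 + al j - x j + 2 * real_of_int p - 2 * real_of_int q * al j)"
    \<comment> \<open>The corners \<open>(0, 0)\<close>, \<open>(1, 1)\<close>,
      \<open>(1, 0)\<close>, \<open>(0, 1)\<close> of the cell, in the order of the products in
      \<open>Sgt\<close>.\<close>
    have "(1 - al j + x j) * (1 - al (Suc j) + y j) = - ?f 0 0"
      "(1 - al j - x j) * (1 - al (Suc j) - y j) = - ?f 1 1"
      "(1 + al j - x j) * (1 + al (Suc j) + y j) = ?f 1 0"
      "(1 + al j + x j) * (1 + al (Suc j) - y j) = ?f 0 1"
      by (simp_all add: algebra_simps)
    then show ?case using elim unfolding Sgt_def by (simp only: abs_minus_cancel)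
  qed
  then obtain K where "\<And>j. K \<le> j \<Longrightarrow> Sgt (al j) (al (Suc j)) c' (x j) (y j)"
    unfolding eventually_sequentially by blast
  then show ?thesis using that c' by blast
qed

section \<open>Existence of expansions\<close>

definition in_range :: "(nat \<Rightarrow> real) \<Rightarrow> (nat \<Rightarrow> real) \<Rightarrow> bool" where
  "in_range x y \<longleftrightarrow> (\<forall>j. - 1 + al j \<le> x j \<and> x j \<le> 1 + al j \<and> - 1 + al (Suc j) \<le> y j \<and> y j \<le> 1 + al (Suc j))"

text \<open>The digits are greedy to the right, and the left value accumulates from 0. Right values
  are fractional parts and stay in range by themselves; left values need the invariant
  \<open>inv\<close>. The largest digit \<open>nn j - 1\<close> occurs only if
  \<open>u j \<ge> 1 - al j\<close>, and then the invariant bounds \<open>w j\<close> so that the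
  next left value does not pass 1.\<close>

lemma chain_exists:
  obtains t x y P \<mu> where "chain t x y" "in_range x y" "lat P \<mu>" "gam (x 0) = \<gamma> + \<mu>"
proof -
  define u where "u = rec_nat (frac \<gamma>) (\<lambda>j z. frac (z / al j))"
  have u0: "u 0 = frac \<gamma>" and uS: "u (Suc j) = frac (u j / al j)" for j by (simp_all add: u_def)
  define d where "d j = \<lfloor>u j / al j\<rfloor>" for j
  define w where "w = rec_nat 0 (\<lambda>j z. al j * (z + real_of_int (d j)))"
  have w0: "w 0 = 0" and wS: "w (Suc j) = al j * (w j + d j)" for j by (simp_all add: w_def)
  have ur: "0 \<le> u j \<and> u j < 1" for j
    by (cases j) (simp_all add: u0 uS frac_lt_1)
  have ud: "u j = al j * (d j + u (Suc j))" for j by (simp add: uS d_def frac_def)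
  have d0: "0 \<le> d j" for j using ur[of j] by (simp add: d_def)
  have dle: "d j \<le> nn j - 1" for j
  proof -
    have "0 \<le> al j * u (Suc j)" using ur[of "Suc j"] by simp
    moreover have "al j * d j + al j * u (Suc j) < 1" using ur[of j] unfolding ud[of j] distrib_left by simp
    ultimately have "al j * d j < al j * nn j" using al_nn[of j] D_pos by (simp add: mult.commute)
    then have "real_of_int (d j) < nn j" by simp
    then show ?thesis by simp
  qed
  have inv: "0 \<le> w j \<and> w j \<le> 1 \<and> (w j > 1 - al (Suc j) \<longrightarrow> u j < 1 - al j)" for j
  proof (induction j)
    case 0
    then show ?case using al_small[of "Suc 0"] by (simp add: w0)
  next
    case (Suc j)
    have i: "1 / al j = nn j - al (Suc j)" by (simp add: nn_eq)
    have w': "w (Suc j) \<le> z \<longleftrightarrow> w j + d j \<le> z * (1 / al j)" "w (Suc j) > z \<longleftrightarrow> w j + d j > z * (1 / al j)"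
      "z \<le> u j \<longleftrightarrow> z * (1 / al j) \<le> d j + u (Suc j)" "z > u j \<longleftrightarrow> z * (1 / al j) > d j + u (Suc j)"for z
      using al_pos[of j] by (simp_all add: wS ud[of j] field_simps)
    have a1: "(1 - al j) * (1 / al j) = nn j - al (Suc j) - 1"
      unfolding nn_eq by (simp add: field_simps)
    have "w (Suc j) \<le> 1"
    proof (cases "d j \<le> nn j - 2")
      case True
      then have "real_of_int (d j) \<le> nn j - 2" by linarith
      then show ?thesis unfolding w'(1) using Suc al_small[of "Suc j"] by (simp add: i)
    next
      case False
      then have "d j = nn j - 1" using dle[of j] by simp
      then have dd: "real_of_int (d j) = real_of_int (nn j) - 1" by simp
      have "1 - al j \<le> u j" unfolding w'(3) a1 dd using al_pos[of "Suc j"] ur[of "Suc j"] by linarith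
      then have "w j \<le> 1 - al (Suc j)" using Suc by linarith
      then show ?thesis unfolding w'(1) by (simp add: i dd)
    qed
    moreover have "0 \<le> w (Suc j)" using Suc d0[of j] by (simp add: wS)
    moreover have "u (Suc j) < 1 - al (Suc j)" if "w (Suc j) > 1 - al (Suc (Suc j))"
    proof (rule ccontr)
      assume n: "\<not> u (Suc j) < 1 - al (Suc j)"
      have w1: "w j + d j > nn j - al (Suc j) - 1" using that unfolding al_SS w'(2) a1 .
      show False
      proof (cases "d j \<le> nn j - 2")
        case True
        then have "real_of_int (d j) \<le> nn j - 2" by linarith
        then have "u j < 1 - al j" using Suc w1 by linarith
        then have "d j + u (Suc j) < nn j - al (Suc j) - 1" unfolding w'(4) a1 .
        then have "real_of_int (d j) < nn j - 2" using n by linarith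
        then have "d j < nn j - 2" by linarith
        then have "real_of_int (d j) \<le> nn j - 3" by linarith
        then show False using w1 Suc al_small[of "Suc j"] by linarith
      next
        case False
        then have "real_of_int (d j) \<ge> real_of_int (nn j) - 1" by linarith
        then have "1 * (1 / al j) \<le> d j + u (Suc j)" using n unfolding i by argo
        then have "1 \<le> u j" unfolding w'(3) .
        then show False using ur[of j] by simp
      qed
    qed
    ultimately show ?case by blast
  qed
  define t where "t j = 2 * d j + 2 - nn j" for j
  define x where "x j = 2 * u j - 1 + al j" for j
  define y where "y j = 2 * w j - 1 + al (Suc j)" for j
  have "chain t x y"
    unfolding chain_def
  proof (intro allI conjI)
    fix j
    show "even (t j)" using even_nn[of j] by (simp add: t_def)
    show "x j = al j * (of_int (t j) + x (Suc j))"
      using al_nn[of j] al_prod[of j] ud[of j] by (simp add: x_def t_def algebra_simps)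
    show "y (Suc j) = al j * (of_int (t j) + y j)"
      using al_nn[of j] al_prod[of j] wS[of j] by (simp add: y_def t_def algebra_simps)
  qed
  moreover have "in_range x y"
    unfolding in_range_def x_def y_def using ur inv al_pos by (simp add: less_imp_le)
  moreover have "lat (- of_int \<lfloor>\<gamma>\<rfloor>) (- of_int \<lfloor>\<gamma>\<rfloor>)"
    unfolding lat_def by (rule exI[of _ 0], rule exI[of _ "\<lfloor>\<gamma>\<rfloor>"]) simp
  moreover have "gam (x 0) = \<gamma> + (- of_int \<lfloor>\<gamma>\<rfloor>)"
    by (simp add: gam_def x_def al_0 u0 frac_def)
  ultimately show ?thesis using that by blast
qed

lemma al_add_even: "al (j + 2 * k) = al j" by (simp add: al_def)

lemma chain_shift: "chain t x y \<Longrightarrow> chain (\<lambda>j. t (j + 2 * k)) (\<lambda>j. x (j + 2 * k)) (\<lambda>j. y (j + 2 * k))"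
  unfolding chain_def by (metis add_Suc al_add_even)

text \<open>Dropping one block amounts to dividing by the unit \<open>D\<close> after removing a
  lattice vector; two positions are taken at once so that the bases line up again.\<close>

lemma Ms_step:
  assumes ch: "chain t x y" and nm: "\<not> member (gam (x 0))"
  shows "\<not> member (gam (x 2)) \<and> Ms (gam (x 2)) = Ms (gam (x 0))"
proof -
  define d e where "d = dg t 0" and "e = dg t (Suc 0)"
  have g2: "gam (x 2) = uu x 2" by (simp add: gam_def uu_def al_def)
  have g: "gam (x 0) = D * gam (x 2) + (d * \<eta> + e * D)"
    unfolding gam_uu g2 uu_Suc[OF ch, of 0] uu_Suc[OF ch, of "Suc 0"]
    by (simp add: al_0 DD_def d_def e_def algebra_simps numeral_2_eq_2)
  have l: "lat (d * vX 1 + e * vX 2) (d * \<eta> + e * D)"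
    using lat_lin[OF lat_v[of 1] lat_v[of 2], of d e] by (simp add: numeral_2_eq_2 al_0 DD_def)
  have "\<not> member (D * gam (x 2))" using nm member_shift[OF l] unfolding g by blast
  then show ?thesis using Ms_lat_shift[OF _ l] Ms_unit member_unit unfolding g by metis
qed

lemma Ms_chain_shift:
  assumes ch: "chain t x y" and nm: "\<not> member (gam (x 0))"
  shows "\<not> member (gam (x (2 * k))) \<and> Ms (gam (x (2 * k))) = Ms (gam (x 0))"
proof (induction k)
  case (Suc k)
  then show ?case using Ms_step[OF chain_shift[OF ch, of k]] by (simp add: numeral_2_eq_2)
qed (use nm in simp)

lemma gam_minus: "gam (- x) = - gam x + (1 - \<eta>)" by (simp add: gam_def field_simps)

lemma lat_one_eta: "lat (1 - 1 / \<beta>) (1 - \<eta>)"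
  unfolding lat_def by (rule exI[of _ "-1"], rule exI[of _ "-1"]) simp

text \<open>Negating all centred digits sends \<open>\<gamma>\<close> to
  \<open>1 - \<eta> - \<gamma>\<close>. Every later argument about digits may therefore be made up
  to a global sign.\<close>

lemma Ms_gam_minus:
  assumes "\<not> member (gam x)"
  shows "Ms (gam (- x)) = Ms (gam x)"
proof -
  have "\<not> member (- gam x)" using assms by (simp only: member_minus not_False_eq_True)
  from Ms_lat_shift[OF this lat_one_eta] show ?thesis by (simp only: gam_minus Ms_minus[OF assms])
qed

end

section \<open>Lower bounds for tight chains\<close>

definition Tge :: "real \<Rightarrow> real \<Rightarrow> real \<Rightarrow> real \<Rightarrow> real \<Rightarrow> bool" where
  "Tge A B c x y \<longleftrightarrow> c \<le> (1 - A + x) * (1 - B + y) \<and> c \<le> (1 - A - x) * (1 - B - y) \<and>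
    c \<le> (1 + A - x) * (1 + B + y) \<and> c \<le> (1 + A + x) * (1 + B - y)"

text \<open>For positive second coordinate, a point between the levels of two consecutive corners
  lies at least as far out as the later corner, so it cannot have the smaller product. For
  \<open>i \<le> 0\<close> this follows from \<open>A * A' < 1\<close>; for \<open>i > 0\<close> the
  bounds contradict each other.\<close>

lemma cell_above:
  fixes A A' u u' w :: real and d i k :: int
  assumes A: "0 < A" "A < 27/100" "0 < A'" "A' < 27/100" and u: "u = A * (d + u')" "0 \<le> u"
    and w: "0 \<le> w" "w < 1 - A'"
    and lt: "i + k * A < 1" and ge: "A * (1 - u') \<le> - u + i + k * A" and pos: "0 \<le> w + i * A' + k"
    and gt: "u < i + k * A"
  shows "d + 1 \<le> i * A' + k"
proof (cases "i \<le> 0")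
  case True
  then have i: "real_of_int i \<le> 0" by simp
  have "A * (d + 1) \<le> i + k * A" using ge by (simp add: u algebra_simps)
  then have "d + 1 \<le> i / A + k" using A by (simp add: field_simps)
  moreover have "i / A \<le> i * A'"
  proof -
    have "A' * A \<le> 1 * 1" using A by (intro mult_mono) auto
    then have "real_of_int i * 1 \<le> real_of_int i * (A' * A)" using i by (intro mult_left_mono_neg) auto
    then show ?thesis using A by (simp add: field_simps)
  qed
  ultimately show ?thesis by linarith
next
  case False
  define m where "m = i - 1"
  have m: "0 \<le> real_of_int m" using False by (simp add: m_def)
  have i: "real_of_int i = m + 1" by (simp add: m_def)
  have "real_of_int k * A < - real_of_int m" using lt i by linarith
  moreover have "- real_of_int m \<le> - real_of_int m * (3 * A)" using m A mult_left_mono[of "3 * A" 1 m] by simp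
  ultimately have "real_of_int k * A < - (3 * m) * A" by (simp add: algebra_simps)
  then have k: "real_of_int k < - (3 * real_of_int m)" using mult_right_less_imp_less[of "real_of_int k" A "real_of_int (- (3 * m))"] A by simp
  have "real_of_int m * A' \<le> real_of_int m * 1" using m A by (intro mult_left_mono) auto
  then have "0 < 1 + m + k" using pos w unfolding i by (simp add: algebra_simps)
  moreover have "k < - (3 * m)" using k by linarith
  moreover have "0 \<le> m" using False by (simp add: m_def)
  ultimately have "m = 0" "k < 0" by linarith+
  then have "w + A' + k \<ge> 0" "real_of_int k \<le> -1" using pos i by simp_all
  then show ?thesis using w by linarith
qed

text \<open>For negative second coordinate the points lie beyond the segment joining two consecutive
  vertices. At the level with parameter \<open>r\<close> the product on the segment is
  \<open>(w + r) * (u - r * A)\<close>, which is concave in \<open>r\<close> and thus minimal at an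
  end, where the two bounds on \<open>C\<close> apply.\<close>

lemma cell_below:
  fixes A A' u w :: real and d i k :: int
  assumes A: "0 < A" "A < 27/100" "0 < A'" "A' < 27/100"
    and w: "0 \<le> w" "A * (w + d) < 1 - A"
    and gt: "0 < i + k * A" and le: "i + k * A \<le> A * d" and pos: "0 \<le> w + i * A' + k"
    and s: "0 \<le> u - (i + k * A)"
    and C: "C \<le> w * u" "C \<le> (w + d) * (u - A * d)"
  shows "C \<le> (w + i * A' + k) * (u - (i + k * A))"
proof -
  have iA: "i * A' \<ge> i / A" if "i \<le> 0"
  proof -
    have "A' * A \<le> 1 * 1" using A by (intro mult_mono) auto
    then have "real_of_int i * 1 \<le> real_of_int i * (A' * A)" using that by (intro mult_left_mono_neg) auto
    then show ?thesis using A by (simp add: field_simps)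
  qed
  \<comment> \<open>A positive \<open>i\<close> would push the first coordinate below 0.\<close>
  have "i \<le> 0"
  proof (rule ccontr)
    assume "\<not> i \<le> 0"
    then have i: "1 \<le> real_of_int i" by simp
    have "A * (w + i * A' + k) \<le> A * (w + d) - i + i * (A * A')"
      using le by (simp add: algebra_simps)
    also have "\<dots> < 1 - A - i * (1 - A * A')" using w by (simp add: algebra_simps)
    also have "\<dots> \<le> 1 - A - (1 - A * A')"
    proof -
      have "A * A' \<le> 1 * 1" using A by (intro mult_mono) auto
      then show ?thesis using mult_right_mono[OF i, of "1 - A * A'"] by simp
    qed
    also have "\<dots> \<le> 0" using A by (simp add: mult_left_le)
    finally have "w + i * A' + k < 0" using A by (simp add: mult_less_0_iff)
    then show False using pos by simp
  qed
  define r where "r = (i + k * A) / A"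
  have r: "i + k * A = r * A" "0 < r" "r \<le> d" using gt le A by (simp_all add: r_def field_simps)
  have "r = i / A + k" using A by (simp add: r_def field_simps)
  then have "w + r \<le> w + i * A' + k" using iA[OF \<open>i \<le> 0\<close>] by simp
  then have "(w + r) * (u - r * A) \<le> (w + i * A' + k) * (u - r * A)"
    using s unfolding r(1) by (intro mult_right_mono) auto
  moreover have "C \<le> (w + r) * (u - r * A)"
  proof (cases "r * A \<le> u - w * A")
    case True
    then have "0 \<le> r * (u - w * A - r * A)" using r by simp
    then show ?thesis using C(1) by (simp add: algebra_simps)
  next
    case False
    moreover have "0 \<le> A * d" using r A by simp
    ultimately have "u - w * A - A * (d + r) \<le> 0" by (simp add: algebra_simps)
    then have "(d - r) * (u - w * A - A * (d + r)) \<le> 0" using r by (intro mult_nonneg_nonpos) auto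
    then show ?thesis using C(2) by (simp add: algebra_simps)
  qed
  ultimately show ?thesis unfolding r(1) by simp
qed

text \<open>Applied to the heights of successive corners, this finds the level of a given lattice
  point.\<close>

lemma bracket:
  fixes f :: "nat \<Rightarrow> real"
  assumes "f \<longlonglongrightarrow> 0" "0 < y" "y < f K"
  obtains j where "K \<le> j" "f (Suc j) \<le> y" "y < f j"
proof -
  have "\<forall>\<^sub>F j in sequentially. f j < y" using order_tendstoD(2)[OF assms(1,2)] .
  then obtain n where "\<forall>j\<ge>n. f j < y" unfolding eventually_sequentially by blast
  then have "f (K + n) \<le> y" by (simp add: less_imp_le)
  then have ex: "\<exists>i. f (K + i) \<le> y" by blast
  define i where "i = (LEAST i. f (K + i) \<le> y)"
  have 1: "f (K + i) \<le> y" unfolding i_def using ex by (rule LeastI_ex)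
  have "i \<noteq> 0" using 1 assms(3) by (metis add.right_neutral not_le)
  then obtain m where m: "i = Suc m" using not0_implies_Suc by blast
  have "\<not> f (K + m) \<le> y" using not_less_Least[of m "\<lambda>i. f (K + i) \<le> y"] m unfolding i_def[symmetric] by simp
  then show ?thesis using that[of "K + m"] 1 m by simp
qed

text \<open>Unrolling gives \<open>z j \<le> q ^ n * max 0 B\<close> for every \<open>n\<close>. Two
  uses follow: uniqueness of right values, and the extremal property of
  \<open>xi_inf\<close>.\<close>

lemma contract_nonpos:
  fixes z :: "nat \<Rightarrow> real"
  assumes B: "\<And>j. z j \<le> B" and q: "0 \<le> q" "q < 1" and z: "\<And>j. z j \<le> q * max 0 (z (Suc j))"
  shows "z j \<le> 0"
proof -
  have "z j \<le> q ^ n * max 0 B" for n j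
  proof (induction n arbitrary: j)
    case 0
    then show ?case using B[of j] by simp
  next
    case (Suc n)
    have "max 0 (z (Suc j)) \<le> q ^ n * max 0 B" using Suc[of "Suc j"] q by simp
    then have "q * max 0 (z (Suc j)) \<le> q * (q ^ n * max 0 B)" using q by (intro mult_left_mono) auto
    then show ?case using z[of j] by simp
  qed
  moreover have "(\<lambda>n. q ^ n * max 0 B) \<longlonglongrightarrow> 0 * max 0 B"
    using q by (intro tendsto_intros LIMSEQ_realpow_zero) auto
  ultimately have "z j \<le> 0 * max 0 B" by (intro LIMSEQ_le_const[of "\<lambda>n. q ^ n * max 0 B"]) auto
  then show ?thesis by simp
qed

lemma mult_pos_nonneg_cancel: "0 < a \<Longrightarrow> 0 \<le> a * b \<Longrightarrow> 0 \<le> (b::real)"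
  by (simp add: zero_le_mult_iff)

context even_pair
begin

text \<open>The digit bound makes the uncentred digits nonnegative, and 1/2 keeps \<open>uu\<close>
  and \<open>ww\<close> strictly between 0 and their maxima. All periodic words evaluated later
  satisfy both.\<close>

definition tight :: "(nat \<Rightarrow> int) \<Rightarrow> (nat \<Rightarrow> real) \<Rightarrow> (nat \<Rightarrow> real) \<Rightarrow> bool" where
  "tight t x y \<longleftrightarrow> chain t x y \<and> (\<forall>j. \<bar>t j\<bar> \<le> nn j - 2 \<and> \<bar>x j\<bar> \<le> 1/2 \<and> \<bar>y j\<bar> \<le> 1/2)"

lemma tight_facts:
  assumes "tight t x y"
  shows "chain t x y" "0 < uu x j" "uu x j < 1 - al j" "0 < ww y j" "ww y j < 1 - al (Suc j)" "0 \<le> dg t j"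
proof -
  have t: "\<bar>t j\<bar> \<le> nn j - 2" and x: "\<bar>x j\<bar> \<le> 1/2" and y: "\<bar>y j\<bar> \<le> 1/2"
    using assms unfolding tight_def by blast+
  show "chain t x y" using assms by (simp add: tight_def)
  show "0 < uu x j" "uu x j < 1 - al j" using x al_small[of j] unfolding uu_def by (simp_all add: field_simps abs_le_iff)
  show "0 < ww y j" "ww y j < 1 - al (Suc j)" using y al_small[of "Suc j"] unfolding ww_def by (simp_all add: field_simps abs_le_iff)
  show "0 \<le> dg t j" using t unfolding dg_def by simp
qed

lemma grid_coords:
  assumes "chain t x y" "lat (X - ww y 0 / \<beta>) (Y + gam (x 0))"
  obtains i k :: int where "X = vX (Suc j) * (ww y j + i * al (Suc j) + k)" "Y = Dj j * (- uu x j + i + k * al j)"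
proof -
  obtain i k :: int where
    "X - ww y 0 / \<beta> - (ww y j * vX (Suc j) - ww y 0 / \<beta>) = i * vX j + k * vX (Suc j)"
    "Y + gam (x 0) - (- (Dj j * uu x j) + gam (x 0)) = i * Dj j + k * Dj (Suc j)"
    using lat_coords[OF lat_diff[OF assms(2) vertex[OF assms(1)]]] by blast
  then have "X = vX (Suc j) * (ww y j + i * al (Suc j) + k)" "Y = Dj j * (- uu x j + i + k * al j)"
    unfolding vX_eq[of j] by (simp_all add: algebra_simps)
  then show ?thesis by (rule that)
qed

text \<open>The half plane \<open>X \<ge> 0\<close>. The height of the point falls between the
  heights of corners at consecutive positions, and \<open>cell_above\<close> or
  \<open>cell_below\<close> compares the products. The other half plane follows by negating the
  chain.\<close>

lemma tight_half:
  assumes T: "tight t x y"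
    and C: "\<And>j. Tge (al j) (al (Suc j)) C (x j) (y j)"
  shows "\<exists>\<delta>>0. \<forall>X Y. lat (X - ww y 0 / \<beta>) (Y + gam (x 0)) \<longrightarrow> 0 \<le> X \<longrightarrow> Y \<noteq> 0 \<longrightarrow> \<bar>Y\<bar> < \<delta> \<longrightarrow> C \<le> 4 * \<beta> * (X * \<bar>Y\<bar>)"
proof -
  note tf = tight_facts[OF T]
  note ch = tf(1)
  have uD: "\<bar>Dj j * uu x j\<bar> \<le> Dj j" "\<bar>Dj j * (1 - uu x j)\<bar> \<le> Dj j" for j
  proof -
    have "\<bar>uu x j\<bar> \<le> 1" "\<bar>1 - uu x j\<bar> \<le> 1" using tf(2,3)[of j] al_pos[of j] by linarith+
    then show "\<bar>Dj j * uu x j\<bar> \<le> Dj j" "\<bar>Dj j * (1 - uu x j)\<bar> \<le> Dj j"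
      unfolding abs_mult abs_of_pos[OF Dj_pos] using mult_left_le less_imp_le[OF Dj_pos] by blast+
  qed
  \<comment> \<open>The heights of the corners \<open>(0, 0)\<close>, up to sign, and
    \<open>(1, 0)\<close>.\<close>
  have lims: "(\<lambda>j. Dj j * uu x j) \<longlonglongrightarrow> 0" "(\<lambda>j. Dj j * (1 - uu x j)) \<longlonglongrightarrow> 0"
    by (rule Lim_null_comparison[OF _ Dj_lim], use uD in simp)+
  define \<delta> where "\<delta> = min (Dj 0 * uu x 0) (Dj 0 * (1 - uu x 0))"
  have u1: "uu x j < 1" for j using tf(3)[of j] al_pos[of j] by linarith
  have "0 < \<delta>" using tf(2)[of 0] u1[of 0] by (simp add: \<delta>_def)
  moreover have "C \<le> 4 * \<beta> * (X * \<bar>Y\<bar>)" if l: "lat (X - ww y 0 / \<beta>) (Y + gam (x 0))" and X: "0 \<le> X" and Y: "Y \<noteq> 0" "\<bar>Y\<bar> < \<delta>" for X Y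
  proof -
    have prod: "4 * \<beta> * ((vX (Suc j) * p) * (Dj j * q)) = 4 * (p * q)" for j p q
      using vX_Dj[of j] by (simp add: mult_ac)
    show ?thesis
    proof (cases "0 < Y")
      case True
      obtain j where j: "Dj (Suc j) * (1 - uu x (Suc j)) \<le> Y" "Y < Dj j * (1 - uu x j)"
        by (rule bracket[OF lims(2) True, of 0]) (use Y True in \<open>simp add: \<delta>_def\<close>)
      obtain i k :: int where ik: "X = vX (Suc j) * (ww y j + i * al (Suc j) + k)" "Y = Dj j * (- uu x j + i + k * al j)"
        by (rule grid_coords[OF ch l])
      define d where "d = dg t j"
      have u: "uu x j = al j * (d + uu x (Suc j))" unfolding d_def by (rule uu_Suc[OF ch])
      have ge: "al j * (1 - uu x (Suc j)) \<le> - uu x j + i + k * al j"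
        using j(1) unfolding ik(2) Dj_Suc mult.assoc by (simp only: mult_le_cancel_left_pos[OF Dj_pos])
      have lt: "- uu x j + i + k * al j < 1 - uu x j" using j(2) unfolding ik(2) by simp
      have gt: "0 < - uu x j + i + k * al j" using True unfolding ik(2) by (rule zero_less_mult_pos[OF _ Dj_pos])
      have Xp: "0 \<le> ww y j + i * al (Suc j) + k" using X unfolding ik(1) by (rule mult_pos_nonneg_cancel[OF vX_pos])
      have "d + 1 \<le> i * al (Suc j) + k"
        by (rule cell_above[where A = "al j" and u = "uu x j" and w = "ww y j" and u' = "uu x (Suc j)"])
          (use al_small[of j] al_small[of "Suc j"] tf(2-5)[of j] ge lt gt Xp in \<open>simp_all add: u\<close>)
      then have "ww y j + d + 1 \<le> ww y j + i * al (Suc j) + k" by simp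
      then have "(ww y j + d + 1) * (al j * (1 - uu x (Suc j))) \<le> (ww y j + i * al (Suc j) + k) * (- uu x j + i + k * al j)"
        using ge Xp u1[of "Suc j"] by (intro mult_mono) auto
      moreover have "C \<le> (1 + al (Suc j) - x (Suc j)) * (1 + al j + y (Suc j))"
        using C[of "Suc j"] unfolding Tge_def by simp
      moreover have "(1 + al (Suc j) - x (Suc j)) * (1 + al j + y (Suc j)) =
          4 * ((ww y j + d + 1) * (al j * (1 - uu x (Suc j))))"
      proof -
        have e1: "1 + al (Suc j) - x (Suc j) = 2 * (1 - uu x (Suc j))" by (simp add: uu_def field_simps)
        have e2: "1 + al j + y (Suc j) = 2 * (al j * (ww y j + d + 1))"
          using ww_Suc[OF ch, of j] unfolding d_def ww_def by (simp add: field_simps)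
        show ?thesis unfolding e1 e2 by (simp add: algebra_simps)
      qed
      ultimately have "C \<le> 4 * ((ww y j + i * al (Suc j) + k) * (- uu x j + i + k * al j))"
        by linarith
      then show ?thesis unfolding abs_of_pos[OF True] unfolding ik prod .
    next
      case False
      then have Y0: "0 < - Y" using Y by simp
      obtain j where j: "Dj (Suc j) * uu x (Suc j) \<le> - Y" "- Y < Dj j * uu x j"
        by (rule bracket[OF lims(1) Y0, of 0]) (use Y Y0 in \<open>simp add: \<delta>_def\<close>)
      obtain i k :: int where ik: "X = vX (Suc j) * (ww y j + i * al (Suc j) + k)" "Y = Dj j * (- uu x j + i + k * al j)"
        by (rule grid_coords[OF ch l])
      have mY: "- Y = Dj j * (uu x j - (i + k * al j))" unfolding ik(2) by (simp add: algebra_simps)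
      define d where "d = dg t j"
      have u: "uu x j = al j * (d + uu x (Suc j))" unfolding d_def by (rule uu_Suc[OF ch])
      have ge: "al j * uu x (Suc j) \<le> uu x j - (i + k * al j)"
        using j(1) unfolding mY Dj_Suc mult.assoc by (simp only: mult_le_cancel_left_pos[OF Dj_pos])
      have lt: "uu x j - (i + k * al j) < uu x j" using j(2) unfolding mY by (simp only: mult_less_cancel_left_pos[OF Dj_pos])
      have gt: "0 < uu x j - (i + k * al j)" using Y0 unfolding mY by (rule zero_less_mult_pos[OF _ Dj_pos])
      have Xp: "0 \<le> ww y j + i * al (Suc j) + k" using X unfolding ik(1) by (rule mult_pos_nonneg_cancel[OF vX_pos])
      have w': "ww y (Suc j) = al j * (ww y j + d)" unfolding d_def by (rule ww_Suc[OF ch])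
      have "C / 4 \<le> (ww y j + i * al (Suc j) + k) * (uu x j - (i + k * al j))"
      proof (rule cell_below[where d = d])
        have "C \<le> (1 - al j + x j) * (1 - al (Suc j) + y j)" using C[of j] unfolding Tge_def by simp
        moreover have "(1 - al j + x j) * (1 - al (Suc j) + y j) = 4 * (ww y j * uu x j)"
          by (simp add: uu_def ww_def field_simps)
        ultimately show "C / 4 \<le> ww y j * uu x j" by simp
        have "C \<le> (1 - al (Suc j) + x (Suc j)) * (1 - al (Suc (Suc j)) + y (Suc j))" using C[of "Suc j"] unfolding Tge_def by simp
        moreover have "(1 - al (Suc j) + x (Suc j)) * (1 - al (Suc (Suc j)) + y (Suc j)) = 4 * (ww y (Suc j) * uu x (Suc j))"
          by (simp add: uu_def ww_def field_simps)
        moreover have "ww y (Suc j) * uu x (Suc j) = (ww y j + d) * (uu x j - al j * d)"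
          unfolding w' u by (simp add: algebra_simps)
        ultimately show "C / 4 \<le> (ww y j + d) * (uu x j - al j * d)" by simp
        show "al j * (ww y j + d) < 1 - al j" using tf(5)[of "Suc j"] unfolding w' by simp
        show "i + k * al j \<le> al j * d" using ge unfolding u by (simp add: algebra_simps)
      qed (use al_small[of j] al_small[of "Suc j"] tf(4)[of j] lt gt Xp in simp_all)
      moreover have "4 * \<beta> * (X * \<bar>Y\<bar>) = 4 * ((ww y j + i * al (Suc j) + k) * (uu x j - (i + k * al j)))"
        using Y0 unfolding abs_of_neg[OF Y0[unfolded neg_0_less_iff_less]] unfolding mY unfolding ik(1) prod by simp
      ultimately show ?thesis by simp
    qed
  qed
  ultimately show ?thesis by blast
qed

lemma chain_minus:
  assumes "chain t x y"
  shows "chain (\<lambda>j. - t j) (\<lambda>j. - x j) (\<lambda>j. - y j)"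
  unfolding chain_def
proof (intro allI conjI)
  fix j
  show "even (- t j)" using chainD(1)[OF assms] by simp
  show "- x j = al j * (of_int (- t j) + - x (Suc j))" using chainD(2)[OF assms, of j] by (simp add: algebra_simps)
  show "- y (Suc j) = al j * (of_int (- t j) + - y j)" using chainD(3)[OF assms, of j] by (simp add: algebra_simps)
qed

lemma tight_minus: "tight t x y \<Longrightarrow> tight (\<lambda>j. - t j) (\<lambda>j. - x j) (\<lambda>j. - y j)"
  unfolding tight_def using chain_minus by simp

lemma Tge_minus: "Tge A B c (- x) (- y) \<longleftrightarrow> Tge A B c x y"
  unfolding Tge_def by auto

text \<open>A lattice point of height 0 has a fixed first coordinate, which tends to 0 in units of
  \<open>vX (Suc j)\<close>. After elimination of \<open>i\<close>, the same quantity is a number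
  well inside the interval from 0 to \<open>1 - D\<close> plus an integer multiple of
  \<open>1 - D\<close>, so it stays at least 1/10 away from 0.\<close>

lemma tight_not_member:
  assumes T: "tight t x y"
  shows "\<not> member (gam (x 0))"
proof
  assume "member (gam (x 0))"
  then obtain X0 where "lat X0 (gam (x 0))" by (auto simp: member_def)
  then have l: "lat (X0 + ww y 0 / \<beta> - ww y 0 / \<beta>) (0 + gam (x 0))" by simp
  define X where "X = X0 + ww y 0 / \<beta>"
  have "(\<lambda>j. X * \<beta> * Dj j) \<longlonglongrightarrow> X * \<beta> * 0" by (intro tendsto_intros Dj_lim)
  then have "(\<lambda>j. X * \<beta> * Dj j) \<longlonglongrightarrow> 0" by simp
  then have "\<forall>\<^sub>F j in sequentially. \<bar>X * \<beta> * Dj j\<bar> < 1/10"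
    using tendstoD[where e = "1/10"] by (fastforce simp: dist_real_def)
  then obtain j where j: "\<bar>X * \<beta> * Dj j\<bar> < 1/10" unfolding eventually_sequentially by blast
  obtain i k :: int where ik: "X = vX (Suc j) * (ww y j + i * al (Suc j) + k)" "0 = Dj j * (- uu x j + i + k * al j)"
    using grid_coords[OF tight_facts(1)[OF T] l, of j] unfolding X_def by metis
  have "X * \<beta> * Dj j = (\<beta> * vX (Suc j) * Dj j) * (ww y j + i * al (Suc j) + k)" unfolding ik(1) by simp
  then have e: "\<bar>ww y j + i * al (Suc j) + k\<bar> < 1/10" using j unfolding vX_Dj by simp
  have "- uu x j + i + k * al j = 0" using ik(2) by simp
  then have i: "real_of_int i = uu x j - k * al j" by simp
  have eq: "ww y j + i * al (Suc j) + k = (1 - D + y j + al (Suc j) * x j) / 2 + k * (1 - D)"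
    unfolding i ww_def uu_def using al_prod[of j] by (simp add: field_simps)
  have xy: "\<bar>x j\<bar> \<le> 1/2" "\<bar>y j\<bar> \<le> 1/2" using T unfolding tight_def by blast+
  have "\<bar>al (Suc j) * x j\<bar> \<le> 27/100 * (1/2)" unfolding abs_mult using xy al_small[of "Suc j"] by (intro mult_mono) auto
  then have ax: "al (Suc j) * x j \<le> 135/1000" "- (135/1000) \<le> al (Suc j) * x j" by (simp_all add: abs_le_iff)
  show False
  proof (cases "k \<ge> 0")
    case True
    then have "0 \<le> k * (1 - D)" using D_less_1 by simp
    then show False using e xy ax D_small unfolding eq abs_le_iff abs_less_iff by argo
  next
    case False
    then have "real_of_int k \<le> -1" by simp
    then have "k * (1 - D) \<le> -1 * (1 - D)" using D_less_1 by (intro mult_right_mono) auto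
    then show False using e xy ax D_small D_pos unfolding eq abs_le_iff abs_less_iff by argo
  qed
qed

theorem tight_lower:
  assumes T: "tight t x y"
    and C: "\<And>j. Tge (al j) (al (Suc j)) C (x j) (y j)"
  shows "ereal C \<le> Ms (gam (x 0))"
proof (rule Ms_ge_lat)
  fix c' assume c': "c' < C"
  obtain d1 where d1: "0 < d1" "\<And>X Y. lat (X - ww y 0 / \<beta>) (Y + gam (x 0)) \<Longrightarrow> 0 \<le> X \<Longrightarrow> Y \<noteq> 0 \<Longrightarrow> \<bar>Y\<bar> < d1 \<Longrightarrow> C \<le> 4 * \<beta> * (X * \<bar>Y\<bar>)"
    using tight_half[OF T C] by blast
  let ?y = "\<lambda>j. - y j"
  obtain d2 where d2: "0 < d2" "\<And>X Y. lat (X - ww ?y 0 / \<beta>) (Y + gam (- x 0)) \<Longrightarrow> 0 \<le> X \<Longrightarrow> Y \<noteq> 0 \<Longrightarrow> \<bar>Y\<bar> < d2 \<Longrightarrow> C \<le> 4 * \<beta> * (X * \<bar>Y\<bar>)"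
    using tight_half[OF tight_minus[OF T], of C] C unfolding Tge_minus by blast
  define \<delta> where "\<delta> = min (min d1 d2) ((C - c') / 4)"
  have "0 < \<delta>" using d1 d2 c' by (simp add: \<delta>_def)
  moreover have "c' \<le> 4 * \<beta> * \<bar>X0 * Y\<bar>" if l: "lat X0 (Y + gam (x 0))" and Y: "\<bar>Y\<bar> < \<delta>" for X0 Y
  proof -
    define X where "X = X0 + ww y 0 / \<beta>"
    have X0: "X0 = X - ww y 0 / \<beta>" by (simp add: X_def)
    have Y0: "Y \<noteq> 0"
    proof
      assume "Y = 0"
      then have "member (gam (x 0))" using l by (auto simp: member_def)
      then show False using tight_not_member[OF T] by simp
    qed
    have "C \<le> 4 * \<beta> * (\<bar>X\<bar> * \<bar>Y\<bar>)"
    proof (cases "0 \<le> X")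
      case True
      then show ?thesis using d1(2)[of X Y] l Y Y0 unfolding X0 by (simp add: \<delta>_def)
    next
      case False
      have wm: "ww ?y 0 = 1 - \<beta> - ww y 0" by (simp add: ww_def al_0 field_simps)
      then have e: "- X - ww ?y 0 / \<beta> = - X0 + (1 - 1 / \<beta>)"
        using beta_pos unfolding wm X_def by (simp add: field_simps)
      have "lat (- X - ww ?y 0 / \<beta>) (- Y + gam (- x 0))"
        using lat_add[OF lat_minus[OF l] lat_one_eta] unfolding e gam_minus by (simp add: algebra_simps)
      then show ?thesis using d2(2)[of "- X" "- Y"] False Y Y0 by (simp add: \<delta>_def)
    qed
    \<comment> \<open>The offset by which \<open>X\<close> differs from \<open>X0\<close> costs only
      a multiple of \<open>\<bar>Y\<bar>\<close>.\<close>
    moreover have "4 * \<beta> * (\<bar>X\<bar> * \<bar>Y\<bar>) \<le> 4 * \<beta> * \<bar>X0 * Y\<bar> + 4 * \<bar>Y\<bar>"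
    proof -
      have w: "\<bar>ww y 0 / \<beta>\<bar> \<le> 1 / \<beta>"
      proof -
        have "\<bar>ww y 0\<bar> \<le> 1" using tight_facts(4,5)[OF T, of 0] al_pos[of "Suc 0"] by linarith
        then show ?thesis using beta_pos by (simp add: divide_le_cancel)
      qed
      have "\<bar>X\<bar> \<le> \<bar>X0\<bar> + \<bar>ww y 0 / \<beta>\<bar>" unfolding X_def by (rule abs_triangle_ineq)
      also have "\<dots> \<le> \<bar>X0\<bar> + 1 / \<beta>" using w by simp
      finally have "4 * \<beta> * (\<bar>X\<bar> * \<bar>Y\<bar>) \<le> 4 * \<beta> * ((\<bar>X0\<bar> + 1 / \<beta>) * \<bar>Y\<bar>)"
        using beta_pos by (intro mult_left_mono mult_right_mono) auto
      also have "\<dots> = 4 * \<beta> * \<bar>X0 * Y\<bar> + 4 * \<bar>Y\<bar>" using beta_pos by (simp add: abs_mult field_simps)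
      finally show ?thesis .
    qed
    moreover have "4 * \<bar>Y\<bar> < C - c'" using Y by (simp add: \<delta>_def)
    ultimately show ?thesis by linarith
  qed
  ultimately show "\<exists>\<delta>>0. \<forall>X Y. lat X (Y + gam (x 0)) \<longrightarrow> \<bar>Y\<bar> < \<delta> \<longrightarrow> c' \<le> 4 * \<beta> * \<bar>X * Y\<bar>" by blast
qed

text \<open>The difference of two solutions is bounded and at each position at most 27/100 of the
  next one, so it vanishes. Hence digits alone determine the right values, and with them
  \<open>\<gamma>\<close>.\<close>

lemma forward_unique:
  assumes x: "\<And>j. x j = al j * (of_int (t j) + x (Suc j))" "\<And>j. \<bar>x j\<bar> \<le> B"
    and x': "\<And>j. x' j = al j * (of_int (t j) + x' (Suc j))" "\<And>j. \<bar>x' j\<bar> \<le> B'"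
  shows "x j = x' j"
proof -
  have "\<bar>x j - x' j\<bar> \<le> 0" for j
  proof (rule contract_nonpos[where q = "27/100" and B = "B + B'"])
    show "\<bar>x j - x' j\<bar> \<le> B + B'" for j using x(2)[of j] x'(2)[of j] by linarith
    show "\<bar>x j - x' j\<bar> \<le> 27/100 * max 0 \<bar>x (Suc j) - x' (Suc j)\<bar>" for j
    proof -
      have "x j - x' j = al j * (x (Suc j) - x' (Suc j))"
        by (subst x(1), subst x'(1)) (simp add: algebra_simps)
      then have "\<bar>x j - x' j\<bar> = al j * \<bar>x (Suc j) - x' (Suc j)\<bar>" by (simp add: abs_mult)
      also have "\<dots> \<le> 27/100 * \<bar>x (Suc j) - x' (Suc j)\<bar>"
        using al_small[of j] by (intro mult_right_mono) auto
      finally show ?thesis by simp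
    qed
  qed auto
  then show ?thesis by simp
qed

lemma gammaP_eq:
  assumes ch: "chain t x y" and B: "\<And>j. \<bar>x j\<bar> \<le> B"
    and P: "\<And>i. dg t (2 * i) = fst (P ! (i mod length P))" "\<And>i. dg t (Suc (2 * i)) = snd (P ! (i mod length P))"
  shows "gammaP a b P = gam (x 0)"
proof -
  define f where "f i = (real_of_int (fst (P ! (i mod length P))) * \<eta> + real_of_int (snd (P ! (i mod length P))) * D) * D ^ i" for i
  have step: "uu x (2 * i) = real_of_int (dg t (2 * i)) * \<eta> + real_of_int (dg t (Suc (2 * i))) * D + D * uu x (2 * Suc i)" for i
    using uu_Suc[OF ch, of "2 * i"] uu_Suc[OF ch, of "Suc (2 * i)"]
    by (simp add: al_def DD_def algebra_simps)
  have part: "(\<Sum>i<n. f i) = uu x 0 - D ^ n * uu x (2 * n)" for n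
  proof (induction n)
    case (Suc n)
    have "f n = (uu x (2 * n) - D * uu x (2 * Suc n)) * D ^ n" unfolding f_def P[symmetric] step[of n] by simp
    then show ?case using Suc by (simp add: algebra_simps)
  qed simp
  have "(\<lambda>n. D ^ n * uu x (2 * n)) \<longlonglongrightarrow> 0"
  proof (rule Lim_null_comparison)
    show "\<forall>\<^sub>F n in sequentially. norm (D ^ n * uu x (2 * n)) \<le> D ^ n * ((2 + B) / 2)"
    proof (rule always_eventually, rule allI)
      fix n
      have "\<bar>uu x (2 * n)\<bar> \<le> (2 + B) / 2" using B[of "2 * n"] al_small[of "2 * n"] al_pos[of "2 * n"]
        unfolding uu_def by argo
      then show "norm (D ^ n * uu x (2 * n)) \<le> D ^ n * ((2 + B) / 2)"
        using D_pos by (simp add: abs_mult)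
    qed
    have "(\<lambda>n. D ^ n * ((2 + B) / 2)) \<longlonglongrightarrow> 0 * ((2 + B) / 2)"
      using D_pos D_less_1 by (intro tendsto_intros LIMSEQ_realpow_zero) auto
    then show "(\<lambda>n. D ^ n * ((2 + B) / 2)) \<longlonglongrightarrow> 0" by simp
  qed
  then have "(\<lambda>n. \<Sum>i<n. f i) \<longlonglongrightarrow> uu x 0 - 0" unfolding part by (intro tendsto_intros)
  then have "f sums uu x 0" by (simp add: sums_def)
  then have "suminf f = uu x 0" by (rule sums_unique[symmetric])
  then show ?thesis unfolding gammaP_def gam_uu f_def .
qed

end

section \<open>Polynomial inequalities\<close>

text \<open>The parameter region of \<open>b = 2 * a - 2\<close> with \<open>a \<ge> 8\<close>. The
  equation is the relation between \<open>a\<close> and \<open>b\<close> rewritten in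
  \<open>e\<close> and \<open>B\<close> alone; the certificates may add any multiple of it.\<close>

definition region3 :: "real \<Rightarrow> real \<Rightarrow> bool" where
  "region3 e B \<longleftrightarrow> 0 \<le> B \<and> 0 \<le> 2*B-e \<and> 0 \<le> 3*e-5*B \<and> 0 \<le> 13-100*e \<and> (2*B-e)*(1+e*B) - 2*(e*B) = 0"

text \<open>The polynomial inequalities below were certified by linear programming: each polynomial is a
  combination, with nonnegative coefficients, of products of the polynomials defining the region.\<close>

lemma region1_A2:
  fixes e B :: real
  assumes "0 \<le> B" "2*B \<le> e" "50*e \<le> 13" "e \<le> 3*B*(1+e)"
  shows "0 \<le> (1-e)*(1-3*B) - (1-e+e*(e+3*B-3*(e*B)))*(1-5*B+B*(e+3*B-3*(e*B)))"
proof -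
  have "446858097281505000 * ((1-e)*(1-3*B) - (1-e+e*(e+3*B-3*(e*B)))*(1-5*B+B*(e+3*B-3*(e*B)))) = 26818494066000000*(e-2*B) + 26771251363439700*(e-2*B)*(13-50*e)
       + 63836871040215000*B*(e-2*B)^2*(13-50*e) + 254536959603545050*(e-2*B)*(13-50*e)*(3*B*(1+e)-e)^2
       + 18770799481827731*(3*B*(1+e)-e)^2 + 149236516643652100*(3*B*(1+e)-e)
       + 20037121585585650*(e-2*B)*(3*B*(1+e)-e)^2 + 5090739192070901*(13-50*e)^2*(3*B*(1+e)-e)^2
       + 1290340605173100*(e-2*B)*(13-50*e)^2 + 4251502371285000*B*(e-2*B)*(13-50*e)^2
       + 51339705810120000*B*(e-2*B)*(13-50*e)*(3*B*(1+e)-e)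
       + 132526868588010000*(e-2*B)*(13-50*e)*(3*B*(1+e)-e) + 136915735320000*B*(13-50*e)^3
       + 4973526140115000*B*(13-50*e)^2*(3*B*(1+e)-e) + 518011081152720200*B*(13-50*e)*(3*B*(1+e)-e)^2
       + 2625300635629100*(13-50*e)^2*(3*B*(1+e)-e)"
    by algebra
  moreover have "0 \<le> \<dots>"
    using assms by (intro add_nonneg_nonneg mult_nonneg_nonneg zero_le_power) auto
  ultimately show ?thesis by simp
qed

text \<open>With \<open>c0 e B\<close> for \<open>(1-e)*(1-3*B)\<close> and \<open>kp e B\<close>
  for \<open>e+3*B-3*(e*B)\<close>, the inequalities \<open>region1_A2\<close> to
  \<open>region1_A5\<close> are what the digit rules require: the largest product that a forbidden
  digit could still allow does not exceed \<open>c0\<close>.\<close>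

lemma region1_A3:
  fixes e B :: real
  assumes "0 \<le> B" "2*B \<le> e" "50*e \<le> 13"
  shows "0 \<le> (1-e)*(1-3*B) - (1-3*e+e*(B*(4+(e+3*B-3*(e*B)))))*(1-B+B*(e+3*B-3*(e*B)))"
proof -
  have "250000000000 * ((1-e)*(1-3*B) - (1-3*e+e*(B*(4+(e+3*B-3*(e*B)))))*(1-B+B*(e+3*B-3*(e*B)))) = 494652240557*(e-2*B) + 146036062200*B*(e-2*B) + 8350100*B*(e-2*B)*(13-50*e)^3 + 191517861438*B
       + 17163764644*B*(13-50*e) + 9733496500*B*(e-2*B)*(13-50*e) + 11133975000*B*(e-2*B)^2*(13-50*e)
       + 122850*(e-2*B)^2*(13-50*e)^2 + 79108867500*(e-2*B)^3 + 346208530*B*(13-50*e)^2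
       + 749109000*B*(e-2*B)*(13-50*e)^2 + 90580*B*(13-50*e)^4 + 1372500*(e-2*B)^3*(13-50*e)^3
       + 173700*(e-2*B)^2*(13-50*e)^3 + 68625000*(e-2*B)^4*(13-50*e)^2 + 411366111*(e-2*B)*(13-50*e)
       + 20130000*B^2*(e-2*B)*(13-50*e)^3 + 4500000*B^2*(e-2*B)^2*(13-50*e)^3
       + 180000*B^2*(e-2*B)*(13-50*e)^4 + 1551225000*(e-2*B)^2*(13-50*e) + 261480000*B*(e-2*B)^2*(13-50*e)^2
       + 54900*B*(e-2*B)*(13-50*e)^4 + 1800*B^2*(13-50*e)^5 + 183000*B^2*(13-50*e)^4
       + 457875000*(e-2*B)^4*(13-50*e) + 11040920*B*(13-50*e)^3 + 40043250000*B*(e-2*B)^3"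
    by algebra
  moreover have "0 \<le> \<dots>"
    using assms by (intro add_nonneg_nonneg mult_nonneg_nonneg zero_le_power) auto
  ultimately show ?thesis by simp
qed

lemma region1_A4:
  fixes e B :: real
  assumes "0 \<le> B" "2*B \<le> e" "50*e \<le> 13"
  shows "0 \<le> (1-e)*(1-3*B) - (1-3*e+e*(B*(4+(e+3*B-3*(e*B)))))*(1+B+B*(e*(e+3*B-3*(e*B))))"
proof -
  have "325000000000000 * ((1-e)*(1-3*B) - (1-3*e+e*(B*(4+(e+3*B-3*(e*B)))))*(1+B+B*(e*(e+3*B-3*(e*B))))) = 646195186578266*(e-2*B) + 12033987030000*B*(e-2*B)^2*(13-50*e) + 109800*B^2*(13-50*e)^6
       + 18852093*(e-2*B)*(13-50*e)^4 + 2205716986200*(e-2*B)^2*(13-50*e) + 19210727874*(e-2*B)*(13-50*e)^2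
       + 50643124074400*B^2*(13-50*e) + 56284222215000*(e-2*B)^3 + 15660000*B^3*(13-50*e)^5
       + 2012212800*(e-2*B)^2*(13-50*e)^3 + 425780397738800*B^2 + 54531014200*B*(e-2*B)*(13-50*e)
       + 604530650893000*B*(e-2*B) + 72937800000*(e-2*B)^3*(13-50*e)^2 + 1848600*B^2*(13-50*e)^5
       + 768634178000*B^2*(13-50*e)^2 + 663560414400*B*(e-2*B)*(13-50*e)^2 + 675324000000*(e-2*B)^4*(13-50*e)
       + 202500*(e-2*B)^3*(13-50*e)^5 + 19800*(e-2*B)^2*(13-50*e)^6 + 35050392000*B^2*(13-50*e)^3
       + 803400000*B^3*(13-50*e)^4 + 19735560000*B^2*(e-2*B)*(13-50*e)^3 + 58500000*B*(e-2*B)^3*(13-50*e)^4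
       + 315*(e-2*B)*(13-50*e)^7 + 1042470000*(e-2*B)^3*(13-50*e)^3 + 18994950*(e-2*B)^2*(13-50*e)^4
       + 11290500000*(e-2*B)^4*(13-50*e)^2 + 270920000*B^2*(13-50*e)^4 + 6938100*B*(e-2*B)*(13-50*e)^4
       + 13534618500000*B*(e-2*B)^3 + 152100*(e-2*B)^2*(13-50*e)^5 + 2808000000*B*(e-2*B)^3*(13-50*e)^3"
    by algebra
  moreover have "0 \<le> \<dots>"
    using assms by (intro add_nonneg_nonneg mult_nonneg_nonneg zero_le_power) auto
  ultimately show ?thesis by simp
qed

lemma region1_A5:
  fixes e B :: real
  assumes "0 \<le> B" "2*B \<le> e" "50*e \<le> 13"
  shows "0 \<le> (1-e)*(1-3*B) - (1-e+e*(B*(4+(e+3*B-3*(e*B)))))*(1-5*B+B*(e+3*B-3*(e*B)))"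
proof -
  have "1625000000000 * ((1-e)*(1-3*B) - (1-e+e*(B*(4+(e+3*B-3*(e*B)))))*(1-5*B+B*(e+3*B-3*(e*B)))) = 287925298947*B + 7465435445*B*(13-50*e)^2 + 952380000*B^2*(e-2*B)*(13-50*e)^2
       + 29250000*B^2*(e-2*B)^2*(13-50*e)^3 + 11700*B^2*(13-50*e)^5 + 129814280986*B*(13-50*e)
       + 4982317080000*B^2 + 260281125000*B*(e-2*B)^3 + 11904750000*B^2*(e-2*B)^2*(13-50*e)
       + 637399100*B*(e-2*B)*(13-50*e)^2 + 1784250000*B^2*(e-2*B)^2*(13-50*e)^2 + 449230*B*(13-50*e)^4
       + 64046000*B^2*(13-50*e)^3 + 95160000*B^2*(e-2*B)*(13-50*e)^3 + 22475602500*B*(e-2*B)^2*(13-50*e)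
       + 22461500*B*(e-2*B)*(13-50*e)^3 + 1189500*B^2*(13-50*e)^4 + 373931032800*B*(e-2*B)*(13-50*e)
       + 180930555000*B^2*(e-2*B) + 1170000*B^2*(e-2*B)*(13-50*e)^4"
    by algebra
  moreover have "0 \<le> \<dots>"
    using assms by (intro add_nonneg_nonneg mult_nonneg_nonneg zero_le_power) auto
  ultimately show ?thesis by simp
qed

text \<open>For the constant pattern with digits -2, 4 when \<open>b \<ge> 3 * a - 4\<close> and
  \<open>a \<ge> 6\<close>: an upper bound of its first product is at most
  \<open>c0\<close>.\<close>

lemma C4_upper:
  fixes e B :: real
  assumes "0 \<le> B" "2*B \<le> e" "100*e \<le> 17" "3*B \<le> e+4*e*B"
  shows "0 \<le> (1-e)*(1-3*B) - (1-3*e+4*(e*B))*(1+3*B-2*(e*B)+5*(B*(e*B)))"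
proof -
  have "107200000 * ((1-e)*(1-3*B) - (1-3*e+4*(e*B))*(1+3*B-2*(e*B)+5*(B*(e*B)))) = 402000000*B*(e-2*B)*(e+4*e*B-3*B) + 670000*(17-100*e)*(e+4*e*B-3*B)^2 + 85000*(e+4*e*B-3*B)^2
       + 180427200*B*(e+4*e*B-3*B) + 26415688*B^2*(17-100*e) + 67000000*(e-2*B)*(e+4*e*B-3*B)^2 + 275504*B^2
       + 9895900*B*(e-2*B)*(17-100*e) + 2182500*(e-2*B)*(17-100*e)*(e+4*e*B-3*B) + 208092575*(e+4*e*B-3*B)
       + 21825*(17-100*e)^2*(e+4*e*B-3*B) + 150750000*(e-2*B)^3 + 1507500*(e-2*B)^2*(17-100*e)"
    by algebra
  moreover have "0 \<le> \<dots>"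
    using assms by (intro add_nonneg_nonneg mult_nonneg_nonneg zero_le_power) auto
  ultimately show ?thesis by simp
qed

text \<open>For the same pattern when \<open>b \<le> 3 * a - 6\<close>. The subtracted product
  bounds \<open>VV gg\<close> from above, and the spare \<open>B^2/10\<close> makes the comparison
  strict. \<open>C4_lower3\<close> and \<open>C4_lower4\<close> do the same for two other products
  of the cell.\<close>

lemma C4_lower1:
  fixes e B :: real
  assumes "0 \<le> B" "2*B \<le> e" "100*e \<le> 17" "2*e+11*e*B \<le> 6*B"
  shows "0 \<le> (1-3*e+4*(e*B)-2*(e*(e*B)))*(1+3*B-2*(e*B)) - (1-e+2*(e*B)^2)*(1-3*B+2*(B*(e*B))) - B^2/10"
proof -
  have "219881200000000 * ((1-3*e+4*(e*B)-2*(e*(e*B)))*(1+3*B-2*(e*B)) - (1-e+2*(e*B)^2)*(1-3*B+2*(B*(e*B))) - B^2/10) = 274517797486800*B^3*(17-100*e) + 40244094277*(17-100*e)^2*(6*B-2*e-11*e*B) + 637655480000000*B^2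
       + 139720542000000*(e-2*B)*(6*B-2*e-11*e*B)^2 + 195844181581853*(6*B-2*e-11*e*B)
       + 710127875290*(17-100*e)*(6*B-2*e-11*e*B) + 5947200000000*B*(e-2*B)*(6*B-2*e-11*e*B)^2
       + 68044228*(17-100*e)^3*(6*B-2*e-11*e*B) + 18679040310400*B*(17-100*e)*(6*B-2*e-11*e*B)
       + 4803347542484400*B^3 + 19824000000*B*(17-100*e)*(6*B-2*e-11*e*B)^2
       + 660800000000*B*(6*B-2*e-11*e*B)^3 + 85961703700*(e-2*B)*(17-100*e)^2*(6*B-2*e-11*e*B)
       + 188899210269100*(e-2*B)*(6*B-2*e-11*e*B) + 1724688000000*B*(e-2*B)^2*(17-100*e)
       + 81449976720000*B^2*(e-2*B)*(17-100*e) + 17841600000000*B*(e-2*B)^2*(6*B-2*e-11*e*B)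
       + 7915728090000*(e-2*B)^2*(17-100*e)*(6*B-2*e-11*e*B) + 17841600000000*B*(e-2*B)^3"
    by algebra
  moreover have "0 \<le> \<dots>"
    using assms by (intro add_nonneg_nonneg mult_nonneg_nonneg zero_le_power) auto
  ultimately show ?thesis by simp
qed

lemma C4_lower3:
  fixes e B :: real
  assumes "0 \<le> B" "2*B \<le> e" "100*e \<le> 17" "2*e+11*e*B \<le> 6*B"
  shows "0 \<le> (1-e+4*(e*B)-2*(e*(e*B)))*(1-3*B+2*(e*B)-4*(B*(e*B))) - (1-e+2*(e*B)^2)*(1-3*B+2*(B*(e*B))) - B^2/10"
proof -
  have "11351366950000000 * ((1-e+4*(e*B)-2*(e*(e*B)))*(1-3*B+2*(e*B)-4*(B*(e*B))) - (1-e+2*(e*B)^2)*(1-3*B+2*(B*(e*B))) - B^2/10) = 60507460406384600*B*(e-2*B) + 412025260000*(17-100*e)*(6*B-2*e-11*e*B)^2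
       + 307024200000000*B*(e-2*B)*(6*B-2*e-11*e*B)^2 + 90347593308441301*B^2
       + 2336769148101744*B^2*(17-100*e) + 430256048006200*B*(e-2*B)*(17-100*e)
       + 15859503918059*B^2*(17-100*e)^2 + 140130900000000*B*(e-2*B)^2*(17-100*e)
       + 13443000000*(e-2*B)*(17-100*e)^2*(6*B-2*e-11*e*B) + 32408110000*(17-100*e)^2*(6*B-2*e-11*e*B)^2
       + 2462248180000*B*(e-2*B)*(17-100*e)^2 + 622352515000*B*(17-100*e)^2*(6*B-2*e-11*e*B)
       + 28855719420000*(e-2*B)*(6*B-2*e-11*e*B) + 921072600000000*B*(e-2*B)^2*(6*B-2*e-11*e*B)
       + 84869763000000*(e-2*B)*(6*B-2*e-11*e*B)^2 + 1344300000000*(e-2*B)^2*(17-100*e)*(6*B-2*e-11*e*B)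
       + 3240811000000*(e-2*B)*(17-100*e)*(6*B-2*e-11*e*B)^2 + 34113800000000*B*(6*B-2*e-11*e*B)^3
       + 921072600000000*B*(e-2*B)^3"
    by algebra
  moreover have "0 \<le> \<dots>"
    using assms by (intro add_nonneg_nonneg mult_nonneg_nonneg zero_le_power) auto
  ultimately show ?thesis by simp
qed

lemma C4_lower4:
  fixes e B :: real
  assumes "0 \<le> B" "2*B \<le> e" "100*e \<le> 17" "2*e+11*e*B \<le> 6*B"
  shows "0 \<le> (1+e-4*(e*B))*(1-5*B+2*(e*B)-4*(B*(e*B))) - (1-e+2*(e*B)^2)*(1-3*B+2*(B*(e*B))) - B^2/10"
proof -
  have "1572527566317400000000 * ((1+e-4*(e*B))*(1-5*B+2*(e*B)-4*(B*(e*B))) - (1-e+2*(e*B)^2)*(1-3*B+2*(B*(e*B))) - B^2/10) = 3017322384676353600000*(e-2*B) + 22353716370531153400*(e-2*B)*(17-100*e)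
       + 266573041445682463*B*(17-100*e)^2 + 46301782871128510000*(e-2*B)*(17-100*e)*(6*B-2*e-11*e*B)
       + 827978969927714320800*B + 115954425968961742329*B*(17-100*e) + 6904367296884000000*B^2*(17-100*e)^2
       + 42532676474400000000*B*(e-2*B)*(6*B-2*e-11*e*B)^2
       + 703136893400000000*(e-2*B)*(17-100*e)*(6*B-2*e-11*e*B)^2
       + 141052613401970000*(e-2*B)*(17-100*e)^2*(6*B-2*e-11*e*B) + 14073176136800000000*(6*B-2*e-11*e*B)^3
       + 3364722555740000*(e-2*B)*(17-100*e)^3 + 4725852941600000000*B*(6*B-2*e-11*e*B)^3
       + 7031368934000000*(17-100*e)^2*(6*B-2*e-11*e*B)^2 + 192627156295992000000*(6*B-2*e-11*e*B)^2
       + 450906069213950200*(17-100*e)^2*(6*B-2*e-11*e*B) + 669885185564000000*(e-2*B)^2*(17-100*e)^2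
       + 127598029423200000000*B*(e-2*B)^2*(6*B-2*e-11*e*B)
       + 5772669999600000000*(e-2*B)^2*(17-100*e)*(6*B-2*e-11*e*B)
       + 833259134059700*(17-100*e)^3*(6*B-2*e-11*e*B) + 33341292999000000000*(e-2*B)^3*(17-100*e)
       + 127598029423200000000*B*(e-2*B)^3"
    by algebra
  moreover have "0 \<le> \<dots>"
    using assms by (intro add_nonneg_nonneg mult_nonneg_nonneg zero_le_power) auto
  ultimately show ?thesis by simp
qed

text \<open>The first product is a lower estimate of the limit value for
  \<open>b = 2 * a - 2\<close>. As \<open>c0\<close> lies below it, the digit rules for
  \<open>c0\<close> remain available in this case.\<close>

lemma region3_S0:
  fixes e B :: real
  assumes "region3 e B"
  shows "0 \<le> (1-3*e+4*(e*B)-2*(e*(e*B)))*(1+B-2*(B*(e*B))) - (1-e)*(1-3*B)"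
proof -
  have nn: "0 \<le> B" "0 \<le> 2*B-e" "0 \<le> 3*e-5*B" "0 \<le> 13-100*e" and rel: "((2*B-e)*(1+e*B) - 2*(e*B)) = 0"
    using assms by (simp_all add: region3_def)
  have "23498437500000000 * ((1-3*e+4*(e*B)-2*(e*(e*B)))*(1+B-2*(B*(e*B))) - (1-e)*(1-3*B)) = (22351890711642900*(2*B-e) + 3338658000*(3*e-5*B)^2*(13-100*e)^3
       + 8822253375000*(2*B-e)*(3*e-5*B)^2*(13-100*e) + 121063950000*(3*e-5*B)^3*(13-100*e)^2
       + 23414276788500*(3*e-5*B)^2 + 50079870000*B*(2*B-e)*(13-100*e)^3
       + 63704320204907*(3*e-5*B)^2*(13-100*e) + 193758657236143*B^2*(13-100*e)
       + 185533532971971*(2*B-e)*(3*e-5*B)*(13-100*e) + 5562520818489*B^2*(13-100*e)^2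
       + 751950000*(3*e-5*B)^3*(13-100*e)^3 + 639777087261*(3*e-5*B)^2*(13-100*e)^2
       + 22558500*(3*e-5*B)^2*(13-100*e)^4 + 23763875850000*(3*e-5*B)^3
       + 2325643684533*(2*B-e)*(3*e-5*B)*(13-100*e)^2 + 338377500*B*(2*B-e)*(13-100*e)^4
       + 451170000*B^2*(13-100*e)^4 + 66773160000*B^2*(13-100*e)^3) +
      ((2*B-e)*(1+e*B) - 2*(e*B)) * (24644984288357100 + 294139695330000*e^1)" (is "_ = ?S + _")
    by algebra
  moreover have "0 \<le> ?S"
    using nn by (intro add_nonneg_nonneg mult_nonneg_nonneg zero_le_power) auto
  ultimately show ?thesis by (simp add: rel)
qed

lemma region3_R2:
  fixes e B :: real
  assumes "region3 e B"
  shows "0 \<le> (1-e)*(1-3*B) - (1-e+e*(e+3*B-3*(e*B)))*(1-5*B+B*(e+3*B-3*(e*B)))"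
proof -
  have nn: "0 \<le> B" "0 \<le> 2*B-e" "0 \<le> 3*e-5*B" "0 \<le> 13-100*e" and rel: "((2*B-e)*(1+e*B) - 2*(e*B)) = 0"
    using assms by (simp_all add: region3_def)
  have "195000000000000 * ((1-e)*(1-3*B) - (1-e+e*(e+3*B-3*(e*B)))*(1-5*B+B*(e+3*B-3*(e*B)))) = (207299498582982*(3*e-5*B) + 16958020599000*(2*B-e)*(3*e-5*B)
       + 35100000*(2*B-e)*(3*e-5*B)^2*(13-100*e)^3 + 558558000*(2*B-e)*(3*e-5*B)*(13-100*e)^3
       + 886320*(3*e-5*B)*(13-100*e)^5 + 9187929091900*B*(13-100*e) + 59642671491*(2*B-e)*(13-100*e)^2
       + 186275700000*(2*B-e)*(3*e-5*B)^2*(13-100*e) + 641265243372780*(2*B-e) + 278105028903*B*(13-100*e)^2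
       + 1296190350*(2*B-e)*(13-100*e)^3 + 2420848228500*(2*B-e)*(3*e-5*B)*(13-100*e)
       + 836901198497*(3*e-5*B)*(13-100*e) + 2287398750*B*(13-100*e)^3
       + 51825969000*(2*B-e)*(3*e-5*B)*(13-100*e)^2 + 5651100000*(2*B-e)*(3*e-5*B)^2*(13-100*e)^2
       + 181125000*(3*e-5*B)^2*(13-100*e)^4 + 46647900*(2*B-e)*(13-100*e)^4 + 1381493880000*(3*e-5*B)^3
       + 455796000*(2*B-e)*(3*e-5*B)*(13-100*e)^4 + 63180*B*(13-100*e)^5) +
      ((2*B-e)*(1+e*B) - 2*(e*B)) * (0)" (is "_ = ?S + _")
    by algebra
  moreover have "0 \<le> ?S"
    using nn by (intro add_nonneg_nonneg mult_nonneg_nonneg zero_le_power) auto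
  ultimately show ?thesis by (simp add: rel)
qed

lemma region3_R4:
  fixes e B :: real
  assumes "region3 e B"
  shows "0 \<le> (1-e)*(1-3*B) - (1-3*e+e*(B*(4+(e+3*B-3*(e*B)))))*(1-B+B*(e+3*B-3*(e*B)))"
proof -
  have nn: "0 \<le> B" "0 \<le> 2*B-e" "0 \<le> 3*e-5*B" "0 \<le> 13-100*e" and rel: "((2*B-e)*(1+e*B) - 2*(e*B)) = 0"
    using assms by (simp_all add: region3_def)
  have "195000000000000000 * ((1-e)*(1-3*B) - (1-3*e+e*(B*(4+(e+3*B-3*(e*B)))))*(1-B+B*(e+3*B-3*(e*B)))) = (134138455311039088*(3*e-5*B) + 346256556377823*(2*B-e)*(13-100*e)
       + 1217395774432500*(2*B-e)*(3*e-5*B)*(13-100*e) + 2808000000*(3*e-5*B)^4*(13-100*e)^3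
       + 336960000*(3*e-5*B)^3*(13-100*e)^4 + 116174817521692280*B + 9039265378296699*B*(13-100*e)
       + 32345096983290*(2*B-e)*(13-100*e)^2 + 446270116500000*(2*B-e)*(3*e-5*B)^2*(13-100*e)
       + 249949440000*(3*e-5*B)^3*(13-100*e)^2 + 452088000000*(3*e-5*B)^4*(13-100*e)^2
       + 114144984167370*B*(13-100*e)^2 + 49356181777500*(2*B-e)*(3*e-5*B)*(13-100*e)^2
       + 26164728*(2*B-e)*(13-100*e)^5 + 2138610750120000*(3*e-5*B)^3 + 59230080000*(3*e-5*B)^3*(13-100*e)^3
       + 1281196722195*(3*e-5*B)*(13-100*e)^3 + 34231383591444000*(2*B-e)*(3*e-5*B)
       + 169501824*B*(13-100*e)^5 + 519634440000*(2*B-e)*(3*e-5*B)*(13-100*e)^3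
       + 690746940000000*(2*B-e)*(3*e-5*B)^3 + 915036000*(3*e-5*B)^2*(13-100*e)^4
       + 379080000*B^2*(13-100*e)^5 + 682344*(2*B-e)*(13-100*e)^6 + 14902056000000*(3*e-5*B)^4*(13-100*e)
       + 49359900000*B^2*(13-100*e)^4 + 1667952*B*(13-100*e)^6 + 4951783605600*(2*B-e)*(13-100*e)^3
       + 149289504000*(3*e-5*B)^2*(13-100*e)^3) +
      ((2*B-e)*(1+e*B) - 2*(e*B)) * (0)" (is "_ = ?S + _")
    by algebra
  moreover have "0 \<le> ?S"
    using nn by (intro add_nonneg_nonneg mult_nonneg_nonneg zero_le_power) auto
  ultimately show ?thesis by (simp add: rel)
qed

lemma region3_kap:
  fixes e B :: real
  assumes "region3 e B"
  shows "0 \<le> 13/5*e - (e+3*B-3*(e*B))"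
proof -
  have nn: "0 \<le> B" "0 \<le> 2*B-e" "0 \<le> 3*e-5*B" "0 \<le> 13-100*e" and rel: "((2*B-e)*(1+e*B) - 2*(e*B)) = 0"
    using assms by (simp_all add: region3_def)
  have "1461000 * (13/5*e - (e+3*B-3*(e*B))) = (23400*(3*e-5*B)^2 + 20074*(3*e-5*B) + 1287*(3*e-5*B)*(13-100*e) + 135*(2*B-e)*(13-100*e)^2 + 255395*B
       + 4500*(2*B-e)*(3*e-5*B)*(13-100*e)) +
      ((2*B-e)*(1+e*B) - 2*(e*B)) * (-2250000)" (is "_ = ?S + _")
    by algebra
  moreover have "0 \<le> ?S"
    using nn by (intro add_nonneg_nonneg mult_nonneg_nonneg zero_le_power) auto
  ultimately show ?thesis by (simp add: rel)
qed

text \<open>This and \<open>region3_T3a\<close>, \<open>region3_T3b\<close>,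
  \<open>region3_T3c\<close> compare the lower estimate of the limit value with the best product
  that one forbidden pattern could reach. The patterns are those of \<open>no_double_minus2\<close>
  and \<open>zero_two\<close>; \<open>13/5*e\<close> replaces \<open>kp\<close> by
  \<open>region3_kap\<close>.\<close>

lemma region3_T4:
  fixes e B :: real
  assumes "region3 e B"
  shows "0 \<le> (1-3*e+4*(e*B)-2*(e*(e*B)))*(1+B-2*(B*(e*B))) - (1-3*e+e*B*(4+13/5*e))*(1+B-2*(e*B)+B*(e*B)*(4+13/5*e))"
proof -
  have nn: "0 \<le> B" "0 \<le> 2*B-e" "0 \<le> 3*e-5*B" "0 \<le> 13-100*e" and rel: "((2*B-e)*(1+e*B) - 2*(e*B)) = 0"
    using assms by (simp_all add: region3_def)
  have "61687500000000000 * ((1-3*e+4*(e*B)-2*(e*(e*B)))*(1+B-2*(B*(e*B))) - (1-3*e+e*B*(4+13/5*e))*(1+B-2*(e*B)+B*(e*B)*(4+13/5*e))) = (112565733286104*(3*e-5*B)^2*(13-100*e)^2 + 333606000*(3*e-5*B)^3*(13-100*e)^4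
       + 1541568848400*(3*e-5*B)^3*(13-100*e)^2 + 358138254420*(2*B-e)*(3*e-5*B)*(13-100*e)^3
       + 464665500*(3*e-5*B)^3*(13-100*e)^3 + 22518405*(2*B-e)^2*(13-100*e)^5
       + 104855183217658200*(2*B-e)^2*(13-100*e) + 10655274776735000*(2*B-e) + 5566786736044846*(3*e-5*B)^2
       + 1311277087500*B^3*(13-100*e)^3 + 88227521382000*(2*B-e)*(3*e-5*B)^2*(13-100*e)
       + 750613500*(2*B-e)*(3*e-5*B)^2*(13-100*e)^4 + 659396190492900*(2*B-e)*(3*e-5*B)*(13-100*e)^2
       + 13782050850800358*(3*e-5*B)^2*(13-100*e) + 951745588321500*(2*B-e)^2*(13-100*e)^2
       + 219331299696600*(3*e-5*B)^3 + 16956977828779560*(2*B-e)*(3*e-5*B)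
       + 76243731741308800*(2*B-e)*(3*e-5*B)*(13-100*e) + 165445264047*(3*e-5*B)^2*(13-100*e)^3
       + 209099475*(2*B-e)^2*(13-100*e)^4 + 1049125943025*B*(2*B-e)*(13-100*e)^3
       + 125459685*(2*B-e)*(3*e-5*B)*(13-100*e)^4 + 22518405*B^2*(13-100*e)^5) +
      ((2*B-e)*(1+e*B) - 2*(e*B)) * (-10655274776735000)" (is "_ = ?S + _")
    by algebra
  moreover have "0 \<le> ?S"
    using nn by (intro add_nonneg_nonneg mult_nonneg_nonneg zero_le_power) auto
  ultimately show ?thesis by (simp add: rel)
qed

lemma region3_T3a:
  fixes e B :: real
  assumes "region3 e B"
  shows "0 \<le> (1-3*e+4*(e*B)-2*(e*(e*B)))*(1+B-2*(B*(e*B))) - (1-e+e*B*(2+1/3*e))*(1-3*B+B*(e*B)*(2+1/3*e))"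
proof -
  have nn: "0 \<le> B" "0 \<le> 2*B-e" "0 \<le> 3*e-5*B" "0 \<le> 13-100*e" and rel: "((2*B-e)*(1+e*B) - 2*(e*B)) = 0"
    using assms by (simp_all add: region3_def)
  have "182994552000000000000 * ((1-3*e+4*(e*B)-2*(e*(e*B)))*(1+B-2*(B*(e*B))) - (1-e+e*B*(2+1/3*e))*(1-3*B+B*(e*B)*(2+1/3*e))) = (8307476733733967400*(2*B-e)*(3*e-5*B)^2 + 3046803876491427*B*(2*B-e)*(13-100*e)^3
       + 40665456000000*(3*e-5*B)^4*(13-100*e)^3 + 1280961864000*(2*B-e)^2*(3*e-5*B)*(13-100*e)^4
       + 4917679693898400*(2*B-e)*(3*e-5*B)*(13-100*e)^3
       + 30291271017507672300*(2*B-e)*(3*e-5*B)^2*(13-100*e)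
       + 97404645129480000000*(2*B-e)*(3*e-5*B)^3*(13-100*e) + 28527113357673304725*(2*B-e)^2*(13-100*e)
       + 614702991876521049*(2*B-e)*(3*e-5*B)*(13-100*e)^2 + 38961858051792000000*(3*e-5*B)^4*(13-100*e)
       + 8545845578400*B*(2*B-e)*(13-100*e)^4 + 781433795831592501858*(2*B-e)^2
       + 12818768367600*(2*B-e)*(3*e-5*B)*(13-100*e)^4 + 80009284680000000*B*(3*e-5*B)^3*(13-100*e)^2
       + 16001856936000000*(3*e-5*B)^4*(13-100*e)^2 + 101663640000000*(2*B-e)*(3*e-5*B)^3*(13-100*e)^3
       + 5489836560*(2*B-e)*(3*e-5*B)*(13-100*e)^5 + 1188591947979696000*(2*B-e)^2*(3*e-5*B)*(13-100*e)^2
       + 1739128316018288000*B^2*(2*B-e)*(13-100*e) + 3659891040*B*(2*B-e)*(13-100*e)^5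
       + 123073742837612820100*B*(2*B-e)*(3*e-5*B)*(13-100*e)
       + 3007698456672000*(2*B-e)^2*(3*e-5*B)*(13-100*e)^3) +
      ((2*B-e)*(1+e*B) - 2*(e*B)) * (365989104000000000000 + -1736226288387532500000*B + 807114960193766250000*e^1
       + -272314708774173000000*e^2)" (is "_ = ?S + _")
    by algebra
  moreover have "0 \<le> ?S"
    using nn by (intro add_nonneg_nonneg mult_nonneg_nonneg zero_le_power) auto
  ultimately show ?thesis by (simp add: rel)
qed

lemma region3_T3b:
  fixes e B :: real
  assumes "region3 e B"
  shows "0 \<le> (1-3*e+4*(e*B)-2*(e*(e*B)))*(1+B-2*(B*(e*B))) - (1-e+7/3*(e*B)^2)*(1-3*B+2*(e*B)-5/3*(B*(e*B)))"
proof -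
  have nn: "0 \<le> B" "0 \<le> 2*B-e" "0 \<le> 3*e-5*B" "0 \<le> 13-100*e" and rel: "((2*B-e)*(1+e*B) - 2*(e*B)) = 0"
    using assms by (simp_all add: region3_def)
  have "4616611564500000000000 * ((1-3*e+4*(e*B)-2*(e*(e*B)))*(1+B-2*(B*(e*B))) - (1-e+7/3*(e*B)^2)*(1-3*B+2*(e*B)-5/3*(B*(e*B)))) = (30331137978765*(2*B-e)*(3*e-5*B)*(13-100*e)^4 + 205823700862714740000*(2*B-e)*(3*e-5*B)^3*(13-100*e)
       + 96948842854500*(2*B-e)^2*(3*e-5*B)*(13-100*e)^4 + 61718967048960000*(3*e-5*B)^4*(13-100*e)^2
       + 427783882582186650*(2*B-e)^2*(13-100*e)^2 + 107720936505000*B^3*(13-100*e)^4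
       + 63110106000396000*(3*e-5*B)^4 + 9048558666420000*(2*B-e)*(3*e-5*B)^3*(13-100*e)^3
       + 7002621001415471346720*B*(2*B-e) + 3590697883500000*(3*e-5*B)^4*(13-100*e)^3
       + 82281967569409000000*(3*e-5*B)^4*(13-100*e) + 45427457794680*B*(2*B-e)*(13-100*e)^4
       + 15866743042820203560*(2*B-e)*(3*e-5*B)^2*(13-100*e) + 20593065663387500000*B^4*(13-100*e)
       + 2407614172479567000*(2*B-e)^2*(3*e-5*B)*(13-100*e)^2 + 6088166841894279480*B^2*(3*e-5*B)*(13-100*e)
       + 302993346546540000*B*(3*e-5*B)^3*(13-100*e)^2 + 10184893272368460*(2*B-e)*(3*e-5*B)*(13-100*e)^3
       + 5689744452220050*B*(2*B-e)*(13-100*e)^3 + 1403224269107089278954*(2*B-e)*(3*e-5*B)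
       + 581693057127*(2*B-e)*(3*e-5*B)*(13-100*e)^5 + 522408717347861760*(3*e-5*B)^3
       + 9116924913459715560*B*(2*B-e)*(3*e-5*B)*(13-100*e)
       + 10858270399704000*(2*B-e)^2*(3*e-5*B)*(13-100*e)^3) +
      ((2*B-e)*(1+e*B) - 2*(e*B)) * (9233223129000000000000 + -27596046819081000000*B + -4207752761299272900000*e^1)" (is "_ = ?S + _")
    by algebra
  moreover have "0 \<le> ?S"
    using nn by (intro add_nonneg_nonneg mult_nonneg_nonneg zero_le_power) auto
  ultimately show ?thesis by (simp add: rel)
qed

lemma region3_T3c:
  fixes e B :: real
  assumes "region3 e B"
  shows "0 \<le> (1-3*e+4*(e*B)-2*(e*(e*B)))*(1+B-2*(B*(e*B))) - (1-e-5/3*(e*B))*(1-3*B+2*(e*B)-5/3*(B*(e*B)))"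
proof -
  have nn: "0 \<le> B" "0 \<le> 2*B-e" "0 \<le> 3*e-5*B" "0 \<le> 13-100*e" and rel: "((2*B-e)*(1+e*B) - 2*(e*B)) = 0"
    using assms by (simp_all add: region3_def)
  have "351562500000000 * ((1-3*e+4*(e*B)-2*(e*(e*B)))*(1+B-2*(B*(e*B))) - (1-e-5/3*(e*B))*(1-3*B+2*(e*B)-5/3*(B*(e*B)))) = (279517616976399*(2*B-e) + 6750000*B^2*(13-100*e)^4 + 15020350725900*(2*B-e)*(3*e-5*B)
       + 433496990277*(2*B-e)*(13-100*e) + 370599750000*B^2*(13-100*e)
       + 182771875000*(2*B-e)*(3*e-5*B)^2*(13-100*e) + 5062500*B*(2*B-e)*(13-100*e)^4
       + 4826809659000*B*(2*B-e)*(13-100*e) + 1100812500*B*(2*B-e)*(13-100*e)^3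
       + 11250000*(3*e-5*B)^3*(13-100*e)^3 + 2592500000*(3*e-5*B)^3*(13-100*e)^2
       + 48065062500*(2*B-e)*(3*e-5*B)*(13-100*e)^2 + 119110312500*B^2*(13-100*e)^2
       + 487565000000*(3*e-5*B)^3 + 13182893750*(3*e-5*B)^2*(13-100*e)^2 + 73387500*(3*e-5*B)^2*(13-100*e)^3
       + 1467750000*B^2*(13-100*e)^3 + 38387293750*(3*e-5*B)^2*(13-100*e) + 337500*(3*e-5*B)^2*(13-100*e)^4) +
      ((2*B-e)*(1+e*B) - 2*(e*B)) * (417971922150000)" (is "_ = ?S + _")
    by algebra
  moreover have "0 \<le> ?S"
    using nn by (intro add_nonneg_nonneg mult_nonneg_nonneg zero_le_power) auto
  ultimately show ?thesis by (simp add: rel)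
qed

text \<open>The \<open>g\<close> certificates serve the converse direction: they bound products of
  the cells of \<open>delta2\<close> and of the constant pattern from below by
  \<open>(1-3*e+4*(e*B))*(1+B)\<close>, which later becomes \<open>du\<close>.\<close>

lemma region3_g3f1:
  fixes e B :: real
  assumes "region3 e B"
  shows "0 \<le> (1-3*e+2*(e*B)-2*(e*B)^2)*(1+3*B-2*(e*B)) - (1-3*e+4*(e*B))*(1+B) - e^2/10"
proof -
  have nn: "0 \<le> B" "0 \<le> 2*B-e" "0 \<le> 3*e-5*B" "0 \<le> 13-100*e" and rel: "((2*B-e)*(1+e*B) - 2*(e*B)) = 0"
    using assms by (simp_all add: region3_def)
  have "3750000000000 * ((1-3*e+2*(e*B)-2*(e*B)^2)*(1+3*B-2*(e*B)) - (1-3*e+4*(e*B))*(1+B) - e^2/10) = (2943594634332*(3*e-5*B) + 270000*B^2*(13-100*e)^4 + 34295535*(3*e-5*B)*(13-100*e)^2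
       + 350482500*(2*B-e)*(3*e-5*B)*(13-100*e)^2 + 120000*(3*e-5*B)^3*(13-100*e)^3
       + 318529213300*B*(13-100*e) + 1967214680*(3*e-5*B)*(13-100*e) + 13320000*(3*e-5*B)^3*(13-100*e)^2
       + 26460000*B^2*(13-100*e)^3 + 8904832671660*(2*B-e) + 2103229800*B*(13-100*e)^2
       + 8718057*(2*B-e)*(13-100*e)^3 + 82620*(3*e-5*B)*(13-100*e)^4 + 11829501*B*(13-100*e)^3
       + 1017900000*(2*B-e)*(3*e-5*B)^2*(13-100*e) + 39964200*(3*e-5*B)^2*(13-100*e)
       + 20539318800*(3*e-5*B)^2 + 2778360000*(3*e-5*B)^3 + 972*B*(13-100*e)^5 + 275400*(2*B-e)*(13-100*e)^4
       + 324*(2*B-e)*(13-100*e)^5) +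
      ((2*B-e)*(1+e*B) - 2*(e*B)) * (0)" (is "_ = ?S + _")
    by algebra
  moreover have "0 \<le> ?S"
    using nn by (intro add_nonneg_nonneg mult_nonneg_nonneg zero_le_power) auto
  ultimately show ?thesis by (simp add: rel)
qed

lemma region3_g3f3:
  fixes e B :: real
  assumes "region3 e B"
  shows "0 \<le> (1-e+2*(e*B)-2*(e*B)^2)*(1-3*B+2*(e*B)-4*(B*(e*B))) - (1-3*e+4*(e*B))*(1+B) - e^2/10"
proof -
  have nn: "0 \<le> B" "0 \<le> 2*B-e" "0 \<le> 3*e-5*B" "0 \<le> 13-100*e" and rel: "((2*B-e)*(1+e*B) - 2*(e*B)) = 0"
    using assms by (simp_all add: region3_def)
  have "4570312500000000000 * ((1-e+2*(e*B)-2*(e*B)^2)*(1-3*B+2*(e*B)-4*(B*(e*B))) - (1-3*e+4*(e*B))*(1+B) - e^2/10) = (473850000000*(2*B-e)*(3*e-5*B)^2*(13-100*e)^4 + 7140972150000*B*(2*B-e)*(13-100*e)^3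
       + 7142850000000*B*(3*e-5*B)^2*(13-100*e)^3 + 19692552295368500*(3*e-5*B)^2*(13-100*e)
       + 1412899956928907226*(2*B-e) + 2490935468287500*B^2*(13-100*e)^2 + 655498791675*(2*B-e)*(13-100*e)^3
       + 74148750000000*(2*B-e)*(3*e-5*B)^3*(13-100*e) + 511696468527636600*(2*B-e)*(3*e-5*B)
       + 734663583240394000*B^2*(13-100*e) + 814960451910771*(2*B-e)*(13-100*e)^2
       + 6046267500000*(3*e-5*B)^3*(13-100*e)^2 + 1356625530000000*(3*e-5*B)^3
       + 1523217150000*(2*B-e)*(3*e-5*B)*(13-100*e)^3 + 31590000*(2*B-e)*(13-100*e)^6
       + 146250000000*(2*B-e)*(3*e-5*B)^3*(13-100*e)^3 + 236925000000*(2*B-e)^2*(13-100*e)^4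
       + 128524500000000*(3*e-5*B)^4 + 7239269700000*B^2*(13-100*e)^3
       + 52501741110000*(2*B-e)*(3*e-5*B)*(13-100*e)^2 + 86251772334736200*(2*B-e)*(3*e-5*B)*(13-100*e)
       + 511274643750000*(2*B-e)*(3*e-5*B)^2*(13-100*e) + 182812500000*(3*e-5*B)^3*(13-100*e)^4
       + 2281500000000*(3*e-5*B)^4*(13-100*e)^2 + 1643557500000*(3*e-5*B)^3*(13-100*e)^3
       + 497542500*(2*B-e)*(13-100*e)^5 + 3948750000*(2*B-e)^2*(13-100*e)^5) +
      ((2*B-e)*(1+e*B) - 2*(e*B)) * (-10693030617090900000)" (is "_ = ?S + _")
    by algebra
  moreover have "0 \<le> ?S"
    using nn by (intro add_nonneg_nonneg mult_nonneg_nonneg zero_le_power) auto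
  ultimately show ?thesis by (simp add: rel)
qed

lemma region3_g3f4:
  fixes e B :: real
  assumes "region3 e B"
  shows "0 \<le> (1+e-4*(e*B))*(1-5*B+2*(e*B)-4*(B*(e*B))) - (1-3*e+4*(e*B))*(1+B) - e^2/100"
proof -
  have nn: "0 \<le> B" "0 \<le> 2*B-e" "0 \<le> 3*e-5*B" "0 \<le> 13-100*e" and rel: "((2*B-e)*(1+e*B) - 2*(e*B)) = 0"
    using assms by (simp_all add: region3_def)
  have "107878125000000 * ((1+e-4*(e*B))*(1-5*B+2*(e*B)-4*(B*(e*B))) - (1-3*e+4*(e*B))*(1+B) - e^2/100) = (9539429429400*(3*e-5*B)^2 + 1052890500*(2*B-e)*(3*e-5*B)*(13-100*e)^2 + 30321850963464*(3*e-5*B)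
       + 12822408885680*B*(13-100*e) + 49155794712*(2*B-e)*(13-100*e)^2 + 583404900000*(2*B-e)*(3*e-5*B)^2
       + 510027318943*(3*e-5*B)*(13-100*e) + 65457891696*B*(13-100*e)^2 + 421984704*(3*e-5*B)*(13-100*e)^3
       + 35901840000*(3*e-5*B)^3*(13-100*e) + 293428500*(2*B-e)*(3*e-5*B)*(13-100*e)^3
       + 1360817820*(2*B-e)*(13-100*e)^3 + 5695965*(2*B-e)*(13-100*e)^4
       + 1771228666500*(2*B-e)*(3*e-5*B)*(13-100*e) + 4315125*B*(13-100*e)^4
       + 3452100000*(2*B-e)*(3*e-5*B)^2*(13-100*e)^2) +
      ((2*B-e)*(1+e*B) - 2*(e*B)) * (-329334309000000)" (is "_ = ?S + _")
    by algebra
  moreover have "0 \<le> ?S"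
    using nn by (intro add_nonneg_nonneg mult_nonneg_nonneg zero_le_power) auto
  ultimately show ?thesis by (simp add: rel)
qed

lemma region3_g1f4:
  fixes e B :: real
  assumes "region3 e B"
  shows "0 \<le> (1-e+2*(e*B)-2*(e*(e*B)))*(1-3*B+2*(e*B)-4*(B*(e*B))) - (1-3*e+4*(e*B))*(1+B)"
proof -
  have nn: "0 \<le> B" "0 \<le> 2*B-e" "0 \<le> 3*e-5*B" "0 \<le> 13-100*e" and rel: "((2*B-e)*(1+e*B) - 2*(e*B)) = 0"
    using assms by (simp_all add: region3_def)
  have "937500000000000 * ((1-e+2*(e*B)-2*(e*(e*B)))*(1-3*B+2*(e*B)-4*(B*(e*B))) - (1-3*e+4*(e*B))*(1+B)) = (5478000000*B^2*(13-100*e)^3 + 385327800*(2*B-e)*(13-100*e)^3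
       + 313950000000*(2*B-e)*(3*e-5*B)^2*(13-100*e) + 7479869893000*(3*e-5*B)^2*(13-100*e)
       + 282201367292853*(2*B-e) + 3660000000*(3*e-5*B)^3*(13-100*e)^2 + 168122491007000*B^2*(13-100*e)
       + 29451442931100*(2*B-e)*(3*e-5*B)*(13-100*e) + 1296000000*B*(2*B-e)*(13-100*e)^3
       + 1057787100000*B^2*(13-100*e)^2 + 36000000*B^2*(13-100*e)^4
       + 26544960000*(2*B-e)*(3*e-5*B)*(13-100*e)^2 + 86400000*(3*e-5*B)^2*(13-100*e)^3
       + 27000000*B*(2*B-e)*(13-100*e)^4 + 94809859977300*(2*B-e)*(3*e-5*B)
       + 60000000*(3*e-5*B)^3*(13-100*e)^3 + 1800000*(3*e-5*B)^2*(13-100*e)^4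
       + 211400837163*(2*B-e)*(13-100*e)^2 + 882180000000*(3*e-5*B)^3) +
      ((2*B-e)*(1+e*B) - 2*(e*B)) * (-2193774673950000)" (is "_ = ?S + _")
    by algebra
  moreover have "0 \<le> ?S"
    using nn by (intro add_nonneg_nonneg mult_nonneg_nonneg zero_le_power) auto
  ultimately show ?thesis by (simp add: rel)
qed

section \<open>Classification of digit sequences\<close>

definition good :: "real \<Rightarrow> real \<Rightarrow> real \<Rightarrow> real \<Rightarrow> real \<Rightarrow> bool" where
  "good A B c x y \<longleftrightarrow> \<bar>x\<bar> < 1 - A \<and> \<bar>y\<bar> < 1 - B \<and>
    c < (1 - A + x) * (1 - B + y) \<and> c < (1 - A - x) * (1 - B - y) \<and>
    c < (1 + A - x) * (1 + B + y) \<and> c < (1 + A + x) * (1 + B - y)"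

lemma good_minus: "good A B c x y \<Longrightarrow> good A B c (- x) (- y)"
  unfolding good_def by simp

lemma good_swap: "good A B c x y \<Longrightarrow> good B A c y x"
  unfolding good_def by (simp add: mult.commute)

lemma good_mono: "good A B c x y \<Longrightarrow> c' \<le> c \<Longrightarrow> good A B c' x y"
  unfolding good_def by linarith

lemma prod_less:
  fixes a b :: real
  assumes "0 \<le> c" "c < a * b" "0 < a" "a \<le> a'" "b \<le> b'"
  shows "c < a' * b'"
proof -
  have "0 < b"
  proof (rule ccontr)
    assume "\<not> 0 < b"
    then have "a * b \<le> 0" using assms(3) by (intro mult_nonneg_nonpos) auto
    then show False using assms by simp
  qed
  then have "a * b \<le> a' * b'" using assms by (intro mult_mono) auto
  then show ?thesis using assms by simp
qed

lemma good_f1: "good A B c x y \<Longrightarrow> 0 \<le> c \<Longrightarrow> x \<le> x' \<Longrightarrow> y \<le> y' \<Longrightarrow> c < (1 - A + x') * (1 - B + y')"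
  unfolding good_def by (rule prod_less[of c "1 - A + x" "1 - B + y"]) auto

lemma good_f4: "good A B c x y \<Longrightarrow> 0 \<le> c \<Longrightarrow> - x \<le> x' \<Longrightarrow> y' \<le> y \<Longrightarrow> c < (1 - A + x') * (1 - B - y')"
  unfolding good_def by (rule prod_less[of c "1 - A - x" "1 - B - y"]) auto

lemma good_f3: "good A B c x y \<Longrightarrow> 0 \<le> c \<Longrightarrow> 0 \<le> A \<Longrightarrow> x \<le> x' \<Longrightarrow> y' \<le> y \<Longrightarrow> c < (1 + A + x') * (1 + B - y')"
  unfolding good_def by (rule prod_less[of c "1 + A + x" "1 + B - y"]) auto

text \<open>By the arithmetic-geometric mean inequality the four factors multiply to at most
  \<open>e * e\<close>, so \<open>p * r\<close> and \<open>q * s\<close> cannot both reach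
  \<open>e\<close>.\<close>

lemma amgm_less:
  fixes p q r s e :: real
  assumes pos: "0 \<le> p" "0 \<le> q" "0 \<le> r" "0 \<le> s" and sum: "p + q = 2 * e" "r + s = 2"
    and c: "0 \<le> c" "c < p * r" "c < q * s"
  shows "c < e"
proof -
  have "c * c < (p * r) * (q * s)"
    by (rule mult_strict_mono) (use c in linarith)+
  also have "\<dots> = (p * q) * (r * s)" by simp
  also have "\<dots> \<le> (e * e) * (1 * 1)"
  proof -
    have q: "q = 2 * e - p" and s: "s = 2 - r" using sum by linarith+
    have "0 \<le> (e - p) * (e - p)" "0 \<le> (1 - r) * (1 - r)" by simp_all
    then have "p * q \<le> e * e" "r * s \<le> 1 * 1" unfolding q s by (simp_all add: algebra_simps)
    then show ?thesis by (rule mult_mono) (use pos in simp_all)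
  qed
  finally have less: "c * c < e * e" by simp
  show ?thesis
  proof (rule ccontr)
    assume "\<not> c < e"
    then have "e * e \<le> c * c" by (intro mult_mono) (use sum pos c in linarith)+
    then show False using less by simp
  qed
qed

text \<open>Outside the square the value of the cell is at most \<open>c\<close>: the two products that share the
  escaping coordinate have factor sums \<open>2A\<close> and \<open>2\<close>, so one of them is at most \<open>A\<close>.\<close>

lemma Sgt_interior:
  assumes S: "Sgt A B c x y" and AB: "0 < A" "0 < B" "A < 1" "B < 1" and c: "A \<le> c" "B \<le> c" "4 * (A * B) \<le> c"
    and x: "- 1 + A \<le> x" "x \<le> 1 + A" and y: "- 1 + B \<le> y" "y \<le> 1 + B"
  shows "good A B c x y"
proof -
  have s: "c < \<bar>1 - A + x\<bar> * \<bar>1 - B + y\<bar>" "c < \<bar>1 - A - x\<bar> * \<bar>1 - B - y\<bar>"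
    "c < \<bar>1 + A - x\<bar> * \<bar>1 + B + y\<bar>" "c < \<bar>1 + A + x\<bar> * \<bar>1 + B - y\<bar>"
    using S unfolding Sgt_def abs_mult by blast+
  \<comment> \<open>If both coordinates escape at once, the factors are at most \<open>2 * A\<close>
    and \<open>2 * B\<close>; this is where \<open>4 * (A * B) \<le> c\<close> enters.\<close>
  have nb: "\<not> (1 - A \<le> x \<and> 1 - B \<le> y)"
  proof
    assume *: "1 - A \<le> x \<and> 1 - B \<le> y"
    have "\<bar>1 - A - x\<bar> * \<bar>1 - B - y\<bar> \<le> (2 * A) * (2 * B)"
      using * x y AB by (intro mult_mono) auto
    also have "\<dots> \<le> c" using c by simp
    finally show False using s(2) by simp
  qed
  have xlt: "x < 1 - A"
  proof (rule ccontr)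
    assume n: "\<not> x < 1 - A"
    then have yl: "y < 1 - B" using nb by linarith
    have "c < A"
      by (rule amgm_less[of "\<bar>1 - A - x\<bar>" "\<bar>1 + A - x\<bar>" "\<bar>1 - B - y\<bar>" "\<bar>1 + B + y\<bar>"])
        (use n yl s x y AB c in auto)
    then show False using c by simp
  qed
  have ylt: "y < 1 - B"
  proof (rule ccontr)
    assume n: "\<not> y < 1 - B"
    have "c < B"
      by (rule amgm_less[of "\<bar>1 - B - y\<bar>" "\<bar>1 + B - y\<bar>" "\<bar>1 - A - x\<bar>" "\<bar>1 + A + x\<bar>"])
        (use n xlt s x y AB c in \<open>auto simp: mult.commute\<close>)
    then show False using c by simp
  qed
  have "x \<noteq> - 1 + A" "y \<noteq> - 1 + B" using s(1) AB c by auto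
  then have xy: "\<bar>x\<bar> < 1 - A" "\<bar>y\<bar> < 1 - B" using xlt ylt x y by linarith+
  then have "0 < 1 - A + x" "0 < 1 - B + y" "0 < 1 - A - x" "0 < 1 - B - y"
    "0 < 1 + A - x" "0 < 1 + B + y" "0 < 1 + A + x" "0 < 1 + B - y" using AB by linarith+
  then show ?thesis unfolding good_def using s xy by (simp only: abs_of_pos simp_thms)
qed

text \<open>With \<open>m = 1 - x\<close>, two of the products are \<open>(m - A) * s\<close> and
  \<open>(m + A) * (2 - s)\<close>. If \<open>m \<le> c\<close>, both exceed \<open>m\<close>;
  adding them gives \<open>s < 1\<close>, and then the first is below \<open>m\<close> after
  all.\<close>

lemma good_upper:
  assumes g: "good A B c x y" and c: "0 < c" "0 < A"
  shows "x < 1 - c"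
proof (rule ccontr)
  assume "\<not> x < 1 - c"
  then have mc: "1 - x \<le> c" by simp
  define m s where "m = 1 - x" and "s = 1 - B - y"
  have m: "A < m" "0 < s" "m \<le> c" using g mc unfolding good_def m_def s_def by auto
  have "c < (m - A) * s" "c < (m + A) * (2 - s)"
    using g unfolding good_def m_def s_def by (auto simp: algebra_simps)
  then have 1: "m < m * s - A * s" and 2: "m < 2 * m + 2 * A - m * s - A * s"
    using m by (auto simp: algebra_simps)
  then have "A * s < A * 1" by simp
  then have "s < 1" using c by simp
  then have "m * s < m * 1" using m c by (intro mult_strict_left_mono) auto
  moreover have "0 < A * s" using m c by simp
  ultimately show False using 1 by simp
qed

lemma good_bounds:
  assumes g: "good A B c x y" and c: "0 < c" "0 < A" "0 < B"
  shows "\<bar>x\<bar> < 1 - c" "\<bar>y\<bar> < 1 - c"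
  using good_upper[OF g c(1,2)] good_upper[OF good_minus[OF g] c(1,2)]
    good_upper[OF good_swap[OF g] c(1,3)] good_upper[OF good_swap[OF good_minus[OF g]] c(1,3)] by simp_all

text \<open>\<open>c0\<close> is the first product with left value \<open>- 2 * B\<close> and right
  value 0, a crude form of \<open>VV gg\<close>. By \<open>good_bounds\<close> every value in a
  sequence above \<open>c0\<close> is at most \<open>kp = 1 - c0\<close> in size.\<close>

definition kp :: "real \<Rightarrow> real \<Rightarrow> real" where "kp e B = e + 3*B - 3*(e*B)"
definition c0 :: "real \<Rightarrow> real \<Rightarrow> real" where "c0 e B = (1-e)*(1-3*B)"

lemma kp_c0: "kp e B = 1 - c0 e B" by (simp add: kp_def c0_def algebra_simps)

text \<open>The chain split by parity, so that \<open>e\<close> and \<open>B\<close> keep fixed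
  roles. \<open>X\<close> and \<open>V\<close> are the right values at even and odd positions,
  \<open>Y\<close> and \<open>H\<close> the left values there. The cells at odd positions are
  transposed to have \<open>e\<close> first.\<close>

definition blocks :: "real \<Rightarrow> real \<Rightarrow> real \<Rightarrow> (nat \<Rightarrow> int) \<Rightarrow> (nat \<Rightarrow> int) \<Rightarrow>
    (nat \<Rightarrow> real) \<Rightarrow> (nat \<Rightarrow> real) \<Rightarrow> (nat \<Rightarrow> real) \<Rightarrow> (nat \<Rightarrow> real) \<Rightarrow> bool" where
  "blocks e B c s r X V Y H \<longleftrightarrow> (\<forall>i. even (s i) \<and> even (r i) \<and>
    X i = e * (s i + V i) \<and> V i = B * (r i + X (Suc i)) \<and>
    H i = e * (s i + Y i) \<and> Y (Suc i) = B * (r i + H i) \<and>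
    good e B c (X i) (Y i) \<and> good e B c (H i) (V i))"

lemma blocksD:
  assumes "blocks e B c s r X V Y H"
  shows "even (s i)" "even (r i)" "X i = e * (s i + V i)" "V i = B * (r i + X (Suc i))"
    "H i = e * (s i + Y i)" "Y (Suc i) = B * (r i + H i)"
    "good e B c (X i) (Y i)" "good e B c (H i) (V i)"
  using assms unfolding blocks_def by blast+

lemma blocks_minus:
  assumes b: "blocks e B c s r X V Y H"
  shows "blocks e B c (\<lambda>i. - s i) (\<lambda>i. - r i) (\<lambda>i. - X i) (\<lambda>i. - V i) (\<lambda>i. - Y i) (\<lambda>i. - H i)"
  unfolding blocks_def
proof (intro allI conjI)
  fix i
  note d = blocksD[OF b, of i]
  show "even (- s i)" "even (- r i)" using d by simp_all
  show "- X i = e * (of_int (- s i) + - V i)" using d(3) by (simp add: algebra_simps)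
  show "- V i = B * (of_int (- r i) + - X (Suc i))" using d(4) by (simp add: algebra_simps)
  show "- H i = e * (of_int (- s i) + - Y i)" using d(5) by (simp add: algebra_simps)
  show "- Y (Suc i) = B * (of_int (- r i) + - H i)" using d(6) by (simp add: algebra_simps)
  show "good e B c (- X i) (- Y i)" using d(7) by (rule good_minus)
  show "good e B c (- H i) (- V i)" using d(8) by (rule good_minus)
qed

lemma even_less_4: "even (z::int) \<Longrightarrow> \<bar>z\<bar> < 4 \<Longrightarrow> z = 0 \<or> z = 2 \<or> z = - 2"
  by presburger

text \<open>In the following rules \<open>s\<close> and \<open>r\<close> are adjacent digits, \<open>p\<close> is the value beyond \<open>s\<close> and \<open>q\<close> the
  value beyond \<open>r\<close>; reading the sequence in either direction gives the same form.\<close>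

lemma rule_s_less_4:
  fixes e B p :: real and s :: int
  assumes "0 < e" "0 < B" "3 * B \<le> 2 * e" "e \<le> 1/3" and p: "\<bar>p\<bar> < kp e B" and x: "\<bar>e * (s + p)\<bar> < kp e B"
  shows "\<bar>s\<bar> < 4"
proof -
  have k: "kp e B * (1 + e) \<le> 4 * e"
  proof -
    have "kp e B = e + 3*B*(1-e)" by (simp add: kp_def algebra_simps)
    also have "\<dots> \<le> e + 2*e*(1-e)" using assms by (intro add_left_mono mult_right_mono) auto
    finally have "kp e B * (1 + e) \<le> (e + 2*e*(1-e)) * (1 + e)" using assms by (intro mult_right_mono) auto
    also have "\<dots> = e * (3 + e - 2*e*e)" by (simp add: algebra_simps)
    also have "\<dots> \<le> e * 4"
    proof (rule mult_left_mono)
      have "0 \<le> e * e" by simp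
      then show "3 + e - 2*e*e \<le> 4" using assms(4) by linarith
    qed (use assms in simp)
    finally show ?thesis by simp
  qed
  have "e * \<bar>real_of_int s + p\<bar> < kp e B" using x assms by (simp add: abs_mult)
  moreover have "e * (\<bar>real_of_int s\<bar> - \<bar>p\<bar>) \<le> e * \<bar>real_of_int s + p\<bar>" using assms by (intro mult_left_mono) auto
  moreover have "e * \<bar>p\<bar> \<le> e * kp e B" using p assms by (intro mult_left_mono) auto
  ultimately have "e * \<bar>real_of_int s\<bar> < kp e B * (1 + e)" by (simp add: algebra_simps)
  then have "e * \<bar>real_of_int s\<bar> < e * 4" using k by simp
  then have "\<bar>real_of_int s\<bar> < 4" using assms by simp
  then show ?thesis by linarith
qed

lemma rule_r_less_6:
  fixes e B p q :: real and r :: int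
  assumes g: "good e B c (e * (- 2 + p)) (B * (r + q))" and pq: "\<bar>p\<bar> < kp e B" "\<bar>q\<bar> < kp e B" and eB: "0 < e" "0 < B"
    and c: "0 \<le> c" and A: "(1-e+e*kp e B)*(1-5*B+B*kp e B) \<le> c"
  shows "r < 6"
proof (rule ccontr)
  assume "\<not> r < 6"
  then have r: "6 \<le> real_of_int r" by linarith
  have "e * (- 2 + p) \<le> e * (- 2 + kp e B)" "B * (6 - kp e B) \<le> B * (r + q)"
    using eB pq r by (auto intro!: mult_left_mono)
  from good_f3[OF g c less_imp_le[OF eB(1)] this] A show False by (simp add: algebra_simps)
qed

lemma rule_r_pos:
  fixes e B p q :: real and r :: int
  assumes g: "good e B c (e * (- 2 + p)) (B * (r + q))" and pq: "p \<le> B * (4 + kp e B)" "\<bar>q\<bar> < kp e B" and eB: "0 < e" "0 < B"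
    and c: "0 \<le> c" and A: "(1-3*e+e*(B*(4+kp e B)))*(1-B+B*kp e B) \<le> c"
  shows "0 < r"
proof (rule ccontr)
  assume "\<not> 0 < r"
  then have r: "real_of_int r \<le> 0" by linarith
  have "e * (- 2 + p) \<le> e * (- 2 + B * (4 + kp e B))" "B * (r + q) \<le> B * kp e B"
    using eB pq r by (auto intro!: mult_left_mono)
  from good_f1[OF g c this] A show False by (simp add: algebra_simps)
qed

text \<open>For \<open>r \<ge> 4\<close> next to a zero digit one factor is so small that the value
  across the zero has to be very negative, which needs an odd digit below \<open>- r\<close> there.
  At \<open>r = 4\<close> the contrary is refuted by \<open>A\<close>; a larger \<open>r\<close>,
  written \<open>4 + m\<close>, only lowers the product because
  \<open>e * Q \<le> P\<close>.\<close>

lemma rule_growth: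
  fixes e B p q q' :: real and r r' :: int
  assumes g: "good e B c (e * p) (B * (r + q))" and p: "p = B * (r' + q')" and q: "\<bar>q\<bar> < kp e B" "\<bar>q'\<bar> < kp e B"
    and eB: "0 < e" "0 < B" "e \<le> 1/3" "5 * B \<le> 1" and kp: "kp e B \<le> 1"
    and c: "0 \<le> c" and A: "(1-e+e*(B*(4+kp e B)))*(1-5*B+B*kp e B) \<le> c" and r: "4 \<le> r"
  shows "r < \<bar>r'\<bar>"
proof (rule ccontr)
  assume "\<not> r < \<bar>r'\<bar>"
  then have "- real_of_int r \<le> real_of_int r'" by linarith
  then have "- (r + kp e B) \<le> r' + q'" using q by linarith
  then have "B * (- (r + kp e B)) \<le> p" unfolding p using eB by (intro mult_left_mono) auto
  then have "e * (B * (- (r + kp e B))) \<le> e * p" using eB by (intro mult_left_mono) auto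
  then have 1: "- (e * p) \<le> e * (B * (r + kp e B))" by (simp add: algebra_simps)
  have 2: "B * (r - kp e B) \<le> B * (r + q)" using eB q by (intro mult_left_mono) auto
  define m where "m = real_of_int r - 4"
  define P Q where "P = 1-e+e*(B*(4+kp e B))" and "Q = 1-5*B+B*kp e B"
  have m: "0 \<le> m" using r by (simp add: m_def)
  have k0: "0 \<le> kp e B" using q by linarith
  have "e * (B * (4 + kp e B)) \<ge> 0" using eB k0 by simp
  then have P: "1 - e \<le> P" by (simp add: P_def)
  have "B * kp e B \<le> B * 1" using eB kp by (intro mult_left_mono) auto
  then have Q: "Q \<le> 1" using eB by (simp add: Q_def)
  have "e * Q \<le> e * 1" using Q eB by (intro mult_left_mono) auto
  then have eQ: "e * Q \<le> P" using P eB by linarith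
  have "c < (1 - e + e * (B * (r + kp e B))) * (1 - B - B * (r - kp e B))" by (rule good_f4[OF g c 1 2])
  also have "\<dots> = (P + e*B*m) * (Q - B*m)" unfolding P_def Q_def m_def by (simp add: algebra_simps)
  also have "\<dots> = P * Q + m * B * (e*Q - P) - e*B*B*m*m" by (simp add: algebra_simps)
  also have "\<dots> \<le> P * Q"
  proof -
    have "m * B * (e * Q - P) \<le> 0" using eQ m eB by (intro mult_nonneg_nonpos) auto
    moreover have "0 \<le> e*B*B*m*m" using m eB by (intro mult_nonneg_nonneg) auto
    ultimately show ?thesis by linarith
  qed
  also have "\<dots> \<le> c" using A by (simp add: P_def Q_def)
  finally show False by simp
qed

lemma bounded_growth:
  fixes r :: "nat \<Rightarrow> int"
  assumes "\<And>n. N \<le> n \<Longrightarrow> \<bar>r n\<bar> < \<bar>r (Suc n)\<bar>" and "\<And>n. N \<le> n \<Longrightarrow> \<bar>r n\<bar> \<le> T"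
  shows False
proof -
  have "int n \<le> \<bar>r (N + n)\<bar>" for n
  proof (induction n)
    case (Suc n)
    then show ?case using assms(1)[of "N + n"] by simp
  qed simp
  moreover have "\<bar>r (N + nat (\<bar>T\<bar> + 1))\<bar> \<le> T" by (rule assms(2)) simp
  ultimately have "int (nat (\<bar>T\<bar> + 1)) \<le> T" by (rule order_trans)
  then show False by linarith
qed

locale block_seq =
  fixes e B c :: real and s r :: "nat \<Rightarrow> int" and X V Y H :: "nat \<Rightarrow> real"
  assumes bl: "blocks e B c s r X V Y H" and e: "0 < e" and B: "0 < B" and c: "c0 e B \<le> c" and c_pos: "0 < c0 e B"
begin

lemmas bd = blocksD[OF bl]

lemma g0: "good e B (c0 e B) (X i) (Y i)" "good e B (c0 e B) (H i) (V i)"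
  using bd(7,8) good_mono c by blast+

lemma bounds: "\<bar>X i\<bar> < kp e B" "\<bar>Y i\<bar> < kp e B" "\<bar>H i\<bar> < kp e B" "\<bar>V i\<bar> < kp e B"
  using good_bounds[OF g0(1) c_pos e B] good_bounds[OF g0(2) c_pos e B] unfolding kp_c0 by simp_all

text \<open>\<open>gap_right\<close> and \<open>gap_left\<close> display an even digit together with
  the odd digit on its right or left, the common form in which the rules are stated.\<close>

lemma gap_right: "good e B c (e * (s i + Y i)) (B * (r i + X (Suc i)))"
  using bd(8)[of i] bd(4)[of i] bd(5)[of i] by simp

lemma gap_left: "good e B c (e * (s (Suc i) + V (Suc i))) (B * (r i + H i))"
  using bd(7)[of "Suc i"] bd(3)[of "Suc i"] bd(6)[of i] by simp

lemma neg: "block_seq e B c (\<lambda>i. - s i) (\<lambda>i. - r i) (\<lambda>i. - X i) (\<lambda>i. - V i) (\<lambda>i. - Y i) (\<lambda>i. - H i)"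
  by unfold_locales (use blocks_minus[OF bl] e B c c_pos in auto)

lemma V_le: "real_of_int (r i) \<le> z \<Longrightarrow> V i \<le> B * (z + kp e B)"
  using bounds(1)[of "Suc i"] B by (subst bd(4)) (auto intro!: mult_left_mono)

lemma Y_le: "real_of_int (r i) \<le> z \<Longrightarrow> Y (Suc i) \<le> B * (z + kp e B)"
  using bounds(3)[of i] B by (subst bd(6)) (auto intro!: mult_left_mono)

lemma V_ge: "z \<le> real_of_int (r i) \<Longrightarrow> B * (z - kp e B) \<le> V i"
  using bounds(1)[of "Suc i"] B by (subst bd(4)) (auto intro!: mult_left_mono)

lemma Y_ge: "z \<le> real_of_int (r i) \<Longrightarrow> B * (z - kp e B) \<le> Y (Suc i)"
  using bounds(3)[of i] B by (subst bd(6)) (auto intro!: mult_left_mono)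

lemma s_cases: "3 * B \<le> 2 * e \<Longrightarrow> e \<le> 1/3 \<Longrightarrow> s i = 0 \<or> s i = 2 \<or> s i = - 2"
  using rule_s_less_4[OF e B, of "V i" "s i"] bounds(1,4)[of i] bd(1)[of i] bd(3)[of i] even_less_4 by simp

lemma r_le_4:
  assumes A: "(1-e+e*kp e B)*(1-5*B+B*kp e B) \<le> c0 e B"
  shows "s i = - 2 \<Longrightarrow> r i \<le> 4" "s (Suc i) = - 2 \<Longrightarrow> r i \<le> 4"
proof -
  assume "s i = - 2"
  then have "good e B (c0 e B) (e * (- 2 + Y i)) (B * (r i + X (Suc i)))"
    using good_mono[OF gap_right c, of i] by simp
  from rule_r_less_6[OF this bounds(2) bounds(1) e B less_imp_le[OF c_pos] A] bd(2)[of i] show "r i \<le> 4" by presburger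
next
  assume "s (Suc i) = - 2"
  then have "good e B (c0 e B) (e * (- 2 + V (Suc i))) (B * (r i + H i))"
    using good_mono[OF gap_left c, of i] by simp
  from rule_r_less_6[OF this bounds(4) bounds(3) e B less_imp_le[OF c_pos] A] bd(2)[of i] show "r i \<le> 4" by presburger
qed

lemma r_pos:
  assumes A: "(1-e+e*kp e B)*(1-5*B+B*kp e B) \<le> c0 e B"
    and A': "(1-3*e+e*(B*(4+kp e B)))*(1-B+B*kp e B) \<le> c0 e B" and i: "s (Suc i) = - 2"
  shows "0 < r i" "0 < r (Suc i)"
proof -
  have "real_of_int (r i) \<le> 4" "real_of_int (r (Suc i)) \<le> 4" using r_le_4[OF A] i by simp_all
  then have V: "V (Suc i) \<le> B * (4 + kp e B)" and Y: "Y (Suc i) \<le> B * (4 + kp e B)" using V_le Y_le by blast+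
  have "good e B (c0 e B) (e * (- 2 + V (Suc i))) (B * (r i + H i))"
    using good_mono[OF gap_left c, of i] i by simp
  from rule_r_pos[OF this V bounds(3) e B less_imp_le[OF c_pos] A'] show "0 < r i" .
  have "good e B (c0 e B) (e * (- 2 + Y (Suc i))) (B * (r (Suc i) + X (Suc (Suc i))))"
    using good_mono[OF gap_right c, of "Suc i"] i by simp
  from rule_r_pos[OF this Y bounds(1) e B less_imp_le[OF c_pos] A'] show "0 < r (Suc i)" .
qed

end

section \<open>Classification for \<open>b \<ge> 2 * a\<close>\<close>

definition region1 :: "real \<Rightarrow> real \<Rightarrow> bool" where
  "region1 e B \<longleftrightarrow> 0 < B \<and> 2*B \<le> e \<and> 50*e \<le> 13"

lemma region1_basic:
  assumes "region1 e B"
  shows "0 < e" "0 < B" "3 * B \<le> 2 * e" "e \<le> 1/3" "5 * B \<le> 1" "0 < c0 e B" "kp e B \<le> 1"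
proof -
  show "0 < e" "0 < B" "3 * B \<le> 2 * e" "e \<le> 1/3" "5 * B \<le> 1" using assms by (auto simp: region1_def)
  show "0 < c0 e B" unfolding c0_def using assms by (intro mult_pos_pos) (auto simp: region1_def)
  then show "kp e B \<le> 1" by (simp add: kp_c0)
qed

lemma region1_rules:
  assumes "region1 e B"
  shows "e \<le> 3*B*(1+e) \<Longrightarrow> (1-e+e*kp e B)*(1-5*B+B*kp e B) \<le> c0 e B"
    "(1-3*e+e*(B*(4+kp e B)))*(1-B+B*kp e B) \<le> c0 e B"
    "(1-3*e+e*(B*(4+kp e B)))*(1+B+B*(e*kp e B)) \<le> c0 e B"
    "(1-e+e*(B*(4+kp e B)))*(1-5*B+B*kp e B) \<le> c0 e B"
  using region1_A2[of B e] region1_A3[of B e] region1_A4[of B e] region1_A5[of B e] assms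
  unfolding region1_def kp_def c0_def by simp_all

context block_seq
begin

text \<open>A digit -2 forces \<open>X\<close> to be about \<open>- 2 * e\<close>, which the bound
  \<open>kp\<close> admits only if \<open>3 * B\<close> is nearly as large as \<open>e\<close>. This
  supplies the extra hypothesis of the first inequality in \<open>region1_rules\<close>.\<close>

lemma steep:
  assumes "e \<le> 1/3" "s i = - 2"
  shows "e \<le> 3*B*(1+e)"
proof -
  have "V i < kp e B" "- kp e B < e * (- 2 + V i)" using bounds(4)[of i] bounds(1)[of i] bd(3)[of i] assms by auto
  moreover have "e * V i \<le> e * kp e B" using \<open>V i < kp e B\<close> e by (intro mult_left_mono) auto
  ultimately have "2 * e < kp e B * (1 + e)" by (simp add: algebra_simps)
  then have "e * (1 - e) < (3*B*(1+e)) * (1 - e)" by (simp add: kp_def algebra_simps)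
  then have "e < 3*B*(1+e)" using assms by (subst (asm) mult_less_cancel_right_pos) auto
  then show ?thesis by simp
qed

text \<open>The rules leave 2 and 4 for the odd digit after -2. After 2 the next even digit is not
  2, as that needs negative neighbours, so \<open>X\<close> beyond is at most \<open>e * kp\<close>
  and the third inequality of \<open>region1_rules\<close> excludes the cell.\<close>

lemma region1_minus2:
  assumes R: "region1 e B" and i: "s (Suc i) = - 2"
  shows "r (Suc i) = 4" and "r i \<le> 4"
proof -
  note b = region1_basic[OF R] and A = region1_rules[OF R]
  have A1: "(1-e+e*kp e B)*(1-5*B+B*kp e B) \<le> c0 e B" using A(1) steep[OF b(4) i] .
  show r4: "r i \<le> 4" using r_le_4(2)[OF A1 i] .
  have rp: "0 < r (Suc i)" "r (Suc i) \<le> 4" using r_pos[OF A1 A(2) i] r_le_4(1)[OF A1 i] by auto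
  have "r (Suc i) \<noteq> 2"
  proof
    assume r2: "r (Suc i) = 2"
    have "s (Suc (Suc i)) \<noteq> 2"
    proof
      interpret n: block_seq e B c "\<lambda>i. - s i" "\<lambda>i. - r i" "\<lambda>i. - X i" "\<lambda>i. - V i" "\<lambda>i. - Y i" "\<lambda>i. - H i" by (rule neg)
      assume "s (Suc (Suc i)) = 2"
      then have "0 < - r (Suc i)" using n.r_pos(1)[OF A1 A(2), of "Suc i"] by simp
      then show False using r2 by simp
    qed
    then have "s (Suc (Suc i)) \<le> 0" using s_cases[OF b(3,4), of "Suc (Suc i)"] by auto
    then have "real_of_int (s (Suc (Suc i))) + V (Suc (Suc i)) \<le> kp e B" using bounds(4)[of "Suc (Suc i)"] by auto
    then have "X (Suc (Suc i)) \<le> e * kp e B" using e by (subst bd(3)) (intro mult_left_mono, auto)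
    then have 2: "B * (r (Suc i) + X (Suc (Suc i))) \<le> B * (2 + e * kp e B)" using r2 B by (intro mult_left_mono) auto
    have "Y (Suc i) \<le> B * (4 + kp e B)" by (rule Y_le) (use r4 in simp)
    then have 1: "e * (s (Suc i) + Y (Suc i)) \<le> e * (- 2 + B * (4 + kp e B))" using i e by (intro mult_left_mono) auto
    from good_f1[OF good_mono[OF gap_right c] less_imp_le[OF c_pos] 1 2] A(3) show False by (simp add: algebra_simps)
  qed
  then show "r (Suc i) = 4" using rp bd(2)[of "Suc i"] by presburger
qed

text \<open>If 0 followed, \<open>rule_growth\<close> would give a larger odd digit, again followed
  by 0 because nonzero even digits tolerate only odd digits up to 4 in size. The odd digits would
  grow forever, against the boundedness of \<open>V\<close>. A digit 2 is impossible since it needs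
  negative neighbours.\<close>

lemma region1_neighbour:
  assumes R: "region1 e B" and r4: "4 \<le> r (Suc i)"
  shows "s (Suc (Suc i)) = - 2"
proof -
  note b = region1_basic[OF R] and A = region1_rules[OF R]
  interpret n: block_seq e B c "\<lambda>i. - s i" "\<lambda>i. - r i" "\<lambda>i. - X i" "\<lambda>i. - V i" "\<lambda>i. - Y i" "\<lambda>i. - H i" by (rule neg)
  have abs4: "\<bar>r j\<bar> \<le> 4" if nz: "s (Suc j) \<noteq> 0" for j
  proof -
    consider "s (Suc j) = - 2" | "- s (Suc j) = - 2" using s_cases[OF b(3,4), of "Suc j"] nz by fastforce
    then show ?thesis
    proof cases
      case 1
      have "(1-e+e*kp e B)*(1-5*B+B*kp e B) \<le> c0 e B" using A(1) steep[OF b(4) 1] .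
      then show ?thesis using r_pos(1)[OF _ A(2) 1] region1_minus2(2)[OF R 1] by simp
    next
      case 2
      have "(1-e+e*kp e B)*(1-5*B+B*kp e B) \<le> c0 e B" using A(1) n.steep[OF b(4) 2] .
      then show ?thesis using n.r_pos(1)[OF _ A(2) 2] n.region1_minus2(2)[OF R 2] by simp
    qed
  qed
  have grow: "\<bar>r j\<bar> < \<bar>r (Suc j)\<bar>" if "s (Suc j) = 0" "4 \<le> \<bar>r j\<bar>" for j
  proof (cases "0 \<le> r j")
    case True
    have g: "good e B (c0 e B) (e * V (Suc j)) (B * (r j + H j))" using good_mono[OF gap_left c, of j] that by simp
    show ?thesis using rule_growth[OF g bd(4)[of "Suc j"] bounds(3)[of j] bounds(1)[of "Suc (Suc j)"] e B b(4,5,7) less_imp_le[OF c_pos] A(4)] that True by auto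
  next
    case False
    have g: "good e B (c0 e B) (e * - V (Suc j)) (B * (of_int (- r j) + - H j))" using good_mono[OF n.gap_left c, of j] that by simp
    show ?thesis using rule_growth[OF g n.bd(4)[of "Suc j"] n.bounds(3)[of j] n.bounds(1)[of "Suc (Suc j)"] e B b(4,5,7) less_imp_le[OF c_pos] A(4)] that False by auto
  qed
  have "s (Suc (Suc i)) \<noteq> 0"
  proof
    assume z: "s (Suc (Suc i)) = 0"
    have st: "s (Suc (Suc (i + n))) = 0 \<and> 4 \<le> \<bar>r (Suc (i + n))\<bar>" for n
    proof (induction n)
      case (Suc n)
      then have "\<bar>r (Suc (i + n))\<bar> < \<bar>r (Suc (Suc (i + n)))\<bar>" using grow by blast
      then have "4 < \<bar>r (Suc (Suc (i + n)))\<bar>" using Suc by simp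
      then show ?case using abs4[of "Suc (Suc (i + n))"] by fastforce
    qed (use z r4 in simp)
    show False
    proof (rule bounded_growth[of "Suc i" r "\<lceil>kp e B * (1 + B) / B\<rceil>"])
      fix n assume "Suc i \<le> n"
      then obtain m where m: "n = Suc (i + m)" by (metis add_Suc nat_le_iff_add)
      show "\<bar>r n\<bar> < \<bar>r (Suc n)\<bar>" using st[of m] grow unfolding m by blast
      have "B * \<bar>real_of_int (r n)\<bar> \<le> \<bar>V n\<bar> + B * \<bar>X (Suc n)\<bar>"
        using B by (subst bd(4)) (simp add: abs_mult flip: distrib_left)
      also have "\<dots> \<le> kp e B + B * kp e B" using bounds(4)[of n] bounds(1)[of "Suc n"] B by (intro add_mono mult_left_mono) auto
      finally have "\<bar>real_of_int (r n)\<bar> \<le> kp e B * (1 + B) / B" using B by (simp add: field_simps)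
      then show "\<bar>r n\<bar> \<le> \<lceil>kp e B * (1 + B) / B\<rceil>" by linarith
    qed
  qed
  moreover have "s (Suc (Suc i)) \<noteq> 2"
  proof
    assume "s (Suc (Suc i)) = 2"
    then have s2: "- s (Suc (Suc i)) = - 2" by simp
    have "(1-e+e*kp e B)*(1-5*B+B*kp e B) \<le> c0 e B" using A(1) n.steep[OF b(4) s2] .
    then show False using n.r_pos(1)[OF _ A(2) s2] r4 by simp
  qed
  ultimately show ?thesis using s_cases[OF b(3,4)] by blast
qed

lemma region1_C4:
  assumes R: "region1 e B" and i: "s (Suc i) = - 2"
  shows "\<forall>j>i. s j = - 2 \<and> r j = 4"
proof -
  have "s (Suc (i + n)) = - 2 \<and> r (Suc (i + n)) = 4" for n
  proof (induction n)
    case 0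
    then show ?case using i region1_minus2(1)[OF R] by simp
  next
    case (Suc n)
    then have "s (Suc (Suc (i + n))) = - 2" using region1_neighbour[OF R] by simp
    then show ?case using region1_minus2(1)[OF R] by simp
  qed
  then show ?thesis by (metis add_Suc less_iff_Suc_add)
qed

end

theorem region1_classification:
  assumes "block_seq e B c s r X V Y H" and R: "region1 e B"
  shows "(\<forall>i>0. s i = 0 \<and> \<bar>r i\<bar> \<le> 2) \<or> (\<exists>k. \<forall>i>k. s i = - 2 \<and> r i = 4) \<or> (\<exists>k. \<forall>i>k. s i = 2 \<and> r i = - 4)"
proof -
  interpret block_seq e B c s r X V Y H by fact
  interpret n: block_seq e B c "\<lambda>i. - s i" "\<lambda>i. - r i" "\<lambda>i. - X i" "\<lambda>i. - V i" "\<lambda>i. - Y i" "\<lambda>i. - H i" by (rule neg)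
  note b = region1_basic[OF R]
  consider (0) "\<forall>i>0. s i = 0" | (1) i where "s (Suc i) = - 2" | (2) i where "- s (Suc i) = - 2"
    using s_cases[OF b(3,4)] by (metis gr0_implies_Suc minus_minus)
  then show ?thesis
  proof cases
    case 0
    have "\<bar>r i\<bar> \<le> 2" if i: "0 < i" for i
    proof -
      define j where "j = i - 1"
      have j: "i = Suc j" using i by (simp add: j_def)
      have z: "s (Suc (Suc j)) = 0" by (rule 0[rule_format]) simp
      have "\<not> 4 \<le> r i" using region1_neighbour[OF R, of j] z unfolding j by auto
      moreover have "\<not> 4 \<le> - r i" using n.region1_neighbour[OF R, of j] z unfolding j by auto
      ultimately show ?thesis using bd(2)[of i] by presburger
    qed
    then show ?thesis using 0 by blast
  next
    case 1
    then show ?thesis using region1_C4[OF R] by blast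
  next
    case 2
    have "s j = 2 \<and> r j = - 4" if "i < j" for j
      using n.region1_C4[OF R 2, rule_format, OF that] by presburger
    then show ?thesis by blast
  qed
qed

section \<open>Classification for \<open>(a, b) = (4, 6)\<close>\<close>

locale seq46 = block_seq +
  assumes e_lo: "2613/10000 \<le> e" and e_hi: "e \<le> 2614/10000"
    and B_lo: "1742/10000 \<le> B" and B_hi: "B \<le> 1743/10000" and c_lo: "3656/10000 \<le> c" and B_e46: "3 * B \<le> 2 * e"
begin

lemma neg46: "seq46 e B c (\<lambda>i. - s i) (\<lambda>i. - r i) (\<lambda>i. - X i) (\<lambda>i. - V i) (\<lambda>i. - Y i) (\<lambda>i. - H i)"
  by (intro seq46.intro neg seq46_axioms.intro e_lo e_hi B_lo B_hi c_lo B_e46)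

lemma c_pos': "0 < c" using c_lo by simp

lemma b46: "\<bar>X i\<bar> \<le> 6344/10000" "\<bar>Y i\<bar> \<le> 6344/10000" "\<bar>H i\<bar> \<le> 6344/10000" "\<bar>V i\<bar> \<le> 6344/10000"
  using good_bounds[OF bd(7) c_pos' e B, of i] good_bounds[OF bd(8) c_pos' e B, of i] c_lo by simp_all

lemma e_le: "z \<le> z' \<Longrightarrow> 0 \<le> z' \<Longrightarrow> e * z \<le> 2614/10000 * z'" "z \<le> z' \<Longrightarrow> z' \<le> 0 \<Longrightarrow> e * z \<le> 2613/10000 * z'"
  and e_ge: "z' \<le> z \<Longrightarrow> 0 \<le> z' \<Longrightarrow> 2613/10000 * z' \<le> e * z" "z' \<le> z \<Longrightarrow> z' \<le> 0 \<Longrightarrow> 2614/10000 * z' \<le> e * z"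
proof -
  have *: "z \<le> z' \<Longrightarrow> e * z \<le> e * z'" for z z' using e by (intro mult_left_mono) auto
  show "z \<le> z' \<Longrightarrow> 0 \<le> z' \<Longrightarrow> e * z \<le> 2614/10000 * z'"
    using *[of z z'] mult_right_mono[OF e_hi, of z'] by linarith
  show "z \<le> z' \<Longrightarrow> z' \<le> 0 \<Longrightarrow> e * z \<le> 2613/10000 * z'"
    using *[of z z'] mult_right_mono_neg[OF e_lo, of z'] by linarith
  show "z' \<le> z \<Longrightarrow> 0 \<le> z' \<Longrightarrow> 2613/10000 * z' \<le> e * z"
    using *[of z' z] mult_right_mono[OF e_lo, of z'] by linarith
  show "z' \<le> z \<Longrightarrow> z' \<le> 0 \<Longrightarrow> 2614/10000 * z' \<le> e * z"
    using *[of z' z] mult_right_mono_neg[OF e_hi, of z'] by linarith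
qed

lemma B_le: "z \<le> z' \<Longrightarrow> 0 \<le> z' \<Longrightarrow> B * z \<le> 1743/10000 * z'"
  and B_ge: "z' \<le> z \<Longrightarrow> 0 \<le> z' \<Longrightarrow> 1742/10000 * z' \<le> B * z"
proof -
  have *: "z \<le> z' \<Longrightarrow> B * z \<le> B * z'" for z z' using B by (intro mult_left_mono) auto
  show "z \<le> z' \<Longrightarrow> 0 \<le> z' \<Longrightarrow> B * z \<le> 1743/10000 * z'"
    using *[of z z'] mult_right_mono[OF B_hi, of z'] by linarith
  show "z' \<le> z \<Longrightarrow> 0 \<le> z' \<Longrightarrow> 1742/10000 * z' \<le> B * z"
    using *[of z' z] mult_right_mono[OF B_lo, of z'] by linarith
qed

text \<open>Interval form of the first product: 7387/10000 and 8258/10000 bound \<open>1 - e\<close>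
  and \<open>1 - B\<close> from above.\<close>

lemma f1_46:
  assumes g: "good e B c x y" and x: "x \<le> x'" and y: "y \<le> y'"
  shows "3656/10000 < (7387/10000 + x') * (8258/10000 + y')"
proof -
  have "c < (7387/10000 + x') * (8258/10000 + y')"
    by (rule prod_less[of c "1 - e + x" "1 - B + y"])
      (use g[unfolded good_def] x y c_lo e_lo B_lo in \<open>auto simp: abs_less_iff\<close>)
  then show ?thesis using c_lo by linarith
qed

lemma f4_46:
  assumes g: "good e B c x y" and x: "x' \<le> x" and y: "y' \<le> y"
  shows "3656/10000 < (7387/10000 - x') * (8258/10000 - y')"
proof -
  have "c < (7387/10000 - x') * (8258/10000 - y')"
    by (rule prod_less[of c "1 - e - x" "1 - B - y"])
      (use g[unfolded good_def] x y c_lo e_lo B_lo in \<open>auto simp: abs_less_iff\<close>)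
  then show ?thesis using c_lo by linarith
qed

lemma s46: "s i = 0 \<or> s i = 2 \<or> s i = - 2"
  by (rule s_cases) (use e_hi B_e46 in simp_all)

lemma r_less_4: "r i < 4"
proof (rule ccontr)
  assume "\<not> r i < 4"
  then have "4 \<le> real_of_int (r i)" by linarith
  then have "33656/10000 \<le> r i + X (Suc i)" using b46(1)[of "Suc i"] by linarith
  then have "1742/10000 * (33656/10000) \<le> V i" unfolding bd(4)[of i] by (intro B_ge) auto
  then have "5862/10000 \<le> V i" by simp
  moreover have "- 6344/10000 \<le> H i" using b46(3)[of i] by linarith
  ultimately show False using f4_46[OF bd(8)[of i]] by fastforce
qed

lemma r46: "r i = 0 \<or> r i = 2 \<or> r i = - 2"
proof -
  interpret n: seq46 e B c "\<lambda>i. - s i" "\<lambda>i. - r i" "\<lambda>i. - X i" "\<lambda>i. - V i" "\<lambda>i. - Y i" "\<lambda>i. - H i" by (rule neg46)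
  show ?thesis using r_less_4[of i] n.r_less_4[of i] bd(2)[of i] even_less_4[of "r i"] by simp
qed

lemma V46: "\<bar>V i\<bar> \<le> 4592/10000" and Y46: "\<bar>Y (Suc i)\<bar> \<le> 4592/10000"
proof -
  have r: "\<bar>real_of_int (r i)\<bar> \<le> 2" using r46[of i] by auto
  have "\<bar>r i + X (Suc i)\<bar> \<le> 26344/10000" "\<bar>r i + H i\<bar> \<le> 26344/10000" using r b46(1)[of "Suc i"] b46(3)[of i] by linarith+
  from B_le[OF this(1)] B_le[OF this(2)] show "\<bar>V i\<bar> \<le> 4592/10000" "\<bar>Y (Suc i)\<bar> \<le> 4592/10000"
    unfolding bd(4)[of i] bd(6)[of i] using B by (simp_all add: abs_mult)
qed

text \<open>If the odd digit on one side of -2 were at most 0, the value on that side would be at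
  most 0.6344 times \<open>B\<close>. The value on the other side is at most 0.4592, so the first
  product falls below the threshold.\<close>

lemma minus2_r:
  assumes "s (Suc i) = - 2"
  shows "r (Suc i) = 2" "r i = 2"
proof -
  have "Y (Suc i) \<le> 4592/10000" "V (Suc i) \<le> 4592/10000" using Y46[of i] V46[of "Suc i"] by linarith+
  then have x: "H (Suc i) \<le> 2613/10000 * (- 15408/10000)" "X (Suc i) \<le> 2613/10000 * (- 15408/10000)"
    unfolding bd(3)[of "Suc i"] bd(5)[of "Suc i"] using assms by (intro e_le; simp)+
  show "r (Suc i) = 2"
  proof (rule ccontr)
    assume "r (Suc i) \<noteq> 2"
    then have "real_of_int (r (Suc i)) \<le> 0" using r46[of "Suc i"] by auto
    then have "r (Suc i) + X (Suc (Suc i)) \<le> 6344/10000" using b46(1)[of "Suc (Suc i)"] by linarith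
    then have "V (Suc i) \<le> 1743/10000 * (6344/10000)" unfolding bd(4)[of "Suc i"] by (intro B_le) auto
    from f1_46[OF bd(8) x(1) this] show False by simp
  qed
  show "r i = 2"
  proof (rule ccontr)
    assume "r i \<noteq> 2"
    then have "real_of_int (r i) \<le> 0" using r46[of i] by auto
    then have "r i + H i \<le> 6344/10000" using b46(3)[of i] by linarith
    then have "Y (Suc i) \<le> 1743/10000 * (6344/10000)" unfolding bd(6)[of i] by (intro B_le) auto
    from f1_46[OF bd(7) x(2) this] show False by simp
  qed
qed

lemma plus2_r:
  assumes "s (Suc i) = 2"
  shows "r (Suc i) = - 2" "r i = - 2"
proof -
  interpret n: seq46 e B c "\<lambda>i. - s i" "\<lambda>i. - r i" "\<lambda>i. - X i" "\<lambda>i. - V i" "\<lambda>i. - Y i" "\<lambda>i. - H i" by (rule neg46)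
  show "r (Suc i) = - 2" "r i = - 2" using n.minus2_r[of i] assms by auto
qed

lemma X_le46:
  assumes "r i = 2"
  shows "X (Suc i) \<le> 1201/10000"
proof -
  have "s (Suc i) \<noteq> 2" using plus2_r(2)[of i] assms by auto
  then have "real_of_int (s (Suc i)) \<le> 0" using s46[of "Suc i"] by auto
  then have "s (Suc i) + V (Suc i) \<le> 4592/10000" using V46[of "Suc i"] by linarith
  then have "X (Suc i) \<le> 2614/10000 * (4592/10000)" unfolding bd(3)[of "Suc i"] by (intro e_le) auto
  then show ?thesis by simp
qed

lemma H_le46:
  assumes "r (Suc i) = 2"
  shows "H (Suc i) \<le> 1201/10000"
proof -
  have "s (Suc i) \<noteq> 2" using plus2_r(1)[of i] assms by auto
  then have "real_of_int (s (Suc i)) \<le> 0" using s46[of "Suc i"] by auto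
  then have "s (Suc i) + Y (Suc i) \<le> 4592/10000" using Y46[of i] by linarith
  then have "H (Suc i) \<le> 2614/10000 * (4592/10000)" unfolding bd(5)[of "Suc i"] by (intro e_le) auto
  then show ?thesis by simp
qed

lemma no_adjacent46:
  assumes g: "good e B c (e * (- 2 + p)) (B * (2 + q))" and p: "p \<le> 3696/10000" and q: "q \<le> - 4026/10000"
  shows False
proof -
  have "- 2 + p \<le> - 16304/10000" using p by simp
  then have x: "e * (- 2 + p) \<le> 2613/10000 * (- 16304/10000)" by (rule e_le) simp
  have "2 + q \<le> 15974/10000" using q by simp
  then have y: "B * (2 + q) \<le> 1743/10000 * (15974/10000)" by (rule B_le) simp
  from f1_46[OF g x y] show False by simp
qed

lemma next_zero46:
  assumes i: "s (Suc (Suc i)) = - 2"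
  shows "s (Suc (Suc (Suc i))) = 0" "s (Suc i) = 0"
proof -
  have r: "r (Suc (Suc i)) = 2" "r (Suc i) = 2" using minus2_r[OF i] by auto
  have "r (Suc i) + H (Suc i) \<le> 21201/10000" using H_le46[OF r(2)] r by simp
  then have "Y (Suc (Suc i)) \<le> 1743/10000 * (21201/10000)" unfolding bd(6)[of "Suc i"] by (intro B_le) auto
  then have Y: "Y (Suc (Suc i)) \<le> 3696/10000" by simp
  have "r (Suc (Suc i)) + X (Suc (Suc (Suc i))) \<le> 21201/10000" using X_le46[OF r(1)] r by simp
  then have "V (Suc (Suc i)) \<le> 1743/10000 * (21201/10000)" unfolding bd(4)[of "Suc (Suc i)"] by (intro B_le) auto
  then have V: "V (Suc (Suc i)) \<le> 3696/10000" by simp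
  have "s (Suc (Suc (Suc i))) \<noteq> - 2"
  proof
    assume n: "s (Suc (Suc (Suc i))) = - 2"
    then have "s (Suc (Suc (Suc i))) + V (Suc (Suc (Suc i))) \<le> - 15408/10000" using V46[of "Suc (Suc (Suc i))"] by linarith
    then have "X (Suc (Suc (Suc i))) \<le> 2613/10000 * (- 15408/10000)" unfolding bd(3)[of "Suc (Suc (Suc i))"] by (intro e_le) auto
    then have q: "X (Suc (Suc (Suc i))) \<le> - 4026/10000" by simp
    show False using no_adjacent46[OF _ Y q] gap_right[of "Suc (Suc i)"] i r by simp
  qed
  moreover have "s (Suc (Suc (Suc i))) \<noteq> 2" using plus2_r(2)[of "Suc (Suc i)"] r by auto
  ultimately show "s (Suc (Suc (Suc i))) = 0" using s46 by blast
  have "s (Suc i) \<noteq> - 2"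
  proof
    assume n: "s (Suc i) = - 2"
    then have "s (Suc i) + Y (Suc i) \<le> - 15408/10000" using Y46[of i] by linarith
    then have "H (Suc i) \<le> 2613/10000 * (- 15408/10000)" unfolding bd(5)[of "Suc i"] by (intro e_le) auto
    then have q: "H (Suc i) \<le> - 4026/10000" by simp
    show False using no_adjacent46[OF _ V q] gap_left[of "Suc i"] i r by simp
  qed
  moreover have "s (Suc i) \<noteq> 2" using plus2_r(1)[of i] r by auto
  ultimately show "s (Suc i) = 0" using s46 by blast
qed

text \<open>A zero digit with 2, -2, 2 on one side: these digits make \<open>e * y\<close> at least
  0.07, and the second product then caps the value \<open>v\<close> on the other side.\<close>

lemma beyond46:
  assumes p: "p = B * (2 + q)" "- 6344/10000 \<le> q" and h: "h = e * (- 2 + p)" and y: "y = B * (2 + h)"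
    and g: "good e B c (e * y) v"
  shows "v \<le> 2791/10000"
proof -
  have "1742/10000 * (13656/10000) \<le> p" unfolding p(1) using p(2) by (intro B_ge) auto
  then have "- 17622/10000 \<le> - 2 + p" by simp
  then have "2614/10000 * (- 17622/10000) \<le> h" unfolding h by (rule e_ge) simp
  then have "15393/10000 \<le> 2 + h" by simp
  then have "1742/10000 * (15393/10000) \<le> y" unfolding y by (rule B_ge) simp
  then have "2613/10000 * (2680/10000) \<le> e * y" by (intro e_ge) auto
  then have "700/10000 \<le> e * y" by simp
  from f4_46[OF g this order_refl] show ?thesis by simp
qed

text \<open>A squeeze on \<open>V ?k\<close>. The cap \<open>Vk\<close> comes from
  \<open>beyond46\<close>; the lower bound \<open>Vk'\<close> is propagated from the cell at the
  digit -2, whose left side is capped by \<open>beyond46\<close> as well. Only the odd digit 2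
  followed by the even digit -2 gives a value in between.\<close>

lemma step46:
  assumes i: "s (Suc (Suc i)) = - 2"
  shows "r (Suc (Suc (Suc i))) = 2" "s (Suc (Suc (Suc (Suc i)))) = - 2"
proof -
  let ?j = "Suc (Suc i)" let ?k = "Suc ?j" let ?l = "Suc ?k"
  have r: "r ?j = 2" "r (Suc i) = 2" using minus2_r[OF i] by auto
  have z: "s ?k = 0" "s (Suc i) = 0" using next_zero46[OF i] by auto
  have Vk: "V ?k \<le> 2791/10000"
  proof (rule beyond46[of "Y ?j" "H (Suc i)" "H ?j" "Y ?k"])
    show "good e B c (e * Y ?k) (V ?k)" using bd(8)[of ?k] bd(5)[of ?k] z by simp
  qed (use bd(6)[of "Suc i"] bd(6)[of ?j] bd(5)[of ?j] b46(3)[of "Suc i"] r i in auto)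
  have Yi: "Y (Suc i) \<le> 2791/10000"
  proof (rule beyond46[of "V ?j" "X ?k" "X ?j" "V (Suc i)"])
    show "good e B c (e * V (Suc i)) (Y (Suc i))" using bd(7)[of "Suc i"] bd(3)[of "Suc i"] z by simp
  qed (use bd(4)[of "Suc i"] bd(4)[of ?j] bd(3)[of ?j] b46(1)[of ?k] r i in auto)
  have "e * Y (Suc i) \<le> 2614/10000 * (2791/10000)" using Yi by (intro e_le) auto
  then have "H (Suc i) \<le> 730/10000" using bd(5)[of "Suc i"] z by simp
  then have "B * (2 + H (Suc i)) \<le> 1743/10000 * (20730/10000)" by (intro B_le) auto
  then have "Y ?j \<le> 3614/10000" using bd(6)[of "Suc i"] r by simp
  then have "e * (- 2 + Y ?j) \<le> 2613/10000 * (- 16386/10000)" by (intro e_le) auto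
  then have "H ?j \<le> - 4281/10000" using bd(5)[of ?j] i by simp
  from f1_46[OF bd(8) this order_refl] have Vj: "3512/10000 < V ?j" by simp
  have "140/10000 < X ?k"
  proof (rule ccontr)
    assume "\<not> 140/10000 < X ?k"
    then have "B * (2 + X ?k) \<le> 1743/10000 * (20140/10000)" by (intro B_le) auto
    then show False using Vj bd(4)[of ?j] r by simp
  qed
  then have Vk': "500/10000 < V ?k"
  proof -
    assume x: "140/10000 < X ?k"
    show ?thesis
    proof (rule ccontr)
      assume "\<not> 500/10000 < V ?k"
      then have "e * V ?k \<le> 2614/10000 * (500/10000)" by (intro e_le) auto
      then show False using x bd(3)[of ?k] z by simp
    qed
  qed
  have Xl: "\<bar>X ?l\<bar> \<le> 1201/10000" if "s ?l = 0"
  proof -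
    have "e * \<bar>V ?l\<bar> \<le> 2614/10000 * (4592/10000)" using V46[of ?l] by (intro e_le) auto
    then show ?thesis using bd(3)[of ?l] that e by (simp add: abs_mult)
  qed
  show r2: "r ?k = 2"
  proof -
    have "r ?k \<noteq> 0"
    proof
      assume r0: "r ?k = 0"
      then have "s ?l = 0" using s46[of ?l] minus2_r(2)[of ?k] plus2_r(2)[of ?k] by auto
      then have "X ?l \<le> 1201/10000" using Xl by linarith
      then have "B * X ?l \<le> 1743/10000 * (1201/10000)" by (intro B_le) auto
      then show False using Vk' bd(4)[of ?k] r0 by simp
    qed
    moreover have "r ?k \<noteq> - 2"
    proof
      assume r0: "r ?k = - 2"
      have "- 2 + X ?l \<le> 0" using b46(1)[of ?l] by linarith
      then have "B * (- 2 + X ?l) \<le> 1743/10000 * 0" by (intro B_le) auto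
      then show False using Vk' bd(4)[of ?k] r0 by simp
    qed
    ultimately show ?thesis using r46 by blast
  qed
  have "s ?l \<noteq> 0"
  proof
    assume "s ?l = 0"
    then have "18799/10000 \<le> 2 + X ?l" using Xl by linarith
    then have "1742/10000 * (18799/10000) \<le> B * (2 + X ?l)" by (intro B_ge) auto
    then show False using Vk bd(4)[of ?k] r2 by simp
  qed
  moreover have "s ?l \<noteq> 2" using plus2_r(2)[of ?k] r2 by auto
  ultimately show "s ?l = - 2" using s46 by blast
qed

lemma period46:
  assumes "s (Suc (Suc i)) = - 2"
  shows "s (Suc (Suc (i + 2 * n))) = - 2 \<and> r (Suc (Suc (i + 2 * n))) = 2 \<and>
    s (Suc (Suc (Suc (i + 2 * n)))) = 0 \<and> r (Suc (Suc (Suc (i + 2 * n)))) = 2"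
proof (induction n)
  case 0
  then show ?case using assms minus2_r(1) next_zero46(1) step46(1) by simp
next
  case (Suc n)
  then have "s (Suc (Suc (i + 2 * Suc n))) = - 2" using step46(2)[of "i + 2 * n"] by simp
  then show ?case using minus2_r(1) next_zero46(1) step46(1) by blast
qed

end

theorem classification46:
  assumes "seq46 e B c s r X V Y H"
  shows "(\<forall>i>1. s i = 0 \<and> \<bar>r i\<bar> \<le> 2) \<or>
    (\<exists>k. \<forall>n. s (k + 2*n) = - 2 \<and> r (k + 2*n) = 2 \<and> s (Suc (k + 2*n)) = 0 \<and> r (Suc (k + 2*n)) = 2) \<or>
    (\<exists>k. \<forall>n. s (k + 2*n) = 2 \<and> r (k + 2*n) = - 2 \<and> s (Suc (k + 2*n)) = 0 \<and> r (Suc (k + 2*n)) = - 2)"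
proof -
  interpret seq46 e B c s r X V Y H by fact
  interpret n: seq46 e B c "\<lambda>i. - s i" "\<lambda>i. - r i" "\<lambda>i. - X i" "\<lambda>i. - V i" "\<lambda>i. - Y i" "\<lambda>i. - H i" by (rule neg46)
  show ?thesis
  proof (cases "\<forall>i. s (Suc (Suc i)) = 0")
    case True
    have "s i = 0 \<and> \<bar>r i\<bar> \<le> 2" if "1 < i" for i
      using True[rule_format, of "i - 2"] r46[of i] that by (auto simp: numeral_2_eq_2 Suc_diff_Suc)
    then show ?thesis by blast
  next
    case False
    then obtain i where "s (Suc (Suc i)) \<noteq> 0" by blast
    then consider "s (Suc (Suc i)) = - 2" | "- s (Suc (Suc i)) = - 2" using s46[of "Suc (Suc i)"] by fastforce
    then show ?thesis
    proof cases
      case 1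
      show ?thesis using period46[OF 1] by (intro disjI2 disjI1 exI[of _ "Suc (Suc i)"]) simp
    next
      case 2
      have "s (Suc (Suc i) + 2*n) = 2 \<and> r (Suc (Suc i) + 2*n) = - 2 \<and> s (Suc (Suc (Suc i) + 2*n)) = 0 \<and> r (Suc (Suc (Suc i) + 2*n)) = - 2" for n
        using n.period46[OF 2, of n] unfolding add_Suc by presburger
      then show ?thesis by blast
    qed
  qed
qed

text \<open>The fixed point of \<open>x = e * (2 - B * (4 - x))\<close>, that is, minus the right
  value at the even positions of the constant pattern -2, 4.\<close>

definition xi_inf :: "real \<Rightarrow> real \<Rightarrow> real" where "xi_inf e B = (2*e - 4*(e*B)) / (1 - e*B)"
text \<open>The first product of the cell that follows the digits -2, 0, 2, where 0 is an even
  digit: the right value there is \<open>- x\<close>, and \<open>x'\<close> is the left value before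
  the odd digit -2.\<close>

definition FF :: "real \<Rightarrow> real \<Rightarrow> real \<Rightarrow> real \<Rightarrow> real" where
  "FF e B x x' = (1 - e - x) * (1 + B - 2*B*(e*B) + B*(e*B)*x')"

section \<open>Classification for \<open>b = 2 * a - 2\<close>\<close>

locale seq3 = block_seq +
  assumes R: "region3 e B" and e_128: "1000 * e \<le> 128" and c_inf: "FF e B (xi_inf e B) (xi_inf e B) \<le> c"
begin

lemma neg3: "seq3 e B c (\<lambda>i. - s i) (\<lambda>i. - r i) (\<lambda>i. - X i) (\<lambda>i. - V i) (\<lambda>i. - Y i) (\<lambda>i. - H i)"
  by (intro seq3.intro neg seq3_axioms.intro R e_128 c_inf)

lemma B_e: "5 * B \<le> 3 * e" "e \<le> 2 * B" using R by (simp_all add: region3_def)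

lemma D_facts: "0 < e * B" "e * B \<le> 1/100" "B * (e * B) \<le> 1/1000"
proof -
  show "0 < e * B" using e B by simp
  have "e * B \<le> 128/1000 * (768/10000)" using e_128 B_e e B by (intro mult_mono) auto
  then show D: "e * B \<le> 1/100" by simp
  have "B * (e * B) \<le> 768/10000 * (1/100)" using D e_128 B_e e B by (intro mult_mono) auto
  then show "B * (e * B) \<le> 1/1000" by simp
qed

lemma xi_eq: "xi_inf e B = 2*e - 4*(e*B) + e*B * xi_inf e B"
  using D_facts by (simp add: xi_inf_def field_simps)

lemma xi_bounds: "0 \<le> xi_inf e B" "xi_inf e B \<le> 2*e" "2*e - 4*(e*B) \<le> xi_inf e B" "xi_inf e B \<le> 2*e - 4*(e*B) + 2*(e*(e*B))"
proof -
  have "4*(e*B) \<le> 2*e" using e_128 B_e e mult_left_mono[of "2*B" 1 e] by simp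
  then show 0: "0 \<le> xi_inf e B" using D_facts unfolding xi_inf_def by (intro divide_nonneg_pos) auto
  then show "2*e - 4*(e*B) \<le> xi_inf e B" using xi_eq mult_nonneg_nonneg[of "e*B" "xi_inf e B"] D_facts by linarith
  have "2*e - 4*(e*B) \<le> 2*e * (1 - e*B)" using mult_left_mono[of e 2 "e*B"] D_facts e_128 by (simp add: algebra_simps)
  then show 2: "xi_inf e B \<le> 2*e" using D_facts unfolding xi_inf_def by (simp add: pos_divide_le_eq)
  have "e*B * xi_inf e B \<le> e*B * (2*e)" using 2 D_facts by (intro mult_left_mono) auto
  then show "xi_inf e B \<le> 2*e - 4*(e*B) + 2*(e*(e*B))" using xi_eq by (simp add: algebra_simps)
qed

text \<open>A polynomial estimate of the rational limit value, so that the certificates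
  apply.\<close>

lemma dl_le: "(1-3*e+4*(e*B)-2*(e*(e*B)))*(1+B-2*(B*(e*B))) \<le> c"
proof -
  have "(1-3*e+4*(e*B)-2*(e*(e*B)))*(1+B-2*(B*(e*B))) \<le> FF e B (xi_inf e B) (xi_inf e B)"
    unfolding FF_def
  proof (rule mult_mono)
    show "1 - 3*e + 4*(e*B) - 2*(e*(e*B)) \<le> 1 - e - xi_inf e B" using xi_bounds(4) by simp
    show "1 + B - 2*(B*(e*B)) \<le> 1 + B - 2*B*(e*B) + B*(e*B)*xi_inf e B"
      using xi_bounds(1) e B by (simp add: mult.assoc)
    show "0 \<le> 1 - e - xi_inf e B" using xi_bounds(2) e_128 by simp
    show "0 \<le> 1 + B - 2*(B*(e*B))" using D_facts B by simp
  qed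
  then show ?thesis using c_inf by simp
qed

lemma k3: "kp e B \<le> 13/5*e" "kp e B \<le> 1/3" "0 \<le> kp e B"
proof -
  show 1: "kp e B \<le> 13/5*e" using region3_kap[OF R] by (simp add: kp_def)
  then show "kp e B \<le> 1/3" using e_128 by simp
  show "0 \<le> kp e B" using bounds(1)[of 0] by linarith
qed

lemma A1: "(1-e+e*kp e B)*(1-5*B+B*kp e B) \<le> c0 e B"
  using region3_R2[OF R] by (simp add: kp_def c0_def)
lemma A3: "(1-3*e+e*(B*(4+kp e B)))*(1-B+B*kp e B) \<le> c0 e B"
  using region3_R4[OF R] by (simp add: kp_def c0_def)

lemmas r_le_4' = r_le_4[OF A1]
lemmas r_pos' = r_pos[OF A1 A3]

lemma s3: "s i = 0 \<or> s i = 2 \<or> s i = - 2"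
  by (rule s_cases) (use B_e e e_128 in simp_all)

lemma r_neg':
  assumes "s (Suc i) = 2"
  shows "r i < 0" "r (Suc i) < 0"
proof -
  interpret n: seq3 e B c "\<lambda>i. - s i" "\<lambda>i. - r i" "\<lambda>i. - X i" "\<lambda>i. - V i" "\<lambda>i. - Y i" "\<lambda>i. - H i" by (rule neg3)
  show "r i < 0" "r (Suc i) < 0" using n.r_pos'[of i] assms by auto
qed

lemma e_mono: "z \<le> z' \<Longrightarrow> e * z \<le> e * z'" and B_mono: "z \<le> z' \<Longrightarrow> B * z \<le> B * z'"
  using e B by (simp_all add: mult_left_mono)

lemma zero_r_le:
  assumes "s (Suc i) = 0"
  shows "r i \<le> 2" "r (Suc i) \<le> 2"
proof -
  have "e * - V (Suc i) \<le> e * kp e B" "e * - Y (Suc i) \<le> e * kp e B"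
    using bounds(2,4)[of "Suc i"] by (intro e_mono; simp)+
  then have x: "- X (Suc i) \<le> e * kp e B" "- H (Suc i) \<le> e * kp e B" using bd(3,5)[of "Suc i"] assms by simp_all
  have "r i < 4"
  proof (rule ccontr)
    assume "\<not> r i < 4"
    then have "4 \<le> real_of_int (r i)" by linarith
    from good_f4[OF g0(1) less_imp_le[OF c_pos] x(1) Y_ge[OF this]] A1 show False by (simp add: algebra_simps)
  qed
  then show "r i \<le> 2" using bd(2)[of i] by presburger
  have "r (Suc i) < 4"
  proof (rule ccontr)
    assume "\<not> r (Suc i) < 4"
    then have "4 \<le> real_of_int (r (Suc i))" by linarith
    from good_f4[OF g0(2) less_imp_le[OF c_pos] x(2) V_ge[OF this]] A1 show False by (simp add: algebra_simps)
  qed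
  then show "r (Suc i) \<le> 2" using bd(2)[of "Suc i"] by presburger
qed

lemma zero_r_abs:
  assumes "s (Suc i) = 0"
  shows "\<bar>r i\<bar> \<le> 2" "\<bar>r (Suc i)\<bar> \<le> 2"
proof -
  interpret n: seq3 e B c "\<lambda>i. - s i" "\<lambda>i. - r i" "\<lambda>i. - X i" "\<lambda>i. - V i" "\<lambda>i. - Y i" "\<lambda>i. - H i" by (rule neg3)
  show "\<bar>r i\<bar> \<le> 2" "\<bar>r (Suc i)\<bar> \<le> 2" using zero_r_le[of i] n.zero_r_le[of i] assms by auto
qed

lemma c_nonneg: "0 \<le> c" using c c_pos by simp

text \<open>Both outer odd digits are at most 4, so the values outside -2, 2, -2 are at most
  \<open>B * (4 + 13/5*e)\<close>, and the first product at the middle digit is too small by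
  \<open>region3_T4\<close>.\<close>

lemma no_double_minus2:
  assumes i: "s (Suc i) = - 2" and r: "r (Suc i) = 2"
  shows "s (Suc (Suc i)) \<noteq> - 2"
proof
  assume n: "s (Suc (Suc i)) = - 2"
  have "real_of_int (r i) \<le> 4" "real_of_int (r (Suc (Suc i))) \<le> 4" using r_le_4' i n by simp_all
  then have "Y (Suc i) \<le> B * (4 + kp e B)" "V (Suc (Suc i)) \<le> B * (4 + kp e B)" using Y_le V_le by blast+
  moreover have "B * (4 + kp e B) \<le> B * (4 + 13/5*e)" using k3 by (intro B_mono) auto
  ultimately have YV: "Y (Suc i) \<le> B * (4 + 13/5*e)" "V (Suc (Suc i)) \<le> B * (4 + 13/5*e)" by linarith+
  have x: "H (Suc i) \<le> e * (- 2 + B * (4 + 13/5*e))" unfolding bd(5)[of "Suc i"] using YV i by (intro e_mono) auto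
  have "X (Suc (Suc i)) \<le> e * (- 2 + B * (4 + 13/5*e))" unfolding bd(3)[of "Suc (Suc i)"] using YV n by (intro e_mono) auto
  then have y: "V (Suc i) \<le> B * (2 + e * (- 2 + B * (4 + 13/5*e)))" unfolding bd(4)[of "Suc i"] using r by (intro B_mono) auto
  from good_f1[OF bd(8) c_nonneg x y] region3_T4[OF R] dl_le show False by (simp add: algebra_simps)
qed

text \<open>A value headed by the odd digit -2 cannot be much below \<open>- 2 * B\<close>: an even
  digit -2 tolerates only positive odd neighbours, so what lies beyond is at least
  \<open>- e * kp e B\<close>. All larger digits are harmless.\<close>

lemma outer_ge:
  fixes m :: int and p q :: real
  assumes m: "- 2 \<le> m" and q: "- kp e B < q" "m = - 2 \<Longrightarrow> - e * kp e B \<le> q" and ev: "even m" and p: "p = B * (m + q)"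
  shows "- (B * (2 + 1/3*e)) \<le> p"
proof -
  have ek: "e * kp e B \<le> e * (1/3)" using k3 by (intro e_mono) auto
  have "- (2 + 1/3*e) \<le> m + q"
  proof (cases "m = - 2")
    case True
    then show ?thesis using q(2) ek by simp
  next
    case False
    then have "0 \<le> real_of_int m" using m ev by presburger
    then show ?thesis using q(1) k3 e by linarith
  qed
  from B_mono[OF this] show ?thesis unfolding p by (simp add: algebra_simps)
qed

lemma V_outer: "s (Suc i) = 0 \<Longrightarrow> - (B * (2 + 1/3*e)) \<le> V (Suc i)"
proof -
  assume z: "s (Suc i) = 0"
  have "- e * kp e B \<le> X (Suc (Suc i))" if "r (Suc i) = - 2"
  proof -
    have "s (Suc (Suc i)) \<noteq> - 2" using r_pos'(1)[of "Suc i"] that by auto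
    then have "0 \<le> real_of_int (s (Suc (Suc i)))" using s3[of "Suc (Suc i)"] by auto
    then have "- kp e B \<le> s (Suc (Suc i)) + V (Suc (Suc i))" using bounds(4)[of "Suc (Suc i)"] by linarith
    from e_mono[OF this] show ?thesis using bd(3)[of "Suc (Suc i)"] by simp
  qed
  then show ?thesis using zero_r_abs(2)[OF z] bounds(1)[of "Suc (Suc i)"] bd(2)[of "Suc i"]
    by (intro outer_ge[of "r (Suc i)" "X (Suc (Suc i))"] bd(4)) auto
qed

lemma Y_outer: "s (Suc (Suc i)) = 0 \<Longrightarrow> - (B * (2 + 1/3*e)) \<le> Y (Suc (Suc i))"
proof -
  assume z: "s (Suc (Suc i)) = 0"
  have "- e * kp e B \<le> H (Suc i)" if "r (Suc i) = - 2"
  proof -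
    have "s (Suc i) \<noteq> - 2" using r_pos'(2)[of i] that by auto
    then have "0 \<le> real_of_int (s (Suc i))" using s3[of "Suc i"] by auto
    then have "- kp e B \<le> s (Suc i) + Y (Suc i)" using bounds(2)[of "Suc i"] by linarith
    from e_mono[OF this] show ?thesis using bd(5)[of "Suc i"] by simp
  qed
  then show ?thesis using zero_r_abs(1)[OF z] bounds(3)[of "Suc i"] bd(2)[of "Suc i"]
    by (intro outer_ge[of "r (Suc i)" "H (Suc i)"] bd(6)) auto
qed

text \<open>A zero followed by 2 survives only inside -2, 0, 2, -2. Otherwise the second product of
  the cell between 0 and 2 is too small: by \<open>region3_T3a\<close> if another zero follows the
  2, by \<open>region3_T3b\<close> or \<open>region3_T3c\<close> if the odd digit on the left is 0
  or 2.\<close>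

lemma zero_two:
  assumes z: "s (Suc (Suc i)) = 0" and r2: "r (Suc (Suc i)) = 2"
  shows "s (Suc (Suc (Suc i))) = - 2" "r (Suc i) = - 2"
proof -
  let ?j = "Suc (Suc i)" let ?k = "Suc (Suc (Suc i))"
  have Hj: "H ?j = e * Y ?j" using bd(5)[of ?j] z by simp
  have Vj: "V ?j = B * (2 + X ?k)" using bd(4)[of ?j] r2 by simp
  have "s ?k \<noteq> 0"
  proof
    assume n: "s ?k = 0"
    have "e * - (B * (2 + 1/3*e)) \<le> H ?j" unfolding Hj by (intro e_mono Y_outer z)
    then have x: "- H ?j \<le> e * B * (2 + 1/3*e)" by simp
    have "e * - (B * (2 + 1/3*e)) \<le> X ?k" using e_mono[OF V_outer[OF n]] bd(3)[of ?k] n by simp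
    then have y: "B * (2 + e * - (B * (2 + 1/3*e))) \<le> V ?j" unfolding Vj by (intro B_mono) auto
    from good_f4[OF bd(8) c_nonneg x y] region3_T3a[OF R] dl_le show False by (simp add: algebra_simps)
  qed
  moreover have "s ?k \<noteq> 2" using r_neg'(1)[of ?j] r2 by auto
  ultimately show sk: "s ?k = - 2" using s3 by blast
  have "2 \<le> r ?k" using r_pos'(2)[OF sk] bd(2)[of ?k] by presburger
  then have "2 \<le> real_of_int (r ?k)" by simp
  from V_ge[OF this] have "B * (2 - kp e B) \<le> V ?k" .
  moreover have "B * (5/3) \<le> B * (2 - kp e B)" using k3 by (intro B_mono) auto
  ultimately have "e * (- 2 + B * (5/3)) \<le> X ?k" using bd(3)[of ?k] sk by (simp add: e_mono)
  then have y: "B * (2 + e * (- 2 + B * (5/3))) \<le> V ?j" unfolding Vj by (intro B_mono) auto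
  have "r (Suc i) \<noteq> 0"
  proof
    assume r0: "r (Suc i) = 0"
    then have s0: "s (Suc i) = 0" using s3[of "Suc i"] r_pos'(2)[of i] r_neg'(2)[of i] by auto
    have "- 2 \<le> real_of_int (r i)" using zero_r_abs(1)[OF s0] by linarith
    from Y_ge[OF this] have "B * (- 2 - kp e B) \<le> Y (Suc i)" .
    moreover have "B * (- 7/3) \<le> B * (- 2 - kp e B)" using k3 by (intro B_mono) auto
    ultimately have "B * (- 7/3) \<le> Y (Suc i)" by (rule order_trans[rotated])
    from e_mono[OF this] have "e * (B * (- 7/3)) \<le> H (Suc i)" using bd(5)[of "Suc i"] s0 by simp
    from B_mono[OF this] have "B * (e * (B * (- 7/3))) \<le> Y ?j" using bd(6)[of "Suc i"] r0 by simp
    from e_mono[OF this] have x: "- H ?j \<le> 7/3 * (e*B)^2" unfolding Hj by (simp add: power2_eq_square algebra_simps)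
    from good_f4[OF bd(8) c_nonneg x y] region3_T3b[OF R] dl_le show False by (simp add: algebra_simps)
  qed
  moreover have "r (Suc i) \<noteq> 2"
  proof
    assume r0: "r (Suc i) = 2"
    then have "2 \<le> real_of_int (r (Suc i))" by simp
    from Y_ge[OF this] have "B * (2 - kp e B) \<le> Y ?j" .
    moreover have "B * (5/3) \<le> B * (2 - kp e B)" using k3 by (intro B_mono) auto
    ultimately have "e * (B * (5/3)) \<le> H ?j" unfolding Hj by (intro e_mono) auto
    then have x: "- H ?j \<le> - (5/3 * (e*B))" by simp
    from good_f4[OF bd(8) c_nonneg x y] region3_T3c[OF R] dl_le show False by (simp add: algebra_simps)
  qed
  ultimately show "r (Suc i) = - 2" using zero_r_abs(1)[OF z] bd(2)[of "Suc i"] even_less_4[of "r (Suc i)"] by auto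
qed

lemma minus2_next: "s (Suc i) = - 2 \<Longrightarrow> r (Suc i) = 4 \<Longrightarrow> s (Suc (Suc i)) = - 2"
  using s3[of "Suc (Suc i)"] zero_r_le(1)[of "Suc i"] r_neg'(1)[of "Suc i"] by auto

text \<open>The excess \<open>X + xi_inf\<close> at digits -2 contracts by the factor
  \<open>e * B\<close>: a following 4 forces another -2 and hands the excess on, and a following 2
  makes it nonpositive at once.\<close>

lemma X_le_inf: "s (Suc i) = - 2 \<Longrightarrow> X (Suc i) \<le> - xi_inf e B"
proof -
  define z where "z i = (if s (Suc i) = - 2 then X (Suc i) + xi_inf e B else 0)" for i
  have "z i \<le> 0" for i
  proof (rule contract_nonpos[where B = "2 + xi_inf e B" and q = "e * B"])
    show "z j \<le> 2 + xi_inf e B" for j using bounds(1)[of "Suc j"] k3 xi_bounds(1) by (auto simp: z_def abs_less_iff)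
    show "z j \<le> e * B * max 0 (z (Suc j))" for j
    proof (cases "s (Suc j) = - 2")
      case True
      have "r (Suc j) = 2 \<or> r (Suc j) = 4" using r_pos'(2)[OF True] r_le_4'(1)[OF True] bd(2)[of "Suc j"] by presburger
      moreover have Xe: "X (Suc j) = e * (- 2 + B * (r (Suc j) + X (Suc (Suc j))))" using bd(3)[of "Suc j"] bd(4)[of "Suc j"] True by simp
      moreover have "z j \<le> e * B * max 0 (z (Suc j))" if r4: "r (Suc j) = 4"
      proof -
        have "z (Suc j) = X (Suc (Suc j)) + xi_inf e B" using minus2_next[OF True r4] by (simp add: z_def)
        moreover have "z j = e * B * (X (Suc (Suc j)) + xi_inf e B)"
          using True Xe r4 xi_eq by (simp add: z_def algebra_simps)
        ultimately show ?thesis using D_facts by (simp add: mult_left_mono)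
      qed
      moreover have "z j \<le> e * B * max 0 (z (Suc j))" if r2: "r (Suc j) = 2"
      proof -
        have "z j = e * B * (X (Suc (Suc j)) - 2 + xi_inf e B)"
          using True Xe r2 xi_eq by (simp add: z_def algebra_simps)
        also have "\<dots> \<le> 0" using bounds(1)[of "Suc (Suc j)"] k3 xi_bounds(2) e_128 D_facts
          by (intro mult_nonneg_nonpos) auto
        also have "0 \<le> e * B * max 0 (z (Suc j))" using D_facts by simp
        finally show ?thesis .
      qed
      ultimately show ?thesis by blast
    qed (use D_facts in \<open>simp add: z_def\<close>)
  qed (use D_facts in auto)
  then show "s (Suc i) = - 2 \<Longrightarrow> X (Suc i) \<le> - xi_inf e B" unfolding z_def by (smt (verit))
qed

text \<open>Raising \<open>m'\<close> to \<open>m\<close> only helps. On the diagonal the first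
  factor falls at rate 1 while the second rises at the tiny rate \<open>B * (e * B)\<close>, so
  moving beyond \<open>xi_inf\<close> lowers the product.\<close>

lemma FF_mono:
  assumes m: "xi_inf e B \<le> m" "m' \<le> m" "m < 1 - e"
  shows "FF e B m m' \<le> FF e B (xi_inf e B) (xi_inf e B)"
proof -
  define d where "d = m - xi_inf e B"
  define P K where "P = 1 - e - xi_inf e B" and "K = B*(e*B)"
  define Q where "Q = 1 + B - 2*K + K * xi_inf e B"
  have d: "0 \<le> d" using m by (simp add: d_def)
  have K: "0 < K" "K \<le> 1/1000" using D_facts B by (simp_all add: K_def)
  have P: "P \<le> 1" using xi_bounds(1) e by (simp add: P_def)
  have Kxi: "0 \<le> K * xi_inf e B" using K xi_bounds(1) by simp
  have Q: "1/2 \<le> Q" using K B Kxi unfolding Q_def by linarith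
  have "FF e B m m' \<le> FF e B m m"
    unfolding FF_def using m K by (intro mult_left_mono add_left_mono) (auto simp: K_def)
  also have "\<dots> = (P - d) * (Q + K * d)" unfolding FF_def P_def Q_def K_def d_def by (simp add: algebra_simps)
  also have "\<dots> = P * Q - d * (Q - K * P) - K * d * d" by (simp add: algebra_simps)
  also have "\<dots> \<le> P * Q"
  proof -
    have "K * P \<le> 1/1000 * 1" using K P m(3) d by (intro mult_mono) (auto simp: P_def d_def)
    then have "0 \<le> d * (Q - K * P)" using d Q by (intro mult_nonneg_nonneg) auto
    moreover have "0 \<le> K * d * d" using K d by simp
    ultimately show ?thesis by linarith
  qed
  also have "\<dots> = FF e B (xi_inf e B) (xi_inf e B)" unfolding FF_def P_def Q_def K_def by (simp add: algebra_simps)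
  finally show ?thesis .
qed

text \<open>The two gaps around a zero digit flanked by \<open>- 2\<close> and \<open>2\<close> cannot both exceed the limit value:
  the side with the larger deviation fails.\<close>

lemma zero_not_two: "s (Suc (Suc i)) = 0 \<Longrightarrow> r (Suc (Suc i)) \<noteq> 2"
proof
  let ?j = "Suc (Suc i)" let ?k = "Suc (Suc (Suc i))"
  assume z: "s ?j = 0" and r2: "r ?j = 2"
  have sk: "s ?k = - 2" and ri: "r (Suc i) = - 2" using zero_two[OF z r2] by auto
  define x h where "x = - X ?k" and "h = H (Suc i)"
  have x: "xi_inf e B \<le> x" using X_le_inf[OF sk] by (simp add: x_def)
  have Vj: "V ?j = B * (2 - x)" using bd(4)[of ?j] r2 by (simp add: x_def)
  have Yk: "Y ?k = B * (2 + e * (B * (- 2 + h)))" using bd(6)[of ?j] bd(5)[of ?j] bd(6)[of "Suc i"] z r2 ri by (simp add: h_def)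
  have Vi: "V (Suc i) = B * (- 2 + e * (B * (2 - x)))" using bd(4)[of "Suc i"] bd(3)[of ?j] Vj ri z by simp
  have g1: "good e B c (- x) (B * (2 + e * (B * (- 2 + h))))" using bd(7)[of ?k] unfolding Yk by (simp add: x_def)
  have g2: "good e B c h (B * (- 2 + e * (B * (2 - x))))" using bd(8)[of "Suc i"] unfolding Vi by (simp add: h_def)
  have 1: "c < FF e B x h" "x < 1 - e" using g1 unfolding good_def FF_def by (auto simp: algebra_simps)
  have 2: "c < FF e B h x" "h < 1 - e" using g2 unfolding good_def FF_def by (auto simp: algebra_simps)
  show False
  proof (cases "h \<le> x")
    case True
    from FF_mono[OF x True 1(2)] 1(1) c_inf show False by simp
  next
    case False
    then have "xi_inf e B \<le> h" "x \<le> h" using x by auto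
    from FF_mono[OF this 2(2)] 2(1) c_inf show False by simp
  qed
qed

lemma zero_next:
  assumes z: "s (Suc (Suc i)) = 0"
  shows "r (Suc (Suc i)) = 0" "s (Suc (Suc (Suc i))) = 0"
proof -
  interpret n: seq3 e B c "\<lambda>i. - s i" "\<lambda>i. - r i" "\<lambda>i. - X i" "\<lambda>i. - V i" "\<lambda>i. - Y i" "\<lambda>i. - H i" by (rule neg3)
  have "r (Suc (Suc i)) \<noteq> 2" "- r (Suc (Suc i)) \<noteq> 2" using zero_not_two[OF z] n.zero_not_two[of i] z by auto
  then show r0: "r (Suc (Suc i)) = 0" using zero_r_abs(2)[OF z] bd(2)[of "Suc (Suc i)"] even_less_4[of "r (Suc (Suc i))"] by auto
  show "s (Suc (Suc (Suc i))) = 0"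
    using s3[of "Suc (Suc (Suc i))"] r_pos'(1)[of "Suc (Suc i)"] r_neg'(1)[of "Suc (Suc i)"] r0 by auto
qed

lemma zero_forever: "s (Suc (Suc i)) = 0 \<Longrightarrow> s (Suc (Suc (i + n))) = 0 \<and> r (Suc (Suc (i + n))) = 0"
  by (induction n) (use zero_next in auto)

lemma minus2_forever:
  assumes nz: "\<And>j. s (Suc (Suc j)) \<noteq> 0" and s2: "s (Suc (Suc 0)) = - 2"
  shows "s (Suc (Suc n)) = - 2 \<and> r (Suc (Suc n)) = 4"
proof -
  have *: "r (Suc (Suc n)) = 4 \<and> s (Suc (Suc (Suc n))) = - 2" if s: "s (Suc (Suc n)) = - 2" for n
  proof -
    have "0 < r (Suc (Suc n))" using r_pos'(2)[OF s] .
    then have s': "s (Suc (Suc (Suc n))) = - 2" using r_neg'(1)[of "Suc (Suc n)"] s3[of "Suc (Suc (Suc n))"] nz[of "Suc n"] by auto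
    then have "r (Suc (Suc n)) \<noteq> 2" using no_double_minus2[OF s] by auto
    then have "r (Suc (Suc n)) = 4" using \<open>0 < r (Suc (Suc n))\<close> r_le_4'(1)[OF s] bd(2)[of "Suc (Suc n)"] by presburger
    then show ?thesis using s' by blast
  qed
  have "s (Suc (Suc n)) = - 2" by (induction n) (use * s2 in auto)
  then show ?thesis using * by blast
qed

end

theorem classification3:
  assumes "seq3 e B c s r X V Y H"
  shows "(\<exists>k. \<forall>n. s (k + n) = 0 \<and> r (k + n) = 0) \<or> (\<exists>k. \<forall>n. s (k + n) = - 2 \<and> r (k + n) = 4) \<or>
    (\<exists>k. \<forall>n. s (k + n) = 2 \<and> r (k + n) = - 4)"
proof -
  interpret seq3 e B c s r X V Y H by fact
  interpret n: seq3 e B c "\<lambda>i. - s i" "\<lambda>i. - r i" "\<lambda>i. - X i" "\<lambda>i. - V i" "\<lambda>i. - Y i" "\<lambda>i. - H i" by (rule neg3)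
  show ?thesis
  proof (cases "\<exists>i. s (Suc (Suc i)) = 0")
    case True
    then obtain i where "s (Suc (Suc i)) = 0" by blast
    then show ?thesis using zero_forever[of i] by (intro disjI1 exI[of _ "Suc (Suc i)"]) simp
  next
    case False
    then have nz: "\<And>i. s (Suc (Suc i)) \<noteq> 0" by blast
    then consider "s (Suc (Suc 0)) = - 2" | "- s (Suc (Suc 0)) = - 2" using s3[of "Suc (Suc 0)"] by fastforce
    then show ?thesis
    proof cases
      case 1
      show ?thesis using minus2_forever[OF nz 1] by (intro disjI2 disjI1 exI[of _ "Suc (Suc 0)"]) simp
    next
      case 2
      have "\<And>i. - s (Suc (Suc i)) \<noteq> 0" using nz by simp
      note forever = n.minus2_forever[OF this 2]
      have "s (Suc (Suc n)) = 2 \<and> r (Suc (Suc n)) = - 4" for n using forever[of n] by presburger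
      then show ?thesis by (intro disjI2 exI[of _ "Suc (Suc 0)"]) simp
    qed
  qed
qed

section \<open>Alternating runs\<close>

text \<open>\<open>g\<close> is the value of an infinite alternating sequence of 2 and -2. Each step
  back along a run multiplies the deviation from it by \<open>- D\<close>, so before a run of length
  \<open>L\<close> it has the size of \<open>D^L\<close> and a sign given by the parity of
  \<open>L\<close>.\<close>

lemma run_error:
  fixes u w :: "nat \<Rightarrow> real"
  assumes "\<And>k. k < L \<Longrightarrow> u k = w k + D * u (Suc k)" "\<And>k. k < L \<Longrightarrow> w k = 2 * \<sigma> * (-1)^k"
    and \<sigma>: "\<sigma> * \<sigma> = 1" and g: "g = 2 - D * g"
  shows "g - \<sigma> * u 0 = (- D)^L * (g - \<sigma> * (-1)^L * u L)"
  using assms(1,2)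
proof (induction L)
  case (Suc L)
  have "\<sigma> * (-1)^L * u L = 2 * (\<sigma> * \<sigma>) * ((-1)^L * (-1)^L) + D * (\<sigma> * (-1)^L * u (Suc L))"
    by (subst Suc.prems(1), simp, subst Suc.prems(2), simp, simp add: algebra_simps)
  then have "g - \<sigma> * (-1)^L * u L = - D * (g - \<sigma> * (-1)^(Suc L) * u (Suc L))"
    using g by (simp add: \<sigma> algebra_simps flip: power_add)
  then show ?case using Suc by simp
qed simp

lemma alternating_run:
  fixes r :: "nat \<Rightarrow> int"
  assumes "\<And>k. Suc k < L \<Longrightarrow> r (Suc k) = - r k"
  shows "k < L \<Longrightarrow> r k = r 0 * (-1)^k"
proof (induction k)
  case (Suc k)
  then show ?case using assms[of k] by simp
qed simp

text \<open>Only the odd digits are left; \<open>U\<close> and \<open>T\<close> are right and left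
  values divided by \<open>\<beta>\<close>, both with the contraction factor \<open>D\<close>. The
  threshold is the limit value itself, so zero digits can be controlled only by comparing
  deviations. In \<open>22/10\<close>, the digit contributes 2 and all further digits at most
  1/5.\<close>

locale zseq =
  fixes e B D g :: real and r :: "nat \<Rightarrow> int" and U T :: "nat \<Rightarrow> real"
  assumes e: "0 < e" "e \<le> 2615/10000" and B: "0 < B" "B \<le> 1744/10000" and D: "D = e * B"
    and g_def: "g = 2 / (1 + D)"
    and U: "\<And>i. U i = r i + D * U (Suc i)" and T: "\<And>i. T (Suc i) = r i + D * T i"
    and ev: "\<And>i. even (r i)" and r2: "\<And>i. \<bar>r i\<bar> \<le> 2"
    and U_le: "\<And>i. \<bar>U i\<bar> \<le> 22/10" and T_le: "\<And>i. \<bar>T i\<bar> \<le> 22/10"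
    and good1: "\<And>i. good e B ((1 - e + D^2*g) * (1 - B - B*g)) (D * U i) (B * T i)"
    and good2: "\<And>i. good e B ((1 - e + D^2*g) * (1 - B - B*g)) (D * T i) (B * U i)"
begin

definition E :: real where "E = 1 - e + D^2*g"
definition F :: real where "F = 1 - B - B*g"

lemma neg: "zseq e B D g (\<lambda>i. - r i) (\<lambda>i. - U i) (\<lambda>i. - T i)"
proof
  show "- U i = real_of_int (- r i) + D * - U (Suc i)" for i using U[of i] by simp
  show "- T (Suc i) = real_of_int (- r i) + D * - T i" for i using T[of i] by simp
  show "good e B ((1 - e + D^2*g) * (1 - B - B*g)) (D * - U i) (B * - T i)" for i
    using good_minus[OF good1[of i]] by simp
  show "good e B ((1 - e + D^2*g) * (1 - B - B*g)) (D * - T i) (B * - U i)" for i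
    using good_minus[OF good2[of i]] by simp
qed (use e B D g_def ev r2 U_le T_le in auto)

text \<open>The comparison of \<open>B * E\<close> with \<open>F\<close> near the end says that two
  deviations that differ by a factor \<open>D^2\<close> cannot balance; \<open>run_compare\<close>
  rests on it.\<close>

lemma cst:
  shows "0 < D" "D \<le> 46/1000" "19/10 \<le> g" "g \<le> 2" "g = 2 - D * g"
  "4768/10000 \<le> F" "F \<le> 1" "7385/10000 \<le> E" "E \<le> 1" "D^2 * F < B * E"
  "B * (E * (g + 22/10 * D)) \<le> F * (g - 22/10 * D)" "D^2 \<le> 22/10000"
proof -
  show D0: "0 < D" using e B by (simp add: D)
  have "D \<le> 2615/10000 * (1744/10000)" unfolding D using e B by (intro mult_mono) auto
  then show D1: "D \<le> 46/1000" by simp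
  show g: "19/10 \<le> g" "g \<le> 2" "g = 2 - D * g" using D0 D1 by (simp_all add: g_def field_simps)
  have Bg: "0 \<le> B * g" "B * g \<le> B * 2" using B g by (auto intro!: mult_left_mono)
  show F: "4768/10000 \<le> F" "F \<le> 1" unfolding F_def using Bg B by linarith+
  have "D * D \<le> D * (46/1000)" using D0 D1 by (intro mult_left_mono) auto
  then show DD: "D^2 \<le> 22/10000" using D1 by (simp add: power2_eq_square)
  have "D * D \<le> e * (1744/10000) * (46/1000)" unfolding D using e B D1[unfolded D] by (intro mult_mono) auto
  then have D2: "D^2 \<le> e * (1/100)" using e by (simp add: power2_eq_square)
  have "D^2 * g \<le> D^2 * 2" "0 \<le> D^2 * g" using g by (auto intro!: mult_left_mono)
  then show E: "7385/10000 \<le> E" "E \<le> 1" unfolding E_def using e D2 by linarith+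
  have "D^2 = B * (e * D)" by (simp add: D power2_eq_square)
  also have "\<dots> \<le> B * (1 * (46/1000))" using e B D0 D1 by (intro mult_left_mono mult_mono) auto
  finally have "D^2 * F \<le> B * (46/1000) * 1" using F B by (intro mult_mono) auto
  also have "\<dots> < B * E" using B E by simp
  finally show "D^2 * F < B * E" .
  have "B * (E * (g + 22/10 * D)) \<le> 1744/10000 * (1 * (22/10))" using B E g D0 D1 by (intro mult_mono) auto
  also have "\<dots> \<le> 4768/10000 * (17/10)" by simp
  also have "\<dots> \<le> F * (g - 22/10 * D)" using F g D1 by (intro mult_mono) auto
  finally show "B * (E * (g + 22/10 * D)) \<le> F * (g - 22/10 * D)" .
qed

lemma EF_ge: "(1 - e) * (1 - 3 * B) \<le> E * F"
  unfolding E_def F_def using cst(4,7) e B mult_left_mono[OF cst(4), of B] cst(3)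
  by (intro mult_mono) auto

lemma EF_pos: "0 \<le> E * F" using cst by simp

lemma g1: "good e B (E * F) (D * U i) (B * T i)" and g2: "good e B (E * F) (D * T i) (B * U i)"
  using good1 good2 unfolding E_def F_def by blast+

lemma DU: "\<bar>D * U i\<bar> \<le> 22/10 * D" and DT: "\<bar>D * T i\<bar> \<le> 22/10 * D"
  using U_le[of i] T_le[of i] cst(1) by (simp_all add: abs_mult)

text \<open>Between two digits 2 both \<open>U\<close> and \<open>T\<close> are at least
  \<open>2 - 22/10 * D\<close>, so both factors of the second product shrink, and it falls below
  even \<open>(1 - e) * (1 - 3 * B)\<close>.\<close>

lemma no_repeat: "\<not> (r i = 2 \<and> r (Suc i) = 2)"
proof
  assume *: "r i = 2 \<and> r (Suc i) = 2"
  have u: "2 - 22/10 * D \<le> U (Suc i)" using U[of "Suc i"] DU[of "Suc (Suc i)"] * by auto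
  have t: "2 - 22/10 * D \<le> T (Suc i)" using T[of i] DT[of i] * by auto
  have x: "- (D * U (Suc i)) \<le> - (D * (2 - 22/10 * D))" using mult_left_mono[OF u, of D] cst(1) by simp
  have y: "B * (2 - 22/10 * D) \<le> B * T (Suc i)" using mult_left_mono[OF t, of B] B by simp
  from good_f4[OF g1 EF_pos x y]
  have "E * F < (1 - e - D * (2 - 22/10 * D)) * (1 - B - B * (2 - 22/10 * D))" by simp
  also have "\<dots> = (1 - e) * (1 - 3 * B) + D * (22/10 * B * (1 - e) - (2 - 22/10 * D) * (1 - 3 * B + 22/10 * (B * D)))"
    by (simp add: field_simps)
  also have "\<dots> \<le> (1 - e) * (1 - 3 * B) + 0"
  proof (intro add_left_mono mult_nonneg_nonpos)
    have "22/10 * B * (1 - e) \<le> 22/10 * (1744/10000) * 1" using B e by (intro mult_mono) auto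
    also have "\<dots> \<le> 18/10 * (4768/10000)" by simp
    also have "\<dots> \<le> (2 - 22/10 * D) * (1 - 3 * B + 22/10 * (B * D))"
    proof (rule mult_mono)
      have "0 \<le> B * D" using B cst(1) by simp
      then show "4768/10000 \<le> 1 - 3 * B + 22/10 * (B * D)" using B by linarith
    qed (use cst(2) in auto)
    finally show "22/10 * B * (1 - e) - (2 - 22/10 * D) * (1 - 3 * B + 22/10 * (B * D)) \<le> 0" by simp
  qed (use cst(1) in simp)
  finally show False using EF_ge by simp
qed

lemma r_cases: "r i = 0 \<or> r i = 2 \<or> r i = - 2"
  using ev[of i] r2[of i] even_less_4 by fastforce

lemma alternate: "r i \<noteq> 0 \<Longrightarrow> r (Suc i) \<noteq> 0 \<Longrightarrow> r (Suc i) = - r i"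
proof -
  interpret n: zseq e B D g "\<lambda>i. - r i" "\<lambda>i. - U i" "\<lambda>i. - T i" by (rule neg)
  show "r i \<noteq> 0 \<Longrightarrow> r (Suc i) \<noteq> 0 \<Longrightarrow> r (Suc i) = - r i"
    using no_repeat[of i] n.no_repeat[of i] r_cases[of i] r_cases[of "Suc i"] by auto
qed

text \<open>The run ends at a zero, where the value is at most \<open>22/10 * D\<close>, so the
  factor \<open>\<theta>\<close> left over from \<open>run_error\<close> is close to
  \<open>g\<close>. For an empty run either sign \<open>\<sigma>\<close> is allowed.\<close>

lemma forward_run:
  assumes "n < m" "r m = 0" "\<And>k. n < k \<Longrightarrow> k < m \<Longrightarrow> r k \<noteq> 0" and \<sigma>: "\<sigma> = 1 \<or> \<sigma> = - 1" "Suc n < m \<Longrightarrow> r (Suc n) = 2 * \<sigma>"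
  shows "\<exists>\<theta>. g - real_of_int \<sigma> * U (Suc n) = (- D)^(m - Suc n) * \<theta> \<and> g - 22/10 * D \<le> \<theta> \<and> \<theta> \<le> g + 22/10 * D"
proof -
  define L where "L = m - Suc n"
  have mL: "Suc n + L = m" using assms(1) by (simp add: L_def)
  have run: "r (Suc n + k) = 2 * \<sigma> * (-1)^k" if k: "k < L" for k
  proof -
    have "r (Suc n + k) = r (Suc n + 0) * (-1)^k"
      by (rule alternating_run[of L "\<lambda>k. r (Suc n + k)"]) (use alternate assms(3) mL k in auto)
    then show ?thesis using \<sigma>(2) k mL by simp
  qed
  have "g - \<sigma> * U (Suc n + 0) = (- D)^L * (g - real_of_int \<sigma> * (-1)^L * U (Suc n + L))"
    by (rule run_error[of L "\<lambda>k. U (Suc n + k)" "\<lambda>k. real_of_int (r (Suc n + k))"])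
      (use run \<sigma> cst(5) U[of "Suc n + _"] in auto)
  moreover have "\<bar>real_of_int \<sigma> * (-1)^L * U m\<bar> \<le> 22/10 * D"
    using U[of m] DU[of "Suc m"] assms(2) \<sigma>(1) by (auto simp: abs_mult power_abs)
  ultimately show ?thesis using mL unfolding L_def[symmetric]
    by (intro exI[of _ "g - real_of_int \<sigma> * (-1)^L * U m"]) (auto simp: abs_le_iff)
qed

lemma backward_run:
  assumes "p < n" "r p = 0" "\<And>k. p < k \<Longrightarrow> k < n \<Longrightarrow> r k \<noteq> 0" and \<sigma>: "\<sigma> = 1 \<or> \<sigma> = - 1" "Suc p < n \<Longrightarrow> r (n - 1) = 2 * \<sigma>"
  shows "\<exists>\<theta>. g - real_of_int \<sigma> * T n = (- D)^(n - Suc p) * \<theta> \<and> g - 22/10 * D \<le> \<theta> \<and> \<theta> \<le> g + 22/10 * D"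
proof -
  define L where "L = n - Suc p"
  have nL: "n - L = Suc p" "n = Suc p + L" using assms(1) by (simp_all add: L_def)
  have run: "r (n - Suc k) = 2 * \<sigma> * (-1)^k" if k: "k < L" for k
  proof -
    have "r (n - Suc k) = r (n - Suc 0) * (-1)^k"
    proof (rule alternating_run[of L "\<lambda>k. r (n - Suc k)"])
      fix k assume k: "Suc k < L"
      have "n - Suc k = Suc (n - Suc (Suc k))" using k nL by simp
      then have "r (n - Suc k) = - r (n - Suc (Suc k))" using alternate[of "n - Suc (Suc k)"] assms(3) nL k by auto
      then show "r (n - Suc (Suc k)) = - r (n - Suc k)" by simp
    qed (rule k)
    then show ?thesis using \<sigma>(2) k nL by simp
  qed
  have "g - \<sigma> * T (n - 0) = (- D)^L * (g - real_of_int \<sigma> * (-1)^L * T (n - L))"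
  proof (rule run_error[of L "\<lambda>k. T (n - k)" "\<lambda>k. real_of_int (r (n - Suc k))"])
    fix k assume k: "k < L"
    have "n - k = Suc (n - Suc k)" using k nL by simp
    then show "T (n - k) = real_of_int (r (n - Suc k)) + D * T (n - Suc k)" using T[of "n - Suc k"] by simp
    show "real_of_int (r (n - Suc k)) = 2 * real_of_int \<sigma> * (-1)^k" using run[OF k] by simp
  qed (use \<sigma> cst(5) in auto)
  moreover have "\<bar>real_of_int \<sigma> * (-1)^L * T (Suc p)\<bar> \<le> 22/10 * D"
    using T[of p] DT[of p] assms(2) \<sigma>(1) by (auto simp: abs_mult power_abs)
  ultimately show ?thesis using nL unfolding L_def[symmetric]
    by (intro exI[of _ "g - real_of_int \<sigma> * (-1)^L * T (Suc p)"]) (auto simp: abs_le_iff)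
qed

text \<open>\<open>z\<close> and \<open>w\<close> are the deviations of the two sides of a zero
  digit from the infinite alternating value, and \<open>E * F\<close> is the case where both vanish.
  The inequalities force both to be positive; then the term with \<open>z * w\<close> may be
  dropped, and what remains bounds each deviation by a multiple of the other.\<close>

lemma zero_errors:
  assumes 1: "E * F < (E - D^2 * z) * (F + B * w)" and 2: "E * F < (E - D^2 * w) * (F + B * z)"
    and zw: "\<bar>z\<bar> \<le> 5" "\<bar>w\<bar> \<le> 5"
  shows "0 < w" "0 < z" "D^2 * (z * F) < B * (w * E)" "D^2 * (w * F) < B * (z * E)"
proof -
  have *: "0 < w" if 1: "E * F < (E - D^2 * z) * (F + B * w)" and 2: "E * F < (E - D^2 * w) * (F + B * z)"
    and zw: "\<bar>z\<bar> \<le> 5" "\<bar>w\<bar> \<le> 5" for z w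
  proof (rule ccontr)
    assume "\<not> 0 < w"
    then have w: "w \<le> 0" by simp
    show False
    proof (cases "0 \<le> z")
      case True
      have "D^2 * z \<le> 22/10000 * 5" using cst zw True by (intro mult_mono) auto
      then have "0 \<le> E - D^2 * z" using cst by simp
      moreover have "F + B * w \<le> F" using w B by (simp add: mult_nonneg_nonpos)
      ultimately have "(E - D^2 * z) * (F + B * w) \<le> (E - D^2 * z) * F" by (rule mult_left_mono[rotated])
      also have "\<dots> \<le> E * F" using True cst by (intro mult_right_mono) auto
      finally show False using 1 by simp
    next
      case False
      have zw0: "0 \<le> D^2 * B * (z * w)" using False w B by (intro mult_nonneg_nonneg mult_nonpos_nonpos) auto
      have "D^2 * F * (z + w) < B * E * (z + w)" using 1 2 zw0 by (simp add: algebra_simps)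
      moreover have "z + w < 0" using False w by simp
      ultimately show False using cst(10) by (simp add: mult_less_cancel_right)
    qed
  qed
  show w: "0 < w" using *[OF 1 2 zw] .
  show z: "0 < z" using *[OF 2 1 zw(2) zw(1)] .
  have "0 < D^2 * B * (z * w)" using z w B cst(1) by simp
  then show "D^2 * (z * F) < B * (w * E)" "D^2 * (w * F) < B * (z * E)" using 1 2 by (simp_all add: algebra_simps)
qed

lemma power_neg_pos:
  assumes "0 < (- D)^L * \<theta>" "g - 22/10 * D \<le> \<theta>"
  shows "even L" "(- D)^L * \<theta> = D^L * \<theta>"
proof -
  have \<theta>: "0 < \<theta>" using assms(2) cst by simp
  show "even L"
  proof (rule ccontr)
    assume "odd L"
    then have "(- D)^L * \<theta> = - (D^L * \<theta>)" by (simp add: power_minus_odd)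
    moreover have "0 < D^L * \<theta>" using \<theta> cst(1) by simp
    ultimately show False using assms(1) by linarith
  qed
  then show "(- D)^L * \<theta> = D^L * \<theta>" by simp
qed

text \<open>The lengths have the same parity, so a longer run has at least two more digits and its
  deviation is smaller by \<open>D^2\<close>, which \<open>cst\<close> does not permit.\<close>

lemma run_compare:
  assumes "even L" "even L'" "D^2 * ((D^L * \<theta>) * F) < B * ((D^L' * \<theta>') * E)"
    and \<theta>: "g - 22/10 * D \<le> \<theta>" "\<theta>' \<le> g + 22/10 * D"
  shows "L' \<le> L"
proof (rule ccontr)
  assume "\<not> L' \<le> L"
  then obtain k where k: "L' = Suc (Suc (L + k))"
    using assms(1,2) by (metis even_Suc less_iff_Suc_add not_le add_Suc_right odd_add nat_neq_iff add_0_right old.nat.exhaust)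
  have g: "0 \<le> g + 22/10 * D" using cst by simp
  have "D^L' \<le> D^(Suc (Suc L))" using cst(1,2) k by (intro power_decreasing) auto
  then have p: "D^L' \<le> D^2 * D^L" by (simp add: power2_eq_square mult.assoc)
  have "D^L' * \<theta>' \<le> D^L' * (g + 22/10 * D)" using \<theta>(2) cst(1) by (intro mult_left_mono) auto
  also have "\<dots> \<le> D^2 * D^L * (g + 22/10 * D)" using p g by (rule mult_right_mono)
  finally have "B * ((D^L' * \<theta>') * E) \<le> B * ((D^2 * D^L * (g + 22/10 * D)) * E)"
    using B cst by (intro mult_left_mono mult_right_mono) auto
  also have "\<dots> = D^2 * D^L * (B * (E * (g + 22/10 * D)))" by (simp add: algebra_simps)
  also have "\<dots> \<le> D^2 * D^L * (F * (g - 22/10 * D))" using cst by (intro mult_left_mono) auto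
  also have "\<dots> \<le> D^2 * D^L * (F * \<theta>)" using cst \<theta>(1) by (intro mult_left_mono) auto
  also have "\<dots> = D^2 * ((D^L * \<theta>) * F)" by (simp add: algebra_simps)
  finally show False using assms(3) by simp
qed

lemma zero_forms:
  assumes "r n = 0"
  shows "E * F < (1 - e - D^2 * T n) * (1 - B - B * U (Suc n))" "E * F < (1 - e + D^2 * U (Suc n)) * (1 - B + B * T n)"
    "E * F < (1 - e - D^2 * U (Suc n)) * (1 - B - B * T n)"
proof -
  have "D * U n = D^2 * U (Suc n)" "D * T (Suc n) = D^2 * T n" using U[of n] T[of n] assms by (simp_all add: power2_eq_square)
  then show "E * F < (1 - e - D^2 * T n) * (1 - B - B * U (Suc n))" "E * F < (1 - e + D^2 * U (Suc n)) * (1 - B + B * T n)"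
    "E * F < (1 - e - D^2 * U (Suc n)) * (1 - B - B * T n)"
    using g2[of "Suc n"] g1[of n] unfolding good_def by auto
qed

text \<open>The sign is normalised so that 2 follows the zero, or -2 precedes it if nothing follows.
  A 2 on both sides would demand a deviation on the left as large as that of an empty run. With
  opposite signs \<open>zero_errors\<close> and \<open>run_compare\<close> apply in both directions
  and give equal lengths; positivity of the deviations makes these even.\<close>

lemma zero_pos:
  assumes p: "p < n" "r p = 0" "\<And>k. p < k \<Longrightarrow> k < n \<Longrightarrow> r k \<noteq> 0"
    and m: "n < m" "r m = 0" "\<And>k. n < k \<Longrightarrow> k < m \<Longrightarrow> r k \<noteq> 0" and n: "r n = 0"
    and f: "Suc n < m \<Longrightarrow> r (Suc n) = 2" and b: "m = Suc n \<Longrightarrow> Suc p < n \<Longrightarrow> r (n - 1) = - 2"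
  shows "m - n = n - p \<and> even (n - Suc p) \<and> (Suc p < n \<longrightarrow> r (n - 1) = - 2)"
proof -
  obtain \<theta> where \<theta>: "g - 1 * U (Suc n) = (- D)^(m - Suc n) * \<theta>" "g - 22/10 * D \<le> \<theta>" "\<theta> \<le> g + 22/10 * D"
    using forward_run[OF m, of 1] f by auto
  define z where "z = g - U (Suc n)"
  have z: "z = (- D)^(m - Suc n) * \<theta>" "U (Suc n) = g - z" using \<theta>(1) by (simp_all add: z_def)
  have z5: "\<bar>z\<bar> \<le> 5" using U_le[of "Suc n"] cst unfolding z_def by simp
  have neg_two: "r (n - 1) = - 2" if pn: "Suc p < n"
  proof (rule ccontr)
    assume "r (n - 1) \<noteq> - 2"
    moreover have "r (n - 1) \<noteq> 0" using p(3)[of "n - 1"] pn by simp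
    ultimately have r2: "r (n - 1) = 2" using r_cases by blast
    then have mn: "Suc n < m" using b pn m(1) by fastforce
    obtain \<theta>' where \<theta>': "g - 1 * T n = (- D)^(n - Suc p) * \<theta>'" "g - 22/10 * D \<le> \<theta>'" "\<theta>' \<le> g + 22/10 * D"
      using backward_run[OF p, of 1] r2 by auto
    define w where "w = g - T n"
    have w: "w = (- D)^(n - Suc p) * \<theta>'" using \<theta>'(1) by (simp add: w_def)
    have "U (Suc n) \<ge> 2 - 22/10 * D" using U[of "Suc n"] f[OF mn] DU[of "Suc (Suc n)"] by auto
    then have U1: "1 \<le> U (Suc n)" using cst by simp
    have "E * F < (E - D^2 * (g + U (Suc n))) * (F + B * w)"
      using zero_forms(3)[OF n] unfolding E_def F_def w_def by (simp add: algebra_simps)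
    then have less: "D^2 * ((g + U (Suc n)) * (F + B * w)) < B * (w * E)" by (simp add: algebra_simps)
    have "\<bar>B * w\<bar> \<le> 1744/10000 * (22/10 + 0)" if "w \<le> 0"
    proof -
      have "\<bar>w\<bar> \<le> 22/10" using that T_le[of n] cst unfolding w_def by simp
      then show ?thesis using B unfolding abs_mult by (intro mult_mono) auto
    qed
    then have Fw: "0 \<le> F + B * w" using cst B by (cases "w \<le> 0") (auto simp: abs_le_iff)
    have "0 < w"
    proof (rule ccontr)
      assume "\<not> 0 < w"
      then have "B * (w * E) \<le> 0" using B cst by (simp add: mult_nonneg_nonpos mult_nonpos_nonneg)
      moreover have "0 \<le> D^2 * ((g + U (Suc n)) * (F + B * w))" using Fw U1 cst by simp
      ultimately show False using less by simp
    qed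
    then have ev: "even (n - Suc p)" and wD: "w = D^(n - Suc p) * \<theta>'" using power_neg_pos[of "n - Suc p" \<theta>'] \<theta>'(2) unfolding w by auto
    have "D^2 * ((D^0 * (g - 22/10*D)) * F) \<le> D^2 * ((g + U (Suc n)) * (F + B * w))"
    proof (intro mult_left_mono mult_mono)
      show "D^0 * (g - 22/10*D) \<le> g + U (Suc n)" using U1 cst(1) by simp
      show "F \<le> F + B * w" using \<open>0 < w\<close> B by simp
    qed (use U1 cst in auto)
    also have "\<dots> < B * ((D^(n - Suc p) * \<theta>') * E)" using less wD by simp
    finally have "n - Suc p \<le> 0" using run_compare[of 0 "n - Suc p" "g - 22/10*D" \<theta>'] ev \<theta>'(3) by simp
    then show False using pn by simp
  qed
  obtain \<theta>' where \<theta>': "g - (- 1) * T n = (- D)^(n - Suc p) * \<theta>'" "g - 22/10 * D \<le> \<theta>'" "\<theta>' \<le> g + 22/10 * D"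
    using backward_run[OF p, of "- 1"] neg_two by auto
  define w where "w = g + T n"
  have w: "w = (- D)^(n - Suc p) * \<theta>'" "T n = - g + w" using \<theta>'(1) by (simp_all add: w_def)
  have w5: "\<bar>w\<bar> \<le> 5" using T_le[of n] cst unfolding w_def by simp
  have 1: "E * F < (E - D^2 * z) * (F + B * w)" using zero_forms(2)[OF n] unfolding z(2) w(2) E_def F_def by (simp add: algebra_simps)
  have 2: "E * F < (E - D^2 * w) * (F + B * z)" using zero_forms(1)[OF n] unfolding z(2) w(2) E_def F_def by (simp add: algebra_simps)
  note ze = zero_errors[OF 1 2 z5 w5]
  have wL: "even (n - Suc p)" "w = D^(n - Suc p) * \<theta>'" using power_neg_pos[of "n - Suc p" \<theta>'] ze(1) \<theta>'(2) w(1) by auto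
  have zL: "even (m - Suc n)" "z = D^(m - Suc n) * \<theta>" using power_neg_pos[of "m - Suc n" \<theta>] ze(2) \<theta>(2) z(1) by auto
  have "n - Suc p \<le> m - Suc n" using run_compare[OF zL(1) wL(1) _ \<theta>(2) \<theta>'(3)] ze(3) unfolding zL(2) wL(2) by blast
  moreover have "m - Suc n \<le> n - Suc p" using run_compare[OF wL(1) zL(1) _ \<theta>'(2) \<theta>(3)] ze(4) unfolding zL(2) wL(2) by blast
  ultimately show ?thesis using wL(1) neg_two p(1) m(1) by auto
qed

lemma zero_step:
  assumes p: "p < n" "r p = 0" "\<And>k. p < k \<Longrightarrow> k < n \<Longrightarrow> r k \<noteq> 0"
    and m: "n < m" "r m = 0" "\<And>k. n < k \<Longrightarrow> k < m \<Longrightarrow> r k \<noteq> 0" and n: "r n = 0"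
  shows "m - n = n - p" "even (n - Suc p)" "Suc p < n \<Longrightarrow> r (Suc n) = - r (n - 1)"
proof -
  interpret n: zseq e B D g "\<lambda>i. - r i" "\<lambda>i. - U i" "\<lambda>i. - T i" by (rule neg)
  have f: "r (Suc n) = 2 \<or> r (Suc n) = - 2" if "Suc n < m" using m(3)[of "Suc n"] r_cases[of "Suc n"] that by simp
  have b: "r (n - 1) = 2 \<or> r (n - 1) = - 2" if "Suc p < n" using p(3)[of "n - 1"] r_cases[of "n - 1"] that by simp
  consider (pos) "Suc n < m \<Longrightarrow> r (Suc n) = 2" "m = Suc n \<Longrightarrow> Suc p < n \<Longrightarrow> r (n - 1) = - 2"
    | (neg) "Suc n < m \<Longrightarrow> - r (Suc n) = 2" "m = Suc n \<Longrightarrow> Suc p < n \<Longrightarrow> - r (n - 1) = - 2"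
    using f b by fastforce
  then have "m - n = n - p \<and> even (n - Suc p) \<and> (Suc p < n \<longrightarrow> r (Suc n) = - r (n - 1))"
  proof cases
    case pos
    have z: "m - n = n - p \<and> even (n - Suc p) \<and> (Suc p < n \<longrightarrow> r (n - 1) = - 2)"
      by (rule zero_pos[OF p m n]) (use pos in auto)
    then have "m - n = n - p" by blast
    then have "Suc p < n \<Longrightarrow> Suc n < m" by arith
    then show ?thesis using z pos(1) by auto
  next
    case neg
    have z: "m - n = n - p \<and> even (n - Suc p) \<and> (Suc p < n \<longrightarrow> - r (n - 1) = - 2)"
      by (rule n.zero_pos) (use p m n neg in auto)
    then have "m - n = n - p" by blast
    then have "Suc p < n \<Longrightarrow> Suc n < m" by arith
    then show ?thesis using z neg(1) by auto
  qed
  then show "m - n = n - p" "even (n - Suc p)" "Suc p < n \<Longrightarrow> r (Suc n) = - r (n - 1)" by blast+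
qed

lemma next_zero:
  assumes "\<forall>N. \<exists>n\<ge>N. r n = 0"
  shows "\<exists>m. n < m \<and> r m = 0 \<and> (\<forall>k. n < k \<longrightarrow> k < m \<longrightarrow> r k \<noteq> 0)"
proof -
  have ex: "\<exists>m. n < m \<and> r m = 0" using assms by (meson Suc_le_lessD)
  show ?thesis
    using LeastI_ex[OF ex] not_less_Least[of _ "\<lambda>m. n < m \<and> r m = 0"]
    by (intro exI[of _ "LEAST m. n < m \<and> r m = 0"]) blast
qed

text \<open>All runs between zeros have one even length \<open>L\<close>. An even run ends with the
  sign opposite to its first, and the sign flips once more across the zero, so all runs start alike
  and the sequence is periodic. \<open>L = 0\<close> is the zero sequence.\<close>

theorem pattern:
  "(\<exists>N \<sigma>. (\<sigma> = 1 \<or> \<sigma> = - 1) \<and> (\<forall>k. r (N + k) = 2 * \<sigma> * (-1)^k)) \<or>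
   (\<exists>N \<sigma> L. (\<sigma> = 1 \<or> \<sigma> = - 1) \<and> even L \<and>
      (\<forall>q k. k \<le> L \<longrightarrow> r (N + q * Suc L + k) = (if k = 0 then 0 else 2 * \<sigma> * (-1)^(k - 1))))"
proof (cases "\<forall>N. \<exists>n\<ge>N. r n = 0")
  case False
  then obtain N where N: "\<And>n. n \<ge> N \<Longrightarrow> r n \<noteq> 0" by blast
  have "r (N + k) = r (N + 0) * (-1)^k" for k
    by (rule alternating_run[of "Suc k" "\<lambda>k. r (N + k)"]) (use alternate N in auto)
  moreover obtain \<sigma> where "r N = 2 * \<sigma>" "\<sigma> = 1 \<or> \<sigma> = - 1" using N[of N] r_cases[of N] by fastforce
  ultimately show ?thesis by (intro disjI1 exI[of _ N] exI[of _ \<sigma>]) simp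
next
  case True
  obtain p where p: "r p = 0" using True by blast
  obtain n where n: "p < n" "r n = 0" "\<And>k. p < k \<Longrightarrow> k < n \<Longrightarrow> r k \<noteq> 0" using next_zero[OF True, of p] by blast
  define L where "L = n - Suc p"
  have nL: "n = p + Suc L" using n(1) by (simp add: L_def)
  have evL: "even L"
  proof -
    obtain m where m: "n < m" "r m = 0" "\<And>k. n < k \<Longrightarrow> k < m \<Longrightarrow> r k \<noteq> 0" using next_zero[OF True, of n] by blast
    show ?thesis using zero_step(2)[OF n(1) p n(3) m n(2)] unfolding L_def .
  qed
  define Z where "Z q \<longleftrightarrow> r (p + q * Suc L) = 0 \<and> r (p + Suc q * Suc L) = 0 \<and>
      (\<forall>k. p + q * Suc L < k \<longrightarrow> k < p + Suc q * Suc L \<longrightarrow> r k \<noteq> 0) \<and>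
      (0 < L \<longrightarrow> r (Suc (p + q * Suc L)) = r (Suc p))" for q
  have run: "r (Suc (p + q * Suc L) + k) = r (Suc p) * (-1)^k" if Z: "Z q" and k: "k < L" for q k
  proof -
    have "r (Suc (p + q * Suc L) + k) = r (Suc (p + q * Suc L) + 0) * (-1)^k"
      by (rule alternating_run[of L "\<lambda>k. r (Suc (p + q * Suc L) + k)"]) (use alternate Z k in \<open>auto simp: Z_def\<close>)
    then show ?thesis using Z k by (simp add: Z_def)
  qed
  have Z: "Z q" for q
  proof (induction q)
    case 0
    show ?case unfolding Z_def using p n nL by auto
  next
    case (Suc q)
    let ?p = "p + q * Suc L" let ?n = "p + Suc q * Suc L"
    have z: "?p < ?n" "r ?p = 0" "\<And>k. ?p < k \<Longrightarrow> k < ?n \<Longrightarrow> r k \<noteq> 0" "r ?n = 0" using Suc unfolding Z_def by auto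
    obtain m where m: "?n < m" "r m = 0" "\<And>k. ?n < k \<Longrightarrow> k < m \<Longrightarrow> r k \<noteq> 0" using next_zero[OF True, of ?n] by blast
    note zs = zero_step[OF z(1-3) m z(4)]
    have meq: "m = p + Suc (Suc q) * Suc L" using zs(1) m(1) by simp
    have "r (Suc ?n) = r (Suc p)" if "0 < L"
    proof -
      have "r (Suc ?n) = - r (?n - 1)" using zs(3) that by simp
      also have "?n - 1 = Suc ?p + (L - 1)" using that by simp
      also have "r (Suc ?p + (L - 1)) = r (Suc p) * (-1)^(L - 1)" using that by (intro run Suc) simp
      also have "(-1)^(L - 1) = (- 1::int)" using evL that by (simp add: power_minus_odd)
      finally show ?thesis by simp
    qed
    then show ?case unfolding Z_def using z(4) m meq by auto
  qed
  obtain \<sigma> where \<sigma>: "\<sigma> = 1 \<or> \<sigma> = - 1" "0 < L \<Longrightarrow> r (Suc p) = 2 * \<sigma>"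
  proof (cases "0 < L")
    case True
    then have "r (Suc p) = 2 \<or> r (Suc p) = - 2" using n(3)[of "Suc p"] nL r_cases[of "Suc p"] by simp
    then show ?thesis using that[of 1] that[of "- 1"] by auto
  qed (use that[of 1] in auto)
  have "r (p + q * Suc L + k) = (if k = 0 then 0 else 2 * \<sigma> * (-1)^(k - 1))" if k: "k \<le> L" for q k
  proof (cases k)
    case 0
    then show ?thesis using Z[of q] unfolding Z_def by simp
  next
    case (Suc j)
    then show ?thesis using run[OF Z, of j q] \<sigma>(2) k by simp
  qed
  then have "\<forall>q k. k \<le> L \<longrightarrow> r (p + q * Suc L + k) = (if k = 0 then 0 else 2 * \<sigma> * (-1)^(k - 1))"
    by (intro allI impI)
  with \<sigma>(1) evL show ?thesis
    by (intro disjI2) (rule exI[of _ p], rule exI[of _ \<sigma>], rule exI[of _ L], rule conjI, assumption, rule conjI, assumption+)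
qed

end

section \<open>Periodic words\<close>

context even_pair
begin

lemma D_eq: "\<eta> * \<beta> = D" by (simp add: DD_def)

text \<open>\<open>\<eta> \<le> c\<close> is what \<open>Sgt_interior\<close> needs in both
  parities. Cells are good only from some position \<open>K\<close> on; discarding
  \<open>2 * K\<close> positions keeps the parity and, by the unit \<open>D\<close>, the
  value.\<close>

lemma blocks_exist:
  assumes nm: "\<not> member \<gamma>" and c: "ereal c < Ms \<gamma>" "\<eta> \<le> c"
  shows "\<exists>c' t x y. c < c' \<and> chain t x y \<and> \<not> member (gam (x 0)) \<and> Ms (gam (x 0)) = Ms \<gamma> \<and> (\<forall>j. \<bar>x j\<bar> \<le> 2) \<and>
    blocks \<eta> \<beta> c' (\<lambda>i. t (2*i)) (\<lambda>i. t (Suc (2*i))) (\<lambda>i. x (2*i)) (\<lambda>i. x (Suc (2*i))) (\<lambda>i. y (2*i)) (\<lambda>i. y (Suc (2*i)))"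
proof -
  obtain t x y P \<mu> where ch: "chain t x y" and rg: "in_range x y" and l: "lat P \<mu>" and g: "gam (x 0) = \<gamma> + \<mu>"
    by (rule chain_exists)
  have nm': "\<not> member (gam (x 0))" using nm member_shift[OF l] g by simp
  have Mg: "Ms (gam (x 0)) = Ms \<gamma>" unfolding g by (rule Ms_lat_shift[OF nm l])
  have x2: "\<bar>x j\<bar> \<le> 2" for j
    using rg[unfolded in_range_def, rule_format, of j] al_small[of j] al_pos[of j] by linarith
  obtain c' K where c': "c < c'" and K: "\<And>j. K \<le> j \<Longrightarrow> Sgt (al j) (al (Suc j)) c' (x j) (y j)"
    using Sgt_eventually[OF ch nm' _ x2, of c] c(1) unfolding Mg by blast
  have gd: "good (al j) (al (Suc j)) c' (x j) (y j)" if "K \<le> j" for j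
  proof (rule Sgt_interior[OF K[OF that]])
    show "4 * (al j * al (Suc j)) \<le> c'"
    proof -
      have "al j * al (Suc j) \<le> \<eta> * (1/4)"
      proof -
        have "4 * \<beta> \<le> 1" using beta_small by simp
        then have "\<eta> * \<beta> \<le> \<eta> * (1/4)" using eta_pos by (intro mult_left_mono) auto
        then show ?thesis unfolding al_prod D_eq .
      qed
      then show ?thesis using c(2) c' by simp
    qed
    show "al j \<le> c'" "al (Suc j) \<le> c'" using al_le_eta[of j] al_le_eta[of "Suc j"] c(2) c' by linarith+
    show "al j < 1" "al (Suc j) < 1" using al_small[of j] al_small[of "Suc j"] by linarith+
    show "- 1 + al j \<le> x j" "x j \<le> 1 + al j" "- 1 + al (Suc j) \<le> y j" "y j \<le> 1 + al (Suc j)"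
      using rg unfolding in_range_def by blast+
  qed (rule al_pos)+
  define k where "k = K"
  let ?t = "\<lambda>j. t (j + 2*k)" and ?x = "\<lambda>j. x (j + 2*k)" and ?y = "\<lambda>j. y (j + 2*k)"
  have ch': "chain ?t ?x ?y" by (rule chain_shift[OF ch])
  have M': "\<not> member (gam (?x 0)) \<and> Ms (gam (?x 0)) = Ms \<gamma>"
    using Ms_chain_shift[OF ch nm', of k] Mg by simp
  have ale: "al (2*i) = \<eta>" "al (Suc (2*i)) = \<beta>" for i by (simp_all add: al_def)
  have bl: "blocks \<eta> \<beta> c' (\<lambda>i. ?t (2*i)) (\<lambda>i. ?t (Suc (2*i))) (\<lambda>i. ?x (2*i)) (\<lambda>i. ?x (Suc (2*i))) (\<lambda>i. ?y (2*i)) (\<lambda>i. ?y (Suc (2*i)))"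
    unfolding blocks_def
  proof (intro allI conjI)
    fix i
    show "even (?t (2*i))" "even (?t (Suc (2*i)))" using chainD(1)[OF ch] by blast+
    show "?x (2*i) = \<eta> * (real_of_int (?t (2*i)) + ?x (Suc (2*i)))" using chainD(2)[OF ch', of "2*i"] unfolding ale .
    show "?x (Suc (2*i)) = \<beta> * (real_of_int (?t (Suc (2*i))) + ?x (2 * Suc i))"
      using chainD(2)[OF ch', of "Suc (2*i)"] unfolding ale by simp
    show "?y (Suc (2*i)) = \<eta> * (real_of_int (?t (2*i)) + ?y (2*i))" using chainD(3)[OF ch', of "2*i"] unfolding ale .
    show "?y (2 * Suc i) = \<beta> * (real_of_int (?t (Suc (2*i))) + ?y (Suc (2*i)))"
      using chainD(3)[OF ch', of "Suc (2*i)"] unfolding ale by simp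
    show "good \<eta> \<beta> c' (?x (2*i)) (?y (2*i))" using gd[of "2*i + 2*k"] by (simp add: k_def al_def)
    show "good \<eta> \<beta> c' (?y (Suc (2*i))) (?x (Suc (2*i)))"
      using good_swap[OF gd[of "Suc (2*i) + 2*k"]] by (simp add: k_def al_def)
  qed
  show ?thesis
    by (rule exI[of _ c'], rule exI[of _ ?t], rule exI[of _ ?x], rule exI[of _ ?y]) (use c' ch' M' x2 bl in simp)
qed

definition weave :: "(nat \<Rightarrow> 'a) \<Rightarrow> (nat \<Rightarrow> 'a) \<Rightarrow> nat \<Rightarrow> 'a" where
  "weave f g j = (if even j then f (j div 2) else g (j div 2))"

lemma weave_simps [simp]: "weave f g (2*i) = f i" "weave f g (Suc (2*i)) = g i"
  by (simp_all add: weave_def)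

lemma weave_cases: "(\<And>i. Q (2*i)) \<Longrightarrow> (\<And>i. Q (Suc (2*i))) \<Longrightarrow> Q (j::nat)"
  by (metis oddE evenE Suc_eq_plus1)

text \<open>Equal digits from an even position on give equal right values there, and shifts by
  blocks do not change \<open>Ms\<close>; the global sign is absorbed by
  \<open>Ms_gam_minus\<close>.\<close>

lemma tail_value:
  assumes ch: "chain t x y" and nm: "\<not> member (gam (x 0))" and x: "\<And>j. \<bar>x j\<bar> \<le> B"
    and ch': "chain t' x' y'" and x': "\<And>j. \<bar>x' j\<bar> \<le> B'"
    and t: "(\<forall>j. t (j + 2*k) = t' j) \<or> (\<forall>j. t (j + 2*k) = - t' j)"
  shows "Ms (gam (x 0)) = Ms (gam (x' 0))"
proof -
  note sh = chain_shift[OF ch, of k]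
  have M: "\<not> member (gam (x (2*k)))" "Ms (gam (x (2*k))) = Ms (gam (x 0))" using Ms_chain_shift[OF ch nm] by auto
  show ?thesis
  proof (cases "\<forall>j. t (j + 2*k) = t' j")
    case True
    have "x (0 + 2*k) = x' 0"
      by (rule forward_unique[of "\<lambda>j. x (j + 2*k)" t' B x' B'])
        (use chainD(2)[OF sh] chainD(2)[OF ch'] True x x' in metis)+
    then show ?thesis using M(2) by simp
  next
    case False
    then have n: "\<forall>j. t (j + 2*k) = - t' j" using t by blast
    note ch2 = chain_minus[OF ch']
    have x2: "\<bar>- x' j\<bar> \<le> B'" for j using x'[of j] by simp
    have "x (0 + 2*k) = - x' 0"
      by (rule forward_unique[of "\<lambda>j. x (j + 2*k)" "\<lambda>j. - t' j" B "\<lambda>j. - x' j" B'])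
        (use chainD(2)[OF sh] chainD(2)[OF ch2] n x x2 in metis)+
    then have "gam (x (2*k)) = gam (- x' 0)" by simp
    then show ?thesis using M Ms_gam_minus[of "- x' 0"] by simp
  qed
qed

end

text \<open>A periodic word given by its centred digits together with closed forms for all right and
  left values. Once the recurrences and the bound 1/2 are checked, its value is read off from the
  cells.\<close>

locale word = even_pair +
  fixes P :: "(int \<times> int) list" and s r :: "nat \<Rightarrow> int" and X V Y H :: "nat \<Rightarrow> real"
  assumes w: "\<And>i. P ! (i mod length P) = ((s i + a - 2) div 2, (r i + b - 2) div 2)"
    and ev: "\<And>i. even (s i)" "\<And>i. even (r i)" and le: "\<And>i. \<bar>s i\<bar> \<le> 2" "\<And>i. \<bar>r i\<bar> \<le> 4"
    and X: "\<And>i. X i = \<eta> * (s i + V i)" and V: "\<And>i. V i = \<beta> * (r i + X (Suc i))"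
    and H: "\<And>i. H i = \<eta> * (s i + Y i)" and Y: "\<And>i. Y (Suc i) = \<beta> * (r i + H i)"
    and half: "\<And>i. \<bar>X i\<bar> \<le> 1/2" "\<And>i. \<bar>V i\<bar> \<le> 1/2" "\<And>i. \<bar>Y i\<bar> \<le> 1/2" "\<And>i. \<bar>H i\<bar> \<le> 1/2"
begin

lemma word_chain: "chain (weave s r) (weave X V) (weave Y H)"
  unfolding chain_def
proof
  fix j
  show "even (weave s r j) \<and> weave X V j = al j * (real_of_int (weave s r j) + weave X V (Suc j)) \<and>
      weave Y H (Suc j) = al j * (real_of_int (weave s r j) + weave Y H j)"
  proof (induction rule: weave_cases)
    case (1 i)
    show ?case using ev(1)[of i] X[of i] H[of i] by (simp add: al_def)
  next
    case (2 i)
    have "weave X V (Suc (Suc (2*i))) = X (Suc i)" "weave Y H (Suc (Suc (2*i))) = Y (Suc i)"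
      using weave_simps(1)[of X V "Suc i"] weave_simps(1)[of Y H "Suc i"] by simp_all
    then show ?case using ev(2)[of i] V[of i] Y[of i] by (simp add: al_def)
  qed
qed

lemma word_tight: "tight (weave s r) (weave X V) (weave Y H)"
  unfolding tight_def
proof (intro conjI word_chain allI)
  fix j
  show "\<bar>weave s r j\<bar> \<le> nn j - 2" "\<bar>weave X V j\<bar> \<le> 1/2" "\<bar>weave Y H j\<bar> \<le> 1/2"
    by (induction rule: weave_cases) (use le half a4 b6 order_trans[OF le(1)] order_trans[OF le(2)] in \<open>auto simp: nn_def\<close>)
qed

lemma word_half: "\<bar>weave X V j\<bar> \<le> 1/2"
  using word_tight unfolding tight_def by blast

lemma gammaP_word: "gammaP a b P = gam (weave X V 0)"
  by (rule gammaP_eq[OF word_chain word_half]) (simp_all add: w dg_def nn_def)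

lemma word_not_member: "\<not> member (gammaP a b P)"
  unfolding gammaP_word by (rule tight_not_member[OF word_tight])

lemma word_Lstar: "Ms (gammaP a b P) \<in> Lstar a b"
  unfolding Lstar_iff using word_not_member by blast

lemma word_lower:
  assumes "\<And>i. Tge \<eta> \<beta> C (X i) (Y i)" "\<And>i. Tge \<eta> \<beta> C (H i) (V i)"
  shows "ereal C \<le> Ms (gammaP a b P)"
  unfolding gammaP_word
proof (rule tight_lower[OF word_tight])
  fix j
  show "Tge (al j) (al (Suc j)) C (weave X V j) (weave Y H j)"
  proof (induction rule: weave_cases)
    case (1 i)
    show ?case using assms(1)[of i] by (simp add: al_def)
  next
    case (2 i)
    show ?case using assms(2)[of i] unfolding weave_simps by (simp add: al_def Tge_def mult.commute)
  qed
qed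

text \<open>A product that recurs at arbitrarily late positions bounds the lower limit; for the
  words considered the first of the four suffices.\<close>

lemma word_upper:
  assumes "\<And>N. \<exists>i\<ge>N. (1 - \<eta> + X i) * (1 - \<beta> + Y i) \<le> C"
  shows "Ms (gammaP a b P) \<le> ereal C"
proof (rule ccontr)
  assume "\<not> Ms (gammaP a b P) \<le> ereal C"
  then have "ereal C < Ms (gam (weave X V 0))" unfolding gammaP_word by simp
  then obtain c' K where c': "C < c'" and K: "\<And>j. K \<le> j \<Longrightarrow> Sgt (al j) (al (Suc j)) c' (weave X V j) (weave Y H j)"
    using Sgt_eventually[OF word_chain _ _ word_half] word_not_member unfolding gammaP_word by blast
  obtain i where i: "K \<le> i" "(1 - \<eta> + X i) * (1 - \<beta> + Y i) \<le> C" using assms by blast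
  have "c' < \<bar>(1 - \<eta> + X i) * (1 - \<beta> + Y i)\<bar>" using K[of "2*i"] i(1) unfolding Sgt_def by (simp add: al_def)
  moreover have "0 \<le> 1 - \<eta> + X i" "0 \<le> 1 - \<beta> + Y i"
    using half(1)[of i] half(3)[of i] eta_small beta_small by (simp_all add: abs_le_iff)
  ultimately show False using c' i(2) by simp
qed

lemma word_tail:
  assumes "chain t x y" "\<not> member (gam (x 0))" "\<And>j. \<bar>x j\<bar> \<le> 2"
    and t: "(\<forall>i. t (2*(k + i)) = s i \<and> t (Suc (2*(k + i))) = r i) \<or> (\<forall>i. t (2*(k + i)) = - s i \<and> t (Suc (2*(k + i))) = - r i)"
  shows "Ms (gam (x 0)) = Ms (gammaP a b P)"
  unfolding gammaP_word
proof (rule tail_value[OF assms(1-3) word_chain word_half])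
  show "(\<forall>j. t (j + 2*k) = weave s r j) \<or> (\<forall>j. t (j + 2*k) = - weave s r j)"
    using t
  proof (elim disj_forward; intro allI)
    fix j assume t: "\<forall>i. t (2*(k + i)) = s i \<and> t (Suc (2*(k + i))) = r i"
    show "t (j + 2*k) = weave s r j"
    proof (induction rule: weave_cases)
      case (1 i)
      show ?case using t[rule_format, of i] unfolding weave_simps by (simp add: algebra_simps)
    next
      case (2 i)
      show ?case using t[rule_format, of i] unfolding weave_simps by (simp add: algebra_simps)
    qed
  next
    fix j assume t: "\<forall>i. t (2*(k + i)) = - s i \<and> t (Suc (2*(k + i))) = - r i"
    show "t (j + 2*k) = - weave s r j"
    proof (induction rule: weave_cases)
      case (1 i)
      show ?case using t[rule_format, of i] unfolding weave_simps by (simp add: algebra_simps)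
    next
      case (2 i)
      show ?case using t[rule_format, of i] unfolding weave_simps by (simp add: algebra_simps)
    qed
  qed
qed

end

context even_pair
begin

text \<open>The first two products have the mean
  \<open>(1 - \<eta>) * (1 - \<beta>) + p * q\<close>. If both exceed the bound, \<open>p\<close>
  and \<open>q\<close> have the same sign, but then one of the products has both factors
  reduced.\<close>

lemma rho_upper:
  assumes nm: "\<not> member \<gamma>"
  shows "Ms \<gamma> \<le> ereal ((1 - \<eta>) * (1 - \<beta>))"
proof (rule ccontr)
  assume "\<not> Ms \<gamma> \<le> ereal ((1 - \<eta>) * (1 - \<beta>))"
  then have c: "ereal ((1 - \<eta>) * (1 - \<beta>)) < Ms \<gamma>" by simp
  have "(7385/10000) * (8256/10000) \<le> (1 - \<eta>) * (1 - \<beta>)"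
    using eta_small beta_small by (intro mult_mono) auto
  then have "\<eta> \<le> (1 - \<eta>) * (1 - \<beta>)" using eta_small by simp
  then obtain c' t x y where c': "(1 - \<eta>) * (1 - \<beta>) < c'" and
    bl: "blocks \<eta> \<beta> c' (\<lambda>i. t (2*i)) (\<lambda>i. t (Suc (2*i))) (\<lambda>i. x (2*i)) (\<lambda>i. x (Suc (2*i))) (\<lambda>i. y (2*i)) (\<lambda>i. y (Suc (2*i)))"
    using blocks_exist[OF nm c] by blast
  define p q where "p = x 0" and "q = y 0"
  have "good \<eta> \<beta> c' p q" using blocksD(7)[OF bl, of 0] by (simp add: p_def q_def)
  then have g: "c' < (1 - \<eta> + p) * (1 - \<beta> + q)" "c' < (1 - \<eta> - p) * (1 - \<beta> - q)"
    and pq: "\<bar>p\<bar> < 1 - \<eta>" "\<bar>q\<bar> < 1 - \<beta>" unfolding good_def by blast+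
  have "0 < p * q" using g c' by (simp add: algebra_simps)
  then consider "0 < p" "0 < q" | "p < 0" "q < 0" by (auto simp: zero_less_mult_iff)
  then show False
  proof cases
    case 1
    then have "(1 - \<eta> - p) * (1 - \<beta> - q) \<le> (1 - \<eta>) * (1 - \<beta>)" using pq by (intro mult_mono) auto
    then show False using g c' by simp
  next
    case 2
    then have "(1 - \<eta> + p) * (1 - \<beta> + q) \<le> (1 - \<eta>) * (1 - \<beta>)" using pq by (intro mult_mono) auto
    then show False using g c' by simp
  qed
qed

end

lemma concat_replicate_pair:
  "j < 2 * k \<Longrightarrow> concat (replicate k [p, q]) ! j = (if even j then p else q)"
proof (induction k arbitrary: j)
  case (Suc k)
  show ?case
  proof (cases j)
    case (Suc i)
    then show ?thesis
    proof (cases i)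
      case (Suc l)
      then show ?thesis using \<open>j = Suc i\<close> Suc.prems Suc.IH[of l] by simp
    qed (use Suc in simp)
  qed simp
qed simp

context even_pair
begin

section \<open>The words with odd digits 0 and alternating 2, -2\<close>

definition gg :: real where "gg = 2 / (1 + D)"

lemma gg: "gg = 2 - D * gg" "19/10 \<le> gg" "gg \<le> 2"
  using D_pos D_small by (simp_all add: gg_def field_simps)

text \<open>In the word with one zero and \<open>k\<close> pairs 2, -2, this is the value following
  the zero, in units of \<open>\<beta>\<close>. It solves \<open>ZZ_eq\<close>, which goes once
  around the period, and increases to \<open>gg\<close>.\<close>

definition ZZ :: "nat \<Rightarrow> real" where "ZZ k = gg * (1 - D^(2*k)) / (1 - D^Suc (2*k))"

definition VV :: "real \<Rightarrow> real" where "VV z = (1 - \<eta> + D^2 * z) * (1 - \<beta> - \<beta> * z)"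

lemma D_pow: "0 < 1 - D^Suc n" "D^n \<le> 1" "0 < D^n"
  using D_pos D_less_1 power_Suc_less_one[of D n] by (simp_all add: power_le_one)

lemma ZZ_eq: "gg - ZZ k = D^(2*k) * (gg - D * ZZ k)"
proof -
  have "ZZ k * (1 - D * D^(2*k)) = gg * (1 - D^(2*k))" using D_pow(1)[of "2*k"] by (simp add: ZZ_def)
  then show ?thesis by (simp add: algebra_simps)
qed

lemma ZZ_bounds: "0 \<le> ZZ k" "ZZ k < gg" "ZZ k \<le> 2"
proof -
  show 0: "0 \<le> ZZ k" unfolding ZZ_def using D_pow[of "2*k"] gg by (intro divide_nonneg_pos mult_nonneg_nonneg) auto
  have "D^Suc (2*k) < D^(2*k)" using D_pow(3)[of "2*k"] D_less_1 by simp
  then have "gg * (1 - D^(2*k)) < gg * (1 - D^Suc (2*k))" using gg by (intro mult_strict_left_mono) auto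
  then show "ZZ k < gg" unfolding ZZ_def using D_pow(1)[of "2*k"] by (simp add: divide_less_eq)
  then show "ZZ k \<le> 2" using gg by simp
qed

lemma ZZ_strict: "ZZ k < ZZ (Suc k)"
proof -
  define p where "p = D^(2*k)"
  have p: "0 < p" "p \<le> 1" using D_pow[of "2*k"] by (simp_all add: p_def)
  have D2: "D * D < 1" using D_pos D_less_1 mult_strict_mono[of D 1 D 1] by simp
  have k: "D^(2 * Suc k) = D * D * p" by (simp add: p_def)
  have dp: "0 < 1 - D * p" "0 < 1 - D * (D * D * p)"
    using D_pow(1)[of "2*k"] D_pow(1)[of "2 * Suc k"] by (simp_all add: p_def mult.assoc)
  have "(1 - D * D * p) * (1 - D * p) - (1 - p) * (1 - D * (D * D * p)) = p * (1 - D) * (1 - D * D)"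
    by (simp add: algebra_simps)
  moreover have "0 < p * (1 - D) * (1 - D * D)" using p D_less_1 D2 by simp
  ultimately have "(1 - p) * (1 - D * (D * D * p)) < (1 - D * D * p) * (1 - D * p)" by linarith
  then have "(1 - p) / (1 - D * p) < (1 - D * D * p) / (1 - D * (D * D * p))"
    using dp by (simp add: divide_less_eq less_divide_eq field_simps)
  then have "gg * ((1 - p) / (1 - D * p)) < gg * ((1 - D * D * p) / (1 - D * (D * D * p)))"
    using gg by (intro mult_strict_left_mono) auto
  then show ?thesis unfolding ZZ_def k power_Suc p_def[symmetric] by simp
qed

lemma ZZ_lim: "ZZ \<longlonglongrightarrow> gg"
proof -
  have "(\<lambda>k. D^(2*k)) \<longlonglongrightarrow> 0"
  proof -
    have "(\<lambda>k. (D^2)^k) \<longlonglongrightarrow> 0"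
      using D_pos D_less_1 by (intro LIMSEQ_realpow_zero) (simp_all add: power_less_one_iff)
    then show ?thesis by (simp add: power_mult)
  qed
  then have "(\<lambda>k. gg * (1 - D^(2*k)) / (1 - D * D^(2*k))) \<longlonglongrightarrow> gg * (1 - 0) / (1 - D * 0)"
    by (intro tendsto_intros) simp_all
  then show ?thesis unfolding ZZ_def by simp
qed

text \<open>Per unit of \<open>z\<close> the second factor loses \<open>\<beta>\<close>, while the
  first gains only \<open>D^2\<close>.\<close>

lemma VV_strict:
  assumes "0 \<le> z" "z < z'"
  shows "VV z' < VV z"
proof -
  have D2: "D * D \<le> 1/100"
    using mult_mono[of D "46/1000" D "46/1000"] D_small D_pos by simp
  have "D^2 \<le> \<beta> * (1/3)"
  proof -
    have "D * D = \<beta> * (\<eta> * D)" by (simp add: DD_def)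
    also have "\<dots> \<le> \<beta> * (1 * (1/3))" using beta_pos eta_pos eta_small D_pos D_small by (intro mult_left_mono mult_mono) auto
    finally show ?thesis by (simp add: power2_eq_square)
  qed
  then have "D^2 * (1 - \<beta>) \<le> \<beta> * (1/3) * 1" using beta_small beta_pos by (intro mult_mono) auto
  moreover have "\<beta> * (7/10) \<le> \<beta> * (1 - \<eta>)" using eta_small beta_pos by (intro mult_left_mono) auto
  ultimately have "0 < \<beta> * (1 - \<eta>) - D^2 * (1 - \<beta>)" using beta_pos by linarith
  moreover have "0 \<le> D^2 * \<beta> * (z + z')" using assms beta_pos by simp
  ultimately have "0 < (z' - z) * (\<beta> * (1 - \<eta>) - D^2 * (1 - \<beta>) + D^2 * \<beta> * (z + z'))" using assms by simp
  also have "\<dots> = VV z - VV z'" unfolding VV_def by (simp add: algebra_simps)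
  finally show ?thesis by simp
qed

lemma VV_0: "VV 0 = (1 - \<eta>) * (1 - \<beta>)" by (simp add: VV_def)

lemma four_D: "4 * D \<le> \<eta>"
  using mult_left_mono[of "4*\<beta>" 1 \<eta>] beta_small eta_pos by (simp add: DD_def)

text \<open>The cells next to a zero digit, up to negation. The first product of the first cell is
  \<open>VV z\<close>; the work is to show that the remaining seven are no smaller.\<close>

lemma gap_zero:
  assumes z: "0 \<le> z" "z \<le> 2"
  shows "Tge \<eta> \<beta> (VV z) (D^2 * z) (- (\<beta> * z))" "Tge \<eta> \<beta> (VV z) (D * z) (- (\<beta> * (D * z)))"
proof -
  have bz: "0 \<le> \<beta> * z" "\<beta> * z \<le> 3488/10000"
    using z beta_pos beta_small mult_mono[of \<beta> "1744/10000" z 2] by simp_all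
  have Dz: "0 \<le> D * z" "D * z \<le> 92/1000" using z D_pos D_small mult_mono[of D "46/1000" z 2] by simp_all
  have D2z: "0 \<le> D^2 * z" "D^2 * z \<le> D * z" using z D_pos D_less_1 by (simp_all add: power2_eq_square mult_right_mono mult_left_le)
  have bDz: "0 \<le> \<beta> * (D * z)" "\<beta> * (D * z) \<le> \<beta> * z"
    using z D_pos D_less_1 beta_pos by (simp_all add: mult_left_mono mult_left_le_one_le)
  note small = eta_small beta_small eta_pos beta_pos beta_less_eta
  have Dz': "D * z \<le> \<eta> / 2" using mult_left_mono[OF z(2), of D] D_pos four_D by linarith
  have v: "VV z \<le> (1 - \<eta> + D^2*z) * (1 - \<beta> - \<beta>*z)" by (simp add: VV_def)
  have vle: "VV z \<le> (1 - \<eta> + D * z) * (1 - \<beta>)"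
    unfolding VV_def using bz D2z Dz small by (intro mult_mono) auto
  have t2: "VV z \<le> (1 - \<eta> - D^2*z) * (1 - \<beta> + \<beta>*z)"
  proof -
    have "(1 - \<eta> - D^2*z) * (1 - \<beta> + \<beta>*z) - VV z = 2 * z * (\<beta> * (1 - \<eta>) - D^2 * (1 - \<beta>))"
      unfolding VV_def by (simp add: algebra_simps)
    moreover have "0 \<le> \<beta> * (1 - \<eta>) - D^2 * (1 - \<beta>)"
    proof -
      have "D^2 * (1 - \<beta>) = \<beta> * (\<eta> * D * (1 - \<beta>))" by (simp add: DD_def power2_eq_square)
      also have "\<dots> \<le> \<beta> * (1 - \<eta>)"
      proof (rule mult_left_mono)
        have "\<eta> * D * (1 - \<beta>) \<le> 1 * (46/1000) * 1" using small D_pos D_small by (intro mult_mono) auto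
        then show "\<eta> * D * (1 - \<beta>) \<le> 1 - \<eta>" using small by simp
      qed (use small in simp)
      finally show ?thesis by simp
    qed
    ultimately show ?thesis using z by (smt (verit) mult_nonneg_nonneg)
  qed
  have big1: "VV z \<le> (1 + \<eta> - u) * (1 + \<beta> - w)" if "u \<le> D * z" "w \<le> \<beta> * z" "0 \<le> u" "0 \<le> w" for u w
    unfolding VV_def by (intro mult_mono; use that D2z Dz Dz' bz small in linarith)
  have big2: "VV z \<le> (1 + \<eta> + u) * (1 + \<beta> + w)" if "0 \<le> u" "0 \<le> w" for u w
  proof -
    have "VV z \<le> (1 - \<eta> + D * z) * (1 - \<beta>)" by (rule vle)
    also have "\<dots> \<le> (1 + \<eta> + u) * (1 + \<beta> + w)"
    proof (rule mult_mono)
      show "1 - \<eta> + D * z \<le> 1 + \<eta> + u" using that Dz' eta_pos by linarith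
    qed (use that small in auto)
    finally show ?thesis .
  qed
  show "Tge \<eta> \<beta> (VV z) (D^2 * z) (- (\<beta> * z))"
    unfolding Tge_def using v t2 big1[of "D^2*z" "\<beta>*z"] big2[of "D^2*z" "\<beta>*z"] D2z bz by simp
  have a1: "VV z \<le> (1 - \<eta> + D*z) * (1 - \<beta> - \<beta>*(D*z))"
    unfolding VV_def using D2z Dz bDz bz small by (intro mult_mono) auto
  have a2: "VV z \<le> (1 - \<eta> - D*z) * (1 - \<beta> + \<beta>*(D*z))"
  proof -
    have "(1 - \<eta> - D*z) * (1 - \<beta> + \<beta>*(D*z)) - VV z = z * \<beta> * (1 + D) * (1 - 2*\<eta> + D)"
      unfolding VV_def by (simp add: DD_def algebra_simps power2_eq_square)
    moreover have "0 \<le> z * \<beta> * (1 + D) * (1 - 2*\<eta> + D)" using z small D_pos by (intro mult_nonneg_nonneg) auto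
    ultimately show ?thesis by linarith
  qed
  show "Tge \<eta> \<beta> (VV z) (D * z) (- (\<beta> * (D * z)))"
    unfolding Tge_def using a1 a2 big1[of "D*z" "\<beta>*(D*z)"] big2[of "D*z" "\<beta>*(D*z)"] Dz bDz by simp
qed

text \<open>A lower bound for the products inside an alternating run, where both sides lie between
  \<open>2 - 2 * D\<close> and 2. It exceeds \<open>VV gg\<close>, so the minimum sits at the zeros;
  for the word of \<open>delta05\<close>, which has no zero, it is the bound itself.\<close>

definition CC :: real where "CC = (1 - \<eta> + 2*D - 2*D^2) * (1 - 3*\<beta>)"

lemma D2: "0 \<le> D^2" "2*D^2 \<le> D"
  using D_pos D_small by (simp_all add: power2_eq_square)

lemma gap_two:
  assumes u: "2 - 2*D \<le> u" "u \<le> 2" and w: "2 - 2*D \<le> w" "w \<le> 2"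
  shows "Tge \<eta> \<beta> CC (D * u) (- (\<beta> * w))"
proof -
  note small = eta_small beta_small eta_pos beta_pos beta_less_eta
  have Du: "2*D - 2*D^2 \<le> D * u" "D * u \<le> 2 * D"
    using mult_left_mono[OF u(1), of D] mult_left_mono[OF u(2), of D] D_pos by (simp_all add: power2_eq_square algebra_simps)
  have bw: "\<beta> * w \<le> 2 * \<beta>" "\<beta> \<le> \<beta> * w"
    using mult_left_mono[OF w(2), of \<beta>] mult_left_mono[of 1 w \<beta>] w(1) D_small beta_pos by simp_all
  note De = four_D
  have C: "CC \<le> (1 - \<eta> + 2*D) * (1 - 3*\<beta>)" unfolding CC_def using D2 small by (intro mult_right_mono) auto
  have 1: "CC \<le> (1 - \<eta> + D*u) * (1 - \<beta> - \<beta>*w)"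
    unfolding CC_def using Du bw small D2 D_pos by (intro mult_mono) auto
  have 2: "CC \<le> (1 - \<eta> - D*u) * (1 - \<beta> + \<beta>*w)"
  proof -
    have "(1 - \<eta> + 2*D) * (1 - 3*\<beta>) \<le> (1 - \<eta> - 2*D) * 1"
    proof -
      have "4 * \<eta> \<le> 3 * (1 - \<eta> + 2*D)" using small D_pos by simp
      from mult_left_mono[OF this, of \<beta>] have "4 * (\<beta> * \<eta>) \<le> 3 * \<beta> * (1 - \<eta> + 2*D)" using small by (simp add: algebra_simps)
      moreover have "\<beta> * \<eta> = D" by (simp add: DD_def)
      ultimately show ?thesis by (simp add: algebra_simps)
    qed
    also have "\<dots> \<le> (1 - \<eta> - D*u) * (1 - \<beta> + \<beta>*w)" using Du bw small De by (intro mult_mono) auto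
    finally show ?thesis using C by simp
  qed
  have 3: "CC \<le> (1 + \<eta> - D*u) * (1 + \<beta> - \<beta>*w)"
  proof -
    have "CC \<le> (1 - \<eta> + 2*D) * (1 - 3*\<beta>)" by (rule C)
    also have "\<dots> \<le> (1 + \<eta> - D*u) * (1 + \<beta> - \<beta>*w)" by (intro mult_mono; use Du bw small De D_pos in linarith)
    finally show ?thesis .
  qed
  have 4: "CC \<le> (1 + \<eta> + D*u) * (1 + \<beta> + \<beta>*w)"
  proof -
    have "CC \<le> (1 - \<eta> + 2*D) * (1 - 3*\<beta>)" by (rule C)
    also have "\<dots> \<le> (1 + \<eta> + D*u) * (1 + \<beta> + \<beta>*w)" using Du bw small De D_pos D2 by (intro mult_mono) auto
    finally show ?thesis .
  qed
  show ?thesis unfolding Tge_def using 1 2 3 4 by simp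
qed

lemma VV_less_CC: "(1 - \<eta> + 2*D^2) * (1 - 3*\<beta> + 2*(\<beta>*D)) < CC"
proof -
  note small = eta_small beta_small eta_pos beta_pos beta_less_eta
  have "\<beta> * (1 - \<eta> + 2*D^2) \<le> 1744/10000 * (1 - 0)" by (intro mult_mono; use small D2 D_small D_pos four_D in linarith)
  also have "\<dots> < (1 - 2*(46/1000)) * (1 - 3*(1744/10000))" by simp
  also have "\<dots> \<le> (1 - 2*D) * (1 - 3*\<beta>)" using small D_small by (intro mult_mono) auto
  finally have "2*D * (\<beta> * (1 - \<eta> + 2*D^2)) < 2*D * ((1 - 2*D) * (1 - 3*\<beta>))" using D_pos by simp
  then show ?thesis unfolding CC_def by (simp add: algebra_simps power2_eq_square)
qed

lemma VV_less_CC': "2 - 2*D \<le> z \<Longrightarrow> z \<le> 2 \<Longrightarrow> VV z < CC"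
proof -
  assume z: "2 - 2*D \<le> z" "z \<le> 2"
  have "VV z \<le> (1 - \<eta> + 2*D^2) * (1 - 3*\<beta> + 2*(\<beta>*D))"
    unfolding VV_def
  proof (rule mult_mono)
    show "1 - \<eta> + D^2 * z \<le> 1 - \<eta> + 2*D^2" using mult_left_mono[OF z(2), of "D^2"] by simp
    show "1 - \<beta> - \<beta> * z \<le> 1 - 3*\<beta> + 2*(\<beta>*D)" using mult_left_mono[OF z(1), of \<beta>] beta_pos by (simp add: algebra_simps)
    show "0 \<le> 1 - \<eta> + 2*D^2" using eta_small D2(1) by simp
    show "0 \<le> 1 - \<beta> - \<beta> * z" using mult_left_mono[OF z(2), of \<beta>] beta_pos beta_small by linarith
  qed
  then show ?thesis using VV_less_CC by simp
qed

lemma Tge_mono: "Tge A B c x y \<Longrightarrow> c' \<le> c \<Longrightarrow> Tge A B c' x y"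
  unfolding Tge_def by linarith

end

context even_pair
begin

lemma zero_s_word:
  fixes r :: "nat \<Rightarrow> int" and U T :: "nat \<Rightarrow> real"
  assumes w: "\<And>i. P ! (i mod length P) = ((a - 2) div 2, (r i + b - 2) div 2)"
    and ev: "\<And>i. even (r i)" and le: "\<And>i. \<bar>r i\<bar> \<le> 4"
    and U: "\<And>i. U i = r i + D * U (Suc i)" and T: "\<And>i. T (Suc i) = r i + D * T i"
    and U2: "\<And>i. \<bar>U i\<bar> \<le> 2" and T2: "\<And>i. \<bar>T i\<bar> \<le> 2"
  shows "word a b P (\<lambda>_. 0) r (\<lambda>i. D * U i) (\<lambda>i. \<beta> * U i) (\<lambda>i. \<beta> * T i) (\<lambda>i. D * T i)"
proof
  show "P ! (i mod length P) = ((0 + a - 2) div 2, (r i + b - 2) div 2)" for i using w[of i] by simp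
  show "D * U i = \<eta> * (real_of_int 0 + \<beta> * U i)" "D * T i = \<eta> * (real_of_int 0 + \<beta> * T i)" for i by (simp_all add: DD_def)
  show "\<beta> * U i = \<beta> * (real_of_int (r i) + D * U (Suc i))" for i using U[of i] by simp
  show "\<beta> * T (Suc i) = \<beta> * (real_of_int (r i) + D * T i)" for i using T[of i] by simp
  have *: "\<bar>D * z\<bar> \<le> 1/2" "\<bar>\<beta> * z\<bar> \<le> 1/2" if "\<bar>z\<bar> \<le> 2" for z
  proof -
    have "D * \<bar>z\<bar> \<le> 1/10 * 2" "\<beta> * \<bar>z\<bar> \<le> 1/4 * 2" using that D_pos D_small beta_pos beta_small by (intro mult_mono; simp)+
    then show "\<bar>D * z\<bar> \<le> 1/2" "\<bar>\<beta> * z\<bar> \<le> 1/2" using D_pos beta_pos by (simp_all add: abs_mult)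
  qed
  show "\<bar>D * U i\<bar> \<le> 1/2" "\<bar>\<beta> * U i\<bar> \<le> 1/2" "\<bar>\<beta> * T i\<bar> \<le> 1/2" "\<bar>D * T i\<bar> \<le> 1/2" for i
    using *[OF U2] *[OF T2] by blast+
qed (use ev le in auto)

lemma gap_two_signed:
  assumes "2 - 2*D \<le> \<sigma> * u" "\<sigma> * u \<le> 2" "2 - 2*D \<le> - (\<sigma> * w)" "- (\<sigma> * w) \<le> 2" and \<sigma>: "\<sigma> = 1 \<or> \<sigma> = - 1"
  shows "Tge \<eta> \<beta> CC (D * u) (\<beta> * w)" "Tge \<eta> \<beta> CC (D * w) (\<beta> * u)"
proof -
  have 1: "Tge \<eta> \<beta> CC (D * (\<sigma> * u)) (- (\<beta> * (- (\<sigma> * w))))" by (rule gap_two) fact+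
  have 2: "Tge \<eta> \<beta> CC (D * (- (\<sigma> * w))) (- (\<beta> * (\<sigma> * u)))" by (rule gap_two) fact+
  show "Tge \<eta> \<beta> CC (D * u) (\<beta> * w)" "Tge \<eta> \<beta> CC (D * w) (\<beta> * u)"
    using 1 2 Tge_minus[of \<eta> \<beta> CC "D * u" "\<beta> * w"] Tge_minus[of \<eta> \<beta> CC "D * w" "\<beta> * u"] \<sigma> by auto
qed

lemma gg_range: "2 - 2*D \<le> gg" "gg \<le> 2"
  using gg mult_left_mono[OF gg(3), of D] D_pos by linarith+

lemma delta05_word:
  "word a b [blkA a b 2, blkA' a b 2] (\<lambda>_. 0) (\<lambda>i. 2 * (-1)^i) (\<lambda>i. D * ((-1)^i * gg)) (\<lambda>i. \<beta> * ((-1)^i * gg))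
    (\<lambda>i. \<beta> * (- ((-1)^i * gg))) (\<lambda>i. D * (- ((-1)^i * gg)))"
proof (rule zero_s_word)
  have ge: "(-1)^i * gg = 2 * (-1)^i - D * ((-1)^i * gg)" for i :: nat
    using arg_cong[OF gg(1), of "\<lambda>z. (-1)^i * z"] by (simp add: algebra_simps)
  show "(-1)^i * gg = real_of_int (2 * (-1)^i) + D * ((-1)^Suc i * gg)" for i :: nat using ge[of i] by simp
  show "- ((-1)^Suc i * gg) = real_of_int (2 * (-1)^i) + D * - ((-1)^i * gg)" for i :: nat using ge[of i] by simp
  show "[blkA a b 2, blkA' a b 2] ! (i mod length [blkA a b 2, blkA' a b 2]) = ((a - 2) div 2, (2 * (-1)^i + b - 2) div 2)" for i
  proof -
    have l: "length [blkA a b 2, blkA' a b 2] = 2" by simp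
    consider "even i" "i mod 2 = 0" | "odd i" "i mod 2 = Suc 0"
      by (cases "even i") (auto simp: odd_iff_mod_2_eq_one even_iff_mod_2_eq_zero)
    then show ?thesis unfolding l by cases (simp_all add: blkA_def blkA'_def)
  qed
qed (use gg in \<open>auto simp: abs_mult power_abs\<close>)

lemma delta05_lower: "ereal CC \<le> delta05 a b"
proof -
  interpret w: word a b "[blkA a b 2, blkA' a b 2]" "\<lambda>_. 0" "\<lambda>i. 2 * (-1)^i" "\<lambda>i. D * ((-1)^i * gg)" "\<lambda>i. \<beta> * ((-1)^i * gg)"
    "\<lambda>i. \<beta> * (- ((-1)^i * gg))" "\<lambda>i. D * (- ((-1)^i * gg))" by (rule delta05_word)
  have "Tge \<eta> \<beta> CC (D * ((-1)^i * gg)) (\<beta> * - ((-1)^i * gg))" "Tge \<eta> \<beta> CC (D * - ((-1)^i * gg)) (\<beta> * ((-1)^i * gg))" for i :: nat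
    by (rule gap_two_signed[of "(-1)^i"]; use gg_range in \<open>auto simp: minus_one_power_iff\<close>)+
  then show ?thesis unfolding delta05_def by (rule w.word_lower)
qed

definition P1 :: "nat \<Rightarrow> (int \<times> int) list" where
  "P1 k = [blkA a b 0] @ concat (replicate k [blkA a b 2, blkA' a b 2])"

definition r1 :: "nat \<Rightarrow> nat \<Rightarrow> int" where
  "r1 k i = (let \<rho> = i mod Suc (2*k) in if \<rho> = 0 then 0 else 2 * (-1)^(\<rho> - 1))"

text \<open>The value at distance \<open>j\<close> after a zero of the periodic sequence \<open>0, 2, - 2, \<dots>, 2, - 2\<close>.\<close>

definition u1 :: "nat \<Rightarrow> nat \<Rightarrow> real" where
  "u1 k j = (-1)^(j - 1) * (gg - (- D)^(Suc (2*k) - j) * (gg - D * ZZ k))"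

text \<open>Reversing the digits after the zero negates them, so left values are negatives of right
  values at the mirrored index. Hence the index \<open>2 * k + 2 - \<rho>\<close> and the minus
  signs in \<open>T1\<close>.\<close>

definition U1 :: "nat \<Rightarrow> nat \<Rightarrow> real" where
  "U1 k i = (let \<rho> = i mod Suc (2*k) in if \<rho> = 0 then D * ZZ k else u1 k \<rho>)"
definition T1 :: "nat \<Rightarrow> nat \<Rightarrow> real" where
  "T1 k i = (let \<rho> = i mod Suc (2*k) in if \<rho> = 0 then - ZZ k else - u1 k (Suc (Suc (2*k)) - \<rho>))"

lemma u1_1: "u1 k 1 = ZZ k" using ZZ_eq[of k] by (simp add: u1_def)
lemma u1_last: "u1 k (Suc (2*k)) = D * ZZ k" by (simp add: u1_def)
lemma u1_rec:
  assumes "1 \<le> j" "j \<le> 2*k"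
  shows "u1 k j = 2 * (-1)^(j - 1) + D * u1 k (Suc j)"
proof -
  define \<theta> where "\<theta> = gg - D * ZZ k"
  obtain i where i: "j = Suc i" using assms(1) by (cases j) auto
  have e: "Suc (2*k) - j = Suc (Suc (2*k) - Suc j)" using assms by simp
  have "u1 k j = (-1)^i * gg + (-1)^i * (D * (- D)^(Suc (2*k) - Suc j) * \<theta>)"
    unfolding u1_def e \<theta>_def[symmetric] by (simp add: i algebra_simps)
  also have "(-1)^i * gg = (-1)^i * 2 - (-1)^i * (D * gg)" using gg(1) by (metis right_diff_distrib)
  finally show ?thesis unfolding u1_def \<theta>_def[symmetric] by (simp add: i algebra_simps)
qed

text \<open>The deviation from \<open>gg\<close> is a power of \<open>- D\<close> times a number
  between 0 and \<open>gg\<close>. An odd power raises the value, at most to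
  \<open>gg + D * gg = 2\<close>; an even one lowers it by at most \<open>D^2 * gg\<close>, which
  leaves \<open>2 - 2 * D\<close>.\<close>

lemma u1_bounds:
  assumes "1 \<le> j" "j \<le> 2*k"
  shows "2 - 2*D \<le> (-1)^(j - 1) * u1 k j" "(-1)^(j - 1) * u1 k j \<le> 2"
proof -
  define \<theta> L where "\<theta> = gg - D * ZZ k" and "L = 2*k - j"
  have \<theta>: "0 \<le> \<theta>" "\<theta> \<le> gg"
    using ZZ_bounds[of k] D_pos D_less_1 mult_left_le_one_le[of "ZZ k" D] by (simp_all add: \<theta>_def)
  have e: "Suc (2*k) - j = Suc L" using assms by (simp add: L_def)
  have "(-1)^(j - 1) * u1 k j = ((-1)^(j - 1) * (-1)^(j - 1)) * (gg - (- D)^Suc L * \<theta>)"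
    unfolding u1_def e \<theta>_def by simp
  then have eq: "(-1)^(j - 1) * u1 k j = gg - (- D)^Suc L * \<theta>" by (simp flip: power_mult_distrib)
  have "D^Suc L * \<theta> \<le> D * gg"
    using D_pow(2)[of L] \<theta> D_pos gg by (intro mult_mono) (auto simp: mult_left_le)
  moreover have "0 \<le> D^Suc L * \<theta>" using \<theta> D_pos by simp
  ultimately have "gg - (- D)^Suc L * \<theta> \<le> 2 \<and> (odd (Suc L) \<longrightarrow> 2 - 2*D \<le> gg - (- D)^Suc L * \<theta>)"
  proof (cases "even (Suc L)")
    case True
    have p: "(- D)^Suc L = D^Suc L" by (rule power_minus_even[OF True])
    show ?thesis unfolding p using \<open>0 \<le> D^Suc L * \<theta>\<close> gg_range True by linarith
  next
    case False
    have p: "(- D)^Suc L = - (D^Suc L)" by (rule power_minus_odd[OF False])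
    show ?thesis unfolding p mult_minus_left
      using \<open>0 \<le> D^Suc L * \<theta>\<close> \<open>D^Suc L * \<theta> \<le> D * gg\<close> gg(1) gg_range by linarith
  qed
  moreover have "2 - 2*D \<le> gg - (- D)^Suc L * \<theta>" if ev: "even (Suc L)"
  proof -
    obtain l where l: "L = Suc l" using ev by (cases L) auto
    have "D^Suc L * \<theta> \<le> (D * D) * gg"
      using D_pow(2)[of l] \<theta> D_pos gg unfolding l by (intro mult_mono) (auto simp: mult_left_le mult.assoc)
    moreover have "gg - (D * D) * gg = 2 * (1 - D)"
      using gg(1) arg_cong[OF gg(1), of "\<lambda>z. D * z"] by (simp add: algebra_simps)
    ultimately have "2 * (1 - D) \<le> gg - D^Suc L * \<theta>" using diff_left_mono[of "D^Suc L * \<theta>" "D * D * gg" gg] by argo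
    then show ?thesis unfolding power_minus_even[OF ev] by argo
  qed
  ultimately show "2 - 2*D \<le> (-1)^(j - 1) * u1 k j" "(-1)^(j - 1) * u1 k j \<le> 2" unfolding eq by blast+
qed

lemma ZZ_range: "0 < k \<Longrightarrow> 2 - 2*D \<le> ZZ k"
  using u1_bounds(1)[of 1 k] by (simp add: u1_1[unfolded One_nat_def])

lemma abs_u1: "1 \<le> j \<Longrightarrow> j \<le> Suc (2*k) \<Longrightarrow> \<bar>u1 k j\<bar> \<le> 2"
proof (cases "j = Suc (2*k)")
  case True
  then show ?thesis using ZZ_bounds[of k] D_pos D_less_1 mult_left_le_one_le[of "ZZ k" D] by (simp add: u1_last abs_mult)
next
  case False
  assume "1 \<le> j" "j \<le> Suc (2*k)"
  then have "\<bar>(-1)^(j - 1) * u1 k j\<bar> \<le> 2" using u1_bounds[of j k] False D_small by (simp add: abs_le_iff)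
  then show ?thesis by (simp add: abs_mult power_abs)
qed

lemma length_P1: "length (P1 k) = Suc (2*k)"
  unfolding P1_def by (induction k) auto

lemma nth_P1: "\<rho> < Suc (2*k) \<Longrightarrow> P1 k ! \<rho> = (if \<rho> = 0 then blkA a b 0 else if odd \<rho> then blkA a b 2 else blkA' a b 2)"
  using concat_replicate_pair[of "\<rho> - 1" k "blkA a b 2" "blkA' a b 2"]
  by (cases \<rho>) (auto simp: P1_def)

lemma delta1_word: "word a b (P1 k) (\<lambda>_. 0) (r1 k) (\<lambda>i. D * U1 k i) (\<lambda>i. \<beta> * U1 k i) (\<lambda>i. \<beta> * T1 k i) (\<lambda>i. D * T1 k i)"
proof (rule zero_s_word)
  fix i
  define \<rho> where "\<rho> = i mod Suc (2*k)"
  have \<rho>: "\<rho> < Suc (2*k)" by (simp add: \<rho>_def)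
  have S: "Suc i mod Suc (2*k) = (if \<rho> = 2*k then 0 else Suc \<rho>)" by (simp add: \<rho>_def mod_Suc)
  show "P1 k ! (i mod length (P1 k)) = ((a - 2) div 2, (r1 k i + b - 2) div 2)"
    unfolding length_P1 \<rho>_def[symmetric] nth_P1[OF \<rho>] r1_def Let_def
    by (cases \<rho>) (auto simp: blkA_def blkA'_def minus_one_power_iff algebra_simps)
  show "even (r1 k i)" "\<bar>r1 k i\<bar> \<le> 4" by (simp_all add: r1_def Let_def abs_mult power_abs)
  show "U1 k i = real_of_int (r1 k i) + D * U1 k (Suc i)"
  proof (cases "\<rho> = 0")
    case True
    then show ?thesis using u1_1[of k] ZZ_eq[of 0] gg unfolding U1_def r1_def Let_def S \<rho>_def[symmetric]
      by (auto simp: ZZ_def)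
  next
    case False
    show ?thesis using u1_rec[of \<rho> k] u1_last[of k] False \<rho> unfolding U1_def r1_def Let_def S \<rho>_def[symmetric] by auto
  qed
  show "T1 k (Suc i) = real_of_int (r1 k i) + D * T1 k i"
  proof (cases "\<rho> = 0")
    case True
    then show ?thesis using u1_last[of k] unfolding T1_def r1_def Let_def S \<rho>_def[symmetric] by (auto simp: ZZ_def)
  next
    case False
    define j where "j = Suc (2*k) - \<rho>"
    have j: "1 \<le> j" "j \<le> 2*k" "Suc (Suc (2*k)) - \<rho> = Suc j" "Suc (2*k) - \<rho> = j" using False \<rho> by (auto simp: j_def)
    have "even (j - 1) \<longleftrightarrow> odd (\<rho> - 1)" using False \<rho> unfolding j_def by (simp add: even_diff_nat)
    then have sg: "(-1::real)^(j - 1) = - ((-1)^(\<rho> - 1))" by (auto simp: minus_one_power_iff)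
    have "- u1 k j = 2 * (-1)^(\<rho> - 1) + D * (- u1 k (Suc j))" using u1_rec[OF j(1,2)] sg by simp
    moreover have "T1 k (Suc i) = - u1 k j"
    proof (cases "\<rho> = 2*k")
      case True
      then have "j = 1" by (simp add: j_def)
      then show ?thesis using u1_1[of k] True unfolding T1_def Let_def S by simp
    next
      case f: False
      then show ?thesis unfolding T1_def Let_def S by (simp add: j)
    qed
    ultimately show ?thesis using False unfolding T1_def[of k i] r1_def Let_def \<rho>_def[symmetric] by (simp add: j)
  qed
  have Z: "\<bar>ZZ k\<bar> \<le> 2" "\<bar>D * ZZ k\<bar> \<le> 2"
    using ZZ_bounds[of k] D_pos D_less_1 mult_left_le_one_le[of "ZZ k" D] by (simp_all add: abs_mult)
  show "\<bar>U1 k i\<bar> \<le> 2" using abs_u1[of \<rho> k] Z \<rho> unfolding U1_def Let_def \<rho>_def[symmetric] by auto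
  show "\<bar>T1 k i\<bar> \<le> 2" using abs_u1[of "Suc (Suc (2*k)) - \<rho>" k] Z \<rho> unfolding T1_def Let_def \<rho>_def[symmetric] by auto
qed

lemma delta1_gaps:
  "Tge \<eta> \<beta> (VV (ZZ k)) (D * U1 k i) (\<beta> * T1 k i)" "Tge \<eta> \<beta> (VV (ZZ k)) (D * T1 k i) (\<beta> * U1 k i)"
proof -
  define \<rho> where "\<rho> = i mod Suc (2*k)"
  have \<rho>: "\<rho> < Suc (2*k)" by (simp add: \<rho>_def)
  note gz = gap_zero[OF ZZ_bounds(1,3), of k]
  have m: "Tge \<eta> \<beta> (VV (ZZ k)) (- (D^2 * ZZ k)) (\<beta> * ZZ k)" "Tge \<eta> \<beta> (VV (ZZ k)) (- (D * ZZ k)) (\<beta> * (D * ZZ k))"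
    using gz Tge_minus[of \<eta> \<beta> "VV (ZZ k)" "D^2 * ZZ k" "- (\<beta> * ZZ k)"] Tge_minus[of \<eta> \<beta> "VV (ZZ k)" "D * ZZ k" "- (\<beta> * (D * ZZ k))"] by simp_all
  consider "\<rho> = 0" | "\<rho> = 1" "0 < k" | "2 \<le> \<rho>" "\<rho> \<le> 2*k" using \<rho> by linarith
  then have "Tge \<eta> \<beta> (VV (ZZ k)) (D * U1 k i) (\<beta> * T1 k i) \<and> Tge \<eta> \<beta> (VV (ZZ k)) (D * T1 k i) (\<beta> * U1 k i)"
  proof cases
    case 1
    then show ?thesis using gz m unfolding U1_def T1_def Let_def \<rho>_def[symmetric] by (simp add: power2_eq_square mult.assoc)
  next
    case 2
    then show ?thesis using gz m u1_1[of k] u1_last[of k] unfolding U1_def T1_def Let_def \<rho>_def[symmetric]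
      by (simp add: power2_eq_square mult.assoc)
  next
    case 3
    define j where "j = Suc (Suc (2*k)) - \<rho>"
    have j: "1 \<le> j" "j \<le> 2*k" using 3 by (auto simp: j_def)
    have "even (j - 1) \<longleftrightarrow> even (\<rho> - 1)" using 3 unfolding j_def by (simp add: even_diff_nat)
    then have sg: "(-1::real)^(j - 1) = (-1)^(\<rho> - 1)" by (auto simp: minus_one_power_iff)
    have "Tge \<eta> \<beta> CC (D * u1 k \<rho>) (\<beta> * - u1 k j)" "Tge \<eta> \<beta> CC (D * - u1 k j) (\<beta> * u1 k \<rho>)"
      using u1_bounds[of \<rho> k] u1_bounds[OF j] 3 unfolding sg
      by (intro gap_two_signed[of "(-1)^(\<rho> - 1)"]; simp add: minus_one_power_iff)+
    moreover have "VV (ZZ k) \<le> CC" using VV_less_CC'[OF ZZ_range ZZ_bounds(3), of k] 3 by simp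
    ultimately show ?thesis using 3 Tge_mono unfolding U1_def T1_def Let_def \<rho>_def[symmetric] j_def[symmetric] by auto
  qed
  then show "Tge \<eta> \<beta> (VV (ZZ k)) (D * U1 k i) (\<beta> * T1 k i)" "Tge \<eta> \<beta> (VV (ZZ k)) (D * T1 k i) (\<beta> * U1 k i)" by auto
qed

lemma delta1_value: "delta1 a b k = ereal (VV (ZZ k))" "delta1 a b k \<in> Lstar a b"
proof -
  interpret w: word a b "P1 k" "\<lambda>_. 0" "r1 k" "\<lambda>i. D * U1 k i" "\<lambda>i. \<beta> * U1 k i" "\<lambda>i. \<beta> * T1 k i" "\<lambda>i. D * T1 k i" by (rule delta1_word)
  have d: "delta1 a b k = Ms (gammaP a b (P1 k))" by (simp add: delta1_def P1_def)
  show "delta1 a b k \<in> Lstar a b" unfolding d by (rule w.word_Lstar)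
  \<comment> \<open>The zeros at the multiples of the period attain
    \<open>VV (ZZ k)\<close>.\<close>
  have "\<exists>i\<ge>N. (1 - \<eta> + D * U1 k i) * (1 - \<beta> + \<beta> * T1 k i) \<le> VV (ZZ k)" for N
  proof (intro exI conjI)
    show "N \<le> N * Suc (2*k)" by simp
    show "(1 - \<eta> + D * U1 k (N * Suc (2*k))) * (1 - \<beta> + \<beta> * T1 k (N * Suc (2*k))) \<le> VV (ZZ k)"
      by (simp add: U1_def T1_def VV_def power2_eq_square mult.assoc del: mult_Suc_right)
  qed
  then have "Ms (gammaP a b (P1 k)) \<le> ereal (VV (ZZ k))" by (rule w.word_upper)
  moreover have "ereal (VV (ZZ k)) \<le> Ms (gammaP a b (P1 k))" by (rule w.word_lower) (rule delta1_gaps)+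
  ultimately show "delta1 a b k = ereal (VV (ZZ k))" unfolding d by (rule antisym)
qed

lemma delta1_strict: "delta1 a b (Suc k) < delta1 a b k"
  unfolding delta1_value using VV_strict[OF ZZ_bounds(1) ZZ_strict] by simp

lemma delta1_above: "ereal (VV gg) < delta1 a b k"
  unfolding delta1_value using VV_strict[OF ZZ_bounds(1,2)] by simp

lemma delta1_lim: "delta1 a b \<longlonglongrightarrow> ereal (VV gg)"
proof -
  have "(\<lambda>k. VV (ZZ k)) \<longlonglongrightarrow> VV gg" unfolding VV_def by (intro tendsto_intros ZZ_lim)
  moreover have "delta1 a b = (\<lambda>k. ereal (VV (ZZ k)))" by (rule ext) (rule delta1_value)
  ultimately show ?thesis by simp
qed

lemma delta1_0: "delta1 a b 0 = ereal ((1 - \<eta>) * (1 - \<beta>))"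
  unfolding delta1_value using VV_0 by (simp add: ZZ_def)

lemma Lstar_le: "z \<in> Lstar a b \<Longrightarrow> z \<le> delta1 a b 0"
  unfolding delta1_0 Lstar_iff using rho_upper by blast

definition V4 :: real where "V4 = \<beta> * (4 - xi_inf \<eta> \<beta>)"

lemma xi_D: "xi_inf \<eta> \<beta> = 2*\<eta> - 4*D + D * xi_inf \<eta> \<beta>"
  unfolding xi_inf_def D_eq using D_less_1 by (simp add: field_simps)

lemma xi_le: "0 \<le> xi_inf \<eta> \<beta>" "xi_inf \<eta> \<beta> \<le> 2*\<eta>" "2*\<eta> - 4*D \<le> xi_inf \<eta> \<beta>" "xi_inf \<eta> \<beta> \<le> 2*\<eta> - 4*D + 2*(\<eta>*D)"
proof -
  have 4: "4*D \<le> 2*\<eta>" using four_D eta_pos by simp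
  show 0: "0 \<le> xi_inf \<eta> \<beta>" unfolding xi_inf_def D_eq using 4 D_less_1 by (intro divide_nonneg_pos) auto
  then show "2*\<eta> - 4*D \<le> xi_inf \<eta> \<beta>" using xi_D mult_nonneg_nonneg[OF less_imp_le[OF D_pos] 0] by linarith
  have "\<eta> * D \<le> 1 * D" using eta_small D_pos by (intro mult_right_mono) auto
  then show 2: "xi_inf \<eta> \<beta> \<le> 2*\<eta>" unfolding xi_inf_def D_eq using D_pos D_less_1 by (simp add: pos_divide_le_eq algebra_simps)
  show "xi_inf \<eta> \<beta> \<le> 2*\<eta> - 4*D + 2*(\<eta>*D)" using xi_D mult_left_mono[OF 2, of D] D_pos by (simp add: algebra_simps)
qed

text \<open>\<open>V4\<close> is the value at the odd positions of the constant pattern. It is close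
  to \<open>4 * \<beta>\<close>, and \<open>b \<ge> 8\<close> keeps it below 1/2.\<close>

lemma delta04_word:
  assumes b8: "8 \<le> b"
  shows "word a b [blkC a b 4] (\<lambda>_. - 2) (\<lambda>_. 4) (\<lambda>_. - xi_inf \<eta> \<beta>) (\<lambda>_. V4) (\<lambda>_. V4) (\<lambda>_. - xi_inf \<eta> \<beta>)"
proof
  have "4 * \<eta> \<le> a * \<eta>" "8 * \<beta> \<le> b * \<beta>" using a4 b8 eta_pos beta_pos by simp_all
  then have e: "4 * \<eta> \<le> 1 + D" "8 * \<beta> \<le> 1 + D" using eta_a beta_b by linarith+
  have ed: "\<eta> * D \<le> 1 * D" "\<beta> * D \<le> (1/4) * D" using eta_small beta_small D_pos by (intro mult_right_mono; simp)+
  have "\<beta> * (4 - xi_inf \<eta> \<beta>) \<le> \<beta> * (4 - (2*\<eta> - 4*D))" "0 \<le> \<beta> * (4 - xi_inf \<eta> \<beta>)"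
    using beta_pos xi_le(2,3) eta_small by (auto intro!: mult_left_mono)
  then have "V4 \<le> 4*\<beta> - 2*D + 4*(\<beta>*D)" "0 \<le> V4" unfolding V4_def by (simp_all add: algebra_simps flip: D_eq)
  then have V4: "0 \<le> V4" "V4 \<le> 1/2" using e ed D_pos by linarith+
  have x: "xi_inf \<eta> \<beta> \<le> 1/2" using xi_le(4) e ed D_pos by linarith
  have X: "- xi_inf \<eta> \<beta> = \<eta> * (real_of_int (- 2) + V4)"
    using xi_D by (simp add: V4_def algebra_simps flip: D_eq)
  show "- xi_inf \<eta> \<beta> = \<eta> * (real_of_int (- 2) + V4)" by (rule X)
  show "V4 = \<beta> * (real_of_int 4 + - xi_inf \<eta> \<beta>)" by (simp add: V4_def)
  show "\<bar>- xi_inf \<eta> \<beta>\<bar> \<le> 1/2" "\<bar>V4\<bar> \<le> 1/2" using V4 xi_le(1) x by simp_all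
  show "[blkC a b 4] ! (i mod length [blkC a b 4]) = ((- 2 + a - 2) div 2, (4 + b - 2) div 2)" for i
    by (simp add: blkC_def algebra_simps)
qed simp_all

lemma delta04_greater:
  assumes b8: "8 \<le> b"
    and f: "d < (1 - \<eta> - xi_inf \<eta> \<beta>) * (1 - \<beta> + V4)" "d < (1 - \<eta> + xi_inf \<eta> \<beta>) * (1 - \<beta> - V4)"
      "d < (1 + \<eta> + xi_inf \<eta> \<beta>) * (1 + \<beta> + V4)" "d < (1 + \<eta> - xi_inf \<eta> \<beta>) * (1 + \<beta> - V4)"
  shows "ereal d < delta04 a b" "delta04 a b \<in> Lstar a b"
proof -
  interpret w: word a b "[blkC a b 4]" "\<lambda>_. - 2" "\<lambda>_. 4" "\<lambda>_. - xi_inf \<eta> \<beta>" "\<lambda>_. V4" "\<lambda>_. V4" "\<lambda>_. - xi_inf \<eta> \<beta>"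
    by (rule delta04_word[OF b8])
  show "delta04 a b \<in> Lstar a b" unfolding delta04_def by (rule w.word_Lstar)
  obtain C where C: "d < C" "C \<le> (1 - \<eta> - xi_inf \<eta> \<beta>) * (1 - \<beta> + V4)" "C \<le> (1 - \<eta> + xi_inf \<eta> \<beta>) * (1 - \<beta> - V4)"
      "C \<le> (1 + \<eta> + xi_inf \<eta> \<beta>) * (1 + \<beta> + V4)" "C \<le> (1 + \<eta> - xi_inf \<eta> \<beta>) * (1 + \<beta> - V4)"
    using f that[of "min (min ((1 - \<eta> - xi_inf \<eta> \<beta>) * (1 - \<beta> + V4)) ((1 - \<eta> + xi_inf \<eta> \<beta>) * (1 - \<beta> - V4)))
      (min ((1 + \<eta> + xi_inf \<eta> \<beta>) * (1 + \<beta> + V4)) ((1 + \<eta> - xi_inf \<eta> \<beta>) * (1 + \<beta> - V4)))"] by (simp add: min_le_iff_disj)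
  have "Tge \<eta> \<beta> C (- xi_inf \<eta> \<beta>) V4" unfolding Tge_def using C by simp
  then have "ereal C \<le> delta04 a b" unfolding delta04_def using w.word_lower[of C] by simp
  then show "ereal d < delta04 a b" using C(1) by (meson less_ereal.simps(1) less_le_trans)
qed

lemma delta04_upper:
  assumes b8: "8 \<le> b"
  shows "delta04 a b \<le> ereal ((1 - \<eta> - xi_inf \<eta> \<beta>) * (1 - \<beta> + V4))"
proof -
  interpret w: word a b "[blkC a b 4]" "\<lambda>_. - 2" "\<lambda>_. 4" "\<lambda>_. - xi_inf \<eta> \<beta>" "\<lambda>_. V4" "\<lambda>_. V4" "\<lambda>_. - xi_inf \<eta> \<beta>"
    by (rule delta04_word[OF b8])
  show ?thesis unfolding delta04_def by (rule w.word_upper) (auto intro: exI[of _ N for N])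
qed

end

section \<open>The spectrum above \<open>VV gg\<close>\<close>

context even_pair
begin

lemma zero_tail:
  assumes ch: "chain t x y" and nm: "\<not> member (gam (x 0))" and x2: "\<And>j. \<bar>x j\<bar> \<le> 2"
    and bl: "blocks \<eta> \<beta> c (\<lambda>i. t (2*i)) (\<lambda>i. t (Suc (2*i))) (\<lambda>i. x (2*i)) (\<lambda>i. x (Suc (2*i))) (\<lambda>i. y (2*i)) (\<lambda>i. y (Suc (2*i)))"
    and c: "VV gg \<le> c" and z: "\<And>i. k < i \<Longrightarrow> t (2*i) = 0 \<and> \<bar>t (Suc (2*i))\<bar> \<le> 2"
  shows "Ms (gam (x 0)) \<in> insert (delta05 a b) (range (delta1 a b))"
proof -
  \<comment> \<open>Three blocks beyond \<open>k\<close>, because the bounds for the left values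
    look back over several digits that must already be covered by \<open>z\<close>.\<close>
  define n r X V Y H where "n = Suc (Suc (Suc k))" and "r i = t (Suc (2*i))" and "X i = x (2*i)" and "V i = x (Suc (2*i))"
    and "Y i = y (2*i)" and "H i = y (Suc (2*i))" for i
  have b: "blocks \<eta> \<beta> c (\<lambda>i. t (2*i)) r X V Y H" using bl unfolding r_def X_def V_def Y_def H_def .
  note bd = blocksD[OF b]
  have z: "t (2*i) = 0" "\<bar>r i\<bar> \<le> 2" if "k < i" for i using z[OF that] by (simp_all add: r_def)
  have r2: "\<bar>real_of_int (r i)\<bar> \<le> 2" if "k < i" for i
    using z(2)[OF that] by linarith
  have XV: "X i = \<eta> * V i" "H i = \<eta> * Y i" if "k < i" for i using bd(3)[of i] bd(5)[of i] z(1)[OF that] by simp_all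
  have lt1: "\<bar>V i\<bar> \<le> 1" "\<bar>Y i\<bar> \<le> 1" "\<bar>X i\<bar> \<le> 1" "\<bar>H i\<bar> \<le> 1" for i
    using bd(7)[of i] bd(8)[of i] eta_pos beta_pos unfolding good_def by linarith+
  have VY: "\<bar>V i\<bar> \<le> 1744/10000 * 3" "\<bar>Y (Suc i)\<bar> \<le> 1744/10000 * 3" if i: "k < i" for i
  proof -
    have *: "\<beta> * \<bar>real_of_int (r i) + u\<bar> \<le> 1744/10000 * 3" if "\<bar>u\<bar> \<le> 1" for u
      using r2[OF i] that beta_small beta_pos by (intro mult_mono) auto
    show "\<bar>V i\<bar> \<le> 1744/10000 * 3" "\<bar>Y (Suc i)\<bar> \<le> 1744/10000 * 3"
      using *[OF lt1(3), of "Suc i"] *[OF lt1(4), of i] beta_pos unfolding bd(4)[of i] bd(6)[of i] by (simp_all add: abs_mult)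
  qed
  have eV: "\<bar>\<eta> * u\<bar> \<le> 1/5" if "\<bar>u\<bar> \<le> 1744/10000 * 3" for u
  proof -
    have "\<eta> * \<bar>u\<bar> \<le> 2615/10000 * (1744/10000 * 3)" using that eta_small eta_pos by (intro mult_mono) auto
    then show ?thesis using eta_pos by (simp add: abs_mult)
  qed
  have XH: "\<bar>X (Suc i)\<bar> \<le> 1/5" "\<bar>H (Suc i)\<bar> \<le> 1/5" if "k < i" for i
    using eV[OF VY(1)[of "Suc i"]] eV[OF VY(2)[OF that]] that XV[of "Suc i"] by simp_all
  have sum: "\<bar>u + v\<bar> \<le> 22/10" if "\<bar>u\<bar> \<le> 2" "\<bar>v\<bar> \<le> 1/5" for u v :: real using that by linarith
  interpret z: zseq \<eta> \<beta> D gg "\<lambda>i. r (n + i)" "\<lambda>i. V (n + i) / \<beta>" "\<lambda>i. Y (n + i) / \<beta>"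
  proof
    show "V (n + i) / \<beta> = real_of_int (r (n + i)) + D * (V (n + Suc i) / \<beta>)" for i
      using bd(4)[of "n + i"] XV(1)[of "Suc (n + i)"] beta_pos by (simp add: n_def DD_def field_simps)
    show "Y (n + Suc i) / \<beta> = real_of_int (r (n + i)) + D * (Y (n + i) / \<beta>)" for i
      using bd(6)[of "n + i"] XV(2)[of "n + i"] beta_pos by (simp add: n_def DD_def field_simps)
    have vv: "VV gg = (1 - \<eta> + D^2 * gg) * (1 - \<beta> - \<beta> * gg)" by (simp add: VV_def)
    have d: "D * (u / \<beta>) = \<eta> * u" "\<beta> * (u / \<beta>) = u" for u using beta_pos by (simp_all add: DD_def)
    show "good \<eta> \<beta> ((1 - \<eta> + D^2 * gg) * (1 - \<beta> - \<beta> * gg)) (D * (V (n + i) / \<beta>)) (\<beta> * (Y (n + i) / \<beta>))"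
      "good \<eta> \<beta> ((1 - \<eta> + D^2 * gg) * (1 - \<beta> - \<beta> * gg)) (D * (Y (n + i) / \<beta>)) (\<beta> * (V (n + i) / \<beta>))" for i
      using good_mono[OF bd(7)[of "n + i"] c] good_mono[OF bd(8)[of "n + i"] c] XV[of "n + i"] unfolding vv d by (simp_all add: n_def)
    show "\<bar>V (n + i) / \<beta>\<bar> \<le> 22/10" for i
    proof -
      have "V (n + i) / \<beta> = real_of_int (r (n + i)) + X (Suc (n + i))" using bd(4)[of "n + i"] beta_pos by simp
      moreover have "\<bar>X (Suc (n + i))\<bar> \<le> 1/5" by (rule XH) (simp add: n_def)
      ultimately show ?thesis using sum[OF r2[of "n + i"]] by (simp add: n_def)
    qed
    show "\<bar>Y (n + i) / \<beta>\<bar> \<le> 22/10" for i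
    proof -
      have "Y (n + i) / \<beta> = real_of_int (r (Suc (Suc (k + i)))) + H (Suc (Suc (k + i)))"
        using bd(6)[of "Suc (Suc (k + i))"] beta_pos by (simp add: n_def)
      moreover have "\<bar>H (Suc (Suc (k + i)))\<bar> \<le> 1/5" by (rule XH) simp
      ultimately show ?thesis using sum[OF r2[of "Suc (Suc (k + i))"]] by simp
    qed
  qed (use eta_pos eta_small beta_pos beta_small z bd(2) in \<open>auto simp: n_def gg_def DD_def\<close>)
  have tail: "Ms (gam (x 0)) = Ms (gammaP a b P)"
    if w: "word a b P (\<lambda>_. 0) R X' V' Y' H'" and \<sigma>: "\<sigma> = 1 \<or> \<sigma> = - 1" and R: "\<And>i. r (n + N + i) = \<sigma> * R i"
    for P R X' V' Y' H' \<sigma> N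
  proof -
    interpret w: word a b P "\<lambda>_. 0" R X' V' Y' H' by fact
    have "t (Suc (2 * (n + N + i))) = \<sigma> * R i" "t (2 * (n + N + i)) = 0" for i using R[of i] z(1)[of "n + N + i"] by (simp_all add: r_def n_def)
    then show ?thesis using \<sigma> by (intro w.word_tail[OF ch nm x2, of "n + N"]) auto
  qed
  show ?thesis
  proof (rule disjE[OF z.pattern])
    assume "\<exists>N \<sigma>. (\<sigma> = 1 \<or> \<sigma> = - 1) \<and> (\<forall>k. r (n + (N + k)) = 2 * \<sigma> * (- 1)^k)"
    then obtain N \<sigma> where \<sigma>: "\<sigma> = 1 \<or> \<sigma> = - 1" and r: "\<forall>k. r (n + (N + k)) = 2 * \<sigma> * (- 1)^k" by blast
    have "Ms (gam (x 0)) = delta05 a b" unfolding delta05_def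
      by (rule tail[OF delta05_word \<sigma>, of N]) (use r in \<open>simp add: add.assoc\<close>)
    then show ?thesis by simp
  next
    assume "\<exists>N \<sigma> L. (\<sigma> = 1 \<or> \<sigma> = - 1) \<and> even L \<and>
      (\<forall>q k. k \<le> L \<longrightarrow> r (n + (N + q * Suc L + k)) = (if k = 0 then 0 else 2 * \<sigma> * (- 1)^(k - 1)))"
    then obtain N \<sigma> l where \<sigma>: "\<sigma> = 1 \<or> \<sigma> = - 1"
      and r: "\<forall>q k. k \<le> 2 * l \<longrightarrow> r (n + (N + q * Suc (2 * l) + k)) = (if k = 0 then 0 else 2 * \<sigma> * (- 1)^(k - 1))"
      by (auto elim!: evenE)
    have "r (n + N + i) = \<sigma> * r1 l i" for i
      using r[rule_format, of "i mod Suc (2 * l)" "i div Suc (2 * l)"] unfolding r1_def Let_def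
      by (simp add: add.assoc del: mult_Suc_right)
    then have "Ms (gam (x 0)) = Ms (gammaP a b (P1 l))" by (rule tail[OF delta1_word \<sigma>])
    then show ?thesis by (simp add: delta1_def P1_def)
  qed
qed

lemma VV_gg: "VV gg = (1 - \<eta> + 2 * D^2 / (1 + D)) * (1 - \<beta> - 2 * \<beta> / (1 + D))"
  unfolding VV_def gg_def by (simp add: mult.commute)

lemma c0_le: "c0 \<eta> \<beta> \<le> VV gg"
  unfolding VV_def c0_def
proof (rule mult_mono)
  show "1 - 3*\<beta> \<le> 1 - \<beta> - \<beta> * gg" using mult_left_mono[OF gg(3), of \<beta>] beta_pos by simp
qed (use gg eta_small beta_small in auto)

lemma VV_gg_le: "VV gg \<le> (1 - \<eta> + 2*(\<eta>*\<beta>)^2) * (1 - 3*\<beta> + 2*(\<beta>*(\<eta>*\<beta>)))" "VV gg < 1"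
proof -
  show "VV gg \<le> (1 - \<eta> + 2*(\<eta>*\<beta>)^2) * (1 - 3*\<beta> + 2*(\<beta>*(\<eta>*\<beta>)))"
    unfolding VV_def D_eq
  proof (rule mult_mono)
    show "1 - \<eta> + D^2 * gg \<le> 1 - \<eta> + 2*D^2" using mult_left_mono[OF gg(3), of "D^2"] by simp
    show "1 - \<beta> - \<beta> * gg \<le> 1 - 3*\<beta> + 2*(\<beta>*D)" using mult_left_mono[OF gg_range(1), of \<beta>] beta_pos by (simp add: algebra_simps)
    show "0 \<le> 1 - \<eta> + 2*D^2" using eta_small D2(1) by simp
    show "0 \<le> 1 - \<beta> - \<beta> * gg" using mult_left_mono[OF gg(3), of \<beta>] beta_pos beta_small by linarith
  qed
  have "VV gg < (1 - \<eta>) * (1 - \<beta>)" using VV_strict[of 0 gg] gg VV_0 by simp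
  also have "\<dots> \<le> 1 * 1" using eta_pos beta_pos eta_small beta_small by (intro mult_mono) auto
  finally show "VV gg < 1" by simp
qed

lemma ab_eq: "a * \<eta> = b * \<beta>" using eta_a beta_b by simp

lemma eta_a8: "8 \<le> b \<Longrightarrow> 50 * \<eta> \<le> 13"
proof -
  assume b8: "8 \<le> b"
  have "4 * \<eta> \<le> a * \<eta>" "8 * \<beta> \<le> b * \<beta>" using a4 b8 eta_pos beta_pos by simp_all
  then have e: "4 * \<eta> \<le> 1 + D" "8 * \<beta> \<le> 1 + D" using eta_a beta_b by linarith+
  then have "\<eta> \<le> 2615/10000" "\<beta> \<le> 1308/10000" using D_small by simp_all
  then have "\<eta> * \<beta> \<le> 2615/10000 * (1308/10000)" using eta_pos beta_pos by (intro mult_mono) auto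
  then show ?thesis using e(1) unfolding D_eq by simp
qed

lemma eta_a6: "6 \<le> a \<Longrightarrow> 12 \<le> b \<Longrightarrow> 100 * \<eta> \<le> 17" "6 \<le> a \<Longrightarrow> 12 \<le> b \<Longrightarrow> 11 * D \<le> 1"
proof -
  assume ab: "6 \<le> a" "12 \<le> b"
  have "6 * \<eta> \<le> a * \<eta>" "12 * \<beta> \<le> b * \<beta>" using ab eta_pos beta_pos by simp_all
  then have e: "6 * \<eta> \<le> 1 + D" "12 * \<beta> \<le> 1 + D" using eta_a beta_b by linarith+
  then have "\<eta> \<le> 18/100" "\<beta> \<le> 9/100" using D_small by simp_all
  then have "\<eta> * \<beta> \<le> 18/100 * (9/100)" using eta_pos beta_pos by (intro mult_mono) auto
  then show "100 * \<eta> \<le> 17" "11 * D \<le> 1" using e(1) unfolding D_eq by simp_all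
qed

lemma two_beta: "2 * a \<le> b \<Longrightarrow> 2 * \<beta> \<le> \<eta>"
proof -
  assume "2 * a \<le> b"
  then have "real_of_int (2 * a) * \<beta> \<le> b * \<beta>" using beta_pos by (intro mult_right_mono) (simp_all only: of_int_le_iff less_imp_le)
  then have "real_of_int a * (2 * \<beta>) \<le> a * \<eta>" using ab_eq by simp
  then show ?thesis using a4 by simp
qed

lemma V4_bounds: "4*\<beta> - 2*D \<le> V4" "V4 \<le> 4*\<beta> - 2*D + 4*(\<beta>*D)" "V4 \<le> 4*\<beta>"
proof -
  have "\<beta> * (4 - 2*\<eta>) \<le> V4" "V4 \<le> \<beta> * (4 - (2*\<eta> - 4*D))" "V4 \<le> \<beta> * 4"
    unfolding V4_def using xi_le beta_pos by (intro mult_left_mono; simp)+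
  then show "4*\<beta> - 2*D \<le> V4" "V4 \<le> 4*\<beta> - 2*D + 4*(\<beta>*D)" "V4 \<le> 4*\<beta>" by (simp_all add: algebra_simps flip: D_eq)
qed

lemma frac_mult_le:
  fixes p z q q' :: real
  assumes z: "0 < 1 + z" "0 < 1 - z" and le: "p * p * (1 + z)^2 \<le> q * q' * (1 - z)^2"
  shows "(p / (4 * (1 - z))) * (p / ((1 + z) * (1 - z))) \<le> (q / (4 * (1 + z))) * (q' / (1 + z)^2)"
proof -
  have "p * p / (1 - z)^2 \<le> q * q' / (1 + z)^2" using le z by (simp add: divide_le_eq le_divide_eq field_simps)
  then have "p * p / (1 - z)^2 / (4 * (1 + z)) \<le> q * q' / (1 + z)^2 / (4 * (1 + z))" using z by (intro divide_right_mono) auto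
  then show ?thesis by (simp only: times_divide_times_eq divide_divide_eq_left power2_eq_square mult_ac)
qed

text \<open>The case \<open>a = 4\<close> in the single variable \<open>z = D\<close>; since
  \<open>(1 + D)^2 = 4 * b * D\<close>, the quadratic hypothesis expresses
  \<open>b \<ge> 8\<close>.\<close>

lemma C4_upper4:
  fixes z :: real
  assumes "0 \<le> z" "0 \<le> 1 - 30*z + z^2" "0 \<le> 1 - 20*z"
  shows "(1 + 10*z + z^2) * (1 + 10*z + z^2) * (1 + z)^2 \<le> (3 + 2*z + 7*z^2) * (1 - 10*z - 3*z^2) * (1 - z)^2"
proof -
  have "328345554684871069040600 * ((3 + 2*z + 7*z^2) * (1 - 10*z - 3*z^2) * (1 - z)^2 - (1 + 10*z + z^2) * (1 + 10*z + z^2) * (1 + z)^2)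
    = 614681500311145170432 + 652242212052828728943860*(1-30*z+z^2) + 1523321169416516014635171*(z*(1-30*z+z^2))
    + 3759865242824878610800*(1-30*z+z^2)^3 + 190391223939780940*((1-30*z+z^2)^2*(1-20*z)^3)
    + 74160182553445575168*(1-20*z)^5 + 897737080504146088629*(z*(1-30*z+z^2)*(1-20*z)^3)
    + 1523129791518247520000*(z*(1-30*z+z^2)^3)"
    by algebra
  moreover have "0 \<le> 614681500311145170432 + 652242212052828728943860*(1-30*z+z^2) + 1523321169416516014635171*(z*(1-30*z+z^2))
    + 3759865242824878610800*(1-30*z+z^2)^3 + 190391223939780940*((1-30*z+z^2)^2*(1-20*z)^3)
    + 74160182553445575168*(1-20*z)^5 + 897737080504146088629*(z*(1-30*z+z^2)*(1-20*z)^3)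
    + 1523129791518247520000*(z*(1-30*z+z^2)^3)"
    by (intro add_nonneg_nonneg mult_nonneg_nonneg zero_le_power assms) simp_all
  ultimately have "0 \<le> (328345554684871069040600::real) * ((3 + 2*z + 7*z^2) * (1 - 10*z - 3*z^2) * (1 - z)^2
      - (1 + 10*z + z^2) * (1 + 10*z + z^2) * (1 + z)^2)" by (simp only:)
  then have "0 \<le> (3 + 2*z + 7*z^2) * (1 - 10*z - 3*z^2) * (1 - z)^2 - (1 + 10*z + z^2) * (1 + 10*z + z^2) * (1 + z)^2"
    by (rule mult_pos_nonneg_cancel[rotated]) simp
  then show ?thesis by (simp only: diff_ge_0_iff_ge)
qed

text \<open>For \<open>a \<ge> 6\<close> the hypothesis becomes
  \<open>3 * \<beta> \<le> \<eta> + 4 * D\<close>, and comparison with \<open>c0\<close> suffices.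
  For \<open>a = 4\<close> the certificate \<open>C4_upper\<close> does not reach, as
  \<open>\<eta>\<close> exceeds 1/4; there everything is a rational function of
  \<open>D\<close>.\<close>

lemma C4_excluded:
  assumes b: "2 * a \<le> b" "3 * a - 4 \<le> b"
  shows "(1 - \<eta> - xi_inf \<eta> \<beta>) * (1 - \<beta> + V4) \<le> VV gg"
proof (cases "a = 4")
  case False
  then have ab: "6 \<le> a" "12 \<le> b" using a4 ea b by presburger+
  have "real_of_int (3 * a - 4) * \<beta> \<le> b * \<beta>" using b(2) beta_pos by (intro mult_right_mono) (simp_all only: of_int_le_iff less_imp_le)
  then have "a * (3 * \<beta> - \<eta>) \<le> 4 * \<beta>" using ab_eq by (simp add: algebra_simps)
  then have "\<eta> * (a * (3 * \<beta> - \<eta>)) \<le> \<eta> * (4 * \<beta>)" using eta_pos by (intro mult_left_mono) auto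
  moreover have "\<eta> * (a * (3 * \<beta> - \<eta>)) = (1 + D) * (3 * \<beta> - \<eta>)" unfolding eta_a[symmetric] by simp
  ultimately have "(1 + D) * (3 * \<beta> - \<eta>) \<le> 4 * D" by (simp add: D_eq[symmetric])
  then have "3 * \<beta> - \<eta> + D * (3 * \<beta> - \<eta>) \<le> 4 * D" by (simp add: distrib_right)
  moreover have "0 \<le> D * (3 * \<beta> - \<eta>)" if "0 \<le> 3 * \<beta> - \<eta>" using that D_pos by (intro mult_nonneg_nonneg) auto
  ultimately have "3 * \<beta> - \<eta> \<le> 4 * D" using D_pos by (cases "0 \<le> 3 * \<beta> - \<eta>") argo+
  then have B3: "3 * \<beta> \<le> \<eta> + 4*\<eta>*\<beta>" by (simp add: D_eq mult.assoc)
  have "(1 - \<eta> - xi_inf \<eta> \<beta>) * (1 - \<beta> + V4) \<le> (1 - 3*\<eta> + 4*(\<eta>*\<beta>)) * (1 + 3*\<beta> - 2*(\<eta>*\<beta>) + 5*(\<beta>*(\<eta>*\<beta>)))"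
    unfolding D_eq
  proof (rule mult_mono)
    show "1 - \<eta> - xi_inf \<eta> \<beta> \<le> 1 - 3*\<eta> + 4*D" using xi_le(3) by simp
    show "1 - \<beta> + V4 \<le> 1 + 3*\<beta> - 2*D + 5*(\<beta>*D)" using V4_bounds(2) beta_pos D_pos mult_pos_pos[of \<beta> D] by linarith
    show "0 \<le> 1 - 3*\<eta> + 4*D" using eta_small D_pos by simp
    show "0 \<le> 1 - \<beta> + V4" using V4_bounds(1) beta_small beta_pos D_small by simp
  qed
  also have "\<dots> \<le> (1 - \<eta>) * (1 - 3*\<beta>)" using C4_upper[OF _ two_beta[OF b(1)] eta_a6(1)[OF ab] B3] beta_pos by simp
  also have "\<dots> \<le> VV gg" using c0_le by (simp add: c0_def)
  finally show ?thesis .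
next
  case True
  have z: "0 < D" "0 < 1 + D" "0 < 1 - D" using D_pos D_less_1 by simp_all
  have e: "\<eta> = (1 + D) / 4" using eta_a True by simp
  have "(1 + D) / 4 * \<beta> = D" by (simp only: e[symmetric] D_eq)
  then have B: "\<beta> = 4 * D / (1 + D)" using z by (simp add: field_simps)
  have "8 * \<beta> \<le> b * \<beta>" using b True beta_pos by simp
  then have "8 * \<beta> * (1 + D) \<le> (1 + D) * (1 + D)" using beta_b z by (intro mult_right_mono) auto
  moreover have "8 * \<beta> * (1 + D) = 32 * D" unfolding B using z by simp
  ultimately have q: "0 \<le> 1 - 30*D + D^2" by (simp add: power2_eq_square algebra_simps)
  have xi: "xi_inf \<eta> \<beta> = (1 - 7*D) / (2 * (1 - D))" unfolding xi_inf_def D_eq unfolding e using z by (simp add: field_simps)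
  have 1: "1 - \<eta> - xi_inf \<eta> \<beta> = (1 + 10*D + D^2) / (4 * (1 - D))"
    unfolding xi unfolding e using z by (simp add: field_simps power2_eq_square)
  have 2: "1 - \<beta> + V4 = (1 + 10*D + D^2) / ((1 + D) * (1 - D))"
    unfolding V4_def xi unfolding B using z by (simp add: divide_simps power2_eq_square) (simp add: algebra_simps)
  have 3: "1 - \<eta> + 2 * D^2 / (1 + D) = (3 + 2*D + 7*D^2) / (4 * (1 + D))"
    unfolding e using z by (simp add: divide_simps power2_eq_square) (simp add: algebra_simps)
  have 4: "1 - \<beta> - 2 * \<beta> / (1 + D) = (1 - 10*D - 3*D^2) / (1 + D)^2"
    unfolding B using z by (simp add: divide_simps power2_eq_square) (simp add: algebra_simps)
  show ?thesis unfolding VV_gg 1 2 3 4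
    by (rule frac_mult_le[OF z(2,3) C4_upper4]) (use z q D_small in auto)
qed

lemma delta04_lower:
  assumes b: "2 * a \<le> b" "b \<le> 3 * a - 6"
  shows "ereal (VV gg) < delta04 a b" "delta04 a b \<in> Lstar a b"
proof -
  have ab: "6 \<le> a" "12 \<le> b" "8 \<le> b" using b by presburger+
  have "b * \<beta> \<le> real_of_int (3 * a - 6) * \<beta>" using b(2) beta_pos by (intro mult_right_mono) (simp_all only: of_int_le_iff less_imp_le)
  then have "6 * \<beta> \<le> a * (3 * \<beta> - \<eta>)" using ab_eq by (simp add: algebra_simps)
  then have "\<eta> * (6 * \<beta>) \<le> \<eta> * (a * (3 * \<beta> - \<eta>))" using eta_pos by (intro mult_left_mono) auto
  moreover have "\<eta> * (a * (3 * \<beta> - \<eta>)) = (1 + D) * (3 * \<beta> - \<eta>)" unfolding eta_a[symmetric] by simp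
  ultimately have 6: "6 * D \<le> (1 + D) * (3 * \<beta> - \<eta>)" by (simp add: D_eq[symmetric])
  \<comment> \<open>Going down from 12 to 11 absorbs the factor \<open>1 + D\<close>, since
    \<open>11 * D \<le> 1\<close>.\<close>
  have "(1 + D) * (11 * D) \<le> 12 * D" using eta_a6(2)[OF ab(1,2)] D_pos mult_left_mono[of "11 * D" 1 D] by (simp add: algebra_simps)
  also have "\<dots> \<le> (1 + D) * (2 * (3 * \<beta> - \<eta>))" using mult_left_mono[OF 6, of 2] by (simp add: algebra_simps)
  finally have "11 * D \<le> 2 * (3 * \<beta> - \<eta>)" using D_pos by simp
  then have h: "2*\<eta> + 11*\<eta>*\<beta> \<le> 6*\<beta>" by (simp add: D_eq mult.assoc)
  note as = less_imp_le[OF beta_pos] two_beta[OF b(1)] eta_a6(1)[OF ab(1,2)] h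
  have B2: "0 < \<beta>^2 / 10" using beta_pos by simp
  note l = C4_lower1[OF as] C4_lower3[OF as] C4_lower4[OF as]
  have eD: "0 \<le> \<eta> * D" "\<eta> * D \<le> D" using eta_pos eta_small D_pos mult_right_mono[of \<eta> 1 D] by simp_all
  have bD: "0 \<le> \<beta> * D" "2 * D \<le> \<beta>" "0 < \<beta>" "4 * (\<beta> * D) \<le> D"
    using beta_pos D_pos mult_right_mono[of "2*\<eta>" 1 \<beta>] eta_small mult_right_mono[of "4*\<beta>" 1 D] beta_small by (simp_all add: D_eq mult.assoc)
  have pos: "0 \<le> 1 - 3*\<eta>" "0 \<le> 1 - 5*\<beta>" using as by linarith+
  have *: "VV gg < u * w" if "0 \<le> l1 * l2 - (1 - \<eta> + 2*(\<eta>*\<beta>)^2) * (1 - 3*\<beta> + 2*(\<beta>*(\<eta>*\<beta>))) - \<beta>^2/10" "l1 \<le> u" "l2 \<le> w" "0 \<le> l2" "0 \<le> u" for l1 l2 u w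
    using mult_mono[OF that(2,3) that(5,4)] that(1) VV_gg_le(1) B2 by linarith
  have f: "VV gg < (1 - \<eta> - xi_inf \<eta> \<beta>) * (1 - \<beta> + V4)" "VV gg < (1 - \<eta> + xi_inf \<eta> \<beta>) * (1 - \<beta> - V4)"
      "VV gg < (1 + \<eta> + xi_inf \<eta> \<beta>) * (1 + \<beta> + V4)" "VV gg < (1 + \<eta> - xi_inf \<eta> \<beta>) * (1 + \<beta> - V4)"
  proof (goal_cases)
    case 1
    show ?case
    proof (rule *[OF l(1)], goal_cases)
      case 1 show ?case unfolding D_eq using xi_le eD by linarith
    next
      case 2 show ?case unfolding D_eq using V4_bounds bD xi_le by (simp add: V4_def algebra_simps)
    next
      case 3 show ?case unfolding D_eq using bD pos D_pos by linarith
    next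
      case 4 show ?case using xi_le pos eta_pos by linarith
    qed
  next
    case 2
    show ?case
    proof (rule *[OF l(3)], goal_cases)
      case 1 show ?case unfolding D_eq using xi_le eD by linarith
    next
      case 2 show ?case unfolding D_eq using V4_bounds bD xi_le by (simp add: V4_def algebra_simps)
    next
      case 3 show ?case unfolding D_eq using bD pos D_pos by linarith
    next
      case 4 show ?case using xi_le pos eta_pos by linarith
    qed
  next
    case 3
    \<comment> \<open>Both factors are at least 1, and \<open>VV gg < 1\<close>.\<close>
    have "1 * 1 \<le> (1 + \<eta> + xi_inf \<eta> \<beta>) * (1 + \<beta> + V4)" 
      by (intro mult_mono) (use xi_le V4_bounds eta_pos beta_pos D_small four_D beta_less_eta bD in auto)
    then show ?case using VV_gg_le(2) by simp
  next
    case 4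
    show ?case
    proof (rule *[OF l(2)], goal_cases)
      case 1 show ?case unfolding D_eq using xi_le eD by linarith
    next
      case 2 show ?case unfolding D_eq using V4_bounds bD xi_le by (simp add: V4_def algebra_simps)
    next
      case 3 show ?case unfolding D_eq using bD pos D_pos by linarith
    next
      case 4 show ?case using xi_le pos eta_pos by linarith
    qed
  qed
  show "ereal (VV gg) < delta04 a b" "delta04 a b \<in> Lstar a b" using delta04_greater[OF ab(3) f] by blast+
qed

lemma C4_tail:
  assumes "8 \<le> b" "chain t x y" "\<not> member (gam (x 0))" "\<And>j. \<bar>x j\<bar> \<le> 2"
    and t: "(\<forall>i. t (2*(k + i)) = - 2 \<and> t (Suc (2*(k + i))) = 4) \<or> (\<forall>i. t (2*(k + i)) = 2 \<and> t (Suc (2*(k + i))) = - 4)"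
  shows "Ms (gam (x 0)) = delta04 a b"
proof -
  interpret w: word a b "[blkC a b 4]" "\<lambda>_. - 2" "\<lambda>_. 4" "\<lambda>_. - xi_inf \<eta> \<beta>" "\<lambda>_. V4" "\<lambda>_. V4" "\<lambda>_. - xi_inf \<eta> \<beta>"
    by (rule delta04_word) fact
  show ?thesis unfolding delta04_def by (rule w.word_tail[OF assms(2-4), of k]) (use t in auto)
qed

lemma part2_case1:
  assumes b: "2 * a \<le> b" and nm: "\<not> member \<gamma>" and g: "ereal (VV gg) < Ms \<gamma>"
  shows "Ms \<gamma> \<in> insert (delta05 a b) (range (delta1 a b)) \<or> Ms \<gamma> = delta04 a b \<and> b \<le> 3 * a - 6"
proof -
  have b8: "8 \<le> b" using b a4 by simp
  have R: "region1 \<eta> \<beta>" unfolding region1_def using beta_pos two_beta[OF b] eta_a8[OF b8] by simp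
  have "(74/100) * (61/100) \<le> (1 - \<eta>) * (1 - 3*\<beta>)"
    using eta_a8[OF b8] two_beta[OF b] by (intro mult_mono) (use eta_a8[OF b8] two_beta[OF b] in linarith)+
  then have c: "\<eta> \<le> VV gg" using c0_le eta_a8[OF b8] unfolding c0_def by simp
  obtain c' t x y where c': "VV gg < c'" and ch: "chain t x y" and nx: "\<not> member (gam (x 0))" and M: "Ms (gam (x 0)) = Ms \<gamma>"
    and x2: "\<And>j. \<bar>x j\<bar> \<le> 2" and bl: "blocks \<eta> \<beta> c' (\<lambda>i. t (2*i)) (\<lambda>i. t (Suc (2*i))) (\<lambda>i. x (2*i)) (\<lambda>i. x (Suc (2*i))) (\<lambda>i. y (2*i)) (\<lambda>i. y (Suc (2*i)))"
    using blocks_exist[OF nm g c] by blast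
  have bs: "block_seq \<eta> \<beta> c' (\<lambda>i. t (2*i)) (\<lambda>i. t (Suc (2*i))) (\<lambda>i. x (2*i)) (\<lambda>i. x (Suc (2*i))) (\<lambda>i. y (2*i)) (\<lambda>i. y (Suc (2*i)))"
    using bl eta_pos beta_pos c0_le c' region1_basic(6)[OF R] by unfold_locales auto
  have C4: ?thesis if "(\<forall>i. t (2*(k + i)) = - 2 \<and> t (Suc (2*(k + i))) = 4) \<or> (\<forall>i. t (2*(k + i)) = 2 \<and> t (Suc (2*(k + i))) = - 4)" for k
  proof -
    have v: "Ms \<gamma> = delta04 a b" unfolding M[symmetric] by (rule C4_tail[OF b8 ch nx x2]) fact
    moreover have "b \<le> 3 * a - 6"
    proof (rule ccontr)
      assume "\<not> b \<le> 3 * a - 6"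
      then have "3 * a - 4 \<le> b" using ea eb by presburger
      then show False using C4_excluded[OF b] delta04_upper[OF b8] g v by (metis ereal_less_eq(3) not_le order_trans)
    qed
    ultimately show ?thesis by blast
  qed
  from region1_classification[OF bs R] show ?thesis
  proof (elim disjE exE)
    assume "\<forall>i>0. t (2*i) = 0 \<and> \<bar>t (Suc (2*i))\<bar> \<le> 2"
    then have "Ms (gam (x 0)) \<in> insert (delta05 a b) (range (delta1 a b))"
      by (intro zero_tail[OF ch nx x2 bl less_imp_le[OF c'], of 0]) auto
    then show ?thesis unfolding M by blast
  next
    fix k assume t: "\<forall>i>k. t (2*i) = - 2 \<and> t (Suc (2*i)) = 4"
    have "t (2*(Suc k + i)) = - 2 \<and> t (Suc (2*(Suc k + i))) = 4" for i by (rule t[rule_format]) simp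
    then show ?thesis by (intro C4[of "Suc k"]) blast
  next
    fix k assume t: "\<forall>i>k. t (2*i) = 2 \<and> t (Suc (2*i)) = - 4"
    have "t (2*(Suc k + i)) = 2 \<and> t (Suc (2*(Suc k + i))) = - 4" for i by (rule t[rule_format]) simp
    then show ?thesis by (intro C4[of "Suc k"]) blast
  qed
qed

text \<open>\<open>\<eta>\<close> is the smaller root of \<open>x^2 - 6 * x + 3/2\<close>, so the
  sign of this polynomial at \<open>d\<close> tells on which side of \<open>d\<close> it
  lies.\<close>

lemma eta46:
  assumes "a = 4" "b = 6"
  shows "26138/100000 < \<eta>" "\<eta> < 26139/100000" "\<beta> = 2 * \<eta> / 3"
proof -
  show B: "\<beta> = 2 * \<eta> / 3" using ab_eq assms by simp
  have q: "\<eta> * \<eta> - 6 * \<eta> + 3/2 = 0"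
    using eta_a assms(1) unfolding D_eq[symmetric] B by simp
  have id: "(d - \<eta>) * (6 - d - \<eta>) = (\<eta> * \<eta> - 6 * \<eta> + 3/2) + (d * (6 - d) - 3/2)" for d by (simp add: algebra_simps)
  show "26138/100000 < \<eta>"
  proof (rule ccontr)
    assume "\<not> 26138/100000 < \<eta>"
    then have "0 \<le> (26138/100000 - \<eta>) * (6 - 26138/100000 - \<eta>)" by (intro mult_nonneg_nonneg) auto
    then show False unfolding id q by simp
  qed
  show "\<eta> < 26139/100000"
  proof (rule ccontr)
    assume "\<not> \<eta> < 26139/100000"
    then have "(26139/100000 - \<eta>) * (6 - 26139/100000 - \<eta>) \<le> 0" using eta_small by (intro mult_nonpos_nonneg) auto
    then show False unfolding id q by simp
  qed
qed

text \<open>Values at the odd positions of the word with odd digits 2 and even digits 0, -2 in turn: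
  \<open>p46\<close> belongs to the blocks with -2, \<open>q46\<close> to those with 0. The closed
  forms solve the mutual recursion \<open>pq46\<close>.\<close>

definition p46 :: real where "p46 = \<beta> * (2 + D * (2 - 2*\<eta>)) / (1 - D * D)"
definition q46 :: real where "q46 = \<beta> * (2 - 2*\<eta> + 2*D) / (1 - D * D)"

lemma pq46: "p46 = \<beta> * (2 + \<eta> * q46)" "q46 = \<beta> * (2 + \<eta> * (p46 - 2))"
proof -
  have n: "1 - D * D \<noteq> 0" using D_pos D_less_1 mult_strict_mono[of D 1 D 1] by simp
  have p: "p46 * (1 - D * D) = \<beta> * (2 + D * (2 - 2*\<eta>))" and q: "q46 * (1 - D * D) = \<beta> * (2 - 2*\<eta> + 2*D)"
    using n by (simp_all add: p46_def q46_def)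
  have "\<beta> * (2 + \<eta> * q46) * (1 - D * D) = \<beta> * (2 * (1 - D * D) + \<eta> * (q46 * (1 - D * D)))" by (simp add: algebra_simps)
  also have "\<dots> = \<beta> * (2 * (1 - D * D) + D * (2 - 2*\<eta> + 2*D))" unfolding q by (simp add: D_eq[symmetric] algebra_simps)
  also have "\<dots> = p46 * (1 - D * D)" unfolding p by (simp add: algebra_simps)
  finally show "p46 = \<beta> * (2 + \<eta> * q46)" using n by simp
  have "\<beta> * (2 + \<eta> * (p46 - 2)) * (1 - D * D) = \<beta> * ((2 - 2*\<eta>) * (1 - D * D) + \<eta> * (p46 * (1 - D * D)))" by (simp add: algebra_simps)
  also have "\<dots> = \<beta> * ((2 - 2*\<eta>) * (1 - D * D) + D * (2 + D * (2 - 2*\<eta>)))" unfolding p by (simp add: D_eq[symmetric] algebra_simps)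
  also have "\<dots> = q46 * (1 - D * D)" unfolding q by (simp add: algebra_simps)
  finally show "q46 = \<beta> * (2 + \<eta> * (p46 - 2))" using n by simp
qed

lemma pq46_bounds:
  assumes ab: "a = 4" "b = 6"
  shows "3600/10000 \<le> p46" "p46 \<le> 3620/10000" "2680/10000 \<le> q46" "q46 \<le> 2740/10000"
proof -
  note e = eta46[OF ab]
  have B: "17425/100000 \<le> \<beta>" "\<beta> \<le> 17426/100000" using e by simp_all
  have D1: "26138/100000 * (17425/100000) \<le> \<eta> * \<beta>" "\<eta> * \<beta> \<le> 26139/100000 * (17426/100000)" using e B by (intro mult_mono; simp)+
  then have D: "4554/100000 \<le> D" "D \<le> 4556/100000" unfolding D_eq by simp_all
  have DD: "D * D \<le> 4556/100000 * (4556/100000)" "4554/100000 * (4554/100000) \<le> D * D" using D by (intro mult_mono; simp)+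
  have De: "4554/100000 * (2 - 2*(26139/100000)) \<le> D * (2 - 2*\<eta>)" "D * (2 - 2*\<eta>) \<le> 4556/100000 * (2 - 2*(26138/100000))"
    using D e by (intro mult_mono; simp)+
  have n: "0 < 1 - D * D" using DD by simp
  have P: "17425/100000 * (2 + 672/10000) \<le> \<beta> * (2 + D * (2 - 2*\<eta>))" "\<beta> * (2 + D * (2 - 2*\<eta>)) \<le> 17426/100000 * (2 + 674/10000)"
    using B De by (intro mult_mono; simp)+
  have Q: "17425/100000 * (15682/10000) \<le> \<beta> * (2 - 2*\<eta> + 2*D)" "\<beta> * (2 - 2*\<eta> + 2*D) \<le> 17426/100000 * (15684/10000)"
    using B D e by (intro mult_mono; simp)+
  show "3600/10000 \<le> p46" "p46 \<le> 3620/10000" unfolding p46_def pos_le_divide_eq[OF n] pos_divide_le_eq[OF n] using n P DD by simp_all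
  show "2680/10000 \<le> q46" "q46 \<le> 2740/10000" unfolding q46_def pos_le_divide_eq[OF n] pos_divide_le_eq[OF n] using n Q DD by simp_all
qed

text \<open>The lower bound is the one demanded by \<open>seq46\<close>; the upper bound 367/1000
  separates the limit from \<open>delta_m2\<close>.\<close>

lemma VV46:
  assumes ab: "a = 4" "b = 6"
  shows "3656/10000 \<le> VV gg" "VV gg < 367/1000"
proof -
  note e = eta46[OF ab]
  have B: "17425/100000 \<le> \<beta>" "\<beta> \<le> 17426/100000" using e by simp_all
  have "26138/100000 * (17425/100000) \<le> \<eta> * \<beta>" "\<eta> * \<beta> \<le> 26139/100000 * (17426/100000)" using e B by (intro mult_mono; simp)+
  then have D: "4554/100000 \<le> D" "D \<le> 4556/100000" unfolding D_eq by simp_all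
  have n: "0 < 1 + D" using D by simp
  have g: "19128/10000 \<le> gg" "gg \<le> 191290/100000" unfolding gg_def pos_le_divide_eq[OF n] pos_divide_le_eq[OF n] using D by simp_all
  have D2: "4554/100000 * (4554/100000) \<le> D * D" "D * D \<le> 4556/100000 * (4556/100000)" using D by (intro mult_mono; simp)+
  have "207/100000 * (19128/10000) \<le> D^2 * gg" "D^2 * gg \<le> 2076/1000000 * 2"
    using D2 g by (intro mult_mono; simp add: power2_eq_square)+
  then have E: "742565/1000000 \<le> 1 - \<eta> + D^2 * gg" "1 - \<eta> + D^2 * gg \<le> 74278/100000" using e by simp_all
  have "17425/100000 * (19128/10000) \<le> \<beta> * gg" "\<beta> * gg \<le> 17426/100000 * (191290/100000)" using B g by (intro mult_mono; simp)+
  then have F: "49239/100000 \<le> 1 - \<beta> - \<beta> * gg" "1 - \<beta> - \<beta> * gg \<le> 4926/10000" using B by simp_all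
  have "742565/1000000 * (49239/100000) \<le> VV gg" "VV gg \<le> 74278/100000 * (4926/10000)"
    unfolding VV_def using E F by (intro mult_mono; simp)+
  then show "3656/10000 \<le> VV gg" "VV gg < 367/1000" by simp_all
qed

definition s46 :: "nat \<Rightarrow> int" where "s46 i = (if even i then 0 else - 2)"

lemma word46:
  assumes ab: "a = 4" "b = 6"
  shows "word a b [blkA a b 2, blkC a b 2] s46 (\<lambda>_. 2) (\<lambda>i. if even i then \<eta> * q46 else \<eta> * (p46 - 2))
    (\<lambda>i. if even i then q46 else p46) (\<lambda>i. if even i then q46 else p46) (\<lambda>i. if even i then \<eta> * q46 else \<eta> * (p46 - 2))"
proof
  show "[blkA a b 2, blkC a b 2] ! (i mod length [blkA a b 2, blkC a b 2]) = ((s46 i + a - 2) div 2, (2 + b - 2) div 2)" for i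
  proof -
    have l: "length [blkA a b 2, blkC a b 2] = 2" by simp
    consider "even i" "i mod 2 = 0" | "odd i" "i mod 2 = Suc 0"
      by (cases "even i") (auto simp: odd_iff_mod_2_eq_one even_iff_mod_2_eq_zero)
    then show ?thesis unfolding l by cases (simp_all add: blkA_def blkC_def s46_def ab)
  qed
  have e: "0 \<le> \<eta>" "\<eta> \<le> 3/10" using eta_pos eta_small by simp_all
  have "\<eta> * q46 \<le> 3/10 * (3/10)" "0 \<le> \<eta> * q46" "\<eta> * (2 - p46) \<le> 262/1000 * (165/100)" "0 \<le> \<eta> * (2 - p46)"
    using pq46_bounds[OF ab] e eta_small by (intro mult_mono mult_nonneg_nonneg; simp)+
  then have h: "\<bar>\<eta> * q46\<bar> \<le> 1/2" "\<bar>\<eta> * (p46 - 2)\<bar> \<le> 1/2" by (simp_all add: abs_le_iff algebra_simps)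
  show "\<bar>if even i then \<eta> * q46 else \<eta> * (p46 - 2)\<bar> \<le> 1/2" "\<bar>if even i then q46 else p46\<bar> \<le> 1/2" for i
    using h pq46_bounds[OF ab] by auto
  show "(if even i then \<eta> * q46 else \<eta> * (p46 - 2)) = \<eta> * (real_of_int (s46 i) + (if even i then q46 else p46))" for i
    by (simp add: s46_def)
  show "(if even i then q46 else p46) = \<beta> * (real_of_int 2 + (if even (Suc i) then \<eta> * q46 else \<eta> * (p46 - 2)))"
    "(if even (Suc i) then q46 else p46) = \<beta> * (real_of_int 2 + (if even i then \<eta> * q46 else \<eta> * (p46 - 2)))" for i
    by (simp_all add: pq46[symmetric])
qed (simp_all add: s46_def)

lemma delta_m2_lower:
  assumes ab: "a = 4" "b = 6"
  shows "ereal (VV gg) < delta_m2 a b" "delta_m2 a b \<in> Lstar a b"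
proof -
  interpret w: word a b "[blkA a b 2, blkC a b 2]" s46 "\<lambda>_. 2" "\<lambda>i. if even i then \<eta> * q46 else \<eta> * (p46 - 2)"
    "\<lambda>i. if even i then q46 else p46" "\<lambda>i. if even i then q46 else p46" "\<lambda>i. if even i then \<eta> * q46 else \<eta> * (p46 - 2)"
    by (rule word46[OF ab])
  show "delta_m2 a b \<in> Lstar a b" unfolding delta_m2_def by (rule w.word_Lstar)
  note e = eta46[OF ab] and pq = pq46_bounds[OF ab]
  have B: "17425/100000 \<le> \<beta>" "\<beta> \<le> 17426/100000" using e by simp_all
  have q: "26138/100000 * (2680/10000) \<le> \<eta> * q46" "\<eta> * q46 \<le> 26139/100000 * (2740/10000)" using e pq by (intro mult_mono; simp)+
  have p: "26138/100000 * (3600/10000) \<le> \<eta> * p46" "\<eta> * p46 \<le> 26139/100000 * (3620/10000)" using e pq by (intro mult_mono; simp)+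
  have p': "\<eta> * (p46 - 2) = \<eta> * p46 - 2*\<eta>" by (simp add: algebra_simps)
  have *: "367/1000 \<le> u * w" if "l1 \<le> u" "l2 \<le> w" "367/1000 \<le> l1 * l2" "0 \<le> l1" "0 \<le> l2" for u w l1 l2 :: real
    using mult_mono[OF that(1,2)] that by linarith
  have 0: "Tge \<eta> \<beta> (367/1000) (\<eta> * q46) q46"
    unfolding Tge_def
  proof (intro conjI, goal_cases)
    case 1 show ?case by (rule *[of "73/100" _ 1]) (use q pq B e in linarith)+
  next
    case 2 show ?case by (rule *[of "6669/10000" _ "5517/10000"]) (use q pq B e in linarith)+
  next
    case 3 show ?case by (rule *[of 1 _ 1]) (use q pq B e in linarith)+
  next
    case 4 show ?case by (rule *[of 1 _ "9/10"]) (use q pq B e in linarith)+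
  qed
  have 1: "Tge \<eta> \<beta> (367/1000) (\<eta> * (p46 - 2)) p46"
    unfolding Tge_def p'
  proof (intro conjI, goal_cases)
    case 1 show ?case by (rule *[of "3099/10000" _ "11857/10000"]) (use p pq B e in linarith)+
  next
    case 2 show ?case by (rule *[of 1 _ "46/100"]) (use p pq B e in linarith)+
  next
    case 3 show ?case by (rule *[of "8/10" _ "8/10"]) (use p pq B e in linarith)+
  next
    case 4 show ?case by (rule *[of "8/10" _ "8/10"]) (use p pq B e in linarith)+
  qed
  have "ereal (367/1000) \<le> delta_m2 a b" unfolding delta_m2_def by (rule w.word_lower) (use 0 1 in auto)
  then show "ereal (VV gg) < delta_m2 a b" using VV46(2)[OF ab] by (meson less_ereal.simps(1) less_le_trans)
qed

lemma part2_case2: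
  assumes ab: "a = 4" "b = 6" and nm: "\<not> member \<gamma>" and g: "ereal (VV gg) < Ms \<gamma>"
  shows "Ms \<gamma> \<in> insert (delta05 a b) (range (delta1 a b)) \<or> Ms \<gamma> = delta_m2 a b"
proof -
  note e = eta46[OF ab]
  have B: "17425/100000 \<le> \<beta>" "\<beta> \<le> 17426/100000" using e by simp_all
  have c: "\<eta> \<le> VV gg" using VV46[OF ab] e by simp
  obtain c' t x y where c': "VV gg < c'" and ch: "chain t x y" and nx: "\<not> member (gam (x 0))" and M: "Ms (gam (x 0)) = Ms \<gamma>"
    and x2: "\<And>j. \<bar>x j\<bar> \<le> 2" and bl: "blocks \<eta> \<beta> c' (\<lambda>i. t (2*i)) (\<lambda>i. t (Suc (2*i))) (\<lambda>i. x (2*i)) (\<lambda>i. x (Suc (2*i))) (\<lambda>i. y (2*i)) (\<lambda>i. y (Suc (2*i)))"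
    using blocks_exist[OF nm g c] by blast
  have eB: "3 * \<beta> \<le> 2 * \<eta>" using e(3) by simp
  have "0 < c0 \<eta> \<beta>" unfolding c0_def using e B by simp
  then have bs: "seq46 \<eta> \<beta> c' (\<lambda>i. t (2*i)) (\<lambda>i. t (Suc (2*i))) (\<lambda>i. x (2*i)) (\<lambda>i. x (Suc (2*i))) (\<lambda>i. y (2*i)) (\<lambda>i. y (Suc (2*i)))"
    using bl eta_pos beta_pos c0_le c' e(1,2) B eB VV46[OF ab] by unfold_locales auto
  interpret w: word a b "[blkA a b 2, blkC a b 2]" s46 "\<lambda>_. 2" "\<lambda>i. if even i then \<eta> * q46 else \<eta> * (p46 - 2)"
    "\<lambda>i. if even i then q46 else p46" "\<lambda>i. if even i then q46 else p46" "\<lambda>i. if even i then \<eta> * q46 else \<eta> * (p46 - 2)"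
    by (rule word46[OF ab])
  \<comment> \<open>The classification starts a period at an even digit 2 or -2, whereas
    \<open>s46\<close> begins with 0; hence the start one block later.\<close>
  have tl: "t (2*(Suc k + i)) = \<sigma> * s46 i \<and> t (Suc (2*(Suc k + i))) = \<sigma> * 2"
    if t: "\<And>n. t (2*(k + 2*n)) = \<sigma> * - 2 \<and> t (Suc (2*(k + 2*n))) = \<sigma> * 2 \<and> t (2*Suc (k + 2*n)) = 0 \<and> t (Suc (2*Suc (k + 2*n))) = \<sigma> * 2" for \<sigma> k i
  proof (cases "even i")
    case True
    then obtain n where "i = 2 * n" by blast
    then show ?thesis using t[of n] by (simp add: s46_def)
  next
    case False
    then obtain n where "i = 2 * n + 1" by (rule oddE)
    then have "Suc k + i = k + 2 * Suc n" by simp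
    then show ?thesis using t[of "Suc n"] False unfolding \<open>Suc k + i = k + 2 * Suc n\<close> by (simp add: s46_def)
  qed
  have M2: ?thesis if "(\<forall>i. t (2*(k + i)) = s46 i \<and> t (Suc (2*(k + i))) = 2) \<or> (\<forall>i. t (2*(k + i)) = - s46 i \<and> t (Suc (2*(k + i))) = - 2)" for k
  proof -
    have "Ms (gam (x 0)) = delta_m2 a b" unfolding delta_m2_def by (rule w.word_tail[OF ch nx x2]) fact
    then show ?thesis using M by simp
  qed
  from classification46[OF bs] show ?thesis
  proof (elim disjE exE)
    assume "\<forall>i>1. t (2*i) = 0 \<and> \<bar>t (Suc (2*i))\<bar> \<le> 2"
    then have "Ms (gam (x 0)) \<in> insert (delta05 a b) (range (delta1 a b))"
      by (intro zero_tail[OF ch nx x2 bl less_imp_le[OF c'], of 1]) auto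
    then show ?thesis unfolding M by blast
  next
    fix k assume t: "\<forall>n. t (2*(k + 2*n)) = - 2 \<and> t (Suc (2*(k + 2*n))) = 2 \<and> t (2*Suc (k + 2*n)) = 0 \<and> t (Suc (2*Suc (k + 2*n))) = 2"
    show ?thesis by (rule M2[of "Suc k"]) (use tl[of k 1] t in simp)
  next
    fix k assume t: "\<forall>n. t (2*(k + 2*n)) = 2 \<and> t (Suc (2*(k + 2*n))) = - 2 \<and> t (2*Suc (k + 2*n)) = 0 \<and> t (Suc (2*Suc (k + 2*n))) = - 2"
    show ?thesis by (rule M2[of "Suc k"]) (use tl[of k "- 1"] t in simp)
  qed
qed

lemma part2:
  assumes h: "2 * a \<le> b \<or> (a = 4 \<and> b = 6)"
  shows "Lstar a b \<inter> {ereal (VV gg)<..} = {delta1 a b k | k. True} \<union> {delta05 a b}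
    \<union> (if 2 * a \<le> b \<and> b \<le> 3 * a - 6 then {delta04 a b} else {})
    \<union> (if a = 4 \<and> b = 6 then {delta_m2 a b} else {})" (is "?L = ?R")
proof
  have r: "{delta1 a b k | k. True} = range (delta1 a b)" by auto
  show "?L \<subseteq> ?R"
  proof
    fix z assume "z \<in> ?L"
    then have "z \<in> Lstar a b" and gz: "ereal (VV gg) < z" by auto
    then obtain \<gamma> where g: "\<not> member \<gamma>" and z: "z = Ms \<gamma>" unfolding Lstar_iff by blast
    note g = g gz[unfolded z]
    show "z \<in> ?R"
    proof (cases "2 * a \<le> b")
      case True
      then show ?thesis using part2_case1[OF True g] unfolding z r by auto
    next
      case False
      then have ab: "a = 4" "b = 6" using h by auto
      then show ?thesis using part2_case2[OF ab g] unfolding z r by auto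
    qed
  qed
  interpret w: word a b "[blkA a b 2, blkA' a b 2]" "\<lambda>_. 0" "\<lambda>i. 2 * (-1)^i" "\<lambda>i. D * ((-1)^i * gg)" "\<lambda>i. \<beta> * ((-1)^i * gg)"
    "\<lambda>i. \<beta> * (- ((-1)^i * gg))" "\<lambda>i. D * (- ((-1)^i * gg))" by (rule delta05_word)
  have "delta05 a b \<in> Lstar a b" unfolding delta05_def by (rule w.word_Lstar)
  moreover have "ereal (VV gg) < delta05 a b"
    using delta05_lower VV_less_CC'[OF gg_range] by (meson less_ereal.simps(1) less_le_trans)
  ultimately show "?R \<subseteq> ?L" using delta1_value(2) delta1_above delta04_lower delta_m2_lower by auto
qed

end

section \<open>The case b = 2a - 2\<close>

locale even_pair3 = even_pair +
  assumes b3: "b = 2 * a - 2" and a8: "8 \<le> a"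
begin

text \<open>\<open>b = 2 * a - 2\<close> reads
  \<open>a * (2 * \<beta> - \<eta>) = 2 * \<beta>\<close>. Multiplying by \<open>\<eta>\<close>
  eliminates \<open>a\<close> and gives the equation of \<open>region3\<close>.\<close>

lemma small3: "1000 * \<eta> \<le> 128" "7 * \<beta> \<le> 4 * \<eta>" "\<eta> \<le> 2 * \<beta>" "(2*\<beta> - \<eta>) * (1 + D) = 2 * D"
proof -
  have "8 * \<eta> \<le> a * \<eta>" "14 * \<beta> \<le> b * \<beta>" using a8 b3 eta_pos beta_pos by simp_all
  then have e: "8 * \<eta> \<le> 1 + D" "14 * \<beta> \<le> 1 + D" using eta_a beta_b by linarith+
  then have "\<eta> \<le> 131/1000" "\<beta> \<le> 75/1000" using D_small by simp_all
  then have "\<eta> * \<beta> \<le> 131/1000 * (75/1000)" using eta_pos beta_pos by (intro mult_mono) auto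
  then show "1000 * \<eta> \<le> 128" using e(1) unfolding D_eq by simp
  have rb: "real_of_int b = 2 * real_of_int a - 2" by (subst b3) simp
  have ab2: "a * (2*\<beta> - \<eta>) = 2*\<beta>" using ab_eq unfolding rb by (simp add: algebra_simps)
  then have "0 \<le> a * (2*\<beta> - \<eta>)" using beta_pos by simp
  then show "\<eta> \<le> 2 * \<beta>" using a4 by (simp add: zero_le_mult_iff)
  have "8 * (2*\<beta> - \<eta>) \<le> a * (2*\<beta> - \<eta>)" using a8 \<open>\<eta> \<le> 2 * \<beta>\<close> by (intro mult_right_mono) auto
  then show "7 * \<beta> \<le> 4 * \<eta>" unfolding ab2 by simp
  have "(2*\<beta> - \<eta>) * (a * \<eta>) = \<eta> * (a * (2*\<beta> - \<eta>))" by (simp add: mult_ac)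
  then show "(2*\<beta> - \<eta>) * (1 + D) = 2 * D" unfolding eta_a ab2 by (simp add: D_eq[symmetric] mult_ac)
qed

lemma R3: "region3 \<eta> \<beta>"
  unfolding region3_def D_eq using small3 beta_pos by simp

lemma bounds3: "\<beta> \<le> 1/12" "\<eta> \<le> 13/100" "8 * D \<le> \<eta>" "4 * D \<le> 3 * \<beta> / 5" "0 \<le> \<beta> * D" "12 * (\<beta> * D) \<le> D" "0 \<le> D * D" "7 * (D * D) \<le> D" "0 \<le> \<eta> * D" "7 * (\<eta> * D) \<le> D"
proof -
  show B: "\<beta> \<le> 1/12" and E: "\<eta> \<le> 13/100" using small3 by simp_all
  show "8 * D \<le> \<eta>" using mult_left_mono[of "8 * \<beta>" 1 \<eta>] B eta_pos by (simp add: D_eq[symmetric])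
  show "4 * D \<le> 3 * \<beta> / 5" using mult_right_mono[of "4 * \<eta>" "3/5" \<beta>] E beta_pos by (simp add: D_eq[symmetric] mult_ac)
  show "0 \<le> \<beta> * D" "0 \<le> D * D" "0 \<le> \<eta> * D" using beta_pos eta_pos D_pos by simp_all
  show "12 * (\<beta> * D) \<le> D" "7 * (D * D) \<le> D" "7 * (\<eta> * D) \<le> D"
    using mult_right_mono[of "12 * \<beta>" 1 D] mult_right_mono[of "7 * D" 1 D] mult_right_mono[of "7 * \<eta>" 1 D] B E D_small D_pos by (simp_all add: mult.assoc)
qed

text \<open>An upper bound for the limit value, see \<open>FF3_le_du\<close>. A product that reaches
  \<open>du\<close> is therefore not the one that determines a value of
  \<open>delta2\<close>.\<close>

definition du :: real where "du = (1 - 3*\<eta> + 4*D) * (1 + \<beta>)"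

lemma du: "du = 1 - 3*\<eta> + \<beta> + D + 4*(\<beta>*D)"
  unfolding du_def by (simp add: algebra_simps D_eq[symmetric])

lemma du_1: "du + \<eta>^2/100 \<le> 1"
proof -
  have "\<eta>^2 \<le> \<eta>" using mult_right_mono[of \<eta> 1 \<eta>] eta_pos bounds3(2) by (simp add: power2_eq_square)
  then show ?thesis unfolding du using bounds3 small3 eta_pos D_pos beta_pos by linarith
qed

text \<open>Cells within a run of pairs -2, 4. The ranges of \<open>x\<close> and \<open>x'\<close>
  cover both the constant pattern and the finite runs of \<open>delta2\<close>; the surplus
  \<open>\<eta>^2/100\<close> puts \<open>delta04\<close> strictly above the limit.\<close>

lemma gap_C4:
  assumes x: "2*\<eta> - 4*D \<le> x" "x \<le> 2*\<eta> - 2*D + 2*D^2" and x': "2*\<eta> - 4*D \<le> x'" "x' \<le> 2*\<eta> - 2*D + 2*D^2"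
  shows "Tge \<eta> \<beta> (du + \<eta>^2/100) (- x) (\<beta> * (4 - x'))"
proof -
  have D2: "D^2 = D * D" by (simp add: power2_eq_square)
  have bx: "\<beta> * x' \<le> 2*D" "2*D - 4*(\<beta>*D) \<le> \<beta> * x'"
  proof -
    have "x' \<le> 2*\<eta>" using x' bounds3 unfolding D2 by linarith
    then show "\<beta> * x' \<le> 2*D" using mult_left_mono[of x' "2*\<eta>" \<beta>] beta_pos by (simp add: D_eq[symmetric] mult_ac)
    show "2*D - 4*(\<beta>*D) \<le> \<beta> * x'" using mult_left_mono[OF x'(1), of \<beta>] beta_pos by (simp add: D_eq[symmetric] algebra_simps)
  qed
  have e2: "\<eta>^2/100 \<le> \<eta>^2/10" by simp
  note R = region3_g3f1[OF R3] region3_g3f3[OF R3] region3_g3f4[OF R3]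
  note R = R[unfolded D_eq, folded du_def]
  note b = bounds3 x bx[unfolded D2] eta_pos beta_pos D_pos
  have bx4: "\<beta> * (4 - x') = 4*\<beta> - \<beta> * x'" by (simp add: right_diff_distrib)
  have "(1-3*\<eta>+2*D-2*D^2) * (1+3*\<beta>-2*D) \<le> (1 - \<eta> + - x) * (1 - \<beta> + \<beta> * (4 - x'))"
    unfolding bx4 D2 by (intro mult_mono; use b[unfolded D2] in linarith)
  then have 1: "du + \<eta>^2/100 \<le> (1 - \<eta> + - x) * (1 - \<beta> + \<beta> * (4 - x'))" using R(1) e2 by linarith
  have "(1+\<eta>-4*D) * (1-5*\<beta>+2*D-4*(\<beta>*D)) \<le> (1 - \<eta> - - x) * (1 - \<beta> - \<beta> * (4 - x'))"
    unfolding bx4 D2 by (intro mult_mono; use b[unfolded D2] in linarith)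
  then have 2: "du + \<eta>^2/100 \<le> (1 - \<eta> - - x) * (1 - \<beta> - \<beta> * (4 - x'))" using R(3) by linarith
  have "(1-\<eta>+2*D-2*D^2) * (1-3*\<beta>+2*D-4*(\<beta>*D)) \<le> (1 + \<eta> + - x) * (1 + \<beta> - \<beta> * (4 - x'))"
    unfolding bx4 D2 by (intro mult_mono; use b[unfolded D2] in linarith)
  then have 4: "du + \<eta>^2/100 \<le> (1 + \<eta> + - x) * (1 + \<beta> - \<beta> * (4 - x'))" using R(2) e2 by linarith
  have "1 * 1 \<le> (1 + \<eta> - - x) * (1 + \<beta> + \<beta> * (4 - x'))"
    unfolding bx4 by (intro mult_mono; use b[unfolded D2] in linarith)
  then show ?thesis unfolding Tge_def using 1 2 4 du_1 by linarith
qed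

text \<open>Cells at the even digit 0, where the two halves of opposite sign meet; \<open>u\<close>
  stands for \<open>2 - xi2 k\<close>.\<close>

lemma gap_turn:
  assumes u: "2 - 2*\<eta> \<le> u" "u \<le> 2 - 2*\<eta> + 4*D"
  shows "Tge \<eta> \<beta> du (D * u) (- (\<beta> * u))"
proof -
  have u2: "u \<le> 2" using u(2) bounds3 eta_pos by linarith
  have Du: "2*D - 2*(\<eta>*D) \<le> D * u" "D * u \<le> 2*D"
    using mult_left_mono[OF u(1), of D] mult_left_mono[OF u2, of D] D_pos by (simp_all add: algebra_simps)
  have bu: "2*\<beta> - 2*D \<le> \<beta> * u" "\<beta> * u \<le> 2*\<beta> - 2*D + 4*(\<beta>*D)"
    using mult_left_mono[OF u(1), of \<beta>] mult_left_mono[OF u(2), of \<beta>] beta_pos by (simp_all add: D_eq[symmetric] algebra_simps)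
  note b = bounds3 Du bu eta_pos beta_pos D_pos beta_less_eta
  have "(1-\<eta>+2*D-2*(\<eta>*D)) * (1-3*\<beta>+2*D-4*(\<beta>*D)) \<le> (1 - \<eta> + D * u) * (1 - \<beta> + - (\<beta> * u))" by (intro mult_mono; use b in linarith)
  then have 1: "du \<le> (1 - \<eta> + D * u) * (1 - \<beta> + - (\<beta> * u))" using region3_g1f4[OF R3, unfolded D_eq, folded du_def] by linarith
  have "(1-\<eta>-2*D) * (1+\<beta>-2*D) \<le> (1 - \<eta> - D * u) * (1 - \<beta> - - (\<beta> * u))" by (intro mult_mono; use b in linarith)
  moreover have "(1-\<eta>-2*D) * (1+\<beta>-2*D) = 1 - \<eta> + \<beta> - 5*D + 2*(\<eta>*D) - 2*(\<beta>*D) + 4*(D*D)" by (simp add: algebra_simps D_eq[symmetric])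
  ultimately have 2: "du \<le> (1 - \<eta> - D * u) * (1 - \<beta> - - (\<beta> * u))" unfolding du using b by linarith
  have "(1+\<eta>-2*D) * (1-\<beta>) \<le> (1 + \<eta> - D * u) * (1 + \<beta> + - (\<beta> * u))" by (intro mult_mono; use b in linarith)
  moreover have "(1+\<eta>-2*D) * (1-\<beta>) = 1 + \<eta> - \<beta> - 3*D + 2*(\<beta>*D)" by (simp add: algebra_simps D_eq[symmetric])
  ultimately have 3: "du \<le> (1 + \<eta> - D * u) * (1 + \<beta> + - (\<beta> * u))" unfolding du using b by linarith
  have "1 * 1 \<le> (1 + \<eta> + D * u) * (1 + \<beta> - - (\<beta> * u))" by (intro mult_mono; use b in linarith)
  moreover have "0 \<le> \<eta>^2/100" by simp
  ultimately have 4: "du \<le> (1 + \<eta> + D * u) * (1 + \<beta> - - (\<beta> * u))" using du_1 by linarith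
  show ?thesis unfolding Tge_def using 1 2 3 4 by simp
qed

abbreviation FF3 :: "real \<Rightarrow> real" where "FF3 x \<equiv> FF \<eta> \<beta> x x"

lemma FF3: "FF3 x = (1 - \<eta> - x) * (1 + \<beta> - 2*(\<beta>*D) + \<beta>*D*x)"
  unfolding FF_def D_eq by (simp add: mult.assoc)

lemma FF3_antimono: "0 \<le> x \<Longrightarrow> x \<le> y \<Longrightarrow> FF3 y \<le> FF3 x"
proof -
  assume x: "0 \<le> x" "x \<le> y"
  have "\<beta>*D * (1 - \<eta>) \<le> \<beta>*D * 1" using bounds3(5) eta_pos by (intro mult_left_mono) auto
  then have p: "0 \<le> 1 + \<beta> - 2*(\<beta>*D) - \<beta>*D*(1 - \<eta>)" using bounds3 beta_pos D_small by linarith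
  have "FF3 x - FF3 y = (y - x) * (1 + \<beta> - 2*(\<beta>*D) - \<beta>*D*(1 - \<eta>) + \<beta>*D*(x + y))"
    unfolding FF3 by (simp add: algebra_simps)
  also have "0 \<le> \<dots>" using x p bounds3(5) by simp
  finally show ?thesis by simp
qed

lemma FF3_le_du: "FF3 (xi_inf \<eta> \<beta>) \<le> du"
  unfolding FF3 du_def
proof (rule mult_mono)
  have "\<beta>*D * xi_inf \<eta> \<beta> \<le> \<beta>*D * 2" using bounds3(5) xi_le(2) eta_small by (intro mult_left_mono) auto
  then show "1 + \<beta> - 2*(\<beta>*D) + \<beta>*D * xi_inf \<eta> \<beta> \<le> 1 + \<beta>" by simp
  show "0 \<le> 1 + \<beta> - 2*(\<beta>*D) + \<beta>*D * xi_inf \<eta> \<beta>"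
    using mult_nonneg_nonneg[OF bounds3(5) xi_le(1)] bounds3 beta_pos D_small by linarith
qed (use xi_le(3) eta_small D_pos in auto)

lemma c0_le_FF3: "c0 \<eta> \<beta> \<le> FF3 (xi_inf \<eta> \<beta>)" "0 < c0 \<eta> \<beta>" "\<eta> \<le> FF3 (xi_inf \<eta> \<beta>)"
proof -
  have "c0 \<eta> \<beta> \<le> (1-3*\<eta>+4*D-2*(\<eta>*D))*(1+\<beta>-2*(\<beta>*D))"
    using region3_S0[OF R3] unfolding c0_def D_eq by simp
  also have "\<dots> \<le> FF3 (xi_inf \<eta> \<beta>)" unfolding FF3
    by (rule mult_mono) (use xi_le mult_nonneg_nonneg[OF bounds3(5) xi_le(1)] bounds3 beta_pos D_small in auto)
  finally show *: "c0 \<eta> \<beta> \<le> FF3 (xi_inf \<eta> \<beta>)" .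
  have "(1/2) * (1/2) \<le> c0 \<eta> \<beta>" unfolding c0_def using bounds3 by (intro mult_mono) auto
  then show "0 < c0 \<eta> \<beta>" "\<eta> \<le> FF3 (xi_inf \<eta> \<beta>)" using * bounds3(2) by simp_all
qed

lemma delta04_part3: "ereal (FF3 (xi_inf \<eta> \<beta>)) < delta04 a b" "delta04 a b \<in> Lstar a b"
proof -
  have b8: "8 \<le> b" using b3 a8 by simp
  have x: "2*\<eta> - 4*D \<le> xi_inf \<eta> \<beta>" "xi_inf \<eta> \<beta> \<le> 2*\<eta> - 2*D + 2*D^2"
    using xi_le bounds3 D_pos unfolding power2_eq_square by linarith+
  have "0 < \<eta>^2/100" using eta_pos by simp
  then have "FF3 (xi_inf \<eta> \<beta>) < du + \<eta>^2/100" using FF3_le_du by linarith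
  moreover note gap_C4[OF x x, folded V4_def, unfolded Tge_def]
  ultimately have f: "FF3 (xi_inf \<eta> \<beta>) < (1 - \<eta> - xi_inf \<eta> \<beta>) * (1 - \<beta> + V4)" "FF3 (xi_inf \<eta> \<beta>) < (1 - \<eta> + xi_inf \<eta> \<beta>) * (1 - \<beta> - V4)"
      "FF3 (xi_inf \<eta> \<beta>) < (1 + \<eta> + xi_inf \<eta> \<beta>) * (1 + \<beta> + V4)" "FF3 (xi_inf \<eta> \<beta>) < (1 + \<eta> - xi_inf \<eta> \<beta>) * (1 + \<beta> - V4)"
    by simp_all
  show "ereal (FF3 (xi_inf \<eta> \<beta>)) < delta04 a b" "delta04 a b \<in> Lstar a b" using delta04_greater[OF b8 f] by blast+
qed

lemma delta1_part3: "ereal (FF3 (xi_inf \<eta> \<beta>)) < delta1 a b 0"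
proof -
  have "(1 - \<eta>) * (1 - \<beta>) = 1 - \<eta> - \<beta> + D" by (simp add: algebra_simps D_eq[symmetric])
  then have "du < (1 - \<eta>) * (1 - \<beta>)" unfolding du using beta_less_eta bounds3 small3 D_pos beta_pos by linarith
  then show ?thesis unfolding delta1_0 using FF3_le_du by simp
qed

lemma part3_upper:
  assumes nm: "\<not> member \<gamma>" and g: "ereal (FF3 (xi_inf \<eta> \<beta>)) < Ms \<gamma>"
  shows "Ms \<gamma> = delta1 a b 0 \<or> Ms \<gamma> = delta04 a b"
proof -
  have b8: "8 \<le> b" using b3 a8 by simp
  obtain c' t x y where c': "FF3 (xi_inf \<eta> \<beta>) < c'" and ch: "chain t x y" and nx: "\<not> member (gam (x 0))" and M: "Ms (gam (x 0)) = Ms \<gamma>"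
    and x2: "\<And>j. \<bar>x j\<bar> \<le> 2" and bl: "blocks \<eta> \<beta> c' (\<lambda>i. t (2*i)) (\<lambda>i. t (Suc (2*i))) (\<lambda>i. x (2*i)) (\<lambda>i. x (Suc (2*i))) (\<lambda>i. y (2*i)) (\<lambda>i. y (Suc (2*i)))"
    using blocks_exist[OF nm g c0_le_FF3(3)] by blast
  have bs: "seq3 \<eta> \<beta> c' (\<lambda>i. t (2*i)) (\<lambda>i. t (Suc (2*i))) (\<lambda>i. x (2*i)) (\<lambda>i. x (Suc (2*i))) (\<lambda>i. y (2*i)) (\<lambda>i. y (Suc (2*i)))"
    using bl eta_pos beta_pos c0_le_FF3 c' R3 small3(1) by unfold_locales auto
  interpret w: word a b "P1 0" "\<lambda>_. 0" "r1 0" "\<lambda>i. D * U1 0 i" "\<lambda>i. \<beta> * U1 0 i" "\<lambda>i. \<beta> * T1 0 i" "\<lambda>i. D * T1 0 i" by (rule delta1_word)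
  from classification3[OF bs] show ?thesis
  proof (elim disjE exE)
    fix k assume "\<forall>n. t (2*(k + n)) = 0 \<and> t (Suc (2*(k + n))) = 0"
    then have "Ms (gam (x 0)) = Ms (gammaP a b (P1 0))" by (intro w.word_tail[OF ch nx x2, of k] disjI1) (simp add: r1_def)
    then show ?thesis using M by (simp add: delta1_def P1_def)
  next
    fix k assume "\<forall>n. t (2*(k + n)) = - 2 \<and> t (Suc (2*(k + n))) = 4"
    then show ?thesis using C4_tail[OF b8 ch nx x2, of k] M by simp
  next
    fix k assume "\<forall>n. t (2*(k + n)) = 2 \<and> t (Suc (2*(k + n))) = - 4"
    then show ?thesis using C4_tail[OF b8 ch nx x2, of k] M by simp
  qed
qed

lemma part3_spectrum: "Lstar a b \<inter> {ereal (FF3 (xi_inf \<eta> \<beta>))<..} = {delta1 a b 0, delta04 a b}"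
proof
  show "Lstar a b \<inter> {ereal (FF3 (xi_inf \<eta> \<beta>))<..} \<subseteq> {delta1 a b 0, delta04 a b}"
  proof
    fix z assume "z \<in> Lstar a b \<inter> {ereal (FF3 (xi_inf \<eta> \<beta>))<..}"
    then have "z \<in> Lstar a b" and gz: "ereal (FF3 (xi_inf \<eta> \<beta>)) < z" by auto
    then obtain \<gamma> where "\<not> member \<gamma>" and z: "z = Ms \<gamma>" unfolding Lstar_iff by blast
    then show "z \<in> {delta1 a b 0, delta04 a b}" using part3_upper[of \<gamma>] gz by simp
  qed
  show "{delta1 a b 0, delta04 a b} \<subseteq> Lstar a b \<inter> {ereal (FF3 (xi_inf \<eta> \<beta>))<..}"
    using delta1_value(2) delta1_part3 delta04_part3 by auto
qed

lemma dinf2: "(1 - 3*\<eta> + 2*D*(2 - \<eta>) / (1 - D)) * (1 + \<beta> - 2*\<beta>*D*(1 - \<eta> + D) / (1 - D)) = FF3 (xi_inf \<eta> \<beta>)"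
proof -
  have n: "1 - D \<noteq> 0" using D_less_1 by simp
  have "1 - 3*\<eta> + 2*D*(2 - \<eta>) / (1 - D) = 1 - \<eta> - xi_inf \<eta> \<beta>"
    unfolding xi_inf_def D_eq using n by (simp add: field_simps)
  moreover have "1 + \<beta> - 2*\<beta>*D*(1 - \<eta> + D) / (1 - D) = 1 + \<beta> - 2*(\<beta>*D) + \<beta>*D*xi_inf \<eta> \<beta>"
    unfolding xi_inf_def D_eq using n by (simp add: field_simps)
  ultimately show ?thesis unfolding FF3 by (simp only:)
qed

text \<open>The sequence of \<open>delta2\<close> is antiperiodic with half-period \<open>k + 2\<close> and symmetric under reversal;
  \<open>xi2 k\<close> is the deviation next to the digit \<open>0\<close> and \<open>aa k j\<close> the one at position \<open>j\<close>.\<close>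

definition xi2 :: "nat \<Rightarrow> real" where
  "xi2 k = xi_inf \<eta> \<beta> + (2 - xi_inf \<eta> \<beta>) * (1 + D) * D^Suc k / (1 + D * D^Suc k)"

definition aa :: "nat \<Rightarrow> nat \<Rightarrow> real" where
  "aa k j = xi_inf \<eta> \<beta> + (2 - xi_inf \<eta> \<beta> + D * (2 - xi2 k)) * D^(k + 2 - j)"

text \<open>\<open>xi2 k\<close> occurs in the definition of \<open>aa\<close> and must come back as
  its first term; this loop is what determines the formula for \<open>xi2\<close>.\<close>

lemma aa_1: "aa k (Suc 0) = xi2 k"
proof -
  define p w where "p = D^Suc k" and "w = 2 - xi_inf \<eta> \<beta>"
  define d where "d = w * (1 + D) * p / (1 + D * p)"
  have n: "0 < 1 + D * p" using D_pos by (simp add: p_def add_pos_pos)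
  have x: "xi2 k = xi_inf \<eta> \<beta> + d" unfolding xi2_def d_def w_def p_def by simp
  have "d * (1 + D * p) = w * (1 + D) * p" using n by (simp add: d_def)
  then have "(w + D * (w - d)) * p = d" by (simp add: algebra_simps)
  moreover have "k + 2 - Suc 0 = Suc k" by simp
  moreover have "2 - xi_inf \<eta> \<beta> + D * (2 - xi2 k) = w + D * (w - d)" unfolding x w_def by simp
  ultimately show ?thesis unfolding aa_def x by (simp add: p_def del: power_Suc)
qed

lemma aa_last: "aa k (k + 2) = 2 + D * (2 - xi2 k)" by (simp add: aa_def)

lemma aa_rec: "j \<le> Suc k \<Longrightarrow> aa k j = 2*\<eta> - 4*D + D * aa k (Suc j)"
proof -
  assume j: "j \<le> Suc k"
  have "k + 2 - j = Suc (k + 2 - Suc j)" using j by simp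
  then show ?thesis using xi_D unfolding aa_def by (simp add: algebra_simps)
qed

lemma aa_Suc: "aa k (Suc k) = 2*\<eta> - 4*D + D * (2 + D * (2 - xi2 k))"
  using aa_rec[of "Suc k" k] aa_last[of k] by simp

lemma xi2_range: "xi_inf \<eta> \<beta> \<le> xi2 k" "xi2 k \<le> 2"
proof -
  define p w where "p = D^Suc k" and "w = 2 - xi_inf \<eta> \<beta>"
  have p: "0 < p" "p \<le> 1" using D_pow[of "Suc k"] by (simp_all add: p_def)
  have w: "0 \<le> w" using xi_le eta_small by (simp add: w_def)
  have n: "0 < 1 + D * p" using D_pos p by (simp add: add_pos_pos)
  have x: "xi2 k = xi_inf \<eta> \<beta> + w * (1 + D) * p / (1 + D * p)" unfolding xi2_def w_def p_def by simp
  have "0 \<le> w * (1 + D) * p / (1 + D * p)" using w D_pos p n by simp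
  then show "xi_inf \<eta> \<beta> \<le> xi2 k" unfolding x by simp
  have "(1 + D) * p \<le> 1 + D * p" using p by (simp add: algebra_simps)
  then have "w * ((1 + D) * p) \<le> w * (1 + D * p)" using w by (intro mult_left_mono)
  then have "w * (1 + D) * p / (1 + D * p) \<le> w" using n by (simp add: divide_le_eq mult.assoc)
  then show "xi2 k \<le> 2" unfolding x w_def by simp
qed

lemma aa_range:
  assumes "j \<le> Suc k"
  shows "2*\<eta> - 4*D \<le> aa k j" "aa k j \<le> 2*\<eta> - 2*D + 2*D^2"
proof -
  define \<kappa> where "\<kappa> = 2 - xi_inf \<eta> \<beta> + D * (2 - xi2 k)"
  have x2: "0 \<le> D * (2 - xi2 k)" "D * (2 - xi2 k) \<le> D * 2"
    using xi2_range[of k] xi_le(1) D_pos by (auto intro: mult_left_mono)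
  have \<kappa>: "0 \<le> \<kappa>" using x2 xi_le eta_small by (simp add: \<kappa>_def)
  obtain i where i: "k + 2 - j = Suc i" using assms by (cases "k + 2 - j") auto
  have p: "0 \<le> D^Suc i" "D^Suc i \<le> D" using D_pow[of i] D_pos by (simp_all add: mult_left_le)
  have a: "aa k j = xi_inf \<eta> \<beta> + \<kappa> * D^Suc i" unfolding aa_def i \<kappa>_def by simp
  show "2*\<eta> - 4*D \<le> aa k j" unfolding a using xi_le(3) mult_nonneg_nonneg[OF \<kappa> p(1)] by linarith
  have "\<kappa> * D^Suc i \<le> \<kappa> * D" using \<kappa> p by (intro mult_left_mono)
  moreover have "\<kappa> * D = 2*D - D * xi_inf \<eta> \<beta> + D * (D * (2 - xi2 k))" by (simp add: \<kappa>_def algebra_simps)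
  moreover have "D * (D * (2 - xi2 k)) \<le> D * (D * 2)" using x2 D_pos by (intro mult_left_mono) auto
  ultimately show "aa k j \<le> 2*\<eta> - 2*D + 2*D^2" unfolding a using xi_D by (simp add: power2_eq_square)
qed

lemma xi2_range': "2*\<eta> - 4*D \<le> xi2 k" "xi2 k \<le> 2*\<eta> - 2*D + 2*D^2" "0 \<le> xi2 k" "xi2 k \<le> 2*\<eta>"
  using aa_range[of "Suc 0" k, OF Suc_leI[OF zero_less_Suc]] xi2_range[of k] xi_le(1) bounds3 D_pos
  unfolding aa_1 power2_eq_square by linarith+

text \<open>One half-period, with indices up to \<open>k + 1\<close>; the other half is its
  negative. Index \<open>k + 2\<close> in \<open>x2\<close> already belongs to the negated
  half.\<close>

definition s2 :: "nat \<Rightarrow> int" where "s2 j = (if j = 0 then 0 else - 2)"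
definition r2 :: "nat \<Rightarrow> nat \<Rightarrow> int" where "r2 k j = (if j = 0 then 2 else if j \<le> k then 4 else 2)"
definition x2 :: "nat \<Rightarrow> nat \<Rightarrow> real" where
  "x2 k j = (if j = 0 then D * (2 - xi2 k) else if j = k + 2 then - (D * (2 - xi2 k)) else - aa k j)"
definition v2 :: "nat \<Rightarrow> nat \<Rightarrow> real" where "v2 k j = \<beta> * (r2 k j + x2 k (Suc j))"
definition h2 :: "nat \<Rightarrow> nat \<Rightarrow> real" where
  "h2 k j = (if j = 0 then - (D * (2 - xi2 k)) else - aa k (k + 2 - j))"
definition y2 :: "nat \<Rightarrow> nat \<Rightarrow> real" where
  "y2 k j = (if j = 0 then - (\<beta> * (2 - xi2 k)) else \<beta> * (r2 k (j - 1) + h2 k (j - 1)))"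

lemma x2_rec: "j < k + 2 \<Longrightarrow> x2 k j = \<eta> * (s2 j + v2 k j)"
proof -
  assume j: "j < k + 2"
  have e: "\<eta> * (\<beta> * z) = D * z" "\<beta> * (\<eta> * z) = D * z" for z by (simp_all add: DD_def)
  consider "j = 0" | "0 < j" "j \<le> k" | "j = Suc k" using j by linarith
  then show ?thesis
  proof cases
    case 1 then show ?thesis by (simp add: x2_def s2_def v2_def r2_def aa_1 e)
  next
    case 2 then show ?thesis using aa_rec[of j k] by (simp add: x2_def s2_def v2_def r2_def distrib_left e algebra_simps)
  next
    case 3 then show ?thesis using aa_Suc[of k] by (simp add: x2_def s2_def v2_def r2_def distrib_left e algebra_simps)
  qed
qed

lemma h2_rec: "j < k + 2 \<Longrightarrow> h2 k j = \<eta> * (s2 j + y2 k j)"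
proof -
  assume j: "j < k + 2"
  have e: "\<eta> * (\<beta> * z) = D * z" "\<beta> * (\<eta> * z) = D * z" for z by (simp_all add: DD_def)
  consider "j = 0" | "j = Suc 0" | i where "j = Suc (Suc i)" "i < k" using j by (cases j; cases "j - 1") auto
  then show ?thesis
  proof cases
    case 1 then show ?thesis by (simp add: h2_def s2_def y2_def e)
  next
    case 2 then show ?thesis using aa_Suc[of k] by (simp add: h2_def s2_def y2_def r2_def distrib_left e algebra_simps)
  next
    case 3
    have i: "k - i \<le> Suc k" "Suc (k - i) = Suc k - i" using 3 by simp_all
    show ?thesis using aa_rec[OF i(1)] i(2) 3 by (simp add: h2_def s2_def y2_def r2_def distrib_left e algebra_simps)
  qed
qed

lemma y2_Suc: "y2 k (Suc j) = \<beta> * (r2 k j + h2 k j)"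
  by (simp add: y2_def)

lemma y2_last: "y2 k (k + 2) = - y2 k 0" "x2 k (k + 2) = - x2 k 0"
  by (simp_all add: y2_def r2_def h2_def aa_1 x2_def)

lemma FF3_xi2: "(1 - \<eta> + - xi2 k) * (1 - \<beta> + \<beta> * (2 - D * (2 - xi2 k))) = FF3 (xi2 k)"
  unfolding FF3 by (simp add: algebra_simps)

lemma FF3_xi2_le: "FF3 (xi2 k) \<le> du"
  using FF3_antimono[OF xi_le(1) xi2_range(1)[of k]] FF3_le_du by simp

text \<open>The decisive cell, at the end of a run of negative even digits: its first product is
  \<open>FF3 (xi2 k)\<close> by \<open>FF3_xi2\<close>, while the other three reach
  \<open>du\<close>.\<close>

lemma gap_last: "Tge \<eta> \<beta> (FF3 (xi2 k)) (- xi2 k) (\<beta> * (2 - D * (2 - xi2 k)))"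
proof -
  have u: "0 \<le> D * (2 - xi2 k)" "D * (2 - xi2 k) \<le> D * 2" using xi2_range[of k] xi2_range'(3)[of k] D_pos by (auto intro: mult_left_mono)
  then have y: "\<beta> * (2 - D * (2 - xi2 k)) \<le> \<beta> * 2" "0 \<le> \<beta> * (2 - D * (2 - xi2 k))" using beta_pos D_small by (auto intro: mult_left_mono)
  note b = bounds3 xi2_range'[of k, unfolded power2_eq_square] y eta_pos beta_pos D_pos small3
  have "(1 + \<eta> - 4*D) * (1 - 3*\<beta>) \<le> (1 - \<eta> - - xi2 k) * (1 - \<beta> - \<beta> * (2 - D * (2 - xi2 k)))" by (intro mult_mono; use b in linarith)
  moreover have "(1 + \<eta> - 4*D) * (1 - 3*\<beta>) = 1 + \<eta> - 3*\<beta> - 7*D + 12*(\<beta>*D)" by (simp add: algebra_simps D_eq[symmetric])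
  ultimately have 2: "du \<le> (1 - \<eta> - - xi2 k) * (1 - \<beta> - \<beta> * (2 - D * (2 - xi2 k)))" unfolding du using b by linarith
  have "(1 - \<eta> + 2*D - 2*(D*D)) * (1 - \<beta>) \<le> (1 + \<eta> + - xi2 k) * (1 + \<beta> - \<beta> * (2 - D * (2 - xi2 k)))" by (intro mult_mono; use b in linarith)
  moreover have "(1 - \<eta> + 2*D - 2*(D*D)) * (1 - \<beta>) = 1 - \<eta> - \<beta> + 3*D - 2*(D*D) - 2*(\<beta>*D) + 2*(\<beta>*(D*D))" by (simp add: algebra_simps D_eq[symmetric])
  moreover have "0 \<le> \<beta>*(D*D)" using beta_pos by simp
  ultimately have 4: "du \<le> (1 + \<eta> + - xi2 k) * (1 + \<beta> - \<beta> * (2 - D * (2 - xi2 k)))" unfolding du using b by linarith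
  have "1 * 1 \<le> (1 + \<eta> - - xi2 k) * (1 + \<beta> + \<beta> * (2 - D * (2 - xi2 k)))" by (intro mult_mono; use b in linarith)
  moreover have "0 \<le> \<eta>^2/100" by simp
  ultimately have 3: "du \<le> (1 + \<eta> - - xi2 k) * (1 + \<beta> + \<beta> * (2 - D * (2 - xi2 k)))" using du_1 by linarith
  show ?thesis unfolding Tge_def FF3_xi2 using FF3_xi2_le[of k] 2 3 4 by linarith
qed

lemma Tge_sign: "Tge A B c x y \<Longrightarrow> Tge A B c ((-1)^n * x) ((-1)^n * y)"
  by (cases "even n") (auto simp: Tge_def)

lemma gap_C4': "i \<le> Suc k \<Longrightarrow> j \<le> Suc k \<Longrightarrow> Tge \<eta> \<beta> (FF3 (xi2 k)) (- aa k i) (\<beta> * (4 - aa k j))"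
  using Tge_mono[OF gap_C4[OF aa_range aa_range], of i k j k "FF3 (xi2 k)"] FF3_xi2_le[of k] by (simp add: add_increasing2)

lemma gap_turn': "Tge \<eta> \<beta> (FF3 (xi2 k)) (D * (2 - xi2 k)) (- (\<beta> * (2 - xi2 k)))"
  by (rule Tge_mono[OF gap_turn FF3_xi2_le]) (use xi2_range'[of k] in auto)

lemma gaps2:
  assumes j: "j < k + 2"
  shows "Tge \<eta> \<beta> (FF3 (xi2 k)) (x2 k j) (y2 k j)" "Tge \<eta> \<beta> (FF3 (xi2 k)) (h2 k j) (v2 k j)"
proof -
  have t: "Tge \<eta> \<beta> (FF3 (xi2 k)) (- (D * (2 - xi2 k))) (\<beta> * (2 - xi2 k))" using Tge_sign[where n = "Suc 0", OF gap_turn'[of k]] by simp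
  have 1: "Tge \<eta> \<beta> (FF3 (xi2 k)) (x2 k 0) (y2 k 0)" using gap_turn' by (simp add: x2_def y2_def)
  have 2: "Tge \<eta> \<beta> (FF3 (xi2 k)) (x2 k (Suc 0)) (y2 k (Suc 0))" using gap_last by (simp add: x2_def y2_def r2_def h2_def aa_1)
  have 3: "Tge \<eta> \<beta> (FF3 (xi2 k)) (x2 k (Suc (Suc i))) (y2 k (Suc (Suc i)))" if "i < k" for i
    using gap_C4'[of "Suc (Suc i)" k "k + 2 - Suc i"] that by (simp add: x2_def y2_def r2_def h2_def)
  show "Tge \<eta> \<beta> (FF3 (xi2 k)) (x2 k j) (y2 k j)"
    using j 1 2 3 by (cases j; cases "j - 1") auto
  have 4: "Tge \<eta> \<beta> (FF3 (xi2 k)) (h2 k 0) (v2 k 0)" using t by (simp add: h2_def v2_def r2_def x2_def aa_1)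
  have 5: "Tge \<eta> \<beta> (FF3 (xi2 k)) (h2 k (Suc k)) (v2 k (Suc k))" using gap_last by (simp add: h2_def v2_def r2_def x2_def aa_1)
  have 6: "Tge \<eta> \<beta> (FF3 (xi2 k)) (h2 k j) (v2 k j)" if "0 < j" "j \<le> k"
    using gap_C4'[of "k + 2 - j" k "Suc j"] that by (simp add: h2_def v2_def r2_def x2_def)
  consider "j = 0" | "0 < j" "j \<le> k" | "j = Suc k" using j by linarith
  then show "Tge \<eta> \<beta> (FF3 (xi2 k)) (h2 k j) (v2 k j)" using 4 5 6 by cases auto
qed

lemma half2:
  assumes "j < k + 2"
  shows "\<bar>x2 k j\<bar> \<le> 1/2" "\<bar>v2 k j\<bar> \<le> 1/2" "\<bar>y2 k j\<bar> \<le> 1/2" "\<bar>h2 k j\<bar> \<le> 1/2"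
proof -
  have D: "0 \<le> D * (2 - xi2 k)" "D * (2 - xi2 k) \<le> D * 2" using xi2_range[of k] xi2_range'(3)[of k] D_pos by (auto intro: mult_left_mono)
  have a: "\<bar>aa k i\<bar> \<le> 1/2" if "i \<le> Suc k" for i
    using aa_range[OF that] bounds3 D_pos eta_pos unfolding power2_eq_square by linarith
  have x: "\<bar>x2 k i\<bar> \<le> 1/2" if "i \<le> k + 2" for i using a[of i] that D D_small by (auto simp: x2_def)
  have h: "\<bar>h2 k i\<bar> \<le> 1/2" for i using a[of "k + 2 - i"] D D_small by (auto simp: h2_def)
  have r: "\<bar>real_of_int (r2 k i)\<bar> \<le> 4" for i by (simp add: r2_def)
  have *: "\<bar>\<beta> * (real_of_int (r2 k i) + z)\<bar> \<le> 1/2" if "\<bar>z\<bar> \<le> 1/2" for z i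
  proof -
    have "\<bar>real_of_int (r2 k i) + z\<bar> \<le> 9/2" using r[of i] that by linarith
    then have "\<beta> * \<bar>real_of_int (r2 k i) + z\<bar> \<le> 1/12 * (9/2)" using bounds3(1) beta_pos by (intro mult_mono) auto
    then show ?thesis using beta_pos by (simp add: abs_mult)
  qed
  show "\<bar>x2 k j\<bar> \<le> 1/2" "\<bar>h2 k j\<bar> \<le> 1/2" using x h assms by simp_all
  show "\<bar>v2 k j\<bar> \<le> 1/2" unfolding v2_def using assms by (intro * x) simp
  have "\<beta> * (2 - xi2 k) \<le> 1/12 * 2" "0 \<le> \<beta> * (2 - xi2 k)"
    using bounds3(1) beta_pos xi2_range[of k] xi2_range'(3)[of k] mult_mono[of \<beta> "1/12" "2 - xi2 k" 2] by simp_all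
  then show "\<bar>y2 k j\<bar> \<le> 1/2" using *[OF h] by (auto simp: y2_def)
qed

definition P2 :: "nat \<Rightarrow> (int \<times> int) list" where
  "P2 k = [blkA a b 2] @ replicate k (blkC a b 4) @ [blkC a b 2, blkA' a b 2] @ replicate k (blkC' a b 4) @ [blkC' a b 2]"

lemma length_P2: "length (P2 k) = (k + 2) * 2" by (simp add: P2_def)

lemma nth_P2:
  assumes "j < k + 2"
  shows "P2 k ! j = ((s2 j + a - 2) div 2, (r2 k j + b - 2) div 2)"
    "P2 k ! (k + 2 + j) = ((- s2 j + a - 2) div 2, (- r2 k j + b - 2) div 2)"
proof -
  define F G where "F = blkA a b 2 # replicate k (blkC a b 4) @ [blkC a b 2]"
    and "G = blkA' a b 2 # replicate k (blkC' a b 4) @ [blkC' a b 2]"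
  have P: "P2 k = F @ G" and l: "length F = k + 2" "length G = k + 2" by (simp_all add: P2_def F_def G_def)
  have e: "((a - 4) div 2, (b - 2 + 4) div 2) = ((- 2 + a - 2) div 2, (4 + b - 2) div 2)" by (simp add: algebra_simps)
  consider "j = 0" | i where "j = Suc i" "i < k" | "j = Suc k" using assms by (cases j) force+
  then have "F ! j = ((s2 j + a - 2) div 2, (r2 k j + b - 2) div 2) \<and> G ! j = ((- s2 j + a - 2) div 2, (- r2 k j + b - 2) div 2)"
    by cases (simp_all add: F_def G_def nth_append s2_def r2_def blkA_def blkA'_def blkC_def blkC'_def algebra_simps)
  then show "P2 k ! j = ((s2 j + a - 2) div 2, (r2 k j + b - 2) div 2)"
    "P2 k ! (k + 2 + j) = ((- s2 j + a - 2) div 2, (- r2 k j + b - 2) div 2)"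
    unfolding P using l assms by (simp_all add: nth_append)
qed

text \<open>At a wrap-around the sign factor flips and \<open>f m\<close> turns into
  \<open>- f 0\<close>; the two signs cancel.\<close>

lemma antiperiodic_step:
  fixes f :: "nat \<Rightarrow> real"
  assumes "0 < m" "f m = - f 0"
  shows "(-1)^(Suc i div m) * f (Suc i mod m) = (-1)^(i div m) * f (Suc (i mod m))"
  using assms by (auto simp: mod_Suc div_Suc)

lemma delta2_word:
  "word a b (P2 k) (\<lambda>i. (-1)^(i div (k + 2)) * s2 (i mod (k + 2))) (\<lambda>i. (-1)^(i div (k + 2)) * r2 k (i mod (k + 2)))
    (\<lambda>i. (-1)^(i div (k + 2)) * x2 k (i mod (k + 2))) (\<lambda>i. (-1)^(i div (k + 2)) * v2 k (i mod (k + 2)))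
    (\<lambda>i. (-1)^(i div (k + 2)) * y2 k (i mod (k + 2))) (\<lambda>i. (-1)^(i div (k + 2)) * h2 k (i mod (k + 2)))"
proof
  fix i
  define m j \<sigma> where "m = k + 2" and "j = i mod m" and "\<sigma> = ((-1)^(i div m) :: int)"
  have m: "0 < m" and j: "j < m" by (simp_all add: m_def j_def)
  have \<sigma>: "\<sigma> = 1 \<or> \<sigma> = - 1" "\<bar>\<sigma>\<bar> = 1" by (simp_all add: \<sigma>_def minus_one_power_iff)
  have r\<sigma>: "((-1)^(i div m) :: real) = real_of_int \<sigma>" by (simp add: \<sigma>_def)
  note fold = m_def[symmetric] j_def[symmetric] \<sigma>_def[symmetric] r\<sigma>
  have sx: "(-1)^(Suc i div m) * x2 k (Suc i mod m) = real_of_int \<sigma> * x2 k (Suc j)"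
    and sy: "(-1)^(Suc i div m) * y2 k (Suc i mod m) = real_of_int \<sigma> * y2 k (Suc j)"
    using antiperiodic_step[OF m, of "x2 k" i] antiperiodic_step[OF m, of "y2 k" i] y2_last[of k] unfolding fold by blast+
  have im: "i mod (m * 2) = m * (i div m mod 2) + j" unfolding j_def by (rule mod_mult2_eq)
  show "P2 k ! (i mod length (P2 k)) = (((-1)^(i div (k + 2)) * s2 (i mod (k + 2)) + a - 2) div 2, ((-1)^(i div (k + 2)) * r2 k (i mod (k + 2)) + b - 2) div 2)"
    unfolding length_P2 fold im
  proof (cases "even (i div m)")
    case True
    then show "P2 k ! (m * (i div m mod 2) + j) = ((\<sigma> * s2 j + a - 2) div 2, (\<sigma> * r2 k j + b - 2) div 2)"
      using nth_P2(1)[of j k] j by (simp add: \<sigma>_def m_def even_iff_mod_2_eq_zero)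
  next
    case False
    then have "i div m mod 2 = 1" "\<sigma> = - 1" by (simp_all add: \<sigma>_def odd_iff_mod_2_eq_one)
    then show "P2 k ! (m * (i div m mod 2) + j) = ((\<sigma> * s2 j + a - 2) div 2, (\<sigma> * r2 k j + b - 2) div 2)"
      using nth_P2(2)[of j k] j by (simp add: m_def)
  qed
  show "even ((-1)^(i div (k + 2)) * s2 (i mod (k + 2)))" "even ((-1)^(i div (k + 2)) * r2 k (i mod (k + 2)))" by (simp_all add: s2_def r2_def)
  show "\<bar>(-1)^(i div (k + 2)) * s2 (i mod (k + 2))\<bar> \<le> 2" "\<bar>(-1)^(i div (k + 2)) * r2 k (i mod (k + 2))\<bar> \<le> 4"
    by (simp_all add: s2_def r2_def abs_mult power_abs)
  show "(-1)^(i div (k + 2)) * x2 k (i mod (k + 2)) = \<eta> * (real_of_int ((-1)^(i div (k + 2)) * s2 (i mod (k + 2))) + (-1)^(i div (k + 2)) * v2 k (i mod (k + 2)))"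
    unfolding fold using x2_rec[of j k] j by (simp add: m_def algebra_simps)
  show "(-1)^(i div (k + 2)) * h2 k (i mod (k + 2)) = \<eta> * (real_of_int ((-1)^(i div (k + 2)) * s2 (i mod (k + 2))) + (-1)^(i div (k + 2)) * y2 k (i mod (k + 2)))"
    unfolding fold using h2_rec[of j k] j by (simp add: m_def algebra_simps)
  show "(-1)^(i div (k + 2)) * v2 k (i mod (k + 2)) = \<beta> * (real_of_int ((-1)^(i div (k + 2)) * r2 k (i mod (k + 2))) + (-1)^(Suc i div (k + 2)) * x2 k (Suc i mod (k + 2)))"
    unfolding fold sx v2_def by (simp add: algebra_simps)
  show "(-1)^(Suc i div (k + 2)) * y2 k (Suc i mod (k + 2)) = \<beta> * (real_of_int ((-1)^(i div (k + 2)) * r2 k (i mod (k + 2))) + (-1)^(i div (k + 2)) * h2 k (i mod (k + 2)))"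
    unfolding fold sy y2_Suc by (simp add: algebra_simps)
  show "\<bar>(-1)^(i div (k + 2)) * x2 k (i mod (k + 2))\<bar> \<le> 1/2" "\<bar>(-1)^(i div (k + 2)) * v2 k (i mod (k + 2))\<bar> \<le> 1/2"
    "\<bar>(-1)^(i div (k + 2)) * y2 k (i mod (k + 2))\<bar> \<le> 1/2" "\<bar>(-1)^(i div (k + 2)) * h2 k (i mod (k + 2))\<bar> \<le> 1/2"
    unfolding abs_mult power_abs using half2[of "i mod (k + 2)" k] by simp_all
qed

lemma delta2_value: "delta2 a b k = ereal (FF3 (xi2 k))"
proof -
  interpret w: word a b "P2 k" "\<lambda>i. (-1)^(i div (k + 2)) * s2 (i mod (k + 2))" "\<lambda>i. (-1)^(i div (k + 2)) * r2 k (i mod (k + 2))"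
    "\<lambda>i. (-1)^(i div (k + 2)) * x2 k (i mod (k + 2))" "\<lambda>i. (-1)^(i div (k + 2)) * v2 k (i mod (k + 2))"
    "\<lambda>i. (-1)^(i div (k + 2)) * y2 k (i mod (k + 2))" "\<lambda>i. (-1)^(i div (k + 2)) * h2 k (i mod (k + 2))" by (rule delta2_word)
  have "\<exists>i\<ge>N. (1 - \<eta> + (-1)^(i div (k + 2)) * x2 k (i mod (k + 2))) * (1 - \<beta> + (-1)^(i div (k + 2)) * y2 k (i mod (k + 2))) \<le> FF3 (xi2 k)" for N
  proof -
    \<comment> \<open>Index 1 in a half-period of even number: the sign factor is 1, and the
      decisive cell recurs.\<close>
    define m i where "m = k + 2" and "i = Suc 0 + m * (2 * N)"
    have i: "i div m = 2 * N" "i mod m = Suc 0" unfolding i_def by (simp_all add: m_def del: mult_Suc mult_Suc_right add_Suc)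
    have "N \<le> i" unfolding i_def m_def by (simp add: add_mult_distrib)
    moreover have "(1 - \<eta> + x2 k (Suc 0)) * (1 - \<beta> + y2 k (Suc 0)) = FF3 (xi2 k)"
      unfolding FF3_xi2[symmetric] by (simp add: x2_def y2_def r2_def h2_def aa_1)
    ultimately show ?thesis unfolding m_def[symmetric] by (intro exI[of _ i]) (simp add: i)
  qed
  then have "Ms (gammaP a b (P2 k)) \<le> ereal (FF3 (xi2 k))" by (rule w.word_upper)
  moreover have "ereal (FF3 (xi2 k)) \<le> Ms (gammaP a b (P2 k))" by (rule w.word_lower; rule Tge_sign; rule gaps2; simp)
  ultimately show ?thesis unfolding delta2_def P2_def by (rule antisym)
qed

text \<open>\<open>xi2 k\<close> decreases in \<open>k\<close>, because
  \<open>p / (1 + D * p)\<close> increases in \<open>p\<close>, and \<open>FF3\<close> is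
  antitone.\<close>

lemma delta2_mono: "delta2 a b k \<le> delta2 a b (Suc k)"
proof -
  define p w where "p = D^Suc k" and "w = (2 - xi_inf \<eta> \<beta>) * (1 + D)"
  have p: "0 < p" using D_pow[of "Suc k"] by (simp add: p_def)
  have w: "0 \<le> w" using xi_le eta_small D_pos by (simp add: w_def)
  have n: "0 < 1 + D * p" "0 < 1 + D * (D * p)" using D_pos p by (simp_all add: add_pos_pos)
  have "D * p \<le> 1 * p" using D_less_1 p by (intro mult_right_mono) auto
  then have "D * p * (1 + D * p) \<le> p * (1 + D * (D * p))" by (simp add: algebra_simps)
  then have "D * p / (1 + D * (D * p)) \<le> p / (1 + D * p)" using n by (simp add: divide_le_eq le_divide_eq mult_ac)
  then have "w * (D * p / (1 + D * (D * p))) \<le> w * (p / (1 + D * p))" using w by (rule mult_left_mono)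
  moreover have "xi2 k = xi_inf \<eta> \<beta> + w * (p / (1 + D * p))" "xi2 (Suc k) = xi_inf \<eta> \<beta> + w * (D * p / (1 + D * (D * p)))"
    unfolding xi2_def w_def p_def by simp_all
  ultimately have "xi2 (Suc k) \<le> xi2 k" by simp
  then show ?thesis unfolding delta2_value using FF3_antimono[OF xi2_range'(3)] by simp
qed

lemma delta2_lim: "delta2 a b \<longlonglongrightarrow> ereal (FF3 (xi_inf \<eta> \<beta>))"
proof -
  have p: "(\<lambda>k. D^Suc k) \<longlonglongrightarrow> 0" by (rule LIMSEQ_Suc, rule LIMSEQ_realpow_zero) (use D_pos D_less_1 in auto)
  have "xi2 \<longlonglongrightarrow> xi_inf \<eta> \<beta> + (2 - xi_inf \<eta> \<beta>) * (1 + D) * 0 / (1 + D * 0)"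
    unfolding xi2_def by (intro tendsto_intros p) simp
  then have "xi2 \<longlonglongrightarrow> xi_inf \<eta> \<beta>" by simp
  then have "(\<lambda>k. FF3 (xi2 k)) \<longlonglongrightarrow> FF3 (xi_inf \<eta> \<beta>)" unfolding FF3 by (intro tendsto_intros)
  moreover have "delta2 a b = (\<lambda>k. ereal (FF3 (xi2 k)))" by (rule ext) (rule delta2_value)
  ultimately show ?thesis by simp
qed

end

theorem theorem1:
  fixes a b :: int
  assumes "4 \<le> a" and "a < b" and "even a" and "even b"
  shows
   "(delta1 a b 0 \<in> Lstar a b \<and> (\<forall>x\<in>Lstar a b. x \<le> delta1 a b 0)
      \<and> delta1 a b 0 = ereal ((1 - eta a b) * (1 - beta a b)))
    \<and> ((2 * a \<le> b \<or> (a = 4 \<and> b = 6)) \<longrightarrow>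
        (let D = DD a b; \<eta> = eta a b; \<beta> = beta a b;
             dinf = (1 - \<eta> + 2 * D^2 / (1 + D)) * (1 - \<beta> - 2 * \<beta> / (1 + D)) in
          (\<forall>k. delta1 a b (Suc k) < delta1 a b k)
          \<and> (delta1 a b \<longlonglongrightarrow> ereal dinf)
          \<and> Lstar a b \<inter> {ereal dinf<..} =
              {delta1 a b k | k. True} \<union> {delta05 a b}
              \<union> (if 2 * a \<le> b \<and> b \<le> 3 * a - 6 then {delta04 a b} else {})
              \<union> (if a = 4 \<and> b = 6 then {delta_m2 a b} else {})))
    \<and> ((b = 2 * a - 2 \<and> 8 \<le> a) \<longrightarrow>
        (let D = DD a b; \<eta> = eta a b; \<beta> = beta a b;
             dinf = (1 - 3 * \<eta> + 2 * D * (2 - \<eta>) / (1 - D))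
                    * (1 + \<beta> - 2 * \<beta> * D * (1 - \<eta> + D) / (1 - D)) in
          (\<forall>k\<ge>1. delta2 a b k \<le> delta2 a b (Suc k))
          \<and> (delta2 a b \<longlonglongrightarrow> ereal dinf)
          \<and> Lstar a b \<inter> {ereal dinf<..} = {delta1 a b 0, delta04 a b}))"
proof -
  interpret even_pair a b using assms by unfold_locales
  have 1: "delta1 a b 0 \<in> Lstar a b \<and> (\<forall>x\<in>Lstar a b. x \<le> delta1 a b 0) \<and> delta1 a b 0 = ereal ((1 - \<eta>) * (1 - \<beta>))"
    using delta1_value(2) Lstar_le delta1_0 by blast
  have 2: "(\<forall>k. delta1 a b (Suc k) < delta1 a b k) \<and> (delta1 a b \<longlonglongrightarrow> ereal (VV gg)) \<and>
      Lstar a b \<inter> {ereal (VV gg)<..} = {delta1 a b k | k. True} \<union> {delta05 a b}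
        \<union> (if 2 * a \<le> b \<and> b \<le> 3 * a - 6 then {delta04 a b} else {})
        \<union> (if a = 4 \<and> b = 6 then {delta_m2 a b} else {})" if "2 * a \<le> b \<or> (a = 4 \<and> b = 6)"
    using part2[OF that] delta1_strict delta1_lim by blast
  \<comment> \<open>Naming the closed form \<open>d\<close> lets \<open>dinf2\<close> replace it by
    the value at \<open>xi_inf\<close> everywhere at once.\<close>
  have 3: "(\<forall>k\<ge>1. delta2 a b k \<le> delta2 a b (Suc k)) \<and> (delta2 a b \<longlonglongrightarrow> ereal d) \<and>
      Lstar a b \<inter> {ereal d<..} = {delta1 a b 0, delta04 a b}"
    if b3: "b = 2 * a - 2 \<and> 8 \<le> a" and d: "d = (1 - 3*\<eta> + 2*D*(2 - \<eta>) / (1 - D)) * (1 + \<beta> - 2*\<beta>*D*(1 - \<eta> + D) / (1 - D))" for d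
  proof -
    interpret even_pair3 a b using b3 by unfold_locales auto
    show ?thesis unfolding d dinf2 using delta2_mono delta2_lim part3_spectrum by blast
  qed
  show ?thesis unfolding Let_def using 1 2[unfolded VV_gg] 3[OF _ refl] by blast
qed

end
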